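(* (i) Consider the matrix equation, with rows and columns indexed by $Z_{n,D}$ (ordered by $\preceq$ and partitioned into blocks by similarity classes), $$\tilde{\mathbf P}_-\,\tilde{\mathbf L}\;{}^t\tilde{\mathbf P}_+=\tilde{\boldsymbol\Omega},$$ in unknown matrices $\tilde{\mathbf P}_-,\tilde{\mathbf P}_+,\tilde{\mathbf L}$ over $\mathbb Q(t)$ subject to: (a) $\tilde{\mathbf P}_\pm$ is a lower triangular block matrix, whose diagonal block for a similarity class $\mathcal C$ is the scalar matrix $t^{a(\Lambda)}I_{\mathcal C}$, $\Lambda\in\mathcal C$; (b) $\tilde{\mathbf L}$ is a block diagonal matrix. This equation has a unique solution, and for it $\tilde K_\pm(t)=\tilde{\mathbf P}_\pm$. (ii) If $\Lambda,\Lambda'\in Z_{n,D}$ have different defects, $d(\Lambda)\neq d(\Lambda')$, then $(\tilde{\mathbf P}_\pm)_{\Lambda,\Lambda'}=0$ and $\tilde{\mathbf L}_{\Lambda,\Lambda'}=0$.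
   Context: **Symbols.** Let $r\ge 1$, $n\ge 0$. $\mathcal P_{N,r}$ is the set of $r$-partitions $\boldsymbol\lambda=(\lambda^{(1)},\dots,\lambda^{(r)})$ with $\sum_k|\lambda^{(k)}|=N$. Fix non-negative integers $\mathbf s=(s_1,\dots,s_r)$ and $e$ with $s_k\le e$ for all $k$, and an integer $0\le\alpha<r$. For $\mathbf m=(m_1,\dots,m_r)\in\mathbb Z_{\ge0}^r$ let $\tilde Z(\mathbf m)$ be the set of $\Lambda=(A^{(1)},\dots,A^{(r)})$, where $A^{(k)}=(a^{(k)}_1,\dots,a^{(k)}_{m_k})$ is a sequence of non-negative integers with $a^{(k)}_i-a^{(k)}_{i+1}\ge e$ and $a^{(k)}_{m_k}\ge s_k$. The shift sends $\Lambda\in\tilde Z(\mathbf m)$ to the element of $\tilde Z(m_1+1,\dots,m_r+1)$ whose $k$-th row is $(a^{(k)}_1+e,\dots,a^{(k)}_{m_k}+e,s_k)$. Symbols are classes for the equivalence relation generated by the shift; the defect of the class of $\Lambda\in\tilde Z(\mathbf m)$ is $d(\Lambda)=\mathbf d=(d_1,\dots,d_r)$, $d_k=m_k-\min_j m_j$. Only defects with $\sum_k d_k\equiv\alpha\pmod r$ are considered. Let $\Lambda^0(\mathbf m)\in\tilde Z(\mathbf m)$ be the element whose $k$-th row has $i$-th entry $s_k+(m_k-i)e$. For a defect $\mathbf d$ put $c_k=d_k-1$ for $k\le\alpha$, $c_k=d_k$ for $k>\alpha$, $d'_k=c_k-\min_jc_j$, $f(\mathbf d)=\sum_{k\le\alpha}d'_k(d'_k-1)/2+\sum_{k>\alpha}d'_k(d'_k+1)/2$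 and $n'=n'(\mathbf d)=n-f(\mathbf d)$. If $n'\ge0$, for $\boldsymbol\lambda\in\mathcal P_{n',r}$ let $\Lambda(\boldsymbol\lambda)$ be the class of $\Lambda^0(\mathbf m)+\boldsymbol\lambda$ (entrywise sum, $\lambda^{(k)}$ padded with zeros to length $m_k$), where $\mathbf m$ has defect $\mathbf d$ and all $m_k\ge n'$. $Z_{n,\mathbf d}$ is the set of these $\Lambda(\boldsymbol\lambda)$; $\boldsymbol\lambda\mapsto\Lambda(\boldsymbol\lambda)$ is a bijection $\mathcal P_{n',r}\to Z_{n,\mathbf d}$. Fix a (finite) set $D$ of defects with $Z_{n,\mathbf d}\neq\emptyset$, and put $Z_{n,D}=\coprod_{\mathbf d\in D}Z_{n,\mathbf d}$. $\Lambda\sim\Lambda'$ (similar) means that $\Lambda,\Lambda'$ have representatives whose multisets of all entries coincide. For a representative $\Lambda\in\tilde Z(\mathbf m)$ with $\sum_km_k=\alpha+rM$, $a(\Lambda)=\sum\min(a,a')-\sum\min(b,b')$, the first sum over unordered pairs of entries of $\Lambda$ at distinct positions, the second over those of $\Lambda^0(\mathbf m^\bullet)$, $\mathbf m^\bullet=(M+1,\dots,M+1,M,\dots,M)$ ($M+1$ occurring $\alpha$ times); it is shift invariant and constant on similarity classes. Fix a total order $\preceq$ on $Z_{n,D}$ such that $\Lambda\prec\Lambda'$ whenever $a(\Lambda)>a(\Lambda')$, and each similarity class is an interval. A matrix is block lower triangular if its $(\Lambda,\Lambda')$-entry vanishes unless $\Lambda'\sim\Lambda$ or $\Lambda'\prec\Lambda$,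 and block diagonal if it vanishes unless $\Lambda'\sim\Lambda$. **Symmetric functions.** $\mathbf t=(t_1,\dots,t_r)$ are indeterminates; superscripts $(k)$ and indices of $t_k$ are read modulo $r$. Let $x^{(k)}=(x^{(k)}_1,x^{(k)}_2,\dots)$, $1\le k\le r$, and let $\Xi^N$ be the degree $N$ part of the tensor product over $\mathbb Z$ of the rings of symmetric functions in $x^{(1)},\dots,x^{(r)}$. For $\boldsymbol\lambda\in\mathcal P_{N,r}$ let $s_{\boldsymbol\lambda}=\prod_ks_{\lambda^{(k)}}(x^{(k)})$, $m_{\boldsymbol\lambda}=\prod_km_{\lambda^{(k)}}(x^{(k)})$. Define $q^{(k)}_{s,\pm}(x;t)$ by $\sum_{s\ge0}q^{(k)}_{s,\pm}(x;t)u^s=\prod_i\frac{1-tu\,x_i^{(k\mp1)}}{1-u\,x_i^{(k)}}$ and $q^{\pm}_{\boldsymbol\lambda}(x;\mathbf t)=\prod_{k}\prod_iq^{(k)}_{\lambda^{(k)}_i,\pm}(x;t_{k-c})$ with $c=1$ for $+$, $c=0$ for $-$. The $q^\pm_{\boldsymbol\lambda}$ form a $\mathbb Q(\mathbf t)$-basis of $\Xi^N\otimes\mathbb Q(\mathbf t)$; a bilinear form there is defined by $\langle q^+_{\boldsymbol\lambda},m_{\boldsymbol\mu}\rangle=\delta_{\boldsymbol\lambda,\boldsymbol\mu}$. For each $\mathbf d\in D$ let $\hat\Xi^{n,\mathbf d}$ be a copy of $\Xi^n$ indexed by $\mathbf d$, fix an injective map $\theta_{\mathbf d}:\mathcal P_{n',r}\to\mathcal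 P_{n,r}$, and let $\Theta_{\mathbf d}:\Xi^{n'}\to\hat\Xi^{n,\mathbf d}$ be the linear embedding $s_{\boldsymbol\lambda}\mapsto s_{\theta_{\mathbf d}(\boldsymbol\lambda)}$ (extended to any coefficients), with image $\Xi^{n,\mathbf d}$. For $\Lambda=\Lambda(\boldsymbol\lambda)\in Z_{n,\mathbf d}$ put $s_\Lambda=\Theta_{\mathbf d}(s_{\boldsymbol\lambda})$. Put $\Xi^{n,D}_{\mathbb Q}(\mathbf t)=\bigoplus_{\mathbf d\in D}\Xi^{n,\mathbf d}\otimes\mathbb Q(\mathbf t)$ with the form $\langle\ ,\ \rangle$ transported by $\Theta_{\mathbf d}$ on each summand, different summands being orthogonal. $\mathscr A\subset\mathbb Q(\mathbf t)$ is the subalgebra of rational functions without pole at $\mathbf t=\mathbf 0$; $\Xi^{n,D}_{\mathscr A}$ is the $\mathscr A$-span of the $s_\Lambda$. **Hall–Littlewood and Kostka functions.** $P^\pm_\Lambda(x;\mathbf t)\in\Xi^{n,D}_{\mathscr A}$ $(\Lambda\in Z_{n,D})$ are the unique families with (1) $P^\pm_\Lambda=s_\Lambda+\sum_{\Lambda'\prec\Lambda,\,\Lambda'\not\sim\Lambda}u^\pm_{\Lambda,\Lambda'}(\mathbf t)s_{\Lambda'}$, $u^\pm_{\Lambda,\Lambda'}\in\mathscr A$; (2) $\langle P^+_\Lambda,P^-_{\Lambda'}\rangle=0$ if $\Lambda\not\sim\Lambda'$; (3) $P^\pm_\Lambda(x;\mathbf 0)=s_\Lambda$. The Kostka functions $K^\pm_{\Lambda,\Lambda'}(\mathbf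 t)$ are defined by $s_\Lambda=\sum_{\Lambda'}K^\pm_{\Lambda,\Lambda'}(\mathbf t)P^\pm_{\Lambda'}(x;\mathbf t)$. In the one-parameter case put $K^\pm_{\Lambda,\Lambda'}(t)=K^\pm_{\Lambda,\Lambda'}(t,\dots,t)\in\mathbb Q(t)$, $\tilde K^\pm_{\Lambda,\Lambda'}(t)=t^{a(\Lambda')}K^\pm_{\Lambda,\Lambda'}(t^{-1})$ (modified Kostka functions), and $\tilde K_\pm(t)=(\tilde K^\pm_{\Lambda,\Lambda'}(t))$. **The matrix $\tilde{\boldsymbol\Omega}$.** Let $\zeta$ be a primitive $r$-th root of unity in $\mathbb C$. $W_{N,r}=S_N\ltimes(\mathbb Z/r\mathbb Z)^N$ is realized on $\mathbf V=\mathbb C^N$ as monomial matrices with entries powers of $\zeta$. An element has type $\boldsymbol\lambda\in\mathcal P_{N,r}$ if the parts of $\lambda^{(k)}$ are the lengths of its cycles whose product of nonzero entries is $\zeta^{k-1}$; $w_{\boldsymbol\lambda}$ denotes an element of type $\boldsymbol\lambda$. The irreducible characters $\chi^{\boldsymbol\mu}$, $\boldsymbol\mu\in\mathcal P_{N,r}$, are labelled so that $p_{\boldsymbol\lambda}=\sum_{\boldsymbol\mu}\chi^{\boldsymbol\mu}(w_{\boldsymbol\lambda})s_{\boldsymbol\mu}$, where $p_{\boldsymbol\lambda}=\prod_k\prod_jp^{(k)}_{\lambda^{(k)}_j}$ and $p^{(k)}_s=\sum_{j=1}^r\zeta^{(k-1)(j-1)}\sum_i(x^{(j)}_i)^s$.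 Put $\mathbb G_W(t)=(t-1)^n\,t^{N^*}\prod_{i=1}^n\frac{t^{ir}-1}{t-1}$ with $N^*=rn(n+1)/2-n$ (for $W=W_{n,r}$). For $\Lambda=\Lambda(\boldsymbol\lambda)$, $\Lambda'=\Lambda(\boldsymbol\mu)$ in $Z_{n,\mathbf d}$, with $W'=W_{n',r}$, $n'=n'(\mathbf d)$, $\mathbf V=\mathbb C^{n'}$, $$\tilde{\boldsymbol\Omega}_{\Lambda,\Lambda'}=\mathbb G_W(t)\,\frac{t^{n'}}{|W'|}\sum_{w\in W'}\frac{\chi^{\boldsymbol\lambda}(w)\overline{\chi^{\boldsymbol\mu}(w)}}{\det_{\mathbf V}(t\cdot\mathrm{id}_{\mathbf V}-w)},$$ and $\tilde{\boldsymbol\Omega}_{\Lambda,\Lambda'}=0$ if $d(\Lambda)\neq d(\Lambda')$. *)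

theory Defs
  imports
    "HOL-Library.Poly_Mapping"
    "HOL-Library.FuncSet"
    "HOL-Library.Multiset"
    "HOL-Combinatorics.Permutations"
    "HOL-Combinatorics.Orbits"
    "HOL-Computational_Algebra.Computational_Algebra"
    "Jordan_Normal_Form.Char_Poly"
begin

text \<open>
  Conventions.  Everything that is indexed by 1..r in the mathematics is indexed here by 0..r-1
  (the alphabets, the rows of a symbol, the components of an r-partition, the indeterminates t,
  the exponents of the root of unity); so the condition "k is at most alpha" reads
  \<open>k < \<alpha>\<close>.  Indices modulo r are taken in 0..r-1.  Tuples indexed by 1..r are lists of
  length r, and r is recovered as \<open>length s\<close> where the list \<open>s\<close> is available.
\<close>

section \<open>Partitions and symbols\<close>

definition is_partition :: "nat list \<Rightarrow> bool" where
  "is_partition \<nu> \<longleftrightarrow> sorted (rev \<nu>) \<and> 0 \<notin> set \<nu>"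

definition mparts :: "nat \<Rightarrow> nat \<Rightarrow> nat list list set" where
  "mparts r N = {\<nu>. length \<nu> = r \<and> (\<forall>k<r. is_partition (\<nu> ! k)) \<and> (\<Sum>k<r. sum_list (\<nu> ! k)) = N}"

definition Ztilde :: "nat \<Rightarrow> nat list \<Rightarrow> nat list \<Rightarrow> nat list list set" where
  "Ztilde e s m = {L. length L = length s \<and> (\<forall>k<length s. length (L ! k) = m ! k \<and>
      (\<forall>i. Suc i < m ! k \<longrightarrow> L ! k ! i \<ge> L ! k ! Suc i + e) \<and>
      (m ! k > 0 \<longrightarrow> last (L ! k) \<ge> s ! k))}"

definition shift :: "nat \<Rightarrow> nat list \<Rightarrow> nat list list \<Rightarrow> nat list list" where
  "shift e s L = map (\<lambda>k. map (\<lambda>a. a + e) (L ! k) @ [s ! k]) [0..<length s]"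

type_synonym symb = "nat list list set"

definition shift_rel :: "nat \<Rightarrow> nat list \<Rightarrow> (nat list list \<times> nat list list) set" where
  "shift_rel e s = {(L, shift e s L) |L m. length m = length s \<and> L \<in> Ztilde e s m}"

definition symb_class :: "nat \<Rightarrow> nat list \<Rightarrow> nat list list \<Rightarrow> symb" where
  "symb_class e s L = (shift_rel e s \<union> (shift_rel e s)\<inverse>)\<^sup>* `` {L}"

definition defect_rep :: "nat list list \<Rightarrow> nat list" where
  "defect_rep L = map (\<lambda>R. length R - Min (length ` set L)) L"

text \<open>\<open>the_elem (f ` \<Lambda>)\<close> is the common value of \<open>f\<close> on all representatives of the class.\<close>

definition defect :: "symb \<Rightarrow> nat list" where
  "defect \<Lambda> = the_elem (defect_rep ` \<Lambda>)"

definition is_defect :: "nat \<Rightarrow> nat \<Rightarrow> nat list \<Rightarrow> bool" where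
  "is_defect r \<alpha> d \<longleftrightarrow> length d = r \<and> Min (set d) = 0 \<and> sum_list d mod r = \<alpha> mod r"

definition Lambda0 :: "nat \<Rightarrow> nat list \<Rightarrow> nat list \<Rightarrow> nat list list" where
  "Lambda0 e s m = map (\<lambda>k. map (\<lambda>i. s ! k + (m ! k - Suc i) * e) [0..<m ! k]) [0..<length s]"

definition cvec :: "nat \<Rightarrow> nat list \<Rightarrow> int list" where
  "cvec \<alpha> d = map (\<lambda>k. if k < \<alpha> then int (d ! k) - 1 else int (d ! k)) [0..<length d]"

definition dprime :: "nat \<Rightarrow> nat list \<Rightarrow> nat \<Rightarrow> int" where
  "dprime \<alpha> d k = cvec \<alpha> d ! k - Min (set (cvec \<alpha> d))"

definition fdef :: "nat \<Rightarrow> nat list \<Rightarrow> int" where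
  "fdef \<alpha> d = (\<Sum>k\<in>{k. k < length d \<and> k < \<alpha>}. dprime \<alpha> d k * (dprime \<alpha> d k - 1) div 2)
            + (\<Sum>k\<in>{k. k < length d \<and> \<alpha> \<le> k}. dprime \<alpha> d k * (dprime \<alpha> d k + 1) div 2)"

text \<open>Only meaningful when \<open>fdef \<alpha> d \<le> int n\<close>.\<close>

definition nprime :: "nat \<Rightarrow> nat \<Rightarrow> nat list \<Rightarrow> nat" where
  "nprime \<alpha> n d = nat (int n - fdef \<alpha> d)"

definition add_mpart :: "nat list list \<Rightarrow> nat list list \<Rightarrow> nat list list" where
  "add_mpart L \<nu> = map (\<lambda>k. map (\<lambda>i. L ! k ! i + (if i < length (\<nu> ! k) then \<nu> ! k ! i else 0))
     [0..<length (L ! k)]) [0..<length L]"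

text \<open>
  The class does not depend on the choice of m among the tuples of defect d with all entries at
  least the size N of the r-partition; the one taken here is the smallest, \<open>d + (N, ..., N)\<close>.
\<close>

definition symb_of :: "nat \<Rightarrow> nat list \<Rightarrow> nat list \<Rightarrow> nat list list \<Rightarrow> symb" where
  "symb_of e s d \<nu> = symb_class e s
     (add_mpart (Lambda0 e s (map (\<lambda>x. x + (\<Sum>k<length s. sum_list (\<nu> ! k))) d)) \<nu>)"

definition Zset :: "nat \<Rightarrow> nat list \<Rightarrow> nat \<Rightarrow> nat \<Rightarrow> nat list \<Rightarrow> symb set" where
  "Zset e s \<alpha> n d = (if fdef \<alpha> d \<le> int n
     then symb_of e s d ` mparts (length s) (nprime \<alpha> n d) else {})"

definition ZD :: "nat \<Rightarrow> nat list \<Rightarrow> nat \<Rightarrow> nat \<Rightarrow> nat list set \<Rightarrow> symb set" where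
  "ZD e s \<alpha> n D = (\<Union>d\<in>D. Zset e s \<alpha> n d)"

text \<open>The r-partition \<open>\<nu>\<close> with \<open>\<Lambda> = symb_of e s (defect \<Lambda>) \<nu>\<close>.\<close>

definition mpart_of :: "nat \<Rightarrow> nat list \<Rightarrow> nat \<Rightarrow> nat \<Rightarrow> symb \<Rightarrow> nat list list" where
  "mpart_of e s \<alpha> n \<Lambda> =
     inv_into (mparts (length s) (nprime \<alpha> n (defect \<Lambda>))) (symb_of e s (defect \<Lambda>)) \<Lambda>"

definition similar :: "symb \<Rightarrow> symb \<Rightarrow> bool" where
  "similar \<Lambda> \<Lambda>' \<longleftrightarrow> (\<exists>L\<in>\<Lambda>. \<exists>L'\<in>\<Lambda>'. mset (concat L) = mset (concat L'))"

definition min_pairs :: "nat list \<Rightarrow> nat" where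
  "min_pairs xs = (\<Sum>(i, j)\<in>{(i, j). i < j \<and> j < length xs}. min (xs ! i) (xs ! j))"

definition mbullet :: "nat \<Rightarrow> nat \<Rightarrow> nat \<Rightarrow> nat list" where
  "mbullet r \<alpha> M = map (\<lambda>k. if k < \<alpha> then M + 1 else M) [0..<r]"

definition a_rep :: "nat \<Rightarrow> nat list \<Rightarrow> nat \<Rightarrow> nat list list \<Rightarrow> int" where
  "a_rep e s \<alpha> L = int (min_pairs (concat L)) - int (min_pairs (concat (Lambda0 e s
     (mbullet (length s) \<alpha> ((length (concat L) - \<alpha>) div length s)))))"

definition a_fun :: "nat \<Rightarrow> nat list \<Rightarrow> nat \<Rightarrow> symb \<Rightarrow> int" where
  "a_fun e s \<alpha> \<Lambda> = the_elem (a_rep e s \<alpha> ` \<Lambda>)"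

definition sprec :: "(symb \<times> symb) set \<Rightarrow> symb \<Rightarrow> symb \<Rightarrow> bool" where
  "sprec ord \<Lambda> \<Lambda>' \<longleftrightarrow> (\<Lambda>, \<Lambda>') \<in> ord \<and> \<Lambda> \<noteq> \<Lambda>'"

definition admissible_order ::
  "nat \<Rightarrow> nat list \<Rightarrow> nat \<Rightarrow> symb set \<Rightarrow> (symb \<times> symb) set \<Rightarrow> bool" where
  "admissible_order e s \<alpha> Z ord \<longleftrightarrow> linear_order_on Z ord \<and>
     (\<forall>\<Lambda>\<in>Z. \<forall>\<Lambda>'\<in>Z. a_fun e s \<alpha> \<Lambda> > a_fun e s \<alpha> \<Lambda>' \<longrightarrow> sprec ord \<Lambda> \<Lambda>') \<and>
     (\<forall>\<Lambda>\<in>Z. \<forall>\<Lambda>'\<in>Z. \<forall>\<Lambda>''\<in>Z.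
        similar \<Lambda> \<Lambda>'' \<and> (\<Lambda>, \<Lambda>') \<in> ord \<and> (\<Lambda>', \<Lambda>'') \<in> ord \<longrightarrow> similar \<Lambda>' \<Lambda>)"


section \<open>Formal power series in arbitrarily many variables\<close>

text \<open>
  Symmetric functions in infinitely many variables are represented by their coefficient functions
  on monomials; the product is the usual convolution.
\<close>

typedef ('v, 'c) mfps = "UNIV :: (('v \<Rightarrow>\<^sub>0 nat) \<Rightarrow> 'c) set"
  morphisms mcoeff Abs_mfps ..

lemma mcoeff_Abs [simp]: "mcoeff (Abs_mfps f) = f"
  by (simp add: Abs_mfps_inverse)

lemma mfps_eqI: "(\<And>m. mcoeff f m = mcoeff g m) \<Longrightarrow> f = g"
  by (metis ext mcoeff_inject)

definition adiag :: "('v \<Rightarrow>\<^sub>0 nat) \<Rightarrow> (('v \<Rightarrow>\<^sub>0 nat) \<times> ('v \<Rightarrow>\<^sub>0 nat)) set" where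
  "adiag m = {(a, b). a + b = m}"

lemma finite_adiag: "finite (adiag (m :: 'v \<Rightarrow>\<^sub>0 nat))"
proof -
  let ?S = "{f. \<forall>v. (v \<in> Poly_Mapping.keys m \<longrightarrow> f v \<in> {..Max (Poly_Mapping.lookup m ` Poly_Mapping.keys m)}) \<and> (v \<notin> Poly_Mapping.keys m \<longrightarrow> f v = 0)}"
  have fin: "finite ?S"
    by (rule finite_set_of_finite_funs[OF finite_keys finite_atMost])
  have sub: "Poly_Mapping.lookup ` (fst ` adiag m) \<subseteq> ?S"
  proof
    fix f assume "f \<in> Poly_Mapping.lookup ` (fst ` adiag m)"
    then obtain a b where ab: "a + b = m" "f = Poly_Mapping.lookup a" by (auto simp: adiag_def)
    have le: "f v \<le> Poly_Mapping.lookup m v" for v using ab by (auto simp: lookup_add)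
    show "f \<in> ?S"
    proof (rule CollectI, intro allI conjI impI)
      fix v assume "v \<in> Poly_Mapping.keys m"
      then have "Poly_Mapping.lookup m v \<le> Max (Poly_Mapping.lookup m ` Poly_Mapping.keys m)" by (intro Max_ge) auto
      then show "f v \<in> {..Max (Poly_Mapping.lookup m ` Poly_Mapping.keys m)}" using le[of v] by simp
    next
      fix v assume "v \<notin> Poly_Mapping.keys m"
      then show "f v = 0" using le[of v] by (simp add: in_keys_iff)
    qed
  qed
  have "finite (Poly_Mapping.lookup ` (fst ` adiag m))" by (rule finite_subset[OF sub fin])
  then have "finite (fst ` adiag m)"
    by (rule finite_imageD) (simp add: inj_on_def)
  moreover have "inj_on fst (adiag m)" by (auto simp: inj_on_def adiag_def)
  ultimately show ?thesis using finite_imageD by blast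
qed

instantiation mfps :: (type, comm_ring_1) comm_ring_1
begin

definition zero_mfps :: "('a, 'b) mfps" where "0 = Abs_mfps (\<lambda>m. 0)"
definition one_mfps :: "('a, 'b) mfps" where "1 = Abs_mfps (\<lambda>m. if m = 0 then 1 else 0)"
definition plus_mfps :: "('a, 'b) mfps \<Rightarrow> ('a, 'b) mfps \<Rightarrow> ('a, 'b) mfps" where
  "f + g = Abs_mfps (\<lambda>m. mcoeff f m + mcoeff g m)"
definition minus_mfps :: "('a, 'b) mfps \<Rightarrow> ('a, 'b) mfps \<Rightarrow> ('a, 'b) mfps" where
  "f - g = Abs_mfps (\<lambda>m. mcoeff f m - mcoeff g m)"
definition uminus_mfps :: "('a, 'b) mfps \<Rightarrow> ('a, 'b) mfps" where
  "- f = Abs_mfps (\<lambda>m. - mcoeff f m)"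
definition times_mfps :: "('a, 'b) mfps \<Rightarrow> ('a, 'b) mfps \<Rightarrow> ('a, 'b) mfps" where
  "f * g = Abs_mfps (\<lambda>m. \<Sum>(a, b)\<in>adiag m. mcoeff f a * mcoeff g b)"

instance
proof
  fix f g h :: "('a, 'b) mfps"
  show "f + g + h = f + (g + h)" "f + g = g + f" "0 + f = f" "- f + f = 0" "f - g = f + - g"
    by (auto intro!: mfps_eqI simp: plus_mfps_def zero_mfps_def uminus_mfps_def minus_mfps_def add_ac)
  show "(f + g) * h = f * h + g * h"
    by (auto intro!: mfps_eqI
        simp: plus_mfps_def times_mfps_def algebra_simps sum.distrib case_prod_unfold)
  show "f * g = g * f"
  proof (rule mfps_eqI)
    fix m :: "'a \<Rightarrow>\<^sub>0 nat"
    have "(\<Sum>p\<in>adiag m. mcoeff f (fst p) * mcoeff g (snd p)) =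
          (\<Sum>p\<in>adiag m. mcoeff g (fst p) * mcoeff f (snd p))"
      by (rule sum.reindex_bij_witness[where i = prod.swap and j = prod.swap])
         (auto simp: adiag_def add.commute mult.commute)
    then show "mcoeff (f * g) m = mcoeff (g * f) m"
      by (simp add: times_mfps_def case_prod_unfold)
  qed
  show "1 * f = f"
  proof (rule mfps_eqI)
    fix m :: "'a \<Rightarrow>\<^sub>0 nat"
    have "mcoeff (1 * f) m =
        (\<Sum>p\<in>adiag m. (if fst p = 0 then 1 else 0) * mcoeff f (snd p))"
      by (simp add: times_mfps_def one_mfps_def case_prod_unfold)
    also have "\<dots> = (\<Sum>p\<in>{(0 :: 'a \<Rightarrow>\<^sub>0 nat, m)}. (if fst p = 0 then 1 else 0) * mcoeff f (snd p))"
      by (rule sum.mono_neutral_right[OF finite_adiag]) (auto simp: adiag_def prod_eq_iff)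
    finally show "mcoeff (1 * f) m = mcoeff f m" by simp
  qed
  show "(0 :: ('a, 'b) mfps) \<noteq> 1"
  proof
    assume "(0 :: ('a, 'b) mfps) = 1"
    then have "mcoeff (0 :: ('a, 'b) mfps) 0 = mcoeff 1 0" by simp
    then show False by (simp add: zero_mfps_def one_mfps_def)
  qed
  show "f * g * h = f * (g * h)"
  proof (rule mfps_eqI)
    fix m :: "'a \<Rightarrow>\<^sub>0 nat"
    have "mcoeff (f * g * h) m = (\<Sum>p\<in>adiag m. \<Sum>q\<in>adiag (fst p).
        mcoeff f (fst q) * mcoeff g (snd q) * mcoeff h (snd p))"
      by (simp add: times_mfps_def case_prod_unfold sum_distrib_right)
    also have "\<dots> = (\<Sum>(p, q)\<in>Sigma (adiag m) (\<lambda>p. adiag (fst p)).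
        mcoeff f (fst q) * mcoeff g (snd q) * mcoeff h (snd p))"
      by (rule sum.Sigma) (auto intro: finite_adiag)
    also have "\<dots> = (\<Sum>(p, q)\<in>Sigma (adiag m) (\<lambda>p. adiag (snd p)).
        mcoeff f (fst p) * (mcoeff g (fst q) * mcoeff h (snd q)))"
      by (rule sum.reindex_bij_witness[where
            j = "\<lambda>(p, q). ((fst q, snd q + snd p), (snd q, snd p))" and
            i = "\<lambda>(p, q). ((fst p + fst q, snd q), (fst p, fst q))"])
         (auto simp: adiag_def add_ac mult_ac)
    also have "\<dots> = (\<Sum>p\<in>adiag m. \<Sum>q\<in>adiag (snd p).
        mcoeff f (fst p) * (mcoeff g (fst q) * mcoeff h (snd q)))"
      by (rule sum.Sigma[symmetric]) (auto intro: finite_adiag)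
    also have "\<dots> = mcoeff (f * (g * h)) m"
      by (simp add: times_mfps_def case_prod_unfold sum_distrib_left)
    finally show "mcoeff (f * g * h) m = mcoeff (f * (g * h)) m" .
  qed
qed

end

definition mconst :: "'c \<Rightarrow> ('v, 'c :: comm_ring_1) mfps" where
  "mconst c = Abs_mfps (\<lambda>m. if m = 0 then c else 0)"

definition mvar :: "'v \<Rightarrow> ('v, 'c :: comm_ring_1) mfps" where
  "mvar v = Abs_mfps (\<lambda>m. if m = Poly_Mapping.single v 1 then 1 else 0)"

definition map_mfps :: "('c \<Rightarrow> 'd) \<Rightarrow> ('v, 'c) mfps \<Rightarrow> ('v, 'd) mfps" where
  "map_mfps h f = Abs_mfps (\<lambda>m. h (mcoeff f m))"


section \<open>Rational functions\<close>

text \<open>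
  The value at \<open>f\<close> of the extension of a ring homomorphism \<open>\<phi>\<close> into a field to fractions with a
  representation whose denominator is not killed by \<open>\<phi>\<close>; all substitutions and changes of
  coefficients below are of this form.
\<close>

definition fract_ext :: "('a :: idom \<Rightarrow> 'b :: field) \<Rightarrow> 'a fract \<Rightarrow> 'b" where
  "fract_ext \<phi> f = (THE y. \<exists>p q. q \<noteq> 0 \<and> f = Fract p q \<and> \<phi> q \<noteq> 0 \<and> y = \<phi> p / \<phi> q)"

text \<open>
  Rational functions in countably many indeterminates; those in the r indeterminates
  \<open>tvar 0, ..., tvar (r - 1)\<close> form the subfield \<open>ratfun r\<close>.
\<close>

type_synonym tpoly = "(nat \<Rightarrow>\<^sub>0 nat) \<Rightarrow>\<^sub>0 rat"
type_synonym tratfun = "tpoly fract"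
type_synonym uratfun = "rat poly fract"

definition tvar :: "nat \<Rightarrow> tratfun" where
  "tvar k = to_fract (Poly_Mapping.single (Poly_Mapping.single k 1) 1)"

definition tpolys :: "nat \<Rightarrow> tpoly set" where
  "tpolys r = {p. \<forall>m\<in>Poly_Mapping.keys p. Poly_Mapping.keys m \<subseteq> {..<r}}"

definition ratfun :: "nat \<Rightarrow> tratfun set" where
  "ratfun r = {Fract p q |p q. p \<in> tpolys r \<and> q \<in> tpolys r \<and> q \<noteq> 0}"

definition eval0_poly :: "tpoly \<Rightarrow> rat" where
  "eval0_poly p = Poly_Mapping.lookup p 0"

definition regular_ratfun :: "nat \<Rightarrow> tratfun set" where
  "regular_ratfun r = {Fract p q |p q. p \<in> tpolys r \<and> q \<in> tpolys r \<and> eval0_poly q \<noteq> 0}"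

definition eval0 :: "tratfun \<Rightarrow> rat" where
  "eval0 = fract_ext eval0_poly"

text \<open>The specialization of all indeterminates to one indeterminate.\<close>

definition one_param_poly :: "tpoly \<Rightarrow> rat poly" where
  "one_param_poly p = (\<Sum>m\<in>Poly_Mapping.keys p. monom (Poly_Mapping.lookup p m) (\<Sum>k\<in>Poly_Mapping.keys m. Poly_Mapping.lookup m k))"

definition one_param :: "tratfun \<Rightarrow> uratfun" where
  "one_param = fract_ext (\<lambda>p. to_fract (one_param_poly p))"

definition ut :: "'a :: idom poly fract" where
  "ut = to_fract [:0, 1:]"

definition subst_inverse :: "uratfun \<Rightarrow> uratfun" where
  "subst_inverse = fract_ext (\<lambda>p. poly (map_poly (\<lambda>c. to_fract [:c:]) p) (inverse ut))"

definition complexify :: "uratfun \<Rightarrow> complex poly fract" where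
  "complexify = fract_ext (\<lambda>p. to_fract (map_poly of_rat p))"


section \<open>Symmetric functions in r alphabets\<close>

text \<open>The variable \<open>(k, i)\<close> is the i-th variable of the k-th alphabet.\<close>

type_synonym 'c sfun = "(nat \<times> nat, 'c) mfps"

text \<open>
  \<open>Xi r N R\<close> is the degree N part of the tensor product of the r rings of symmetric functions,
  with coefficients in R: power series in the variables of the r alphabets, homogeneous of degree N
  and invariant under permutations of each alphabet.
\<close>

definition Xi :: "nat \<Rightarrow> nat \<Rightarrow> 'c set \<Rightarrow> ('c :: comm_ring_1) sfun set" where
  "Xi r N R = {f. (\<forall>m. mcoeff f m \<in> R) \<and>
     (\<forall>m. mcoeff f m \<noteq> 0 \<longrightarrow> fst ` Poly_Mapping.keys m \<subseteq> {..<r} \<and> (\<Sum>v\<in>Poly_Mapping.keys m. Poly_Mapping.lookup m v) = N) \<and>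
     (\<forall>\<pi> m m'. (\<forall>k. bij (\<pi> k)) \<and> (\<forall>k i. Poly_Mapping.lookup m' (k, i) = Poly_Mapping.lookup m (k, \<pi> k i))
        \<longrightarrow> mcoeff f m' = mcoeff f m)}"

definition monomial_sym1 :: "nat \<Rightarrow> nat list \<Rightarrow> ('c :: comm_ring_1) sfun" where
  "monomial_sym1 k \<mu> = Abs_mfps (\<lambda>m. if fst ` Poly_Mapping.keys m \<subseteq> {k} \<and>
     image_mset (Poly_Mapping.lookup m) (mset_set (Poly_Mapping.keys m)) = mset \<mu> then 1 else 0)"

definition monomial_sym :: "nat list list \<Rightarrow> ('c :: comm_ring_1) sfun" where
  "monomial_sym \<nu> = (\<Prod>k<length \<nu>. monomial_sym1 k (\<nu> ! k))"

text \<open>Schur functions, as generating functions of semistandard tableaux.\<close>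

definition diagram :: "nat list \<Rightarrow> (nat \<times> nat) set" where
  "diagram \<nu> = {(i, j). i < length \<nu> \<and> j < \<nu> ! i}"

definition ssyt :: "nat list \<Rightarrow> (nat \<times> nat \<Rightarrow> nat) set" where
  "ssyt \<nu> = {T \<in> extensional (diagram \<nu>).
     (\<forall>i j. (i, j) \<in> diagram \<nu> \<and> (i, Suc j) \<in> diagram \<nu> \<longrightarrow> T (i, j) \<le> T (i, Suc j)) \<and>
     (\<forall>i j. (i, j) \<in> diagram \<nu> \<and> (Suc i, j) \<in> diagram \<nu> \<longrightarrow> T (i, j) < T (Suc i, j))}"

definition schur1 :: "nat \<Rightarrow> nat list \<Rightarrow> ('c :: comm_ring_1) sfun" where
  "schur1 k \<nu> = Abs_mfps (\<lambda>m. of_nat (card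
     {T \<in> ssyt \<nu>. (\<Sum>c\<in>diagram \<nu>. Poly_Mapping.single (k, T c) 1) = m}))"

definition schur :: "nat list list \<Rightarrow> ('c :: comm_ring_1) sfun" where
  "schur \<nu> = (\<Prod>k<length \<nu>. schur1 k (\<nu> ! k))"

definition pred_mod :: "nat \<Rightarrow> nat \<Rightarrow> nat" where
  "pred_mod r k = (k + r - 1) mod r"

text \<open>
  The generating series of the \<open>q\<close> (sign plus), as power series in u over the ring of power series
  in x, restricted to the variables with index in the finite set I; the geometric series is
  1/(1 - u x).
\<close>

definition q_series :: "nat \<Rightarrow> nat \<Rightarrow> nat set \<Rightarrow> tratfun sfun fps" where
  "q_series r k I = (\<Prod>i\<in>I.
     (1 - fps_const (mconst (tvar (pred_mod r k)) * mvar (pred_mod r k, i)) * fps_X) *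
     Abs_fps (\<lambda>j. mvar (k, i) ^ j))"

text \<open>
  The infinite product over i, read coefficientwise: factors whose variables do not occur in the
  monomial m contribute only their constant term 1 to the coefficient at m.
\<close>

definition q_plus1 :: "nat \<Rightarrow> nat \<Rightarrow> nat \<Rightarrow> tratfun sfun" where
  "q_plus1 r k j = Abs_mfps (\<lambda>m. mcoeff (fps_nth (q_series r k (snd ` Poly_Mapping.keys m)) j) m)"

definition q_plus :: "nat \<Rightarrow> nat list list \<Rightarrow> tratfun sfun" where
  "q_plus r \<nu> = (\<Prod>k<r. \<Prod>i<length (\<nu> ! k). q_plus1 r k (\<nu> ! k ! i))"

text \<open>The bilinear form on the degree N part over the field \<open>ratfun r\<close> (0 off its domain).\<close>

definition is_hl_form :: "nat \<Rightarrow> nat \<Rightarrow> (tratfun sfun \<Rightarrow> tratfun sfun \<Rightarrow> tratfun) \<Rightarrow> bool" where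
  "is_hl_form r N B \<longleftrightarrow> (let X = Xi r N (ratfun r) in
     (\<forall>f\<in>X. \<forall>g\<in>X. \<forall>h\<in>X. B (f + g) h = B f h + B g h \<and> B h (f + g) = B h f + B h g) \<and>
     (\<forall>c\<in>ratfun r. \<forall>f\<in>X. \<forall>g\<in>X. B (mconst c * f) g = c * B f g \<and> B f (mconst c * g) = c * B f g) \<and>
     (\<forall>f g. f \<notin> X \<or> g \<notin> X \<longrightarrow> B f g = 0) \<and>
     (\<forall>\<nu>\<in>mparts r N. \<forall>\<mu>\<in>mparts r N. B (q_plus r \<nu>) (monomial_sym \<mu>) = (if \<nu> = \<mu> then 1 else 0)))"

definition hl_form :: "nat \<Rightarrow> nat \<Rightarrow> tratfun sfun \<Rightarrow> tratfun sfun \<Rightarrow> tratfun" where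
  "hl_form r N = (THE B. is_hl_form r N B)"

text \<open>The linear map on the degree N part determined by \<open>\<theta>\<close> on Schur functions (0 off its domain).\<close>

definition Theta :: "nat \<Rightarrow> nat \<Rightarrow> (nat list list \<Rightarrow> nat list list) \<Rightarrow> tratfun sfun \<Rightarrow> tratfun sfun" where
  "Theta r N \<theta> = (THE T. let X = Xi r N (ratfun r) in
     (\<forall>f\<in>X. \<forall>g\<in>X. T (f + g) = T f + T g) \<and>
     (\<forall>c\<in>ratfun r. \<forall>f\<in>X. T (mconst c * f) = mconst c * T f) \<and>
     (\<forall>f. f \<notin> X \<longrightarrow> T f = 0) \<and>
     (\<forall>\<nu>\<in>mparts r N. T (schur \<nu>) = schur (\<theta> \<nu>)))"


section \<open>Hall-Littlewood and Kostka functions\<close>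

text \<open>
  An element of the direct sum over the defects d is a function of d.  In what follows
  \<open>\<theta> d\<close> is the injection chosen for the defect d.
\<close>

definition s_symb :: "nat \<Rightarrow> nat list \<Rightarrow> nat \<Rightarrow> nat \<Rightarrow> (nat list \<Rightarrow> nat list list \<Rightarrow> nat list list) \<Rightarrow>
    symb \<Rightarrow> nat list \<Rightarrow> ('c :: comm_ring_1) sfun" where
  "s_symb e s \<alpha> n \<theta> \<Lambda> = (\<lambda>d. if d = defect \<Lambda> then schur (\<theta> d (mpart_of e s \<alpha> n \<Lambda>)) else 0)"

definition sum_form :: "nat \<Rightarrow> nat \<Rightarrow> nat \<Rightarrow> nat list set \<Rightarrow>
    (nat list \<Rightarrow> nat list list \<Rightarrow> nat list list) \<Rightarrow>
    (nat list \<Rightarrow> tratfun sfun) \<Rightarrow> (nat list \<Rightarrow> tratfun sfun) \<Rightarrow> tratfun" where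
  "sum_form r \<alpha> n D \<theta> F G = (\<Sum>d\<in>D. let N = nprime \<alpha> n d;
       back = inv_into (Xi r N (ratfun r)) (Theta r N (\<theta> d))
     in hl_form r N (back (F d)) (back (G d)))"

datatype pm = Plus | Minus

definition is_hl_family :: "nat \<Rightarrow> nat list \<Rightarrow> nat \<Rightarrow> nat \<Rightarrow> nat list set \<Rightarrow>
    (nat list \<Rightarrow> nat list list \<Rightarrow> nat list list) \<Rightarrow> (symb \<times> symb) set \<Rightarrow>
    (pm \<Rightarrow> symb \<Rightarrow> nat list \<Rightarrow> tratfun sfun) \<Rightarrow> bool" where
  "is_hl_family e s \<alpha> n D \<theta> ord P \<longleftrightarrow> (let Z = ZD e s \<alpha> n D; r = length s in
     (\<forall>\<sigma>. \<exists>u. (\<forall>\<Lambda>\<in>Z. \<forall>\<Lambda>'\<in>Z. u \<Lambda> \<Lambda>' \<in> regular_ratfun r) \<and>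
        (\<forall>\<Lambda>\<in>Z. \<forall>d. P \<sigma> \<Lambda> d = s_symb e s \<alpha> n \<theta> \<Lambda> d +
           (\<Sum>\<Lambda>'\<in>{\<Lambda>'\<in>Z. sprec ord \<Lambda>' \<Lambda> \<and> \<not> similar \<Lambda>' \<Lambda>}.
              mconst (u \<Lambda> \<Lambda>') * s_symb e s \<alpha> n \<theta> \<Lambda>' d))) \<and>
     (\<forall>\<Lambda>\<in>Z. \<forall>\<Lambda>'\<in>Z. \<not> similar \<Lambda> \<Lambda>' \<longrightarrow> sum_form r \<alpha> n D \<theta> (P Plus \<Lambda>) (P Minus \<Lambda>') = 0) \<and>
     (\<forall>\<sigma>. \<forall>\<Lambda>\<in>Z. \<forall>d. map_mfps eval0 (P \<sigma> \<Lambda> d) = s_symb e s \<alpha> n \<theta> \<Lambda> d) \<and>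
     (\<forall>\<sigma> \<Lambda>. \<Lambda> \<notin> Z \<longrightarrow> P \<sigma> \<Lambda> = (\<lambda>d. 0)))"

definition hall_littlewood :: "nat \<Rightarrow> nat list \<Rightarrow> nat \<Rightarrow> nat \<Rightarrow> nat list set \<Rightarrow>
    (nat list \<Rightarrow> nat list list \<Rightarrow> nat list list) \<Rightarrow> (symb \<times> symb) set \<Rightarrow>
    pm \<Rightarrow> symb \<Rightarrow> nat list \<Rightarrow> tratfun sfun" where
  "hall_littlewood e s \<alpha> n D \<theta> ord = (THE P. is_hl_family e s \<alpha> n D \<theta> ord P)"

text \<open>Matrices indexed by Z are functions of two symbols that vanish off \<open>Z \<times> Z\<close>.\<close>

definition matrix_on :: "symb set \<Rightarrow> (symb \<Rightarrow> symb \<Rightarrow> 'c :: zero) \<Rightarrow> bool" where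
  "matrix_on Z A \<longleftrightarrow> (\<forall>\<Lambda> \<Lambda>'. \<Lambda> \<notin> Z \<or> \<Lambda>' \<notin> Z \<longrightarrow> A \<Lambda> \<Lambda>' = 0)"

definition kostka :: "nat \<Rightarrow> nat list \<Rightarrow> nat \<Rightarrow> nat \<Rightarrow> nat list set \<Rightarrow>
    (nat list \<Rightarrow> nat list list \<Rightarrow> nat list list) \<Rightarrow> (symb \<times> symb) set \<Rightarrow>
    pm \<Rightarrow> symb \<Rightarrow> symb \<Rightarrow> tratfun" where
  "kostka e s \<alpha> n D \<theta> ord \<sigma> = (THE K. let Z = ZD e s \<alpha> n D in
     matrix_on Z K \<and> (\<forall>\<Lambda>\<in>Z. \<forall>\<Lambda>'\<in>Z. K \<Lambda> \<Lambda>' \<in> ratfun (length s)) \<and>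
     (\<forall>\<Lambda>\<in>Z. \<forall>d. s_symb e s \<alpha> n \<theta> \<Lambda> d =
        (\<Sum>\<Lambda>'\<in>Z. mconst (K \<Lambda> \<Lambda>') * hall_littlewood e s \<alpha> n D \<theta> ord \<sigma> \<Lambda>' d)))"

definition modified_kostka :: "nat \<Rightarrow> nat list \<Rightarrow> nat \<Rightarrow> nat \<Rightarrow> nat list set \<Rightarrow>
    (nat list \<Rightarrow> nat list list \<Rightarrow> nat list list) \<Rightarrow> (symb \<times> symb) set \<Rightarrow>
    pm \<Rightarrow> symb \<Rightarrow> symb \<Rightarrow> uratfun" where
  "modified_kostka e s \<alpha> n D \<theta> ord \<sigma> \<Lambda> \<Lambda>' =
     ut powi a_fun e s \<alpha> \<Lambda>' * subst_inverse (one_param (kostka e s \<alpha> n D \<theta> ord \<sigma> \<Lambda> \<Lambda>'))"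


section \<open>The complex reflection group and the matrix Omega\<close>

definition primitive_root :: "nat \<Rightarrow> complex \<Rightarrow> bool" where
  "primitive_root r \<zeta> \<longleftrightarrow> \<zeta> ^ r = 1 \<and> (\<forall>k. 0 < k \<and> k < r \<longrightarrow> \<zeta> ^ k \<noteq> 1)"

definition Wgrp :: "nat \<Rightarrow> complex \<Rightarrow> complex mat set" where
  "Wgrp N \<zeta> = {mat N N (\<lambda>(i, j). if i = \<sigma> j then \<zeta> ^ c j else 0) |\<sigma> c :: nat \<Rightarrow> nat.
     \<sigma> permutes {..<N}}"

text \<open>The cycles (including fixed points) are the orbits of the underlying permutation.\<close>

definition has_type :: "nat \<Rightarrow> nat \<Rightarrow> complex \<Rightarrow> complex mat \<Rightarrow> nat list list \<Rightarrow> bool" where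
  "has_type r N \<zeta> w \<nu> \<longleftrightarrow> (\<exists>\<sigma>. \<sigma> permutes {..<N} \<and> (\<forall>j<N. w $$ (\<sigma> j, j) \<noteq> 0) \<and>
     (\<forall>k<r. mset (\<nu> ! k) = image_mset card (mset_set
        {C \<in> Orbits.orbit \<sigma> ` {..<N}. (\<Prod>j\<in>C. w $$ (\<sigma> j, j)) = \<zeta> ^ k})))"

definition mat_trace :: "'c :: comm_ring_1 mat \<Rightarrow> 'c" where
  "mat_trace A = (\<Sum>i<dim_row A. A $$ (i, i))"

definition irreducible_rep ::
  "complex mat set \<Rightarrow> nat \<Rightarrow> nat \<Rightarrow> (complex mat \<Rightarrow> complex mat) \<Rightarrow> bool" where
  "irreducible_rep W N l \<rho> \<longleftrightarrow> l > 0 \<and> (\<forall>g\<in>W. \<rho> g \<in> carrier_mat l l) \<and>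
     \<rho> (1\<^sub>m N) = 1\<^sub>m l \<and> (\<forall>g\<in>W. \<forall>h\<in>W. \<rho> (g * h) = \<rho> g * \<rho> h) \<and>
     (\<forall>U. U \<subseteq> carrier_vec l \<and> 0\<^sub>v l \<in> U \<and> (\<forall>u\<in>U. \<forall>v\<in>U. u + v \<in> U) \<and>
        (\<forall>c. \<forall>u\<in>U. c \<cdot>\<^sub>v u \<in> U) \<and> (\<forall>g\<in>W. \<forall>u\<in>U. \<rho> g *\<^sub>v u \<in> U)
        \<longrightarrow> U = {0\<^sub>v l} \<or> U = carrier_vec l)"

definition irreducible_characters :: "nat \<Rightarrow> complex \<Rightarrow> (complex mat \<Rightarrow> complex) set" where
  "irreducible_characters N \<zeta> =
     {restrict (\<lambda>w. mat_trace (\<rho> w)) (Wgrp N \<zeta>) |\<rho> l. irreducible_rep (Wgrp N \<zeta>) N l \<rho>}"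

definition power_sum1 :: "nat \<Rightarrow> nat \<Rightarrow> ('c :: comm_ring_1) sfun" where
  "power_sum1 j m = Abs_mfps (\<lambda>x. if \<exists>i. x = Poly_Mapping.single (j, i) m then 1 else 0)"

definition power_sum :: "nat \<Rightarrow> complex \<Rightarrow> nat list list \<Rightarrow> complex sfun" where
  "power_sum r \<zeta> \<nu> = (\<Prod>k<r. \<Prod>i<length (\<nu> ! k).
     (\<Sum>j<r. mconst (\<zeta> ^ (k * j)) * power_sum1 j (\<nu> ! k ! i)))"

text \<open>
  \<open>\<chi> \<mu>\<close> runs bijectively through the irreducible characters of the group of size-N monomial matrices
  and is labelled by the Frobenius formula (which determines \<open>\<chi>\<close> on \<open>mparts r N\<close> uniquely).
\<close>

definition char_labelling ::
  "nat \<Rightarrow> complex \<Rightarrow> nat \<Rightarrow> (nat list list \<Rightarrow> complex mat \<Rightarrow> complex) \<Rightarrow> bool" where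
  "char_labelling r \<zeta> N \<chi> \<longleftrightarrow> bij_betw \<chi> (mparts r N) (irreducible_characters N \<zeta>) \<and>
     (\<forall>\<nu>\<in>mparts r N. \<forall>w\<in>Wgrp N \<zeta>. has_type r N \<zeta> w \<nu> \<longrightarrow>
        power_sum r \<zeta> \<nu> = (\<Sum>\<mu>\<in>mparts r N. mconst (\<chi> \<mu> w) * schur \<mu>))"

definition Nstar :: "nat \<Rightarrow> nat \<Rightarrow> nat" where
  "Nstar r n = r * n * (n + 1) div 2 - n"

definition GW :: "nat \<Rightarrow> nat \<Rightarrow> complex poly fract" where
  "GW r n = (ut - 1) ^ n * ut ^ Nstar r n * (\<Prod>i=1..n. (ut ^ (i * r) - 1) / (ut - 1))"

text \<open>\<open>char_poly w\<close> is the determinant of \<open>t id - w\<close>; \<open>\<chi> N\<close> is the labelling for size N.\<close>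

definition Omega :: "nat \<Rightarrow> nat list \<Rightarrow> nat \<Rightarrow> nat \<Rightarrow> complex \<Rightarrow>
    (nat \<Rightarrow> nat list list \<Rightarrow> complex mat \<Rightarrow> complex) \<Rightarrow> symb \<Rightarrow> symb \<Rightarrow> complex poly fract" where
  "Omega e s \<alpha> n \<zeta> \<chi> \<Lambda> \<Lambda>' = (if defect \<Lambda> \<noteq> defect \<Lambda>' then 0 else
     (let N = nprime \<alpha> n (defect \<Lambda>); \<nu> = mpart_of e s \<alpha> n \<Lambda>; \<mu> = mpart_of e s \<alpha> n \<Lambda>' in
      GW (length s) n * (ut ^ N / of_nat (card (Wgrp N \<zeta>))) *
      (\<Sum>w\<in>Wgrp N \<zeta>. to_fract [:\<chi> N \<nu> w * cnj (\<chi> N \<mu> w):] / to_fract (char_poly w))))"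


section \<open>The matrix equation\<close>

definition block_lower_triangular ::
  "symb set \<Rightarrow> (symb \<times> symb) set \<Rightarrow> (symb \<Rightarrow> symb \<Rightarrow> 'c :: zero) \<Rightarrow> bool" where
  "block_lower_triangular Z ord A \<longleftrightarrow> (\<forall>\<Lambda>\<in>Z. \<forall>\<Lambda>'\<in>Z.
     A \<Lambda> \<Lambda>' \<noteq> 0 \<longrightarrow> similar \<Lambda>' \<Lambda> \<or> sprec ord \<Lambda>' \<Lambda>)"

definition block_diagonal :: "symb set \<Rightarrow> (symb \<Rightarrow> symb \<Rightarrow> 'c :: zero) \<Rightarrow> bool" where
  "block_diagonal Z A \<longleftrightarrow> (\<forall>\<Lambda>\<in>Z. \<forall>\<Lambda>'\<in>Z. A \<Lambda> \<Lambda>' \<noteq> 0 \<longrightarrow> similar \<Lambda>' \<Lambda>)"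

definition unknown_P :: "symb set \<Rightarrow> (symb \<times> symb) set \<Rightarrow> (symb \<Rightarrow> int) \<Rightarrow>
    (symb \<Rightarrow> symb \<Rightarrow> uratfun) \<Rightarrow> bool" where
  "unknown_P Z ord a P \<longleftrightarrow> matrix_on Z P \<and> block_lower_triangular Z ord P \<and>
     (\<forall>\<Lambda>\<in>Z. \<forall>\<Lambda>'\<in>Z. similar \<Lambda> \<Lambda>' \<longrightarrow> P \<Lambda> \<Lambda>' = (if \<Lambda> = \<Lambda>' then ut powi a \<Lambda> else 0))"

text \<open>
  The unknown matrices have entries in Q(t); the equation is read in C(t), where the entries of
  the right-hand side \<open>\<Omega>\<close> are given.
\<close>

definition is_solution :: "symb set \<Rightarrow> (symb \<times> symb) set \<Rightarrow> (symb \<Rightarrow> int) \<Rightarrow>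
    (symb \<Rightarrow> symb \<Rightarrow> complex poly fract) \<Rightarrow> (symb \<Rightarrow> symb \<Rightarrow> uratfun) \<Rightarrow>
    (symb \<Rightarrow> symb \<Rightarrow> uratfun) \<Rightarrow> (symb \<Rightarrow> symb \<Rightarrow> uratfun) \<Rightarrow> bool" where
  "is_solution Z ord a \<Omega> Pm Pp L \<longleftrightarrow>
     unknown_P Z ord a Pm \<and> unknown_P Z ord a Pp \<and> matrix_on Z L \<and> block_diagonal Z L \<and>
     (\<forall>\<Lambda>\<in>Z. \<forall>\<Lambda>'\<in>Z.
        complexify (\<Sum>M\<in>Z. \<Sum>M'\<in>Z. Pm \<Lambda> M * L M M' * Pp \<Lambda>' M') = \<Omega> \<Lambda> \<Lambda>')"

end

(*
  Omega is, up to transposition and a nonzero factor, the Gram matrix of the Schur functions at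
  t = (1/t, ..., 1/t).  Write q^+_mu as the sum of M_{mu,lambda} m_lambda, and let R_w(lambda) be
  the coefficient of x^lambda in the power sum attached to the type of w.  Expanding R_w over
  the colourings of the N points that are fixed by w, and det(t - w) over the w-stable subsets,
  a signed orbit count gives
      |W| t^N M_{mu,lambda}(1/t) = sum over w of conj(R_w(mu)) R_w(lambda) det(t - w).
  By the Frobenius formula R_w(lambda) is the sum of chi^kappa(w) K_{kappa,lambda} with a
  unitriangular integral matrix K, so the orthogonality relations invert M: the Gram matrix
  G = K M^{-1} K^T of the Schur functions satisfies
      G_{kappa,mu}(1/t) = t^N/|W| sum over w of conj(chi^kappa(w)) chi^mu(w) / det(t - w),
  and G is the identity at t = 0.  The Hall-Littlewood functions of the symbols amount to the
  block factorization G = K_+ B K_-^T, whose specialization is a solution of the matrix equation;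
  the solution is unique because a block LDU factorization of an invertible matrix is.
  Conjugating the solution by the sign matrix that is 1 on one defect and -1 on the others
  yields a solution again, which forces the vanishing in (ii).
*)
theory Submission
  imports Defs
    "Jordan_Normal_Form.Spectral_Radius"
    "HOL-Combinatorics.Cycles"
begin

text \<open>The form, the maps \<open>Theta\<close>, the Hall-Littlewood family and the Kostka
  matrix are definite descriptions, so each of them is first identified with an explicit object by
  an existence and a uniqueness proof. The Hall-Littlewood coefficients have to be regular at t = 0.
  The ring of such functions is local with residue map \<open>eval0\<close>, and a matrix over it is
  invertible as soon as its residue is. As G reduces to the identity, all its principal submatrices
  are invertible over this ring, and row x of a Hall-Littlewood matrix solves a linear system
  indexed by the symbols strictly below the block of x. The value of G at t = 0 comes from the same
  character sum: det(t - w) is monic of degree N. Substituting 1/t is legitimate on regular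
  functions, since a denominator with nonzero constant term survives the identification of all
  variables. It is not defined on the whole field, so inverses must be found among regular functions
  before they are specialized. Omega lives over C(t); the injection of Q(t) into C(t) brings the
  equation back to Q(t). The transposition between G and Omega puts the sign minus on the left of
  the matrix equation.\<close>

type_synonym monom_exp = "nat \<times> nat \<Rightarrow>\<^sub>0 nat"

abbreviation (input) "lookup \<equiv> Poly_Mapping.lookup"
abbreviation (input) "keys \<equiv> Poly_Mapping.keys"
abbreviation (input) "single \<equiv> Poly_Mapping.single"
abbreviation (input) "map_key \<equiv> Poly_Mapping.map_key"

section \<open>Matrices over a local subring\<close>

text \<open>A numbering of the index set identifies matrices given as functions with square arrays,
  compatibly with products; this is how one-sided inverses become two-sided.\<close>

lemma fin_mat_to_mat:
  assumes "finite Z"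
  obtains h n where "bij_betw h {0..<n::nat} Z"
    "\<And>A B :: 'a \<Rightarrow> 'a \<Rightarrow> 'f::field.
       mat n n (\<lambda>(i,j). A (h i) (h j)) * mat n n (\<lambda>(i,j). B (h i) (h j)) =
       mat n n (\<lambda>(i,j). \<Sum>z\<in>Z. A (h i) z * B z (h j))"
proof -
  obtain h where h: "bij_betw h {0..<card Z} Z" using ex_bij_betw_nat_finite[OF assms] by blast
  have "mat (card Z) (card Z) (\<lambda>(i,j). A (h i) (h j)) * mat (card Z) (card Z) (\<lambda>(i,j). B (h i) (h j)) =
       mat (card Z) (card Z) (\<lambda>(i,j). \<Sum>z\<in>Z. A (h i) z * B z (h j))" for A B :: "'a \<Rightarrow> 'a \<Rightarrow> 'f"
    by (rule eq_matI) (auto simp: scalar_prod_def sum.reindex_bij_betw[OF h, symmetric])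
  then show ?thesis using h that by blast
qed

lemma fin_mat_left_right_inverse:
  fixes A B :: "'a \<Rightarrow> 'a \<Rightarrow> 'f::field"
  assumes fin: "finite Z"
    and AB: "\<And>x y. x \<in> Z \<Longrightarrow> y \<in> Z \<Longrightarrow> (\<Sum>z\<in>Z. A x z * B z y) = (if x = y then 1 else 0)"
    and x: "x \<in> Z" and y: "y \<in> Z"
  shows "(\<Sum>z\<in>Z. B x z * A z y) = (if x = y then 1 else 0)"
proof -
  obtain h n where h: "bij_betw h {0..<n::nat} Z"
    and mult: "\<And>A B :: 'a \<Rightarrow> 'a \<Rightarrow> 'f. mat n n (\<lambda>(i,j). A (h i) (h j)) * mat n n (\<lambda>(i,j). B (h i) (h j)) =
       mat n n (\<lambda>(i,j). \<Sum>z\<in>Z. A (h i) z * B z (h j))"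
    by (rule fin_mat_to_mat[OF fin]) blast
  have inZ: "h i \<in> Z" if "i < n" for i using h that by (auto simp: bij_betw_def)
  have inj: "h i = h j \<longleftrightarrow> i = j" if "i < n" "j < n" for i j
    using h that by (auto simp: bij_betw_def inj_on_def)
  let ?A = "mat n n (\<lambda>(i,j). A (h i) (h j))" and ?B = "mat n n (\<lambda>(i,j). B (h i) (h j))"
  have "?A * ?B = 1\<^sub>m n"
    by (subst mult, rule eq_matI) (auto simp: AB inZ inj)
  then have BA: "?B * ?A = 1\<^sub>m n"
    by (rule mat_mult_left_right_inverse[OF mat_carrier mat_carrier])
  obtain i j where ij: "i < n" "j < n" "x = h i" "y = h j"
    using x y unfolding bij_betw_imp_surj_on[OF h, symmetric] by auto
  have "(?B * ?A) $$ (i,j) = (\<Sum>z\<in>Z. B x z * A z y)"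
    using ij by (subst mult) auto
  then show ?thesis using ij by (auto simp: BA inj)
qed

text \<open>A local subring of a field, presented by its residue map.\<close>

locale local_subring =
  fixes A :: "'f::field set" and \<phi> :: "'f \<Rightarrow> 'g::field"
  assumes zero_in: "0 \<in> A" and one_in: "1 \<in> A"
    and add_in: "a \<in> A \<Longrightarrow> b \<in> A \<Longrightarrow> a + b \<in> A"
    and mult_in: "a \<in> A \<Longrightarrow> b \<in> A \<Longrightarrow> a * b \<in> A"
    and uminus_in: "a \<in> A \<Longrightarrow> - a \<in> A"
    and inverse_in: "a \<in> A \<Longrightarrow> \<phi> a \<noteq> 0 \<Longrightarrow> inverse a \<in> A"
    and hom_one: "\<phi> 1 = 1"
    and hom_add: "a \<in> A \<Longrightarrow> b \<in> A \<Longrightarrow> \<phi> (a + b) = \<phi> a + \<phi> b"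
    and hom_mult: "a \<in> A \<Longrightarrow> b \<in> A \<Longrightarrow> \<phi> (a * b) = \<phi> a * \<phi> b"
begin

lemma hom_zero: "\<phi> 0 = 0"
  by (metis add.right_neutral add_left_cancel hom_add zero_in)

lemma hom_uminus: "a \<in> A \<Longrightarrow> \<phi> (- a) = - \<phi> a"
  using hom_add[of a "- a"] uminus_in[of a] hom_zero by (simp add: eq_neg_iff_add_eq_0 add.commute)

lemma sum_in: "(\<And>x. x \<in> X \<Longrightarrow> f x \<in> A) \<Longrightarrow> sum f X \<in> A"
  by (induction X rule: infinite_finite_induct) (auto intro: zero_in add_in)

lemma hom_sum: "(\<And>x. x \<in> X \<Longrightarrow> f x \<in> A) \<Longrightarrow> \<phi> (sum f X) = (\<Sum>x\<in>X. \<phi> (f x))"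
  by (induction X rule: infinite_finite_induct) (auto simp: hom_zero hom_add sum_in)

lemma prod_in: "(\<And>x. x \<in> X \<Longrightarrow> f x \<in> A) \<Longrightarrow> prod f X \<in> A"
  by (induction X rule: infinite_finite_induct) (auto intro: one_in mult_in)

lemma hom_prod: "(\<And>x. x \<in> X \<Longrightarrow> f x \<in> A) \<Longrightarrow> \<phi> (prod f X) = (\<Prod>x\<in>X. \<phi> (f x))"
  by (induction X rule: infinite_finite_induct) (auto simp: hom_one hom_mult prod_in)

lemma signof_in: "signof p \<in> A"
  by (auto simp: sign_def one_in uminus_in)

lemma hom_signof: "\<phi> (signof p) = signof p"
  by (auto simp: sign_def one_in uminus_in hom_one hom_uminus)

lemma det_in:
  assumes "B \<in> carrier_mat n n" "\<And>i j. i < n \<Longrightarrow> j < n \<Longrightarrow> B $$ (i,j) \<in> A"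
  shows "det B \<in> A"
proof -
  have "p i < n" if "p permutes {0..<n}" "i < n" for p i
    using that permutes_in_image[of p "{0..<n}" i] by auto
  then show ?thesis
    unfolding det_def'[OF assms(1)] by (intro sum_in mult_in signof_in prod_in) (auto intro: assms(2))
qed

lemma hom_det:
  assumes "B \<in> carrier_mat n n" "\<And>i j. i < n \<Longrightarrow> j < n \<Longrightarrow> B $$ (i,j) \<in> A"
  shows "\<phi> (det B) = det (map_mat \<phi> B)"
proof -
  have lt: "p i < n" if "p permutes {0..<n}" "i < n" for p i
    using that permutes_in_image[of p "{0..<n}" i] by auto
  have in': "signof p \<in> A" "(\<Prod>i = 0..<n. B $$ (i, p i)) \<in> A" if "p permutes {0..<n}" for p
    using that lt by (auto intro!: signof_in prod_in assms(2))
  have "\<phi> (det B) = (\<Sum>p | p permutes {0..<n}. \<phi> (signof p * (\<Prod>i = 0..<n. B $$ (i, p i))))"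
    unfolding det_def'[OF assms(1)] by (rule hom_sum) (auto intro: mult_in in')
  also have "\<dots> = (\<Sum>p | p permutes {0..<n}. signof p * (\<Prod>i = 0..<n. map_mat \<phi> B $$ (i, p i)))"
  proof (rule sum.cong[OF refl])
    fix p assume "p \<in> {p. p permutes {0..<n}}"
    then have p: "p permutes {0..<n}" by simp
    have "\<phi> (\<Prod>i = 0..<n. B $$ (i, p i)) = (\<Prod>i = 0..<n. \<phi> (B $$ (i, p i)))"
      using lt[OF p] by (intro hom_prod assms(2)) auto
    also have "\<dots> = (\<Prod>i = 0..<n. map_mat \<phi> B $$ (i, p i))"
      using lt[OF p] assms(1) by (intro prod.cong) auto
    finally show "\<phi> (signof p * (\<Prod>i = 0..<n. B $$ (i, p i))) =
        signof p * (\<Prod>i = 0..<n. map_mat \<phi> B $$ (i, p i))"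
      using in'[OF p] by (simp add: hom_mult hom_signof)
  qed
  finally show ?thesis using assms(1) by (subst det_def'[of _ n]) auto
qed

text \<open>The determinant has nonzero residue, because the residue matrix has an inverse; so it is
  a unit of \<open>A\<close>, and the adjugate divided by it is an inverse with entries in
  \<open>A\<close>. An inverse over the field alone would leave its entries uncontrolled.\<close>

lemma fin_mat_inverse:
  fixes M :: "'a \<Rightarrow> 'a \<Rightarrow> 'f" and N :: "'a \<Rightarrow> 'a \<Rightarrow> 'g"
  assumes fin: "finite Z" and MA: "\<And>x y. x \<in> Z \<Longrightarrow> y \<in> Z \<Longrightarrow> M x y \<in> A"
    and N: "\<And>x y. x \<in> Z \<Longrightarrow> y \<in> Z \<Longrightarrow> (\<Sum>z\<in>Z. \<phi> (M x z) * N z y) = (if x = y then 1 else 0)"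
  obtains M' where "\<And>x y. x \<in> Z \<Longrightarrow> y \<in> Z \<Longrightarrow> M' x y \<in> A"
    and "\<And>x y. x \<in> Z \<Longrightarrow> y \<in> Z \<Longrightarrow> (\<Sum>z\<in>Z. M x z * M' z y) = (if x = y then 1 else 0)"
    and "\<And>x y. x \<in> Z \<Longrightarrow> y \<in> Z \<Longrightarrow> (\<Sum>z\<in>Z. M' x z * M z y) = (if x = y then 1 else 0)"
proof -
  define n where "n = card Z"
  obtain h where h: "bij_betw h {0..<n} Z"
    using ex_bij_betw_nat_finite[OF fin] unfolding n_def by blast
  have inZ: "h i \<in> Z" if "i < n" for i using h that by (auto simp: bij_betw_def)
  have inj: "h i = h j \<longleftrightarrow> i = j" if "i < n" "j < n" for i j
    using h that by (auto simp: bij_betw_def inj_on_def)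
  let ?M = "mat n n (\<lambda>(i,j). M (h i) (h j))" and ?N = "mat n n (\<lambda>(i,j). N (h i) (h j))"
  have M: "?M \<in> carrier_mat n n" by simp
  have MinA: "?M $$ (i,j) \<in> A" if "i < n" "j < n" for i j using that by (auto intro: MA inZ)
  have "map_mat \<phi> ?M * ?N = 1\<^sub>m n"
    by (rule eq_matI) (auto simp: scalar_prod_def sum.reindex_bij_betw[OF h, of "\<lambda>z. \<phi> (M _ z) * N z _"] N inZ inj)
  then have "det (map_mat \<phi> ?M) * det ?N = 1"
    using det_mult[of "map_mat \<phi> ?M" n ?N] by simp
  then have d0: "\<phi> (det ?M) \<noteq> 0" using hom_det[OF M MinA] by auto
  define d where "d = det ?M"
  have dA: "inverse d \<in> A" unfolding d_def using det_in[OF M MinA] d0 by (intro inverse_in) auto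
  have "d \<noteq> 0" using d0 hom_zero unfolding d_def by metis
  define g where "g = inv_into {0..<n} h"
  have g: "g (h i) = i" if "i < n" for i using h that unfolding g_def by (auto simp: bij_betw_def)
  have gZ: "g x < n" "h (g x) = x" if "x \<in> Z" for x
    using h that unfolding g_def bij_betw_def
    by (metis atLeastLessThan_iff inv_into_into, metis f_inv_into_f)
  define M' where "M' x y = inverse d * adj_mat ?M $$ (g x, g y)" for x y
  have adjc: "adj_mat ?M \<in> carrier_mat n n" using adj_mat(1)[OF M] .
  have adjA: "adj_mat ?M $$ (i,j) \<in> A" if "i < n" "j < n" for i j
  proof -
    have "mat_delete ?M j i \<in> carrier_mat (n-1) (n-1)" using mat_delete_carrier[OF M] .
    then have "det (mat_delete ?M j i) \<in> A"
    proof (rule det_in)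
      fix a b assume ab: "a < n - 1" "b < n - 1"
      show "mat_delete ?M j i $$ (a,b) \<in> A"
      proof -
        have "mat_delete ?M j i $$ (a,b) =
            M (h (if a < j then a else Suc a)) (h (if b < i then b else Suc b))"
          using ab by (simp add: mat_delete_def)
        moreover have "(if a < j then a else Suc a) < n" "(if b < i then b else Suc b) < n"
          using ab by auto
        ultimately show ?thesis using MA inZ by metis
      qed
    qed
    then have "cofactor ?M j i \<in> A"
      unfolding cofactor_def by (auto simp: minus_one_power_iff intro: mult_in one_in uminus_in)
    then show ?thesis using that by (simp add: adj_mat_def)
  qed
  have MM': "(\<Sum>z\<in>Z. M x z * M' z y) = (if x = y then 1 else 0)" if "x \<in> Z" "y \<in> Z" for x y
  proof -
    have "(\<Sum>z\<in>Z. M x z * M' z y) = inverse d * (?M * adj_mat ?M) $$ (g x, g y)"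
    proof -
      have "(?M * adj_mat ?M) $$ (g x, g y) = (\<Sum>i\<in>{0..<n}. M x (h i) * adj_mat ?M $$ (i, g y))"
        using that gZ adjc by (simp add: scalar_prod_def)
      also have "\<dots> = (\<Sum>i\<in>{0..<n}. M x (h i) * adj_mat ?M $$ (g (h i), g y))"
        by (intro sum.cong) (auto simp: g)
      also have "\<dots> = (\<Sum>z\<in>Z. M x z * adj_mat ?M $$ (g z, g y))"
        by (rule sum.reindex_bij_betw[OF h])
      finally show ?thesis by (simp add: M'_def sum_distrib_left mult_ac)
    qed
    moreover have "?M * adj_mat ?M = d \<cdot>\<^sub>m 1\<^sub>m n" unfolding d_def by (rule adj_mat(2)[OF M])
    moreover have "g x = g y \<longleftrightarrow> x = y" using gZ that by metis
    ultimately show ?thesis using gZ that \<open>d \<noteq> 0\<close> by simp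
  qed
  have M'A: "M' x y \<in> A" if "x \<in> Z" "y \<in> Z" for x y
    unfolding M'_def using that gZ adjA by (intro mult_in dA) auto
  have M'M: "(\<Sum>z\<in>Z. M' x z * M z y) = (if x = y then 1 else 0)" if "x \<in> Z" "y \<in> Z" for x y
    by (rule fin_mat_left_right_inverse[OF fin MM' that])
  show ?thesis by (rule that[OF M'A MM' M'M])
qed

end

section \<open>Specialization of rational functions\<close>

locale frac_hom =
  fixes \<phi> :: "'a::idom \<Rightarrow> 'b::field"
  assumes one: "\<phi> 1 = 1" and add: "\<phi> (a + b) = \<phi> a + \<phi> b" and mult: "\<phi> (a * b) = \<phi> a * \<phi> b"
begin

lemma zero: "\<phi> 0 = 0"
  using add[of 0 0] by (metis add.right_neutral add_left_cancel)

text \<open>Equal fractions satisfy p q' = p' q; applying \<open>\<phi>\<close> to this identity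
  shows that the definite description in \<open>fract_ext\<close> has exactly one value.\<close>

lemma ext_Fract:
  assumes "\<phi> q \<noteq> 0"
  shows "fract_ext \<phi> (Fract p q) = \<phi> p / \<phi> q"
  unfolding fract_ext_def
proof (rule the_equality)
  have "q \<noteq> 0" using assms zero by auto
  then show "\<exists>p' q'. q' \<noteq> 0 \<and> Fract p q = Fract p' q' \<and> \<phi> q' \<noteq> 0 \<and> \<phi> p / \<phi> q = \<phi> p' / \<phi> q'"
    using assms by blast
  fix y assume "\<exists>p' q'. q' \<noteq> 0 \<and> Fract p q = Fract p' q' \<and> \<phi> q' \<noteq> 0 \<and> y = \<phi> p' / \<phi> q'"
  then obtain p' q' where pq: "q' \<noteq> 0" "Fract p q = Fract p' q'" "\<phi> q' \<noteq> 0" "y = \<phi> p' / \<phi> q'" by blast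
  then have "p * q' = p' * q" using \<open>q \<noteq> 0\<close> by (simp add: eq_fract)
  then have "\<phi> p * \<phi> q' = \<phi> p' * \<phi> q" by (metis mult)
  then show "y = \<phi> p / \<phi> q" using pq(3,4) assms by (simp add: frac_eq_eq)
qed

text \<open>The localization at the kernel of \<open>\<phi>\<close>, the domain on which
  \<open>fract_ext\<close> is shown to be a homomorphism.\<close>

definition reg :: "'a fract set" where
  "reg = {Fract p q |p q. \<phi> q \<noteq> 0}"

lemma regI: "\<phi> q \<noteq> 0 \<Longrightarrow> Fract p q \<in> reg"
  by (auto simp: reg_def)

lemma ext_to_fract: "fract_ext \<phi> (to_fract p) = \<phi> p"
  using ext_Fract[of 1 p] one by (simp add: to_fract_def)

lemma ext_add: "f \<in> reg \<Longrightarrow> g \<in> reg \<Longrightarrow> fract_ext \<phi> (f + g) = fract_ext \<phi> f + fract_ext \<phi> g"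
  by (auto simp: reg_def) (subst add_fract; auto simp: ext_Fract mult add field_simps zero)

lemma ext_mult: "f \<in> reg \<Longrightarrow> g \<in> reg \<Longrightarrow> fract_ext \<phi> (f * g) = fract_ext \<phi> f * fract_ext \<phi> g"
  by (auto simp: reg_def ext_Fract mult)

lemma ext_one: "fract_ext \<phi> 1 = 1"
  using ext_to_fract[of 1] one by simp

lemma ext_zero: "fract_ext \<phi> 0 = 0"
  using ext_to_fract[of 0] zero by simp

end

text \<open>Reduces the multiplicativity of the specializations to products of two monomials with
  coefficients.\<close>

lemma poly_mapping_add_induct:
  fixes p :: "'a \<Rightarrow>\<^sub>0 'b::comm_monoid_add"
  assumes "P 0" "\<And>k c. P (single k c)" "\<And>p q. P p \<Longrightarrow> P q \<Longrightarrow> P (p + q)"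
  shows "P p"
proof -
  have "P (\<Sum>k\<in>K. single k (lookup p k))" if "finite K" for K
    using that by induction (auto intro: assms)
  moreover have "p = (\<Sum>k\<in>keys p. single k (lookup p k))"
    by (rule poly_mapping_eqI)
      (auto simp: lookup_sum lookup_single when_def in_keys_iff)
  ultimately show ?thesis by (metis finite_keys)
qed

section \<open>Total degree, and the effect of the specializations on monomials\<close>

definition mdeg :: "('a \<Rightarrow>\<^sub>0 nat) \<Rightarrow> nat" where
  "mdeg m = (\<Sum>v\<in>keys m. lookup m v)"

lemma mdeg_zero [simp]: "mdeg 0 = 0"
  by (simp add: mdeg_def)

lemma mdeg_single [simp]: "mdeg (single v n) = n"
  by (simp add: mdeg_def)

lemma mdeg_add [simp]: "mdeg (a + b) = mdeg a + mdeg b"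
  unfolding mdeg_def by (rule setsum_keys_plus_distrib) auto

lemma mdeg_sum: "mdeg (sum f A) = (\<Sum>x\<in>A. mdeg (f x))"
  by (induction A rule: infinite_finite_induct) auto

lemma mdeg_eq_0_iff [simp]: "mdeg m = 0 \<longleftrightarrow> m = 0"
  by (auto simp: mdeg_def in_keys_iff intro!: poly_mapping_eqI)

lemma nat_poly_mapping_add_eq_0_iff: "a + b = (0 :: 'a \<Rightarrow>\<^sub>0 nat) \<longleftrightarrow> a = 0 \<and> b = 0"
  by (auto simp: poly_mapping_eq_iff fun_eq_iff lookup_add)

lemma one_param_poly_single: "one_param_poly (single m c) = monom c (mdeg m)"
  by (cases "c = 0") (simp_all add: one_param_poly_def mdeg_def)

lemma one_param_poly_add: "one_param_poly (p + q) = one_param_poly p + one_param_poly q"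
  unfolding one_param_poly_def
  by (rule setsum_keys_plus_distrib[where f = "\<lambda>m c. monom c (\<Sum>k\<in>keys m. lookup m k)"])
    (simp_all add: add_monom)

lemma one_param_poly_mult: "one_param_poly (p * q) = one_param_poly p * one_param_poly q"
proof (induction p rule: poly_mapping_add_induct)
  case (2 m c)
  show ?case
  proof (induction q rule: poly_mapping_add_induct)
    case (2 m' c')
    show ?case by (simp add: mult_single one_param_poly_single mult_monom)
  qed (simp_all add: one_param_poly_add distrib_left, simp add: one_param_poly_def)
qed (simp_all add: one_param_poly_add distrib_right, simp add: one_param_poly_def)

lemma eval0_poly_single: "eval0_poly (single m c) = (if m = 0 then c else 0)"
  by (simp add: eval0_poly_def lookup_single when_def)

lemma eval0_poly_add: "eval0_poly (p + q) = eval0_poly p + eval0_poly q"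
  by (simp add: eval0_poly_def lookup_add)

lemma eval0_poly_mult: "eval0_poly (p * q) = eval0_poly p * eval0_poly q"
proof (induction p rule: poly_mapping_add_induct)
  case (2 m c)
  show ?case
  proof (induction q rule: poly_mapping_add_induct)
    case (2 m' c')
    show ?case by (simp add: mult_single eval0_poly_single nat_poly_mapping_add_eq_0_iff)
  qed (simp_all add: eval0_poly_add distrib_left, simp add: eval0_poly_def)
qed (simp_all add: eval0_poly_add distrib_right, simp add: eval0_poly_def)

text \<open>The trivial monomial is the only one of degree 0, so identifying the variables keeps the
  constant term. A denominator that is nonzero at the origin therefore stays nonzero.\<close>

lemma coeff_0_one_param_poly: "coeff (one_param_poly p) 0 = eval0_poly p"
proof (induction p rule: poly_mapping_add_induct)
  case 1 then show ?case by (simp add: one_param_poly_def eval0_poly_def)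
next
  case (2 m c) then show ?case by (auto simp: one_param_poly_single eval0_poly_single coeff_monom)
next
  case (3 p q) then show ?case by (simp add: one_param_poly_add eval0_poly_add)
qed

interpretation eval0_poly: frac_hom eval0_poly
  by unfold_locales (simp_all add: eval0_poly_add eval0_poly_mult, simp add: eval0_poly_def)

interpretation one_param_poly: frac_hom "\<lambda>p. to_fract (one_param_poly p)"
  using one_param_poly_single[of 0 1]
  by unfold_locales (simp_all add: one_param_poly_add one_param_poly_mult)

interpretation const_fract: comm_ring_hom "\<lambda>c::'a::field. to_fract [:c:]"
  by unfold_locales (simp_all flip: to_fract_add to_fract_mult one_pCons)

interpretation const_fract_poly: map_poly_comm_ring_hom "\<lambda>c::'a::field. to_fract [:c:]" ..

interpretation subst_inverse: frac_hom "\<lambda>p. poly (map_poly (\<lambda>c. to_fract [:c::rat:]) p) (inverse ut)"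
  by unfold_locales (simp_all add: hom_distribs)

lemma ut_nonzero [simp]: "(ut :: 'a::field poly fract) \<noteq> 0"
  by (simp add: ut_def)

lemma poly_map_const_ut: "poly (map_poly (\<lambda>c. to_fract [:c::'a::field:]) p) ut = to_fract p"
proof (induction p)
  case (pCons a p)
  then show ?case
    by (simp add: map_poly_pCons ut_def flip: to_fract_add to_fract_mult)
qed simp

text \<open>Multiplying p(1/t) by a power of t gives the reflected polynomial, which vanishes only
  with p. Hence every rational function of one variable can be evaluated at 1/t.\<close>

lemma poly_map_const_inverse_ut_nonzero:
  assumes "(p :: rat poly) \<noteq> 0"
  shows "poly (map_poly (\<lambda>c. to_fract [:c:]) p) (inverse ut) \<noteq> 0"
proof
  let ?h = "\<lambda>c::rat. to_fract [:c:]"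
  assume "poly (map_poly ?h p) (inverse ut) = 0"
  then have "poly (reflect_poly (map_poly ?h p)) ut = 0"
    by (subst poly_reflect_poly_nz) simp_all
  moreover have "reflect_poly (map_poly ?h p) = map_poly ?h (reflect_poly p)"
    by (rule poly_eqI) (auto simp: coeff_reflect_poly coeff_map_poly degree_map_poly)
  ultimately have "to_fract (reflect_poly p) = 0" by (simp add: poly_map_const_ut)
  then show False using assms by simp
qed

interpretation of_rat_complex: comm_ring_hom "of_rat :: rat \<Rightarrow> complex"
  by unfold_locales (simp_all add: of_rat_add of_rat_mult)

interpretation of_rat_complex_poly: map_poly_comm_ring_hom "of_rat :: rat \<Rightarrow> complex" ..

interpretation complexify: frac_hom "\<lambda>p. to_fract (map_poly (of_rat :: rat \<Rightarrow> complex) p)"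
  by unfold_locales (simp_all add: hom_distribs)

text \<open>The substitution of 1/t for all indeterminates. \<open>modified_kostka\<close> is this
  map applied to a Kostka function, times a power of \<open>ut\<close>.\<close>

definition tau :: "tratfun \<Rightarrow> uratfun" where
  "tau f = subst_inverse (one_param f)"

lemma Fract_in_frac_reg:
  assumes "frac_hom (\<phi> :: 'a::idom \<Rightarrow> 'b::field)" "\<And>q. q \<noteq> 0 \<Longrightarrow> \<phi> q \<noteq> 0"
  shows "f \<in> frac_hom.reg \<phi>"
  by (metis Fract_cases assms frac_hom.regI)

lemma subst_inverse_reg: "f \<in> subst_inverse.reg"
  by (rule Fract_in_frac_reg[OF subst_inverse.frac_hom_axioms poly_map_const_inverse_ut_nonzero])

lemma complexify_reg: "f \<in> complexify.reg"
  by (rule Fract_in_frac_reg[OF complexify.frac_hom_axioms]) simp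

lemmas subst_inverse_hom =
  subst_inverse.ext_add[OF subst_inverse_reg subst_inverse_reg, folded subst_inverse_def]
  subst_inverse.ext_mult[OF subst_inverse_reg subst_inverse_reg, folded subst_inverse_def]
  subst_inverse.ext_one[folded subst_inverse_def] subst_inverse.ext_zero[folded subst_inverse_def]

lemma complexify_add: "complexify (f + g) = complexify f + complexify g"
  and complexify_mult: "complexify (f * g) = complexify f * complexify g"
  and complexify_one: "complexify 1 = 1"
  and complexify_zero: "complexify 0 = 0"
  and complexify_to_fract: "complexify (to_fract p) = to_fract (map_poly of_rat p)"
  unfolding complexify_def
  by (simp_all add: complexify.ext_add complexify.ext_mult complexify_reg complexify.ext_one
      complexify.ext_zero complexify.ext_to_fract)

lemma complexify_uminus: "complexify (- f) = - complexify f"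
  using complexify_add[of f "- f"] by (simp add: complexify_zero eq_neg_iff_add_eq_0 add.commute)

lemma complexify_diff: "complexify (f - g) = complexify f - complexify g"
  using complexify_add[of f "- g"] by (simp add: complexify_uminus)

lemma complexify_sum: "complexify (sum f A) = (\<Sum>x\<in>A. complexify (f x))"
  by (induction A rule: infinite_finite_induct) (auto simp: complexify_zero complexify_add)

lemma complexify_prod: "complexify (prod f A) = (\<Prod>x\<in>A. complexify (f x))"
  by (induction A rule: infinite_finite_induct) (auto simp: complexify_one complexify_mult)

lemma complexify_power: "complexify (f ^ n) = complexify f ^ n"
  by (induction n) (auto simp: complexify_one complexify_mult)

lemma complexify_eq_0_iff [simp]: "complexify f = 0 \<longleftrightarrow> f = 0"
proof
  assume *: "complexify f = 0"
  show "f = 0"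
  proof (rule ccontr)
    assume "f \<noteq> 0"
    then have "complexify f * complexify (inverse f) = 1"
      by (simp add: complexify_one flip: complexify_mult)
    then show False using * by simp
  qed
qed (simp add: complexify_zero)

lemma complexify_inverse: "complexify (inverse f) = inverse (complexify f)"
proof (cases "f = 0")
  case False
  then have "complexify f * complexify (inverse f) = 1"
    by (simp add: complexify_one flip: complexify_mult)
  then show ?thesis using inverse_unique by metis
qed (simp add: complexify_zero)

lemma complexify_divide: "complexify (f / g) = complexify f / complexify g"
  by (simp add: divide_inverse complexify_mult complexify_inverse)

lemma complexify_inj: "complexify f = complexify g \<longleftrightarrow> f = g"
  using complexify_eq_0_iff[of "f - g"] by (simp add: complexify_diff)

lemma complexify_ut [simp]: "complexify ut = ut"
  by (simp add: ut_def complexify_to_fract map_poly_pCons)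

section \<open>Rational functions in r indeterminates, and those regular at the origin\<close>

lemma tpolys_add: "p \<in> tpolys r \<Longrightarrow> q \<in> tpolys r \<Longrightarrow> p + q \<in> tpolys r"
  unfolding tpolys_def using keys_add[of p q] by blast

lemma tpolys_uminus: "p \<in> tpolys r \<Longrightarrow> - p \<in> tpolys r"
  unfolding tpolys_def by (auto simp: in_keys_iff)

lemma tpolys_mult: "p \<in> tpolys r \<Longrightarrow> q \<in> tpolys r \<Longrightarrow> p * q \<in> tpolys r"
  unfolding tpolys_def
proof (intro CollectI ballI)
  fix m assume *: "p \<in> {p. \<forall>m\<in>keys p. keys m \<subseteq> {..<r}}"
    "q \<in> {p. \<forall>m\<in>keys p. keys m \<subseteq> {..<r}}" "m \<in> keys (p * q)"
  then obtain a b where "m = a + b" "a \<in> keys p" "b \<in> keys q"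
    using keys_mult[of p q] by blast
  then show "keys m \<subseteq> {..<r}" using * keys_add[of a b] by blast
qed

lemma tpolys_one: "1 \<in> tpolys r"
  by (auto simp: tpolys_def)

lemma tpolys_zero: "0 \<in> tpolys r"
  by (auto simp: tpolys_def)

lemma tpolys_single: "k < r \<Longrightarrow> single (single k n) c \<in> tpolys r"
  by (auto simp: tpolys_def split: if_splits)

lemma eval0_poly_nonzero: "eval0_poly q \<noteq> 0 \<Longrightarrow> q \<noteq> 0"
  by (auto simp: eval0_poly_def)

lemma ratfun_zero: "0 \<in> ratfun r" and ratfun_one: "1 \<in> ratfun r"
  unfolding ratfun_def Zero_fract_def One_fract_def
  using tpolys_zero tpolys_one by fastforce+

lemma ratfun_add: "f \<in> ratfun r \<Longrightarrow> g \<in> ratfun r \<Longrightarrow> f + g \<in> ratfun r"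
proof -
  assume "f \<in> ratfun r" "g \<in> ratfun r"
  then obtain p q p' q' where "f = Fract p q" "g = Fract p' q'" "p \<in> tpolys r" "q \<in> tpolys r"
    "p' \<in> tpolys r" "q' \<in> tpolys r" "q \<noteq> 0" "q' \<noteq> 0" unfolding ratfun_def by blast
  then have "f + g = Fract (p * q' + p' * q) (q * q')" "p * q' + p' * q \<in> tpolys r"
    "q * q' \<in> tpolys r" "q * q' \<noteq> 0" by (auto intro: tpolys_add tpolys_mult)
  then show ?thesis unfolding ratfun_def by blast
qed

lemma ratfun_mult: "f \<in> ratfun r \<Longrightarrow> g \<in> ratfun r \<Longrightarrow> f * g \<in> ratfun r"
proof -
  assume "f \<in> ratfun r" "g \<in> ratfun r"
  then obtain p q p' q' where "f = Fract p q" "g = Fract p' q'" "p \<in> tpolys r" "q \<in> tpolys r"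
    "p' \<in> tpolys r" "q' \<in> tpolys r" "q \<noteq> 0" "q' \<noteq> 0" unfolding ratfun_def by blast
  then have "f * g = Fract (p * p') (q * q')" "p * p' \<in> tpolys r"
    "q * q' \<in> tpolys r" "q * q' \<noteq> 0" by (auto intro: tpolys_mult)
  then show ?thesis unfolding ratfun_def by blast
qed

lemma ratfun_sum: "(\<And>x. x \<in> X \<Longrightarrow> f x \<in> ratfun r) \<Longrightarrow> sum f X \<in> ratfun r"
  by (induction X rule: infinite_finite_induct) (auto intro: ratfun_zero ratfun_add)

lemma ratfun_of_nat: "of_nat n \<in> ratfun r"
  by (induction n) (auto intro: ratfun_zero ratfun_one ratfun_add)

lemma regular_subset_ratfun: "regular_ratfun r \<subseteq> ratfun r"
  unfolding regular_ratfun_def ratfun_def using eval0_poly_nonzero by blast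

lemma regular_tvar: "k < r \<Longrightarrow> tvar k \<in> regular_ratfun r"
proof -
  assume "k < r"
  then have "single (single k 1) 1 \<in> tpolys r" by (rule tpolys_single)
  moreover have "eval0_poly 1 \<noteq> 0" by (simp add: eval0_poly.one)
  ultimately show ?thesis unfolding regular_ratfun_def tvar_def to_fract_def using tpolys_one by blast
qed

text \<open>The local ring of the origin in affine r-space, with residue field Q.\<close>

interpretation regular: local_subring "regular_ratfun r" eval0
proof
  have one: "eval0_poly 1 \<noteq> 0" by (simp add: eval0_poly.one)
  show "0 \<in> regular_ratfun r" "1 \<in> regular_ratfun r"
    unfolding regular_ratfun_def Zero_fract_def One_fract_def using tpolys_zero tpolys_one one by blast+
  have sub: "regular_ratfun r \<subseteq> eval0_poly.reg"
    unfolding regular_ratfun_def eval0_poly.reg_def by blast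
  show "eval0 1 = 1" by (simp add: eval0_def eval0_poly.ext_one)
  fix f g assume f: "f \<in> regular_ratfun r"
  then obtain p q where pq: "f = Fract p q" "p \<in> tpolys r" "q \<in> tpolys r" "eval0_poly q \<noteq> 0"
    unfolding regular_ratfun_def by blast
  show "- f \<in> regular_ratfun r"
    using pq tpolys_uminus unfolding regular_ratfun_def by (auto simp del: minus_fract) (metis minus_fract)
  show "inverse f \<in> regular_ratfun r" if "eval0 f \<noteq> 0"
  proof -
    have "eval0_poly p \<noteq> 0" using that pq by (auto simp: eval0_def eval0_poly.ext_Fract)
    then show ?thesis unfolding pq(1) inverse_fract regular_ratfun_def using pq by blast
  qed
  assume g: "g \<in> regular_ratfun r"
  then obtain p' q' where pq': "g = Fract p' q'" "p' \<in> tpolys r" "q' \<in> tpolys r" "eval0_poly q' \<noteq> 0"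
    unfolding regular_ratfun_def by blast
  have nz: "q \<noteq> 0" "q' \<noteq> 0" using pq pq' eval0_poly_nonzero by auto
  have qq: "q * q' \<in> tpolys r" "eval0_poly (q * q') \<noteq> 0"
    using pq pq' by (auto intro: tpolys_mult simp: eval0_poly_mult)
  have "f + g = Fract (p * q' + p' * q) (q * q')" "p * q' + p' * q \<in> tpolys r"
    using pq pq' nz by (auto intro: tpolys_add tpolys_mult)
  then show "f + g \<in> regular_ratfun r" unfolding regular_ratfun_def using qq by blast
  have "f * g = Fract (p * p') (q * q')" "p * p' \<in> tpolys r"
    using pq pq' by (auto intro: tpolys_mult)
  then show "f * g \<in> regular_ratfun r" unfolding regular_ratfun_def using qq by blast
  show "eval0 (f + g) = eval0 f + eval0 g" "eval0 (f * g) = eval0 f * eval0 g"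
    unfolding eval0_def using f g sub by (blast intro: eval0_poly.ext_add eval0_poly.ext_mult)+
qed

lemma regular_of_nat: "of_nat k \<in> regular_ratfun r"
  using regular.sum_in[of "{..<k}" "\<lambda>_. 1" r] regular.one_in by simp

lemma eval0_of_nat: "eval0 (of_nat k) = of_nat k"
  using regular.hom_sum[of "{..<k}" "\<lambda>_. 1" 0] regular.one_in regular.hom_one by simp

lemma eval0_tvar: "eval0 (tvar k) = 0"
proof -
  have "single k (1::nat) \<noteq> 0"
    using mdeg_single[of k 1] by (metis mdeg_zero zero_neq_one)
  then show ?thesis
    by (simp add: eval0_def tvar_def eval0_poly.ext_to_fract eval0_poly_single)
qed

text \<open>Regularity is what makes the specialization meaningful: the denominator of 1/(t_0 -
  t_1), for example, is killed when the variables are identified.\<close>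

lemma regular_one_param: "regular_ratfun r \<subseteq> one_param_poly.reg"
proof
  fix f assume "f \<in> regular_ratfun r"
  then obtain p q where pq: "f = Fract p q" "eval0_poly q \<noteq> 0"
    unfolding regular_ratfun_def by blast
  then have "one_param_poly q \<noteq> 0" using coeff_0_one_param_poly[of q] by auto
  then show "f \<in> one_param_poly.reg" unfolding pq(1) by (intro one_param_poly.regI) simp
qed

lemma tau_one: "tau 1 = 1" and tau_zero: "tau 0 = 0"
  unfolding tau_def one_param_def one_param_poly.ext_one one_param_poly.ext_zero
  by (simp_all add: subst_inverse_hom)

lemma tau_add: "f \<in> regular_ratfun r \<Longrightarrow> g \<in> regular_ratfun r \<Longrightarrow> tau (f + g) = tau f + tau g"
  and tau_mult: "f \<in> regular_ratfun r \<Longrightarrow> g \<in> regular_ratfun r \<Longrightarrow> tau (f * g) = tau f * tau g"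
  using regular_one_param
  by (auto simp: tau_def one_param_def one_param_poly.ext_add one_param_poly.ext_mult subst_inverse_hom subset_iff)

lemma tau_tvar: "tau (tvar k) = inverse ut"
  by (simp add: tau_def one_param_def tvar_def one_param_poly.ext_to_fract one_param_poly_single
      subst_inverse_def subst_inverse.ext_to_fract monom_altdef map_poly_pCons)

lemma tau_sum: "(\<And>x. x \<in> X \<Longrightarrow> f x \<in> regular_ratfun r) \<Longrightarrow> tau (sum f X) = (\<Sum>x\<in>X. tau (f x))"
  by (induction X rule: infinite_finite_induct)
    (auto simp: tau_zero tau_add[of _ r] regular.sum_in)

lemma tau_prod: "(\<And>x. x \<in> X \<Longrightarrow> f x \<in> regular_ratfun r) \<Longrightarrow> tau (prod f X) = (\<Prod>x\<in>X. tau (f x))"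
  by (induction X rule: infinite_finite_induct)
    (auto simp: tau_one tau_mult[of _ r] regular.prod_in)

section \<open>Power series and symmetric functions\<close>

lemma mcoeff_zero [simp]: "mcoeff 0 m = 0"
  by (simp add: zero_mfps_def)

lemma mcoeff_one: "mcoeff 1 m = (if m = 0 then 1 else 0)"
  by (simp add: one_mfps_def)

lemma mcoeff_add [simp]: "mcoeff (f + g) m = mcoeff f m + mcoeff g m"
  by (simp add: plus_mfps_def)

lemma mcoeff_uminus [simp]: "mcoeff (- f) m = - mcoeff f m"
  by (simp add: uminus_mfps_def)

lemma mcoeff_diff [simp]: "mcoeff (f - g) m = mcoeff f m - mcoeff g m"
  by (simp add: minus_mfps_def)

lemma mcoeff_mult: "mcoeff (f * g) m = (\<Sum>p\<in>adiag m. mcoeff f (fst p) * mcoeff g (snd p))"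
  by (simp add: times_mfps_def case_prod_unfold)

lemma mcoeff_sum: "mcoeff (sum f A) m = (\<Sum>x\<in>A. mcoeff (f x) m)"
  by (induction A rule: infinite_finite_induct) auto

lemma mcoeff_mconst_mult [simp]:
  fixes f :: "('a, 'c::comm_ring_1) mfps"
  shows "mcoeff (mconst c * f) m = c * mcoeff f m"
proof -
  have "mcoeff (mconst c * f) m = (\<Sum>p\<in>adiag m. (if fst p = 0 then c else 0) * mcoeff f (snd p))"
    by (simp add: mcoeff_mult mconst_def)
  also have "\<dots> = (\<Sum>p\<in>{(0 :: 'a \<Rightarrow>\<^sub>0 nat, m)}. (if fst p = 0 then c else 0) * mcoeff f (snd p))"
    by (rule sum.mono_neutral_right[OF finite_adiag]) (auto simp: adiag_def prod_eq_iff)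
  finally show ?thesis by simp
qed

lemma mconst_add: "mconst (c + d) = mconst c + mconst d"
  by (rule mfps_eqI) (simp add: mconst_def)

lemma mconst_mult: "mconst (c * d) = mconst c * mconst d"
  by (rule mfps_eqI) (simp, simp add: mconst_def)

lemma mconst_0 [simp]: "mconst 0 = 0"
  by (rule mfps_eqI) (simp add: mconst_def)

lemma mconst_1 [simp]: "mconst 1 = 1"
  by (rule mfps_eqI) (simp add: mconst_def mcoeff_one)

lemma mconst_sum: "mconst (sum f A) = (\<Sum>x\<in>A. mconst (f x))"
  by (induction A rule: infinite_finite_induct) (auto simp: mconst_add)

text \<open>The counterpart of \<open>adiag\<close> for a product of many factors: the ways to
  distribute a monomial over them. Extensionality outside \<open>I\<close> keeps their number
  finite.\<close>

definition splits :: "'i set \<Rightarrow> ('v \<Rightarrow>\<^sub>0 nat) \<Rightarrow> ('i \<Rightarrow> ('v \<Rightarrow>\<^sub>0 nat)) set" where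
  "splits I b = {\<gamma> \<in> extensional I. (\<Sum>i\<in>I. \<gamma> i) = b}"

lemma splits_insert:
  assumes "finite I" "x \<notin> I"
  shows "bij_betw (\<lambda>(p, \<gamma>). \<gamma>(x := fst p)) (SIGMA p:adiag b. splits I (snd p)) (splits (insert x I) b)"
proof (rule bij_betwI[where g = "\<lambda>\<gamma>. ((\<gamma> x, \<Sum>i\<in>I. \<gamma> i), \<gamma>(x := undefined))"])
  have *: "(\<Sum>i\<in>I. (\<gamma>(x := a)) i) = (\<Sum>i\<in>I. \<gamma> i)" for \<gamma> :: "'a \<Rightarrow> 'b \<Rightarrow>\<^sub>0 nat" and a
    using assms by (intro sum.cong) auto
  show "(\<lambda>(p, \<gamma>). \<gamma>(x := fst p)) \<in> (SIGMA p:adiag b. splits I (snd p)) \<rightarrow> splits (insert x I) b"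
    using assms * by (auto simp: splits_def adiag_def extensional_def)
  show "(\<lambda>\<gamma>. ((\<gamma> x, \<Sum>i\<in>I. \<gamma> i), \<gamma>(x := undefined))) \<in> splits (insert x I) b \<rightarrow> (SIGMA p:adiag b. splits I (snd p))"
    using assms * by (auto simp: splits_def adiag_def extensional_def)
  show "((((\<lambda>(p, \<gamma>). \<gamma>(x := fst p)) z) x, \<Sum>i\<in>I. ((\<lambda>(p, \<gamma>). \<gamma>(x := fst p)) z) i), ((\<lambda>(p, \<gamma>). \<gamma>(x := fst p)) z)(x := undefined)) = z"
    if "z \<in> (SIGMA p:adiag b. splits I (snd p))" for z
    using that assms * by (cases z) (auto simp: splits_def extensional_def fun_eq_iff)
  show "(\<lambda>(p, \<gamma>). \<gamma>(x := fst p)) ((\<gamma> x, \<Sum>i\<in>I. \<gamma> i), \<gamma>(x := undefined)) = \<gamma>" for \<gamma> :: "'a \<Rightarrow> 'b \<Rightarrow>\<^sub>0 nat"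
    by simp
qed

lemma splits_empty: "splits {} b = (if b = 0 then {\<lambda>_. undefined} else {})"
  by (auto simp: splits_def)

lemma finite_splits: "finite I \<Longrightarrow> finite (splits I b)"
proof (induction I arbitrary: b rule: finite_induct)
  case empty
  have "splits {} b \<subseteq> {\<lambda>_. undefined}" by (auto simp: splits_def)
  then show ?case using finite_subset by blast
next
  case (insert x I)
  show ?case
    unfolding bij_betw_finite[OF splits_insert[OF insert.hyps(1,2)], symmetric]
    by (intro finite_SigmaI finite_adiag insert.IH)
qed

lemma mcoeff_prod:
  assumes "finite I"
  shows "mcoeff (\<Prod>i\<in>I. F i) b = (\<Sum>\<gamma>\<in>splits I b. \<Prod>i\<in>I. mcoeff (F i) (\<gamma> i))"
  using assms
proof (induction I arbitrary: b rule: finite_induct)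
  case empty
  show ?case by (simp add: mcoeff_one splits_empty)
next
  case (insert x I)
  have "mcoeff (\<Prod>i\<in>insert x I. F i) b =
      (\<Sum>p\<in>adiag b. \<Sum>\<gamma>\<in>splits I (snd p). mcoeff (F x) (fst p) * (\<Prod>i\<in>I. mcoeff (F i) (\<gamma> i)))"
    using insert by (simp add: mcoeff_mult sum_distrib_left)
  also have "\<dots> = (\<Sum>(p,\<gamma>)\<in>(SIGMA p:adiag b. splits I (snd p)). mcoeff (F x) (fst p) * (\<Prod>i\<in>I. mcoeff (F i) (\<gamma> i)))"
    by (rule sum.Sigma) (auto intro: finite_adiag finite_splits insert)
  also have "\<dots> = (\<Sum>z\<in>(SIGMA p:adiag b. splits I (snd p)). \<Prod>i\<in>insert x I. mcoeff (F i) (((\<lambda>(p, \<gamma>). \<gamma>(x := fst p)) z) i))"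
    using insert.hyps by (intro sum.cong refl) (auto intro!: arg_cong2[where f = "(*)"] prod.cong)
  also have "\<dots> = (\<Sum>\<gamma>\<in>splits (insert x I) b. \<Prod>i\<in>insert x I. mcoeff (F i) (\<gamma> i))"
    by (rule sum.reindex_bij_betw[OF splits_insert[OF insert.hyps(1,2)]])
  finally show ?case .
qed

definition alph :: "nat \<Rightarrow> monom_exp \<Rightarrow> monom_exp" where
  "alph k b = (\<Sum>v\<in>{v \<in> keys b. fst v = k}. single v (lookup b v))"

lemma lookup_alph: "lookup (alph k b) v = (if fst v = k then lookup b v else 0)"
proof -
  have "lookup (alph k b) v =
      (\<Sum>w\<in>{w \<in> keys b. fst w = k}. if w = v then lookup b w else 0)"
    by (simp add: alph_def lookup_sum lookup_single when_def)
  also have "\<dots> = (if fst v = k then lookup b v else 0)"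
    by (subst sum.delta) (auto simp: in_keys_iff)
  finally show ?thesis .
qed

lemma keys_alph: "keys (alph k b) = {v \<in> keys b. fst v = k}"
  by (auto simp: in_keys_iff lookup_alph split: if_splits)

text \<open>A factor in the alphabet k alone can only take up the part of the monomial in that
  alphabet, so a single term of the convolution survives.\<close>

lemma mcoeff_prod_alph:
  fixes F :: "nat \<Rightarrow> (nat \<times> nat, 'c::comm_ring_1) mfps"
  assumes F: "\<And>k m. k < r \<Longrightarrow> mcoeff (F k) m \<noteq> 0 \<Longrightarrow> fst ` keys m \<subseteq> {k}"
  shows "mcoeff (\<Prod>k<r. F k) b =
    (if fst ` keys b \<subseteq> {..<r} then \<Prod>k<r. mcoeff (F k) (alph k b) else 0)"
proof -
  let ?g = "restrict (\<lambda>k. alph k b) {..<r}"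
  have uniq: "fst ` keys b \<subseteq> {..<r} \<and> \<gamma> = ?g"
    if g: "\<gamma> \<in> splits {..<r} b" and nz: "\<forall>k<r. mcoeff (F k) (\<gamma> k) \<noteq> 0" for \<gamma>
  proof -
    have k: "fst ` keys (\<gamma> k) \<subseteq> {k}" if "k < r" for k using F nz that by blast
    have lb: "lookup b v = (\<Sum>j<r. lookup (\<gamma> j) v)" for v
      using g by (auto simp: splits_def lookup_sum[symmetric])
    have z: "lookup (\<gamma> j) v = 0" if "j < r" "fst v \<noteq> j" for j v
      using k[OF that(1)] that(2) by (force simp: in_keys_iff)
    have lv: "lookup b v = (if fst v < r then lookup (\<gamma> (fst v)) v else 0)" for v
    proof -
      have "(\<Sum>j<r. lookup (\<gamma> j) v) = (\<Sum>j<r. if j = fst v then lookup (\<gamma> j) v else 0)"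
        by (intro sum.cong) (auto simp: z)
      then show ?thesis by (simp add: lb)
    qed
    have "fst ` keys b \<subseteq> {..<r}"
      by (auto simp: in_keys_iff lv split: if_splits)
    moreover have "\<gamma> k = ?g k" for k
    proof (cases "k < r")
      case True
      have "\<gamma> k = alph k b" by (rule poly_mapping_eqI) (use True z lv in \<open>auto simp: lookup_alph\<close>)
      then show ?thesis using True by simp
    next
      case False then show ?thesis using g by (auto simp: splits_def extensional_def)
    qed
    ultimately show ?thesis by auto
  qed
  show ?thesis
  proof (cases "fst ` keys b \<subseteq> {..<r}")
    case True
    have "(\<Sum>k<r. alph k b) = b"
    proof (rule poly_mapping_eqI)
      fix v
      have "lookup b v = 0" if "\<not> fst v < r"
        using True that by (force simp: in_keys_iff)
      then show "lookup (\<Sum>k<r. alph k b) v = lookup b v"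
        by (auto simp: lookup_sum lookup_alph)
    qed
    then have "?g \<in> splits {..<r} b" by (auto simp: splits_def)
    then have "mcoeff (\<Prod>k<r. F k) b = (\<Sum>\<gamma>\<in>{?g}. \<Prod>k<r. mcoeff (F k) (\<gamma> k))"
      unfolding mcoeff_prod[OF finite_lessThan]
    proof (intro sum.mono_neutral_right finite_splits finite_lessThan ballI)
      fix \<gamma> assume g: "\<gamma> \<in> splits {..<r} b - {?g}"
      then obtain k where "k < r" "mcoeff (F k) (\<gamma> k) = 0" using uniq[of \<gamma>] by blast
      then show "(\<Prod>k<r. mcoeff (F k) (\<gamma> k)) = 0" by (intro prod_zero) auto
    qed simp
    then show ?thesis using True by simp
  next
    case False
    have "(\<Prod>k<r. mcoeff (F k) (\<gamma> k)) = 0" if "\<gamma> \<in> splits {..<r} b" for \<gamma>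
      using uniq[OF that] False by (intro prod_zero) auto
    then show ?thesis unfolding mcoeff_prod[OF finite_lessThan] using False by (auto intro: sum.neutral)
  qed
qed

section \<open>Permutations of the variables inside each alphabet; symmetry and homogeneity\<close>

definition apm :: "(nat \<Rightarrow> nat \<Rightarrow> nat) \<Rightarrow> nat \<times> nat \<Rightarrow> nat \<times> nat" where
  "apm \<pi> v = (fst v, \<pi> (fst v) (snd v))"

lemma bij_apm: "(\<And>k. bij (\<pi> k)) \<Longrightarrow> bij (apm \<pi>)"
  by (rule o_bij[where g = "apm (\<lambda>k. inv_into UNIV (\<pi> k))"])
    (auto simp: apm_def fun_eq_iff bij_is_inj inv_f_f bij_is_surj surj_f_inv_f)

definition symmetric_mfps :: "(nat \<times> nat, 'c) mfps \<Rightarrow> bool" where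
  "symmetric_mfps f \<longleftrightarrow> (\<forall>\<pi> m. (\<forall>k. bij (\<pi> k)) \<longrightarrow> mcoeff f (map_key (apm \<pi>) m) = mcoeff f m)"

definition homog :: "nat \<Rightarrow> nat \<Rightarrow> (nat \<times> nat, 'c::zero) mfps \<Rightarrow> bool" where
  "homog r N f \<longleftrightarrow> (\<forall>m. mcoeff f m \<noteq> 0 \<longrightarrow> fst ` keys m \<subseteq> {..<r} \<and> mdeg m = N)"

lemma lookup_map_key: "inj f \<Longrightarrow> lookup (map_key f m) v = lookup m (f v)"
  by (simp add: map_key.rep_eq)

text \<open>The relation between two monomials in \<open>Xi\<close> is replaced by the pullback
  \<open>map_key\<close>, which is additive and hence compatible with products of series.\<close>

lemma Xi_iff: "f \<in> Xi r N R \<longleftrightarrow> (\<forall>m. mcoeff f m \<in> R) \<and> homog r N f \<and> symmetric_mfps f"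
proof -
  have "(\<forall>\<pi> m m'. (\<forall>k. bij (\<pi> k)) \<and> (\<forall>k i. lookup m' (k, i) = lookup m (k, \<pi> k i))
        \<longrightarrow> mcoeff f m' = mcoeff f m) \<longleftrightarrow> symmetric_mfps f" (is "?L \<longleftrightarrow> ?R")
  proof
    assume L: ?L
    show ?R unfolding symmetric_mfps_def
    proof (intro allI impI)
      fix \<pi> :: "nat \<Rightarrow> nat \<Rightarrow> nat" and m assume *: "\<forall>k. bij (\<pi> k)"
      then have "inj (apm \<pi>)" by (intro bij_is_inj bij_apm) auto
      then show "mcoeff f (map_key (apm \<pi>) m) = mcoeff f m"
        by (intro L[rule_format, of \<pi> "map_key (apm \<pi>) m" m]) (use * in \<open>auto simp: lookup_map_key apm_def\<close>)
    qed
  next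
    assume R: ?R
    show ?L
    proof (intro allI impI)
      fix \<pi> :: "nat \<Rightarrow> nat \<Rightarrow> nat" and m m' :: monom_exp
      assume *: "(\<forall>k. bij (\<pi> k)) \<and> (\<forall>k i. lookup m' (k, i) = lookup m (k, \<pi> k i))"
      then have "inj (apm \<pi>)" by (intro bij_is_inj bij_apm) auto
      then have "m' = map_key (apm \<pi>) m"
        using * by (intro poly_mapping_eqI) (auto simp: lookup_map_key apm_def)
      then show "mcoeff f m' = mcoeff f m" using R * unfolding symmetric_mfps_def by simp
    qed
  qed
  then show ?thesis unfolding Xi_def homog_def mdeg_def by blast
qed

lemma homog_add: "homog r N f \<Longrightarrow> homog r N g \<Longrightarrow> homog r N (f + g)"
  unfolding homog_def mcoeff_add by (metis add.right_neutral add.left_neutral)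

lemma homog_zero: "homog r N 0" by (simp add: homog_def)

lemma homog_mconst_mult: "homog r N f \<Longrightarrow> homog r N (mconst c * f)"
  unfolding homog_def mcoeff_mconst_mult by (metis mult_zero_right)

lemma homog_one: "homog r 0 1"
  by (auto simp: homog_def mcoeff_one)

lemma homog_mult: "homog r N f \<Longrightarrow> homog r M g \<Longrightarrow> homog r (N + M) (f * g)"
  unfolding homog_def
proof (intro allI impI)
  fix m assume f: "\<forall>m. mcoeff f m \<noteq> 0 \<longrightarrow> fst ` keys m \<subseteq> {..<r} \<and> mdeg m = N"
    and g: "\<forall>m. mcoeff g m \<noteq> 0 \<longrightarrow> fst ` keys m \<subseteq> {..<r} \<and> mdeg m = M"
    and nz: "mcoeff (f * g) m \<noteq> 0"
  then obtain p where p: "p \<in> adiag m" "mcoeff f (fst p) * mcoeff g (snd p) \<noteq> 0"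
    unfolding mcoeff_mult by (meson sum.neutral)
  then have nz': "mcoeff f (fst p) \<noteq> 0" "mcoeff g (snd p) \<noteq> 0" by auto
  have m: "m = fst p + snd p" using p by (auto simp: adiag_def)
  have "fst ` keys m \<subseteq> fst ` keys (fst p) \<union> fst ` keys (snd p)"
    unfolding m image_Un[symmetric] by (intro image_mono keys_add)
  also have "\<dots> \<subseteq> {..<r}" using f[rule_format, OF nz'(1)] g[rule_format, OF nz'(2)] by simp
  finally show "fst ` keys m \<subseteq> {..<r} \<and> mdeg m = N + M"
    using f[rule_format, OF nz'(1)] g[rule_format, OF nz'(2)] m by simp
qed

lemma homog_sum: "(\<And>x. x \<in> A \<Longrightarrow> homog r N (f x)) \<Longrightarrow> homog r N (sum f A)"
  by (induction A rule: infinite_finite_induct) (auto intro: homog_add homog_zero)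

lemma homog_prod: "finite A \<Longrightarrow> (\<And>x. x \<in> A \<Longrightarrow> homog r (N x) (f x)) \<Longrightarrow> homog r (sum N A) (prod f A)"
  by (induction A rule: finite_induct) (auto intro: homog_mult homog_one)

lemma symmetric_add: "symmetric_mfps f \<Longrightarrow> symmetric_mfps g \<Longrightarrow> symmetric_mfps (f + g)"
  by (auto simp: symmetric_mfps_def)

lemma symmetric_zero: "symmetric_mfps 0"
  by (auto simp: symmetric_mfps_def)

lemma symmetric_mconst_mult: "symmetric_mfps f \<Longrightarrow> symmetric_mfps (mconst c * f)"
  by (auto simp: symmetric_mfps_def)

lemma symmetric_sum: "(\<And>x. x \<in> A \<Longrightarrow> symmetric_mfps (f x)) \<Longrightarrow> symmetric_mfps (sum f A)"
  by (induction A rule: infinite_finite_induct) (auto intro: symmetric_add symmetric_zero)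

lemma map_key_inverse:
  fixes f :: "'a \<Rightarrow> 'a"
  assumes "bij f"
  shows "map_key (inv_into UNIV f) (map_key f m) = m"
    and "map_key f (map_key (inv_into UNIV f) m) = m"
  using assms bij_imp_bij_inv[OF assms]
  by (auto intro!: poly_mapping_eqI simp: lookup_map_key bij_is_inj bij_is_surj surj_f_inv_f inv_f_f)

lemma symmetric_one: "symmetric_mfps 1"
  unfolding symmetric_mfps_def mcoeff_one
proof (intro allI impI)
  fix \<pi> :: "nat \<Rightarrow> nat \<Rightarrow> nat" and m assume "\<forall>k. bij (\<pi> k)"
  then have b: "bij (apm \<pi>)" by (intro bij_apm) auto
  have "map_key (apm \<pi>) m = 0 \<longleftrightarrow> m = 0"
    by (metis b bij_imp_bij_inv bij_is_inj map_key_inverse(1) map_key_zero)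
  then show "(if map_key (apm \<pi>) m = 0 then 1 else 0) = (if m = 0 then 1 else (0::'a))" by simp
qed

text \<open>Pulling back along a bijection of the variables permutes the splittings of a monomial
  into two factors.\<close>

lemma symmetric_mult: "symmetric_mfps f \<Longrightarrow> symmetric_mfps g \<Longrightarrow> symmetric_mfps (f * g)"
  unfolding symmetric_mfps_def
proof (intro allI impI)
  fix \<pi> :: "nat \<Rightarrow> nat \<Rightarrow> nat" and m assume
    f: "\<forall>\<pi> m. (\<forall>k. bij (\<pi> k)) \<longrightarrow> mcoeff f (map_key (apm \<pi>) m) = mcoeff f m" and
    g: "\<forall>\<pi> m. (\<forall>k. bij (\<pi> k)) \<longrightarrow> mcoeff g (map_key (apm \<pi>) m) = mcoeff g m" and
    pi: "\<forall>k. bij (\<pi> k)"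
  then have b: "bij (apm \<pi>)" by (intro bij_apm) auto
  let ?h = "map_key (apm \<pi>)" and ?i = "map_key (inv_into UNIV (apm \<pi>))"
  have "(\<Sum>p\<in>adiag (?h m). mcoeff f (fst p) * mcoeff g (snd p)) = (\<Sum>p\<in>adiag m. mcoeff f (fst p) * mcoeff g (snd p))"
  proof (rule sum.reindex_bij_witness[where i = "map_prod ?h ?h" and j = "map_prod ?i ?i"], goal_cases)
    case (2 p)
    then have "?i (fst p + snd p) = ?i (?h m)" by (auto simp: adiag_def)
    then show ?case
      using b by (cases p) (auto simp: adiag_def map_key_inverse map_key_plus bij_imp_bij_inv bij_is_inj)
  next
    case (4 p)
    then show ?case using b by (auto simp: adiag_def map_key_plus[symmetric] bij_is_inj)
  next
    case (5 p)
    have "mcoeff f (fst p) = mcoeff f (?i (fst p))" "mcoeff g (snd p) = mcoeff g (?i (snd p))"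
      using f g pi map_key_inverse(2)[OF b] by metis+
    then show ?case by simp
  qed (use b in \<open>auto simp: map_key_inverse prod_eq_iff\<close>)
  then show "mcoeff (f * g) (?h m) = mcoeff (f * g) m" by (simp add: mcoeff_mult)
qed

lemma symmetric_prod: "(\<And>x. x \<in> A \<Longrightarrow> symmetric_mfps (f x)) \<Longrightarrow> symmetric_mfps (prod f A)"
  by (induction A rule: infinite_finite_induct) (auto intro: symmetric_mult symmetric_one)

section \<open>Orbits of monomials and r-partitions\<close>

definition xm :: "nat list list \<Rightarrow> monom_exp" where
  "xm \<nu> = (\<Sum>k<length \<nu>. \<Sum>i<length (\<nu> ! k). single (k, i) (\<nu> ! k ! i))"

text \<open>The orbits of monomials under permutations of each alphabet are labelled by
  r-partitions: \<open>shape\<close> reads off the label, and \<open>xm\<close> is the dominant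
  element of the orbit. A symmetric series is thus known from its coefficients at the
  \<open>xm\<close>.\<close>

definition shape :: "nat \<Rightarrow> monom_exp \<Rightarrow> nat list list" where
  "shape r b = map (\<lambda>k. rev (sorted_list_of_multiset (image_mset (\<lambda>i. lookup b (k, i))
     (mset_set {i. lookup b (k, i) \<noteq> 0})))) [0..<r]"

lemma lookup_xm: "lookup (xm \<nu>) (k, i) =
    (if k < length \<nu> \<and> i < length (\<nu> ! k) then \<nu> ! k ! i else 0)"
proof -
  have "lookup (xm \<nu>) (k, i) =
      (\<Sum>j<length \<nu>. \<Sum>l<length (\<nu> ! j). if j = k then if l = i then \<nu> ! k ! i else 0 else 0)"
    unfolding xm_def lookup_sum lookup_single when_def by (intro sum.cong) auto
  also have "\<dots> = (\<Sum>j<length \<nu>. if j = k then \<Sum>l<length (\<nu> ! k). if l = i then \<nu> ! k ! i else 0 else 0)"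
    by (intro sum.cong) auto
  finally show ?thesis by auto
qed

lemma finite_row: "finite {i. lookup (b :: monom_exp) (k, i) \<noteq> 0}"
proof -
  have "{i. lookup b (k, i) \<noteq> 0} \<subseteq> snd ` keys b"
    by (force simp: in_keys_iff image_iff)
  then show ?thesis by (rule finite_subset) simp
qed

lemma mset_shape: "k < r \<Longrightarrow> mset (shape r b ! k) =
    image_mset (\<lambda>i. lookup b (k, i)) (mset_set {i. lookup b (k, i) \<noteq> 0})"
  by (simp add: shape_def)

lemma length_shape [simp]: "length (shape r b) = r"
  by (simp add: shape_def)

lemma is_partition_shape: "k < r \<Longrightarrow> is_partition (shape r b ! k)"
proof -
  assume k: "k < r"
  have "0 \<notin># mset (shape r b ! k)" unfolding mset_shape[OF k] using finite_row by auto
  then show ?thesis using k by (simp add: is_partition_def) (simp add: shape_def)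
qed

lemma partition_eqI: "is_partition \<mu> \<Longrightarrow> is_partition \<nu> \<Longrightarrow> mset \<mu> = mset \<nu> \<Longrightarrow> \<mu> = \<nu>"
  unfolding is_partition_def
  by (metis mset_rev properties_for_sort rev_rev_ident)

lemma mparts_eqI:
  assumes "\<mu> \<in> mparts r N" "\<nu> \<in> mparts r N'" "\<And>k. k < r \<Longrightarrow> mset (\<mu> ! k) = mset (\<nu> ! k)"
  shows "\<mu> = \<nu>"
  using assms by (auto simp: mparts_def intro!: nth_equalityI[of \<mu>] partition_eqI)

lemma mdeg_rows:
  fixes b :: monom_exp
  assumes "fst ` keys b \<subseteq> {..<r}"
  shows "mdeg b = (\<Sum>k<r. \<Sum>i | lookup b (k, i) \<noteq> 0. lookup b (k, i))"
proof -
  have "keys b = (SIGMA k:{..<r}. {i. lookup b (k, i) \<noteq> 0})"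
    using assms by (force simp: in_keys_iff)
  then show ?thesis unfolding mdeg_def using finite_row[of b]
    by (subst sum.Sigma) (auto simp: case_prod_unfold)
qed

lemma shape_in_mparts:
  assumes "fst ` keys b \<subseteq> {..<r}"
  shows "shape r b \<in> mparts r (mdeg b)"
proof -
  have "sum_list (shape r b ! k) = (\<Sum>i | lookup b (k, i) \<noteq> 0. lookup b (k, i))" if "k < r" for k
    by (subst sum_mset_sum_list[symmetric], subst mset_shape[OF that]) (simp add: sum_unfold_sum_mset)
  then show ?thesis unfolding mparts_def mdeg_rows[OF assms] by (auto simp: is_partition_shape)
qed

lemma row_xm:
  assumes "\<nu> \<in> mparts r N" "k < r"
  shows "{i. lookup (xm \<nu>) (k, i) \<noteq> 0} = {..<length (\<nu> ! k)}"
    and "i < length (\<nu> ! k) \<Longrightarrow> lookup (xm \<nu>) (k, i) = \<nu> ! k ! i"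
proof -
  have "\<nu> ! k ! i \<noteq> 0" if "i < length (\<nu> ! k)" for i
    using assms nth_mem[OF that] unfolding mparts_def is_partition_def by (metis (mono_tags, lifting) mem_Collect_eq)
  then show "{i. lookup (xm \<nu>) (k, i) \<noteq> 0} = {..<length (\<nu> ! k)}"
    using assms by (auto simp: lookup_xm mparts_def split: if_splits)
  show "i < length (\<nu> ! k) \<Longrightarrow> lookup (xm \<nu>) (k, i) = \<nu> ! k ! i"
    using assms by (auto simp: lookup_xm mparts_def)
qed

lemma keys_xm:
  assumes "\<nu> \<in> mparts r N"
  shows "keys (xm \<nu>) = (SIGMA k:{..<r}. {..<length (\<nu> ! k)})"
proof -
  have "v \<in> keys (xm \<nu>) \<longleftrightarrow> v \<in> (SIGMA k:{..<r}. {..<length (\<nu> ! k)})" for v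
  proof (cases "fst v < r")
    case True
    have "v \<in> keys (xm \<nu>) \<longleftrightarrow> snd v \<in> {i. lookup (xm \<nu>) (fst v, i) \<noteq> 0}"
      by (simp add: in_keys_iff)
    then show ?thesis using True unfolding row_xm(1)[OF assms True] by (cases v) auto
  next
    case False
    then show ?thesis using assms by (cases v) (auto simp: in_keys_iff lookup_xm mparts_def)
  qed
  then show ?thesis by blast
qed

lemma fst_keys_xm: "\<nu> \<in> mparts r N \<Longrightarrow> fst ` keys (xm \<nu>) \<subseteq> {..<r}"
  by (auto simp: keys_xm)

lemma mdeg_xm: "\<nu> \<in> mparts r N \<Longrightarrow> mdeg (xm \<nu>) = N"
  unfolding xm_def mdeg_sum by (simp add: mparts_def sum_list_sum_nth atLeast0LessThan)

lemma shape_xm: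
  assumes "\<nu> \<in> mparts r N"
  shows "shape r (xm \<nu>) = \<nu>"
proof (rule mparts_eqI)
  show "shape r (xm \<nu>) \<in> mparts r N"
    using shape_in_mparts[OF fst_keys_xm[OF assms]] by (simp add: mdeg_xm[OF assms])
  show "\<nu> \<in> mparts r N" by fact
  fix k assume k: "k < r"
  have "mset (\<nu> ! k) = mset (map ((!) (\<nu> ! k)) [0..<length (\<nu> ! k)])" by (simp add: map_nth)
  also have "\<dots> = image_mset ((!) (\<nu> ! k)) (mset_set {..<length (\<nu> ! k)})"
    by (simp flip: mset_set_upto_eq_mset_upto atLeast0LessThan)
  also have "\<dots> = mset (shape r (xm \<nu>) ! k)"
    unfolding mset_shape[OF k] row_xm(1)[OF assms k]
    by (intro image_mset_cong) (auto simp: row_xm(2)[OF assms k])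
  finally show "mset (shape r (xm \<nu>) ! k) = mset (\<nu> ! k)" by simp
qed

lemma xm_inj: "\<mu> \<in> mparts r N \<Longrightarrow> \<nu> \<in> mparts r N' \<Longrightarrow> xm \<mu> = xm \<nu> \<longleftrightarrow> \<mu> = \<nu>"
  by (metis shape_xm)

text \<open>On the union of the two supports the values agree as multisets with the zeros included,
  because the supports have equal size. So they differ by a permutation of that finite set, and this
  extends by the identity to all indices.\<close>

lemma finite_support_rearrange:
  fixes g h :: "nat \<Rightarrow> nat"
  assumes "finite {i. g i \<noteq> 0}" "finite {i. h i \<noteq> 0}"
    and eq: "image_mset g (mset_set {i. g i \<noteq> 0}) = image_mset h (mset_set {i. h i \<noteq> 0})"
  shows "\<exists>\<pi>. bij \<pi> \<and> (\<forall>i. g i = h (\<pi> i))"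
proof -
  define A where "A = {i. g i \<noteq> 0} \<union> {i. h i \<noteq> 0}"
  have A: "finite A" using assms by (simp add: A_def)
  have ms: "image_mset u (mset_set A) = image_mset u (mset_set {i. u i \<noteq> 0}) +
      replicate_mset (card A - card {i. u i \<noteq> 0}) 0" if "{i. u i \<noteq> 0} \<subseteq> A" for u :: "nat \<Rightarrow> nat"
  proof -
    have f: "finite {i. u i \<noteq> 0}" using that A finite_subset by blast
    have "A = {i. u i \<noteq> 0} \<union> (A - {i. u i \<noteq> 0})" using that by blast
    then have "mset_set A = mset_set {i. u i \<noteq> 0} + mset_set (A - {i. u i \<noteq> 0})"
      using A f by (subst mset_set_Union[symmetric]) auto
    moreover have "image_mset u (mset_set (A - {i. u i \<noteq> 0})) = image_mset (\<lambda>_. 0) (mset_set (A - {i. u i \<noteq> 0}))"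
      using A by (intro image_mset_cong) auto
    ultimately show ?thesis using that f by (simp add: image_mset_const_eq card_Diff_subset)
  qed
  have "card {i. g i \<noteq> 0} = card {i. h i \<noteq> 0}"
    using arg_cong[OF eq, of size] by simp
  then have "image_mset g (mset_set A) = image_mset h (mset_set A)"
    using ms[of g] ms[of h] eq by (auto simp: A_def)
  then obtain p where p: "p permutes A" "\<forall>x\<in>A. g x = h (p x)"
    using image_mset_eq_implies_permutes[OF A] by blast
  have "g x = h (p x)" for x
  proof (cases "x \<in> A")
    case False
    then have "g x = 0" "h x = 0" by (simp_all add: A_def)
    then show ?thesis using permutes_not_in[OF p(1) False] by simp
  qed (use p(2) in blast)
  then show ?thesis using permutes_bij[OF p(1)] by blast
qed

lemma symmetric_shape:
  assumes f: "symmetric_mfps f" and b: "fst ` keys b \<subseteq> {..<r}"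
  shows "mcoeff f b = mcoeff f (xm (shape r b))"
proof -
  note sh = shape_in_mparts[OF b]
  have "\<exists>\<pi>. bij \<pi> \<and> (\<forall>i. lookup b (k, i) = lookup (xm (shape r b)) (k, \<pi> i))" for k
  proof (cases "k < r")
    case True
    have "mset (shape r b ! k) = mset (shape r (xm (shape r b)) ! k)" by (simp add: shape_xm[OF sh])
    then show ?thesis
      using finite_support_rearrange[OF finite_row[of b k] finite_row[of "xm (shape r b)" k]]
      by (simp only: mset_shape[OF True])
  next
    case False
    then have "lookup b (k, i) = 0" for i using b by (force simp: in_keys_iff)
    moreover have "lookup (xm (shape r b)) (k, i) = 0" for i
      using False by (simp add: lookup_xm)
    ultimately show ?thesis by (intro exI[of _ id]) auto
  qed
  then obtain \<pi> where pi: "\<And>k. bij (\<pi> k)"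
    "\<And>k i. lookup b (k, i) = lookup (xm (shape r b)) (k, \<pi> k i)" by metis
  have "b = map_key (apm \<pi>) (xm (shape r b))"
    using bij_apm[OF pi(1)] by (intro poly_mapping_eqI) (auto simp: lookup_map_key bij_is_inj apm_def pi(2))
  then show ?thesis using f pi(1) unfolding symmetric_mfps_def by metis
qed

lemma mcoeff_monomial_sym:
  assumes \<nu>: "\<nu> \<in> mparts r N"
  shows "mcoeff (monomial_sym \<nu>) b = (if fst ` keys b \<subseteq> {..<r} \<and> shape r b = \<nu> then 1 else 0)"
proof (cases "fst ` keys b \<subseteq> {..<r}")
  case True
  have len: "length \<nu> = r" using \<nu> by (simp add: mparts_def)
  have c: "mcoeff (monomial_sym1 k (\<nu> ! k)) (alph k b) = (if mset (shape r b ! k) = mset (\<nu> ! k) then 1 else (0::'a))"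
    if "k < r" for k
  proof -
    have keys: "keys (alph k b) = Pair k ` {i. lookup b (k, i) \<noteq> 0}"
      by (auto simp: keys_alph in_keys_iff)
    have "image_mset (lookup (alph k b)) (mset_set (keys (alph k b))) =
        image_mset (\<lambda>i. lookup (alph k b) (k, i)) (mset_set {i. lookup b (k, i) \<noteq> 0})"
      unfolding keys by (subst image_mset_mset_set[symmetric]) (auto simp: inj_on_def multiset.map_comp o_def)
    also have "\<dots> = mset (shape r b ! k)"
      by (simp add: mset_shape[OF that] lookup_alph)
    finally have "image_mset (lookup (alph k b)) (mset_set (keys (alph k b))) = mset (shape r b ! k)" .
    then show ?thesis by (auto simp: monomial_sym1_def keys)
  qed
  have supp: "fst ` keys m \<subseteq> {k}" if "mcoeff (monomial_sym1 k \<mu> :: (_, 'a) mfps) m \<noteq> 0" for k \<mu> m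
    using that by (auto simp: monomial_sym1_def split: if_splits)
  have "mcoeff (monomial_sym \<nu>) b = (\<Prod>k<r. if mset (shape r b ! k) = mset (\<nu> ! k) then 1 else (0::'a))"
    unfolding monomial_sym_def len using True c supp by (subst mcoeff_prod_alph) auto
  also have "\<dots> = (if \<forall>k<r. mset (shape r b ! k) = mset (\<nu> ! k) then 1 else 0)"
    by (auto intro!: prod_zero)
  also have "(\<forall>k<r. mset (shape r b ! k) = mset (\<nu> ! k)) \<longleftrightarrow> shape r b = \<nu>"
    using mparts_eqI[OF shape_in_mparts[OF True] \<nu>] by auto
  finally show ?thesis using True by simp
next
  case False
  have len: "length \<nu> = r" using \<nu> by (simp add: mparts_def)
  show ?thesis using False unfolding monomial_sym_def len
    by (subst mcoeff_prod_alph) (auto simp: monomial_sym1_def split: if_splits)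
qed

lemma mcoeff_monomial_sym_xm:
  assumes "\<nu> \<in> mparts r N" "\<mu> \<in> mparts r N'"
  shows "mcoeff (monomial_sym \<nu>) (xm \<mu>) = (if \<mu> = \<nu> then 1 else 0)"
  using assms by (simp add: mcoeff_monomial_sym fst_keys_xm shape_xm)

lemma finite_mparts: "finite (mparts r N)"
proof (rule finite_subset)
  let ?L = "{xs. set xs \<subseteq> {..N} \<and> length xs \<le> N}"
  show "mparts r N \<subseteq> {\<nu>. set \<nu> \<subseteq> ?L \<and> length \<nu> = r}"
  proof clarsimp
    fix \<nu> assume \<nu>: "\<nu> \<in> mparts r N"
    show "set \<nu> \<subseteq> ?L \<and> length \<nu> = r"
    proof (intro conjI subsetI)
      fix xs assume "xs \<in> set \<nu>"
      then obtain k where k: "k < r" "xs = \<nu> ! k" using \<nu> by (auto simp: mparts_def in_set_conv_nth)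
      have "sum_list (\<nu> ! k) \<le> (\<Sum>j<r. sum_list (\<nu> ! j))"
        using k by (intro member_le_sum[of k "{..<r}" "\<lambda>j. sum_list (\<nu> ! j)"]) auto
      then have s: "sum_list xs \<le> N" using \<nu> k by (auto simp: mparts_def)
      have "0 \<notin> set xs" using \<nu> k by (auto simp: mparts_def is_partition_def)
      then have "length xs \<le> sum_list xs" by (induction xs) auto
      moreover have "x \<le> N" if "x \<in> set xs" for x
        using member_le_sum_list[OF that] s by simp
      ultimately show "xs \<in> ?L" using s by auto
    qed (use \<nu> in \<open>auto simp: mparts_def\<close>)
  qed
  have "finite ?L" by (rule finite_lists_length_le) simp
  then show "finite {\<nu>. set \<nu> \<subseteq> ?L \<and> length \<nu> = r}" by (rule finite_lists_length_eq)
qed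

lemma keys_map_key_bij: "bij f \<Longrightarrow> f ` keys (map_key f m) = keys m"
proof -
  assume b: "bij f"
  have "keys (map_key f m) = f -` keys m"
    using b by (auto simp: in_keys_iff lookup_map_key bij_is_inj)
  then show ?thesis using b by (simp add: bij_is_surj surj_image_vimage_eq)
qed

lemma fst_keys_map_key:
  assumes "bij (apm \<pi>)"
  shows "fst ` keys (map_key (apm \<pi>) m) = fst ` keys m"
proof -
  have "fst ` apm \<pi> ` X = fst ` X" for X by (auto simp: apm_def image_image)
  then show ?thesis using keys_map_key_bij[OF assms, of m] by metis
qed

lemma monomial_sym_in_Xi:
  fixes R :: "'c::comm_ring_1 set"
  assumes "\<nu> \<in> mparts r N" "0 \<in> R" "1 \<in> R"
  shows "monomial_sym \<nu> \<in> Xi r N R"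
  unfolding Xi_iff
proof (intro conjI allI)
  show "mcoeff (monomial_sym \<nu> :: (nat \<times> nat, 'c) mfps) m \<in> R" for m using assms by (simp add: mcoeff_monomial_sym)
  show "homog r N (monomial_sym \<nu> :: (nat \<times> nat, 'c) mfps)"
    unfolding homog_def
  proof (intro allI impI)
    fix m assume "mcoeff (monomial_sym \<nu> :: (nat \<times> nat, 'c) mfps) m \<noteq> 0"
    then have m: "fst ` keys m \<subseteq> {..<r}" "shape r m = \<nu>"
      using assms(1) by (auto simp: mcoeff_monomial_sym split: if_splits)
    then have "mdeg m = N" using shape_in_mparts[OF m(1)] assms(1) by (auto simp: mparts_def)
    then show "fst ` keys m \<subseteq> {..<r} \<and> mdeg m = N" using m by simp
  qed
  show "symmetric_mfps (monomial_sym \<nu> :: (nat \<times> nat, 'c) mfps)"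
    unfolding symmetric_mfps_def
  proof (intro allI impI)
    fix \<pi> :: "nat \<Rightarrow> nat \<Rightarrow> nat" and m :: monom_exp
    assume pi: "\<forall>k. bij (\<pi> k)"
    then have b: "bij (apm \<pi>)" by (intro bij_apm) auto
    let ?h = "map_key (apm \<pi>)"
    have l: "lookup (?h m) (k, i) = lookup m (k, \<pi> k i)" for k i
      using b by (simp add: lookup_map_key bij_is_inj apm_def)
    have "fst ` keys (?h m) = fst ` keys m" by (rule fst_keys_map_key[OF b])
    moreover have "shape r (?h m) = shape r m"
      unfolding shape_def
    proof (intro map_cong refl arg_cong[where f = "\<lambda>x. rev (sorted_list_of_multiset x)"])
      fix k
      have inj: "inj_on (\<pi> k) {i. lookup (?h m) (k, i) \<noteq> 0}"
        using pi by (auto intro: inj_on_subset[OF bij_is_inj])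
      have "{i. lookup (?h m) (k, i) \<noteq> 0} = \<pi> k -` {i. lookup m (k, i) \<noteq> 0}"
        by (auto simp: l)
      then have "{i. lookup m (k, i) \<noteq> 0} = \<pi> k ` {i. lookup (?h m) (k, i) \<noteq> 0}"
        using surj_image_vimage_eq[OF bij_is_surj[OF pi[rule_format, of k]], of "{i. lookup m (k, i) \<noteq> 0}"]
        by (simp only:)
      then have E: "{i. lookup m (k, i) \<noteq> 0} = \<pi> k ` {i. lookup (?h m) (k, i) \<noteq> 0}" .
      show "image_mset (\<lambda>i. lookup (?h m) (k, i)) (mset_set {i. lookup (?h m) (k, i) \<noteq> 0}) =
          image_mset (\<lambda>i. lookup m (k, i)) (mset_set {i. lookup m (k, i) \<noteq> 0})"
        unfolding E by (subst image_mset_mset_set[OF inj, symmetric]) (simp add: multiset.map_comp o_def l)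
    qed
    ultimately show "mcoeff (monomial_sym \<nu> :: (nat \<times> nat, 'c) mfps) (?h m) = mcoeff (monomial_sym \<nu>) m"
      using assms(1) by (simp add: mcoeff_monomial_sym)
  qed
qed

lemma monomial_expansion:
  assumes f: "homog r N f" "symmetric_mfps f"
  shows "f = (\<Sum>\<nu>\<in>mparts r N. mconst (mcoeff f (xm \<nu>)) * monomial_sym \<nu>)"
proof (rule mfps_eqI)
  fix b
  have "mcoeff (\<Sum>\<nu>\<in>mparts r N. mconst (mcoeff f (xm \<nu>)) * monomial_sym \<nu>) b =
      (\<Sum>\<nu>\<in>mparts r N. if fst ` keys b \<subseteq> {..<r} \<and> shape r b = \<nu> then mcoeff f (xm \<nu>) else 0)"
    by (auto simp: mcoeff_sum mcoeff_monomial_sym intro!: sum.cong)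
  also have "\<dots> = mcoeff f b"
  proof (cases "fst ` keys b \<subseteq> {..<r} \<and> mdeg b = N")
    case True
    then have "shape r b \<in> mparts r N" using shape_in_mparts by blast
    then show ?thesis using True symmetric_shape[OF f(2), of b r] by (simp add: finite_mparts)
  next
    case False
    then have "mcoeff f b = 0" using f(1) by (auto simp: homog_def)
    moreover have "(\<Sum>\<nu>\<in>mparts r N. if fst ` keys b \<subseteq> {..<r} \<and> shape r b = \<nu>
        then mcoeff f (xm \<nu>) else 0) = 0"
    proof (rule sum.neutral, rule ballI)
      fix \<nu> assume "\<nu> \<in> mparts r N"
      then have "\<not> (fst ` keys b \<subseteq> {..<r} \<and> shape r b = \<nu>)"
        using False shape_in_mparts[of b r] by (auto simp: mparts_def)
      then show "(if fst ` keys b \<subseteq> {..<r} \<and> shape r b = \<nu> then mcoeff f (xm \<nu>) else 0) = 0"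
        by (rule if_not_P)
    qed
    ultimately show ?thesis by simp
  qed
  finally show "mcoeff f b = mcoeff (\<Sum>\<nu>\<in>mparts r N. mconst (mcoeff f (xm \<nu>)) * monomial_sym \<nu>) b" by simp
qed

lemma homog_symmetric_eqI:
  fixes f g :: "(nat \<times> nat, 'c::comm_ring_1) mfps"
  assumes "homog r N f" "symmetric_mfps f" "homog r N g" "symmetric_mfps g"
    and "\<And>\<nu>. \<nu> \<in> mparts r N \<Longrightarrow> mcoeff f (xm \<nu>) = mcoeff g (xm \<nu>)"
  shows "f = g"
  using monomial_expansion[OF assms(1,2)] monomial_expansion[OF assms(3,4)] assms(5)
  by (metis (no_types, lifting) sum.cong)

section \<open>Schur functions\<close>

lemma finite_diagram [simp]: "finite (diagram \<nu>)"
proof -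
  have "diagram \<nu> = (SIGMA i:{..<length \<nu>}. {..<\<nu> ! i})" by (auto simp: diagram_def)
  then show ?thesis by simp
qed

lemma card_diagram: "card (diagram \<nu>) = sum_list \<nu>"
proof -
  have "diagram \<nu> = (SIGMA i:{..<length \<nu>}. {..<\<nu> ! i})" by (auto simp: diagram_def)
  then show ?thesis by (simp add: sum_list_sum_nth atLeast0LessThan)
qed

definition rown :: "nat list \<Rightarrow> nat \<Rightarrow> nat" where
  "rown \<nu> i = (if i < length \<nu> then \<nu> ! i else 0)"

lemma card_rows: "card {c \<in> diagram \<nu>. fst c < p} = (\<Sum>i<p. rown \<nu> i)"
proof -
  have "{c \<in> diagram \<nu>. fst c < p} = (SIGMA i:{..<p}. {..<rown \<nu> i})"
    by (auto simp: diagram_def rown_def split: if_splits)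
  then show ?thesis by simp
qed

text \<open>Columns increase strictly and start at an entry that is at least 0. That \<nu> is a
  partition ensures that the cell above a cell is in the diagram.\<close>

lemma ssyt_ge_row:
  assumes T: "T \<in> ssyt \<nu>" and p: "is_partition \<nu>"
  shows "(i, j) \<in> diagram \<nu> \<Longrightarrow> i \<le> T (i, j)"
proof (induction i)
  case (Suc i)
  have "sorted_wrt (\<ge>) \<nu>" using p by (simp add: is_partition_def sorted_wrt_rev)
  then have "\<nu> ! Suc i \<le> \<nu> ! i"
    using Suc.prems sorted_wrt_nth_less[of "(\<ge>)" \<nu> i "Suc i"] by (auto simp: diagram_def)
  then have "(i, j) \<in> diagram \<nu>" using Suc.prems by (auto simp: diagram_def)
  then show ?case using Suc T unfolding ssyt_def by fastforce
qed simp

definition content :: "nat \<Rightarrow> nat list \<Rightarrow> (nat \<times> nat \<Rightarrow> nat) \<Rightarrow> monom_exp" where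
  "content k \<nu> T = (\<Sum>c\<in>diagram \<nu>. single (k, T c) 1)"

lemma lookup_content: "lookup (content k \<nu> T) (j, i) = (if j = k then card {c \<in> diagram \<nu>. T c = i} else 0)"
proof -
  have "lookup (content k \<nu> T) (j, i) = (\<Sum>c\<in>diagram \<nu>. if j = k \<and> T c = i then 1 else 0)"
    unfolding content_def lookup_sum by (intro sum.cong) (auto simp: lookup_single when_def)
  then show ?thesis by (simp add: sum.If_cases Int_def)
qed

lemma sum_lookup_content: "(\<Sum>i<p. lookup (content k \<nu> T) (k, i)) = card {c \<in> diagram \<nu>. T c < p}"
proof -
  have "(\<Sum>i<p. lookup (content k \<nu> T) (k, i)) = (\<Sum>i<p. card {c \<in> diagram \<nu>. T c = i})"
    by (simp add: lookup_content)
  also have "\<dots> = card (\<Union>i\<in>{..<p}. {c \<in> diagram \<nu>. T c = i})"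
    by (intro card_UN_disjoint[symmetric]) auto
  also have "(\<Union>i\<in>{..<p}. {c \<in> diagram \<nu>. T c = i}) = {c \<in> diagram \<nu>. T c < p}" by auto
  finally show ?thesis .
qed

lemma mcoeff_schur1: "mcoeff (schur1 k \<nu>) m = of_nat (card {T \<in> ssyt \<nu>. content k \<nu> T = m})"
  by (simp add: schur1_def content_def)

lemma schur1_nonzero:
  assumes "mcoeff (schur1 k \<nu>) m \<noteq> 0"
  obtains T where "T \<in> ssyt \<nu>" "content k \<nu> T = m"
proof -
  have "{T \<in> ssyt \<nu>. content k \<nu> T = m} \<noteq> {}"
    using assms by (auto simp: mcoeff_schur1 simp del: Collect_empty_eq)
  then show ?thesis using that by blast
qed

lemma keys_content: "fst ` keys (content k \<nu> T) \<subseteq> {k}"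
  by (auto simp: in_keys_iff lookup_content split: if_splits)

lemma mdeg_content: "mdeg (content k \<nu> T) = sum_list \<nu>"
  by (simp add: content_def mdeg_sum card_diagram)

text \<open>Entries smaller than p can only occur in the first p rows. This is the dominance
  condition for nonzero Kostka numbers, valid here for any order of the exponents.\<close>

lemma schur1_dominance:
  assumes "mcoeff (schur1 k \<nu>) m \<noteq> 0" "is_partition \<nu>"
  shows "(\<Sum>i<p. lookup m (k, i)) \<le> (\<Sum>i<p. rown \<nu> i)"
proof -
  obtain T where T: "T \<in> ssyt \<nu>" "content k \<nu> T = m" using schur1_nonzero[OF assms(1)] .
  have "{c \<in> diagram \<nu>. T c < p} \<subseteq> {c \<in> diagram \<nu>. fst c < p}"
    using ssyt_ge_row[OF T(1) assms(2)] by (auto, meson order.strict_trans1)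
  then have "card {c \<in> diagram \<nu>. T c < p} \<le> card {c \<in> diagram \<nu>. fst c < p}"
    by (intro card_mono) auto
  then show ?thesis unfolding card_rows sum_lookup_content[where p = p and k = k, symmetric] using T by simp
qed

text \<open>Equality in the dominance bound for every p forces the entries of row i to be i, so
  there is just one tableau.\<close>

lemma schur1_diagonal:
  assumes p: "is_partition \<nu>" and m: "\<And>j i. lookup m (j, i) = (if j = k then rown \<nu> i else 0)"
  shows "mcoeff (schur1 k \<nu>) m = 1"
proof -
  let ?T = "restrict fst (diagram \<nu>)"
  have "sorted_wrt (\<ge>) \<nu>" using p by (simp add: is_partition_def sorted_wrt_rev)
  then have dec: "\<nu> ! Suc i \<le> \<nu> ! i" if "Suc i < length \<nu>" for i
    using that sorted_wrt_nth_less[of "(\<ge>)" \<nu> i "Suc i"] by auto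
  have "?T \<in> ssyt \<nu>" by (auto simp: ssyt_def)
  moreover have "content k \<nu> ?T = m"
  proof (rule poly_mapping_eqI)
    fix v :: "nat \<times> nat"
    obtain j i where v: "v = (j, i)" by (cases v)
    have "{c \<in> diagram \<nu>. ?T c = i} = {c \<in> diagram \<nu>. fst c = i}" by auto
    also have "\<dots> = Pair i ` {..<rown \<nu> i}" by (auto simp: diagram_def rown_def split: if_splits)
    finally have "card {c \<in> diagram \<nu>. ?T c = i} = rown \<nu> i"
      by (simp add: card_image inj_on_def)
    then show "lookup (content k \<nu> ?T) v = lookup m v"
      unfolding v lookup_content m by simp
  qed
  moreover have "T = ?T" if T: "T \<in> ssyt \<nu>" "content k \<nu> T = m" for T
  proof -
    have "T c = fst c" if c: "c \<in> diagram \<nu>" for c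
    proof -
      \<comment> \<open>Comparing with the rows up to that of c bounds \<open>T c\<close> from above
        by the row index; the lower bound is \<open>ssyt_ge_row\<close>.\<close>
      define p where "p = Suc (fst c)"
      have sub: "{c \<in> diagram \<nu>. T c < p} \<subseteq> {c \<in> diagram \<nu>. fst c < p}"
        using ssyt_ge_row[OF T(1) assms(1)] by (auto, meson order.strict_trans1)
      have "card {c \<in> diagram \<nu>. T c < p} = card {c \<in> diagram \<nu>. fst c < p}"
        unfolding card_rows sum_lookup_content[where p = p and k = k, symmetric] using T m by simp
      then have "{c \<in> diagram \<nu>. T c < p} = {c \<in> diagram \<nu>. fst c < p}"
        using sub by (intro card_subset_eq) auto
      then have "T c < p" using c by (auto simp: p_def)
      moreover have "fst c \<le> T c" using ssyt_ge_row[OF T(1) assms(1), of "fst c" "snd c"] c by simp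
      ultimately show ?thesis by (simp add: p_def)
    qed
    then show ?thesis using T by (auto simp: ssyt_def extensional_def restrict_def fun_eq_iff)
  qed
  ultimately have "{T \<in> ssyt \<nu>. content k \<nu> T = m} = {?T}" by blast
  then show ?thesis by (simp add: mcoeff_schur1)
qed

lemma mcoeff_schur:
  assumes "length \<nu> = r"
  shows "mcoeff (schur \<nu>) b = (if fst ` keys b \<subseteq> {..<r}
     then \<Prod>k<r. mcoeff (schur1 k (\<nu> ! k)) (alph k b) else 0)"
  unfolding schur_def assms
proof (rule mcoeff_prod_alph)
  fix k m assume "mcoeff (schur1 k (\<nu> ! k) :: (nat \<times> nat, 'a) mfps) m \<noteq> 0"
  then show "fst ` keys m \<subseteq> {k}" using schur1_nonzero keys_content by metis
qed

lemma homog_schur: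
  assumes "\<nu> \<in> mparts r N"
  shows "homog r N (schur \<nu> :: (nat \<times> nat, 'a::comm_ring_1) mfps)"
proof -
  have "homog r (\<Sum>k<r. sum_list (\<nu> ! k)) (\<Prod>k<r. schur1 k (\<nu> ! k) :: (nat \<times> nat, 'a) mfps)"
  proof (rule homog_prod)
    fix k assume "k \<in> {..<r}"
    then show "homog r (sum_list (\<nu> ! k)) (schur1 k (\<nu> ! k) :: (nat \<times> nat, 'a) mfps)"
      unfolding homog_def
    proof (intro allI impI)
      fix m assume "mcoeff (schur1 k (\<nu> ! k) :: (nat \<times> nat, 'a) mfps) m \<noteq> 0"
      then obtain T where "content k (\<nu> ! k) T = m" using schur1_nonzero by blast
      then show "fst ` keys m \<subseteq> {..<r} \<and> mdeg m = sum_list (\<nu> ! k)"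
        using keys_content[of k "\<nu> ! k" T] mdeg_content[of k "\<nu> ! k" T] \<open>k \<in> {..<r}\<close> by auto
    qed
  qed simp
  then show ?thesis using assms by (simp add: mparts_def schur_def)
qed

lemma lookup_xm_rown: "\<nu> \<in> mparts r N \<Longrightarrow> k < r \<Longrightarrow> lookup (xm \<nu>) (k, i) = rown (\<nu> ! k) i"
  by (auto simp: lookup_xm rown_def mparts_def)

lemma length_part_le: "\<nu> \<in> mparts r N \<Longrightarrow> k < r \<Longrightarrow> length (\<nu> ! k) \<le> N"
proof -
  assume \<nu>: "\<nu> \<in> mparts r N" and k: "k < r"
  have "0 \<notin> set (\<nu> ! k)" using \<nu> k by (auto simp: mparts_def is_partition_def)
  then have "length (\<nu> ! k) \<le> sum_list (\<nu> ! k)"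
  proof (induction "\<nu> ! k" rule: list.induct)
    case Nil then show ?case by (metis le0 list.size(3))
  next
    case (Cons a xs)
    have "length xs \<le> sum_list xs" if "0 \<notin> set xs" for xs :: "nat list"
      using that by (induction xs) auto
    then show ?case using Cons by blast
  qed
  also have "\<dots> \<le> (\<Sum>j<r. sum_list (\<nu> ! j))"
    using k by (intro member_le_sum[of k "{..<r}" "\<lambda>j. sum_list (\<nu> ! j)"]) auto
  finally show ?thesis using \<nu> by (simp add: mparts_def)
qed

text \<open>A numerical function that is strictly monotone for the dominance order.\<close>

definition potential :: "nat \<Rightarrow> nat \<Rightarrow> nat list list \<Rightarrow> nat" where
  "potential r N \<nu> = (\<Sum>k<r. \<Sum>p\<le>N. \<Sum>i<p. rown (\<nu> ! k) i)"

text \<open>Every partial sum for \<mu> is at most that for \<nu>, so the assumed inequality of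
  their totals forces equality throughout. The range up to N suffices, because no component has more
  than N parts.\<close>

lemma schur_triangular:
  assumes \<nu>: "\<nu> \<in> mparts r N" and \<mu>: "\<mu> \<in> mparts r N"
    and nz: "mcoeff (schur \<nu>) (xm \<mu>) \<noteq> 0" and pot: "potential r N \<nu> \<le> potential r N \<mu>"
  shows "\<nu> = \<mu>"
proof -
  have len: "length \<nu> = r" "length \<mu> = r" using \<nu> \<mu> by (auto simp: mparts_def)
  have dom: "(\<Sum>i<p. rown (\<mu> ! k) i) \<le> (\<Sum>i<p. rown (\<nu> ! k) i)" if k: "k < r" for k p
  proof -
    have "mcoeff (schur1 k (\<nu> ! k) :: (nat \<times> nat, 'a) mfps) (alph k (xm \<mu>)) \<noteq> 0"
    proof
      assume *: "mcoeff (schur1 k (\<nu> ! k) :: (nat \<times> nat, 'a) mfps) (alph k (xm \<mu>)) = 0"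
      have "(\<Prod>k<r. mcoeff (schur1 k (\<nu> ! k) :: (nat \<times> nat, 'a) mfps) (alph k (xm \<mu>))) = 0"
        using k * by (intro prod_zero) auto
      then show False using nz by (simp add: mcoeff_schur[OF len(1)] split: if_splits)
    qed
    from schur1_dominance[OF this, of p] show ?thesis
      using \<nu> k by (simp add: mparts_def lookup_alph lookup_xm_rown[OF \<mu> k])
  qed
  have eq: "(\<Sum>i<p. rown (\<mu> ! k) i) = (\<Sum>i<p. rown (\<nu> ! k) i)" if k: "k < r" and p: "p \<le> N" for k p
  proof (rule ccontr)
    assume "\<not> ?thesis"
    then have "(\<Sum>i<p. rown (\<mu> ! k) i) < (\<Sum>i<p. rown (\<nu> ! k) i)" using dom[OF k, of p] by simp
    then have "(\<Sum>p\<le>N. \<Sum>i<p. rown (\<mu> ! k) i) < (\<Sum>p\<le>N. \<Sum>i<p. rown (\<nu> ! k) i)"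
      using p dom[OF k] by (intro sum_strict_mono_ex1) auto
    moreover have "(\<Sum>p\<le>N. \<Sum>i<p. rown (\<mu> ! j) i) \<le> (\<Sum>p\<le>N. \<Sum>i<p. rown (\<nu> ! j) i)" if "j < r" for j
      by (rule sum_mono) (rule dom[OF that])
    ultimately have "potential r N \<mu> < potential r N \<nu>"
      unfolding potential_def using k by (intro sum_strict_mono_ex1) auto
    then show False using pot by simp
  qed
  have "rown (\<mu> ! k) i = rown (\<nu> ! k) i" if k: "k < r" for k i
  proof (cases "i < N")
    case True
    then show ?thesis using eq[OF k, of i] eq[OF k, of "Suc i"] by simp
  next
    case False
    then show ?thesis using length_part_le[OF \<mu> k] length_part_le[OF \<nu> k] by (simp add: rown_def)
  qed
  then have "lookup (xm \<mu>) (k, i) = lookup (xm \<nu>) (k, i)" for k i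
    using lookup_xm_rown[OF \<mu>, of k i] lookup_xm_rown[OF \<nu>, of k i] len
    by (cases "k < r") (auto simp: lookup_xm)
  then have "xm \<mu> = xm \<nu>" by (intro poly_mapping_eqI) auto
  then show ?thesis using xm_inj[OF \<mu> \<nu>] by simp
qed

lemma schur_diagonal:
  assumes \<nu>: "\<nu> \<in> mparts r N"
  shows "mcoeff (schur \<nu>) (xm \<nu>) = 1"
proof -
  have len: "length \<nu> = r" using \<nu> by (auto simp: mparts_def)
  have "mcoeff (schur1 k (\<nu> ! k) :: (nat \<times> nat, 'a) mfps) (alph k (xm \<nu>)) = 1" if "k < r" for k
    using \<nu> that by (intro schur1_diagonal) (auto simp: mparts_def lookup_alph lookup_xm_rown[OF \<nu>])
  then show ?thesis by (simp add: mcoeff_schur[OF len] fst_keys_xm[OF \<nu>])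
qed

text \<open>Among the indices with nonzero coefficient take one of maximal potential: at its
  dominant monomial only its own Schur function contributes, and with coefficient 1. No division
  occurs, so this is valid over any commutative ring.\<close>

lemma schur_independent:
  fixes c :: "nat list list \<Rightarrow> 'c::comm_ring_1"
  assumes z: "\<And>\<mu>. \<mu> \<in> mparts r N \<Longrightarrow> (\<Sum>\<nu>\<in>mparts r N. c \<nu> * mcoeff (schur \<nu>) (xm \<mu>)) = 0"
    and \<nu>: "\<nu> \<in> mparts r N"
  shows "c \<nu> = 0"
proof (rule ccontr)
  assume "c \<nu> \<noteq> 0"
  define S where "S = {\<nu> \<in> mparts r N. c \<nu> \<noteq> 0}"
  have S: "finite S" "S \<noteq> {}" using \<nu> \<open>c \<nu> \<noteq> 0\<close> by (auto simp: S_def finite_mparts)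
  have "Max (potential r N ` S) \<in> potential r N ` S" using S by (intro Max_in) auto
  then obtain \<mu> where "\<mu> \<in> S" "potential r N \<mu> = Max (potential r N ` S)" by auto
  then have \<mu>: "\<mu> \<in> S" "\<And>\<kappa>. \<kappa> \<in> S \<Longrightarrow> potential r N \<kappa> \<le> potential r N \<mu>"
    using S by auto
  have m: "\<mu> \<in> mparts r N" "c \<mu> \<noteq> 0" using \<mu> by (auto simp: S_def)
  have "(\<Sum>\<nu>\<in>mparts r N. c \<nu> * mcoeff (schur \<nu>) (xm \<mu>)) = (\<Sum>\<nu>\<in>{\<mu>}. c \<nu> * mcoeff (schur \<nu>) (xm \<mu>))"
  proof (intro sum.mono_neutral_right finite_mparts ballI)
    fix \<kappa> assume \<kappa>: "\<kappa> \<in> mparts r N - {\<mu>}"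
    show "c \<kappa> * mcoeff (schur \<kappa>) (xm \<mu>) = 0"
    proof (cases "c \<kappa> = 0")
      case False
      then have "mcoeff (schur \<kappa> :: 'c sfun) (xm \<mu>) = 0"
        using schur_triangular[of \<kappa> r N \<mu>] \<kappa> m \<mu>(2)[of \<kappa>] by (auto simp: S_def)
      then show ?thesis by simp
    qed simp
  qed (use m in auto)
  then show False using z[OF m(1)] m schur_diagonal[OF m(1), where 'a = 'c] by simp
qed

text \<open>A version of the coefficients free of the ring, through which facts proved over the
  complex numbers pass to other coefficients.\<close>

definition schur_count :: "nat list list \<Rightarrow> monom_exp \<Rightarrow> nat" where
  "schur_count \<nu> b = (if fst ` keys b \<subseteq> {..<length \<nu>}
     then \<Prod>k<length \<nu>. card {T \<in> ssyt (\<nu> ! k). content k (\<nu> ! k) T = alph k b} else 0)"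

lemma mcoeff_schur_count: "mcoeff (schur \<nu>) b = of_nat (schur_count \<nu> b)"
  by (simp add: schur_count_def mcoeff_schur[OF refl] mcoeff_schur1 of_nat_prod)

section \<open>Orthogonality of irreducible characters\<close>

lemma mat_trace_comm:
  assumes "A \<in> carrier_mat n m" "B \<in> carrier_mat m n"
  shows "mat_trace (A * B) = mat_trace (B * A)"
proof -
  have "mat_trace (A * B) = (\<Sum>i<n. \<Sum>j<m. A $$ (i,j) * B $$ (j,i))"
    using assms by (auto simp: mat_trace_def scalar_prod_def atLeast0LessThan intro!: sum.cong)
  also have "\<dots> = (\<Sum>j<m. \<Sum>i<n. B $$ (j,i) * A $$ (i,j))"
    by (subst sum.swap) (simp add: mult.commute)
  also have "\<dots> = mat_trace (B * A)"
    using assms by (auto simp: mat_trace_def scalar_prod_def atLeast0LessThan intro!: sum.cong)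
  finally show ?thesis .
qed

lemma mat_eq_on_vecI:
  assumes A: "A \<in> carrier_mat n m" and B: "B \<in> carrier_mat n m"
    and eq: "\<And>v. v \<in> carrier_vec m \<Longrightarrow> A *\<^sub>v v = B *\<^sub>v (v :: 'a::comm_ring_1 vec)"
  shows "A = B"
proof (rule mat_col_eqI)
  fix i assume "i < dim_col B"
  then have i: "i < m" using B by simp
  have "X *\<^sub>v unit_vec m i = col X i" if "X \<in> carrier_mat n m" for X :: "'a mat"
    using that i by (intro eq_vecI) auto
  then show "col A i = col B i"
    using eq[of "unit_vec m i"] A B by simp
qed (use A B in auto)

lemma zero_mat_mult_vec: "v \<in> carrier_vec m \<Longrightarrow> 0\<^sub>m n m *\<^sub>v v = (0\<^sub>v n :: 'a::comm_ring_1 vec)"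
  by (intro eq_vecI) auto

section \<open>Invariant subspaces and Schur's lemma\<close>

definition inv_subspace :: "nat \<Rightarrow> complex mat set \<Rightarrow> complex vec set \<Rightarrow> bool" where
  "inv_subspace l R U \<longleftrightarrow> U \<subseteq> carrier_vec l \<and> 0\<^sub>v l \<in> U \<and> (\<forall>u\<in>U. \<forall>v\<in>U. u + v \<in> U) \<and>
        (\<forall>c. \<forall>u\<in>U. c \<cdot>\<^sub>v u \<in> U) \<and> (\<forall>g\<in>R. \<forall>u\<in>U. g *\<^sub>v u \<in> U)"

lemma irreducible_rep_D:
  assumes "irreducible_rep W N l \<rho>"
  shows "l > 0" "\<And>g. g \<in> W \<Longrightarrow> \<rho> g \<in> carrier_mat l l" "\<rho> (1\<^sub>m N) = 1\<^sub>m l"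
    "\<And>g h. g \<in> W \<Longrightarrow> h \<in> W \<Longrightarrow> \<rho> (g * h) = \<rho> g * \<rho> h"
    "\<And>U. inv_subspace l (\<rho> ` W) U \<Longrightarrow> U = {0\<^sub>v l} \<or> U = carrier_vec l"
proof -
  note d = assms[unfolded irreducible_rep_def]
  show "l > 0" "\<rho> (1\<^sub>m N) = 1\<^sub>m l" using d by simp_all
  show "\<rho> g \<in> carrier_mat l l" if "g \<in> W" for g using d that by simp
  show "\<rho> (g * h) = \<rho> g * \<rho> h" if "g \<in> W" "h \<in> W" for g h using d that by simp
  show "U = {0\<^sub>v l} \<or> U = carrier_vec l" if U: "inv_subspace l (\<rho> ` W) U" for U
  proof -
    have "\<forall>g\<in>W. \<forall>u\<in>U. \<rho> g *\<^sub>v u \<in> U" using U unfolding inv_subspace_def by simp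
    with U show ?thesis
      using d[THEN conjunct2, THEN conjunct2, THEN conjunct2, THEN conjunct2, rule_format, of U]
      unfolding inv_subspace_def by simp
  qed
qed

text \<open>Kernel and image of an intertwiner are invariant. In the only case with T nonzero, T is
  injective and onto, and S is assembled column by column from preimages of the unit
  vectors.\<close>

lemma schur_lemma:
  assumes \<rho>: "irreducible_rep W N l \<rho>" and \<rho>': "irreducible_rep W N l' \<rho>'"
    and T: "T \<in> carrier_mat l l'" and comm: "\<And>g. g \<in> W \<Longrightarrow> \<rho> g * T = T * \<rho>' g"
  shows "T = 0\<^sub>m l l' \<or> (\<exists>S\<in>carrier_mat l' l. T * S = 1\<^sub>m l \<and> S * T = 1\<^sub>m l')"
proof -
  note D = irreducible_rep_D[OF \<rho>] and D' = irreducible_rep_D[OF \<rho>']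
  have swap: "\<rho> g *\<^sub>v (T *\<^sub>v v) = T *\<^sub>v (\<rho>' g *\<^sub>v v)" if "g \<in> W" "v \<in> carrier_vec l'" for g v
    using comm[OF that(1)] that T D(2)[OF that(1)] D'(2)[OF that(1)]
    by (metis assoc_mult_mat_vec)
  define U where "U = {v \<in> carrier_vec l'. T *\<^sub>v v = 0\<^sub>v l}"
  have "inv_subspace l' (\<rho>' ` W) U"
    unfolding inv_subspace_def
  proof (intro conjI ballI allI)
    show "0\<^sub>v l' \<in> U" using T by (auto simp: U_def)
    show "u + v \<in> U" if "u \<in> U" "v \<in> U" for u v
      using that T by (auto simp: U_def mult_add_distrib_mat_vec[OF T])
    show "c \<cdot>\<^sub>v u \<in> U" if "u \<in> U" for c u
      using that T by (auto simp: U_def mult_mat_vec[OF T])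
    show "g *\<^sub>v u \<in> U" if gu: "g \<in> \<rho>' ` W" "u \<in> U" for g u
    proof -
      obtain h where h: "h \<in> W" "g = \<rho>' h" using gu(1) by auto
      have "\<rho> h *\<^sub>v 0\<^sub>v l = 0\<^sub>v l" using D(2)[OF h(1)] by auto
      then show ?thesis using gu h swap[OF h(1), of u] D'(2)[OF h(1)] by (auto simp: U_def)
    qed
  qed (auto simp: U_def)
  then consider (all) "U = carrier_vec l'" | (none) "U = {0\<^sub>v l'}" using D'(5) by blast
  then show ?thesis
  proof cases
    case all
    then have "T *\<^sub>v v = 0\<^sub>m l l' *\<^sub>v v" if "v \<in> carrier_vec l'" for v
      using that by (auto simp: U_def zero_mat_mult_vec)
    then have "T = 0\<^sub>m l l'" by (rule mat_eq_on_vecI[OF T zero_carrier_mat])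
    then show ?thesis by simp
  next
    case none
    define V where "V = (\<lambda>v. T *\<^sub>v v) ` carrier_vec l'"
    have "inv_subspace l (\<rho> ` W) V"
      unfolding inv_subspace_def
    proof (intro conjI ballI allI)
      show "V \<subseteq> carrier_vec l" using T by (auto simp: V_def)
      have "T *\<^sub>v 0\<^sub>v l' = 0\<^sub>v l" using T by auto
      then show "0\<^sub>v l \<in> V" unfolding V_def by (metis image_eqI zero_carrier_vec)
      show "u + v \<in> V" if uv: "u \<in> V" "v \<in> V" for u v
      proof -
        obtain x y where "x \<in> carrier_vec l'" "y \<in> carrier_vec l'" "u = T *\<^sub>v x" "v = T *\<^sub>v y"
          using uv by (auto simp: V_def)
        then have "u + v = T *\<^sub>v (x + y)" "x + y \<in> carrier_vec l'"
          by (simp_all add: mult_add_distrib_mat_vec[OF T])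
        then show ?thesis unfolding V_def by blast
      qed
      show "c \<cdot>\<^sub>v u \<in> V" if u: "u \<in> V" for c u
      proof -
        obtain x where "x \<in> carrier_vec l'" "u = T *\<^sub>v x" using u by (auto simp: V_def)
        then have "c \<cdot>\<^sub>v u = T *\<^sub>v (c \<cdot>\<^sub>v x)" "c \<cdot>\<^sub>v x \<in> carrier_vec l'"
          by (simp_all add: mult_mat_vec[OF T])
        then show ?thesis unfolding V_def by blast
      qed
      show "g *\<^sub>v u \<in> V" if gu: "g \<in> \<rho> ` W" "u \<in> V" for g u
      proof -
        obtain h v where h: "h \<in> W" "g = \<rho> h" "v \<in> carrier_vec l'" "u = T *\<^sub>v v" using gu by (auto simp: V_def)
        have "\<rho>' h *\<^sub>v v \<in> carrier_vec l'" using D'(2)[OF h(1)] h(3) by auto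
        then show ?thesis unfolding V_def using h swap[OF h(1,3)] by auto
      qed
    qed
    then consider "V = {0\<^sub>v l}" | (all') "V = carrier_vec l" using D(5) by blast
    then show ?thesis
    proof cases
      case 1
      then have "T *\<^sub>v v = 0\<^sub>m l l' *\<^sub>v v" if "v \<in> carrier_vec l'" for v
        using that by (auto simp: V_def zero_mat_mult_vec)
      then have "T = 0\<^sub>m l l'" by (rule mat_eq_on_vecI[OF T zero_carrier_mat])
      then show ?thesis by simp
    next
      case all'
      have "\<exists>v\<in>carrier_vec l'. T *\<^sub>v v = unit_vec l i" if "i < l" for i
        using all' unit_vec_carrier[of l i] unfolding V_def by (metis imageE)
      then obtain w where w: "\<And>i. i < l \<Longrightarrow> w i \<in> carrier_vec l'" "\<And>i. i < l \<Longrightarrow> T *\<^sub>v w i = unit_vec l i"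
        by metis
      define S where "S = mat_of_cols l' (map w [0..<l])"
      have S: "S \<in> carrier_mat l' l" by (auto simp: S_def)
      have "T * S = 1\<^sub>m l"
      proof (rule mat_col_eqI)
        fix i assume "i < dim_col (1\<^sub>m l :: complex mat)"
        then have i: "i < l" by simp
        have "col (T * S) i = T *\<^sub>v col S i" using T S i by (subst col_mult2[where n = l' and nr = l and nc = l]) auto
        also have "col S i = w i" unfolding S_def using i w(1)[OF i] by (subst col_mat_of_cols) auto
        finally show "col (T * S) i = col (1\<^sub>m l) i" using w(2)[OF i] i by simp
      qed (use T S in auto)
      moreover have "S * T = 1\<^sub>m l'"
      proof (rule mat_eq_on_vecI)
        fix v :: "complex vec" assume v: "v \<in> carrier_vec l'"
        define u where "u = S *\<^sub>v (T *\<^sub>v v)"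
        have Tv: "T *\<^sub>v v \<in> carrier_vec l" using T v by auto
        have u: "u \<in> carrier_vec l'" using S Tv by (auto simp: u_def)
        have "T *\<^sub>v u = (T * S) *\<^sub>v (T *\<^sub>v v)" unfolding u_def
          by (rule assoc_mult_mat_vec[OF T S Tv, symmetric])
        then have Tu: "T *\<^sub>v u = T *\<^sub>v v" using \<open>T * S = 1\<^sub>m l\<close> Tv by simp
        have "u - v \<in> U" using u v Tu Tv T
          by (auto simp: U_def mult_minus_distrib_mat_vec[OF T])
        then have "u - v = 0\<^sub>v l'" using none by simp
        then have "u = v" using u v by (intro eq_vecI) (auto simp: vec_eq_iff)
        then show "S * T *\<^sub>v v = 1\<^sub>m l' *\<^sub>v v"
          using v assoc_mult_mat_vec[OF S T v] by (simp add: u_def)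
      qed (use S T in auto)
      ultimately show ?thesis using S by blast
    qed
  qed
qed

text \<open>Over the complex numbers T has an eigenvalue c; then T - c commutes with the group and
  has a nonzero kernel, so it is not invertible and must vanish.\<close>

lemma schur_lemma_scalar:
  assumes \<rho>: "irreducible_rep W N l \<rho>"
    and T: "T \<in> carrier_mat l l" and comm: "\<And>g. g \<in> W \<Longrightarrow> \<rho> g * T = T * \<rho> g"
  shows "\<exists>c. T = c \<cdot>\<^sub>m 1\<^sub>m l"
proof -
  note D = irreducible_rep_D[OF \<rho>]
  obtain c where "c \<in> spectrum T" using spectrum_non_empty[OF T D(1)] by blast
  then obtain v where "eigenvector T v c" unfolding spectrum_def eigenvalue_def by blast
  then have v: "v \<in> carrier_vec l" "v \<noteq> 0\<^sub>v l" "T *\<^sub>v v = c \<cdot>\<^sub>v v"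
    unfolding eigenvector_def carrier_matD(1)[OF T] by blast+
  define X where "X = T - c \<cdot>\<^sub>m 1\<^sub>m l"
  have X: "X \<in> carrier_mat l l" using T by (auto simp: X_def)
  have "\<rho> g * X = X * \<rho> g" if "g \<in> W" for g
  proof -
    note c = D(2)[OF that]
    have I: "c \<cdot>\<^sub>m 1\<^sub>m l \<in> carrier_mat l l" by simp
    have "\<rho> g * (c \<cdot>\<^sub>m 1\<^sub>m l) = c \<cdot>\<^sub>m \<rho> g" "(c \<cdot>\<^sub>m 1\<^sub>m l) * \<rho> g = c \<cdot>\<^sub>m \<rho> g"
      using c mult_smult_distrib[OF c one_carrier_mat, of c] mult_smult_assoc_mat[OF one_carrier_mat c, of c] by auto
    then show ?thesis
      unfolding X_def mult_minus_distrib_mat[OF c T I] minus_mult_distrib_mat[OF T I c] comm[OF that] by simp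
  qed
  from schur_lemma[OF \<rho> \<rho> X this] show ?thesis
  proof
    assume "X = 0\<^sub>m l l"
    then have "T = c \<cdot>\<^sub>m 1\<^sub>m l" unfolding X_def using T
      by (intro eq_matI) (auto simp: mat_eq_iff)
    then show ?thesis by blast
  next
    assume "\<exists>S\<in>carrier_mat l l. X * S = 1\<^sub>m l \<and> S * X = 1\<^sub>m l"
    then obtain S where S: "S \<in> carrier_mat l l" "S * X = 1\<^sub>m l" by blast
    have "X *\<^sub>v v = T *\<^sub>v v - (c \<cdot>\<^sub>m 1\<^sub>m l) *\<^sub>v v"
      unfolding X_def using T v by (intro minus_mult_distrib_mat_vec) auto
    also have "(c \<cdot>\<^sub>m 1\<^sub>m l) *\<^sub>v v = c \<cdot>\<^sub>v v"
      using v(1) by (intro eq_vecI) auto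
    finally have "X *\<^sub>v v = 0\<^sub>v l" using v by auto
    then have "v = 0\<^sub>v l" using S v X assoc_mult_mat_vec[OF S(1) X v(1)] by auto
    then show ?thesis using v by simp
  qed
qed

section \<open>Averaging over a finite matrix group, and relations between characters\<close>

locale matrix_group =
  fixes N :: nat and W :: "complex mat set"
  assumes carrier: "W \<subseteq> carrier_mat N N" and fin: "finite W" and one_mem: "1\<^sub>m N \<in> W"
    and mult_mem: "g \<in> W \<Longrightarrow> h \<in> W \<Longrightarrow> g * h \<in> W"
    and inv_ex: "g \<in> W \<Longrightarrow> \<exists>h\<in>W. g * h = 1\<^sub>m N \<and> h * g = 1\<^sub>m N"
begin

definition ginv :: "complex mat \<Rightarrow> complex mat" where
  "ginv g = (SOME h. h \<in> W \<and> g * h = 1\<^sub>m N \<and> h * g = 1\<^sub>m N)"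

lemma ginv: "g \<in> W \<Longrightarrow> ginv g \<in> W" "g \<in> W \<Longrightarrow> g * ginv g = 1\<^sub>m N" "g \<in> W \<Longrightarrow> ginv g * g = 1\<^sub>m N"
  using someI_ex[of "\<lambda>h. h \<in> W \<and> g * h = 1\<^sub>m N \<and> h * g = 1\<^sub>m N"] inv_ex[of g]
  unfolding ginv_def by blast+

lemma ginv_unique: "g \<in> W \<Longrightarrow> h \<in> W \<Longrightarrow> h * g = 1\<^sub>m N \<Longrightarrow> h = ginv g"
proof -
  assume g: "g \<in> W" and h: "h \<in> W" and hg: "h * g = 1\<^sub>m N"
  have c: "g \<in> carrier_mat N N" "h \<in> carrier_mat N N" "ginv g \<in> carrier_mat N N"
    using g h ginv carrier by auto
  have "h = h * (g * ginv g)" using c ginv(2)[OF g] by simp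
  also have "\<dots> = h * g * ginv g" by (rule assoc_mult_mat[OF c(2,1,3), symmetric])
  also have "\<dots> = ginv g" unfolding hg using c by simp
  finally show ?thesis .
qed

lemma left_mult_bij:
  assumes "h \<in> W"
  shows "bij_betw (\<lambda>g. h * g) W W"
proof (rule bij_betwI[where g = "\<lambda>g. ginv h * g"])
  have c: "g \<in> carrier_mat N N" if "g \<in> W" for g using carrier that by auto
  note hc = c[OF assms] c[OF ginv(1)[OF assms]]
  show "ginv h * (h * g) = g" if "g \<in> W" for g
    unfolding assoc_mult_mat[OF hc(2,1) c[OF that], symmetric] ginv(3)[OF assms] using c[OF that] by simp
  show "h * (ginv h * g) = g" if "g \<in> W" for g
    unfolding assoc_mult_mat[OF hc(1,2) c[OF that], symmetric] ginv(2)[OF assms] using c[OF that] by simp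
qed (use assms ginv mult_mem in auto)

lemma ginv_mult:
  assumes "g \<in> W" "h \<in> W"
  shows "ginv (h * g) = ginv g * ginv h"
proof (rule ginv_unique[symmetric])
  have c: "g \<in> carrier_mat N N" "h \<in> carrier_mat N N" "ginv g \<in> carrier_mat N N" "ginv h \<in> carrier_mat N N"
    using assms ginv carrier by auto
  have "ginv h * (h * g) = g"
    unfolding assoc_mult_mat[OF c(4,2,1), symmetric] ginv(3)[OF assms(2)] using c by simp
  then show "ginv g * ginv h * (h * g) = 1\<^sub>m N"
    using assoc_mult_mat[OF c(3,4) mult_carrier_mat[OF c(2,1)]] ginv(3)[OF assms(1)] by simp
qed (use assms ginv mult_mem in auto)

text \<open>The elementary matrix E with entry 1 at (a, b), averaged as the sum of \<rho>(g) E
  \<rho>'(g^{-1}) without dividing by the group order.\<close>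

definition avg :: "nat \<Rightarrow> nat \<Rightarrow> (complex mat \<Rightarrow> complex mat) \<Rightarrow> (complex mat \<Rightarrow> complex mat) \<Rightarrow> nat \<Rightarrow> nat \<Rightarrow> complex mat" where
  "avg l l' \<rho> \<rho>' a b = mat l l' (\<lambda>(i,j). \<Sum>g\<in>W. \<rho> g $$ (i,a) * \<rho>' (ginv g) $$ (b,j))"

lemma avg_carrier [simp]: "avg l l' \<rho> \<rho>' a b \<in> carrier_mat l l'"
  by (simp add: avg_def)

text \<open>Substituting h g for g in the sum moves h from one side of the average to the
  other.\<close>

lemma avg_intertwines:
  assumes \<rho>: "irreducible_rep W N l \<rho>" and \<rho>': "irreducible_rep W N l' \<rho>'"
    and h: "h \<in> W" and a: "a < l" and b: "b < l'"
  shows "\<rho> h * avg l l' \<rho> \<rho>' a b = avg l l' \<rho> \<rho>' a b * \<rho>' h"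
proof (rule eq_matI)
  note D = irreducible_rep_D[OF \<rho>] and D' = irreducible_rep_D[OF \<rho>']
  fix i j assume "i < dim_row (avg l l' \<rho> \<rho>' a b * \<rho>' h)" "j < dim_col (avg l l' \<rho> \<rho>' a b * \<rho>' h)"
  then have ij: "i < l" "j < l'" using D'(2)[OF h] by (auto simp: avg_def)
  have entry: "(A * B) $$ (i,j) = (\<Sum>k<m. A $$ (i,k) * B $$ (k,j))"
    if "A \<in> carrier_mat n m" "B \<in> carrier_mat m q" "i < n" "j < q" for A B :: "complex mat" and n m q i j
    using that by (simp add: scalar_prod_def atLeast0LessThan)
  have "(\<rho> h * avg l l' \<rho> \<rho>' a b) $$ (i,j) =
      (\<Sum>k<l. \<rho> h $$ (i,k) * (\<Sum>g\<in>W. \<rho> g $$ (k,a) * \<rho>' (ginv g) $$ (b,j)))"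
    using ij by (subst entry[OF D(2)[OF h] avg_carrier]) (auto simp: avg_def)
  also have "\<dots> = (\<Sum>g\<in>W. (\<Sum>k<l. \<rho> h $$ (i,k) * \<rho> g $$ (k,a)) * \<rho>' (ginv g) $$ (b,j))"
    by (simp add: sum_distrib_left sum_distrib_right mult.assoc) (rule sum.swap)
  also have "\<dots> = (\<Sum>g\<in>W. \<rho> (h * g) $$ (i,a) * \<rho>' (ginv g) $$ (b,j))"
    using h ij a D by (intro sum.cong refl) (simp add: D(4) entry[of _ l l _ l])
  also have "\<dots> = (\<Sum>g\<in>W. \<rho> (h * g) $$ (i,a) * \<rho>' (ginv (h * g) * h) $$ (b,j))"
  proof (intro sum.cong refl)
    fix g assume g: "g \<in> W"
    have c: "ginv g \<in> carrier_mat N N" "ginv h \<in> carrier_mat N N" "h \<in> carrier_mat N N"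
      using g h ginv carrier by auto
    have "ginv (h * g) * h = ginv g * (ginv h * h)"
      unfolding ginv_mult[OF g h] by (rule assoc_mult_mat[OF c])
    then have "ginv (h * g) * h = ginv g" using ginv(3)[OF h] c by simp
    then show "\<rho> (h * g) $$ (i,a) * \<rho>' (ginv g) $$ (b,j) = \<rho> (h * g) $$ (i,a) * \<rho>' (ginv (h * g) * h) $$ (b,j)"
      by simp
  qed
  also have "\<dots> = (\<Sum>g\<in>W. \<rho> g $$ (i,a) * \<rho>' (ginv g * h) $$ (b,j))"
    by (rule sum.reindex_bij_betw[OF left_mult_bij[OF h]])
  also have "\<dots> = (\<Sum>g\<in>W. \<rho> g $$ (i,a) * (\<Sum>k<l'. \<rho>' (ginv g) $$ (b,k) * \<rho>' h $$ (k,j)))"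
    using h ij b D' ginv by (intro sum.cong refl) (simp add: D'(4) entry[of _ l' l' _ l'])
  also have "\<dots> = (\<Sum>k<l'. (\<Sum>g\<in>W. \<rho> g $$ (i,a) * \<rho>' (ginv g) $$ (b,k)) * \<rho>' h $$ (k,j))"
    by (simp add: sum_distrib_left sum_distrib_right mult.assoc) (rule sum.swap)
  also have "\<dots> = (avg l l' \<rho> \<rho>' a b * \<rho>' h) $$ (i,j)"
    using ij by (subst entry[OF avg_carrier D'(2)[OF h]]) (auto simp: avg_def)
  finally show "(\<rho> h * avg l l' \<rho> \<rho>' a b) $$ (i,j) = (avg l l' \<rho> \<rho>' a b * \<rho>' h) $$ (i,j)" .
qed (use irreducible_rep_D(2)[OF \<rho> h] irreducible_rep_D(2)[OF \<rho>' h] in \<open>auto simp: avg_def\<close>)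

text \<open>A product of two traces is the sum of the products of diagonal entries (i, i) and (j,
  j), and each of these is the (i, j) entry of the average of the elementary matrix at (i,
  j).\<close>

lemma sum_char_ginv:
  assumes \<rho>: "irreducible_rep W N l \<rho>" and \<rho>': "irreducible_rep W N l' \<rho>'"
  shows "(\<Sum>g\<in>W. mat_trace (\<rho> g) * mat_trace (\<rho>' (ginv g))) = (\<Sum>i<l. \<Sum>j<l'. avg l l' \<rho> \<rho>' i j $$ (i,j))"
proof -
  have "(\<Sum>g\<in>W. mat_trace (\<rho> g) * mat_trace (\<rho>' (ginv g))) =
      (\<Sum>g\<in>W. \<Sum>i<l. \<Sum>j<l'. \<rho> g $$ (i,i) * \<rho>' (ginv g) $$ (j,j))"
  proof (rule sum.cong[OF refl])
    fix g assume g: "g \<in> W"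
    have "mat_trace (\<rho> g) = (\<Sum>i<l. \<rho> g $$ (i,i))"
      "mat_trace (\<rho>' (ginv g)) = (\<Sum>i<l'. \<rho>' (ginv g) $$ (i,i))"
      using irreducible_rep_D(2)[OF \<rho> g] irreducible_rep_D(2)[OF \<rho>' ginv(1)[OF g]]
      by (simp_all add: mat_trace_def)
    then show "mat_trace (\<rho> g) * mat_trace (\<rho>' (ginv g)) = (\<Sum>i<l. \<Sum>j<l'. \<rho> g $$ (i,i) * \<rho>' (ginv g) $$ (j,j))"
      by (simp add: sum_product)
  qed
  also have "\<dots> = (\<Sum>i<l. \<Sum>g\<in>W. \<Sum>j<l'. \<rho> g $$ (i,i) * \<rho>' (ginv g) $$ (j,j))"
    by (rule sum.swap)
  also have "\<dots> = (\<Sum>i<l. \<Sum>j<l'. \<Sum>g\<in>W. \<rho> g $$ (i,i) * \<rho>' (ginv g) $$ (j,j))"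
    by (intro sum.cong refl sum.swap)
  finally show ?thesis by (simp add: avg_def)
qed

text \<open>An invertible intertwiner would make the two traces equal at every group element, so all
  averages vanish by Schur's lemma.\<close>

lemma char_orthogonal_ginv:
  assumes \<rho>: "irreducible_rep W N l \<rho>" and \<rho>': "irreducible_rep W N l' \<rho>'"
    and ne: "g0 \<in> W" "mat_trace (\<rho> g0) \<noteq> mat_trace (\<rho>' g0)"
  shows "(\<Sum>g\<in>W. mat_trace (\<rho> g) * mat_trace (\<rho>' (ginv g))) = 0"
proof -
  note D = irreducible_rep_D[OF \<rho>] and D' = irreducible_rep_D[OF \<rho>']
  have "avg l l' \<rho> \<rho>' a b = 0\<^sub>m l l'" if ab: "a < l" "b < l'" for a b
  proof (rule ccontr)
    let ?T = "avg l l' \<rho> \<rho>' a b"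
    assume "?T \<noteq> 0\<^sub>m l l'"
    then obtain S where S: "S \<in> carrier_mat l' l" "?T * S = 1\<^sub>m l" "S * ?T = 1\<^sub>m l'"
      using schur_lemma[OF \<rho> \<rho>' avg_carrier avg_intertwines[OF \<rho> \<rho>' _ ab]] by blast
    note c = D(2)[OF ne(1)] D'(2)[OF ne(1)] S(1) avg_carrier[of l l' \<rho> \<rho>' a b]
    have "\<rho>' g0 = S * (\<rho> g0 * ?T)"
      using c S(3) avg_intertwines[OF \<rho> \<rho>' ne(1) ab] assoc_mult_mat[OF c(3) c(4) c(2)] by simp
    then have "mat_trace (\<rho>' g0) = mat_trace (\<rho> g0 * ?T * S)"
      using c mat_trace_comm[of S l' l "\<rho> g0 * ?T"] by simp
    also have "\<rho> g0 * ?T * S = \<rho> g0" using c S(2) assoc_mult_mat[OF c(1) c(4) c(3)] by simp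
    finally show False using ne by simp
  qed
  then show ?thesis unfolding sum_char_ginv[OF \<rho> \<rho>'] by simp
qed

text \<open>The average of an elementary matrix is a scalar matrix, and its trace is |W| times the
  trace of the elementary matrix; this determines the scalar.\<close>

lemma char_norm_ginv:
  assumes \<rho>: "irreducible_rep W N l \<rho>"
  shows "(\<Sum>g\<in>W. mat_trace (\<rho> g) * mat_trace (\<rho> (ginv g))) = of_nat (card W)"
proof -
  note D = irreducible_rep_D[OF \<rho>]
  have "avg l l \<rho> \<rho> a b $$ (a,b) = (if a = b then of_nat (card W) / of_nat l else 0)"
    if ab: "a < l" "b < l" for a b
  proof -
    obtain c where c: "avg l l \<rho> \<rho> a b = c \<cdot>\<^sub>m 1\<^sub>m l"
      using schur_lemma_scalar[OF \<rho> avg_carrier avg_intertwines[OF \<rho> \<rho> _ ab]] by blast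
    have "of_nat l * c = (\<Sum>i<l. avg l l \<rho> \<rho> a b $$ (i,i))" by (simp add: c)
    also have "\<dots> = (\<Sum>g\<in>W. \<Sum>i<l. \<rho> (ginv g) $$ (b,i) * \<rho> g $$ (i,a))"
      by (simp add: avg_def mult.commute) (rule sum.swap)
    also have "\<dots> = (\<Sum>g\<in>W. (if a = b then 1 else 0))"
    proof (rule sum.cong[OF refl])
      fix g assume g: "g \<in> W"
      have "(\<Sum>i<l. \<rho> (ginv g) $$ (b,i) * \<rho> g $$ (i,a)) = (\<rho> (ginv g) * \<rho> g) $$ (b,a)"
        using D(2)[OF g] D(2)[OF ginv(1)[OF g]] ab by (simp add: scalar_prod_def atLeast0LessThan)
      also have "\<dots> = \<rho> (ginv g * g) $$ (b,a)" using D(4) g ginv(1) by simp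
      finally show "(\<Sum>i<l. \<rho> (ginv g) $$ (b,i) * \<rho> g $$ (i,a)) = (if a = b then 1 else 0)"
        using ab D(3) ginv(3)[OF g] by auto
    qed
    finally have "of_nat l * c = (if a = b then of_nat (card W) else 0)" by simp
    then show ?thesis using ab D(1) by (auto simp: c field_simps split: if_splits)
  qed
  then have "(\<Sum>i<l. \<Sum>j<l. avg l l \<rho> \<rho> i j $$ (i,j)) = (\<Sum>i<l. \<Sum>j<l. if i = j then of_nat (card W) / of_nat l else 0)"
    by (intro sum.cong refl) simp
  then show ?thesis unfolding sum_char_ginv[OF \<rho> \<rho>] using D(1) by simp
qed

section \<open>Characters at inverse elements are complex conjugates\<close>

lemma upper_triangular_mult:
  fixes A B :: "'a::comm_ring_1 mat"
  assumes A: "A \<in> carrier_mat n n" "upper_triangular A" and B: "B \<in> carrier_mat n n" "upper_triangular B"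
  shows "upper_triangular (A * B)" and "i < n \<Longrightarrow> (A * B) $$ (i,i) = A $$ (i,i) * B $$ (i,i)"
proof -
  have e: "(A * B) $$ (i,j) = (\<Sum>k<n. A $$ (i,k) * B $$ (k,j))" if "i < n" "j < n" for i j
    using that A B by (simp add: scalar_prod_def atLeast0LessThan)
  have zero: "A $$ (i,k) * B $$ (k,j) = 0" if "i < n" "j \<le> i" "k < n" "\<not> (k = i \<and> j = i)" for i j k
  proof (cases "k < i")
    case True
    then have "A $$ (i,k) = 0" using upper_triangularD[OF A(2) True] A(1) that by simp
    then show ?thesis by simp
  next
    case False
    then have "j < k" using that by auto
    then have "B $$ (k,j) = 0" using upper_triangularD[OF B(2)] B(1) that by simp
    then show ?thesis by simp
  qed
  show "upper_triangular (A * B)"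
  proof (rule upper_triangularI)
    fix i j assume "j < i" "i < dim_row (A * B)"
    then have ij: "i < n" "j < n" "j \<le> i" "j \<noteq> i" using A(1) by auto
    show "(A * B) $$ (i,j) = 0"
      unfolding e[OF ij(1,2)] using zero[OF ij(1,3)] ij(4) by (intro sum.neutral) simp
  qed
  assume i: "i < n"
  have "(\<Sum>k<n. A $$ (i,k) * B $$ (k,i)) = (\<Sum>k\<in>{i}. A $$ (i,k) * B $$ (k,i))"
    using i zero[OF i order_refl] by (intro sum.mono_neutral_right) (auto simp del: mult_eq_0_iff)
  then show "(A * B) $$ (i,i) = A $$ (i,i) * B $$ (i,i)" using e[OF i i] by simp
qed

lemma upper_triangular_pow:
  fixes A :: "'a::comm_ring_1 mat"
  assumes A: "A \<in> carrier_mat n n" "upper_triangular A"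
  shows "upper_triangular (A ^\<^sub>m k) \<and> (\<forall>i<n. (A ^\<^sub>m k) $$ (i,i) = (A $$ (i,i)) ^ k)"
proof (induction k)
  case 0 then show ?case using A by simp
next
  case (Suc k)
  have "A ^\<^sub>m k \<in> carrier_mat n n" using A by simp
  then show ?case using upper_triangular_mult[OF _ _ A, of "A ^\<^sub>m k"] Suc by (simp add: mult.commute)
qed

text \<open>After triangularization the diagonal entries of A are m-th roots of unity, and B is the
  power of A with exponent m - 1. For a root of unity that power is the complex conjugate.\<close>

lemma trace_of_finite_order:
  assumes A: "A \<in> carrier_mat l l" and AB: "A * B = 1\<^sub>m l" and B: "B \<in> carrier_mat l l"
    and m: "m > 0" "A ^\<^sub>m m = 1\<^sub>m l"
  shows "mat_trace B = cnj (mat_trace A)"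
proof -
  obtain es where es: "char_poly A = (\<Prod> a \<leftarrow> es. [:- a, 1:])" using char_poly_factorized[OF A] by blast
  obtain U where U: "U \<in> carrier_mat l l" "upper_triangular U" "similar_mat A U"
    using schur_decomposition_exists[OF A es] by blast
  then obtain P Q where wit: "similar_mat_wit A U P Q" by (auto simp: similar_mat_def)
  note w = similar_mat_witD2[OF A wit]
  have pow: "A ^\<^sub>m k = P * U ^\<^sub>m k * Q" for k
    by (rule similar_mat_wit_pow_id[OF wit])
  have tr: "mat_trace (A ^\<^sub>m k) = (\<Sum>i<l. (U $$ (i,i)) ^ k)" for k
  proof -
    have Uk: "U ^\<^sub>m k \<in> carrier_mat l l" using U by simp
    have "mat_trace (A ^\<^sub>m k) = mat_trace (Q * (P * U ^\<^sub>m k))"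
      unfolding pow by (rule mat_trace_comm[OF mult_carrier_mat[OF w(6) Uk] w(7)])
    also have "Q * (P * U ^\<^sub>m k) = U ^\<^sub>m k"
      unfolding assoc_mult_mat[OF w(7,6) Uk, symmetric] w(2) by (rule left_mult_one_mat[OF Uk])
    finally show ?thesis using upper_triangular_pow[OF U(1,2), of k] Uk U(1) by (simp add: mat_trace_def)
  qed
  have "Q * A ^\<^sub>m m * P = U ^\<^sub>m m"
  proof -
    have Um: "U ^\<^sub>m m \<in> carrier_mat l l" using U by simp
    have UQ: "U ^\<^sub>m m * Q \<in> carrier_mat l l" by (rule mult_carrier_mat[OF Um w(7)])
    have "Q * (P * U ^\<^sub>m m * Q) = U ^\<^sub>m m * Q"
      unfolding assoc_mult_mat[OF w(6) Um w(7)] assoc_mult_mat[OF w(7,6) UQ, symmetric] w(2)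
      by (rule left_mult_one_mat[OF UQ])
    then show ?thesis
      unfolding pow using assoc_mult_mat[OF Um w(7,6)] right_mult_one_mat[OF Um] w(2) by simp
  qed
  then have "U ^\<^sub>m m = 1\<^sub>m l" using m(2) w(2,7) by simp
  then have root: "(U $$ (i,i)) ^ m = 1" if "i < l" for i
    using upper_triangular_pow[OF U(1,2), of m] that by simp
  obtain k where k: "m = Suc k" using m(1) by (cases m) auto
  have Ak: "A ^\<^sub>m k \<in> carrier_mat l l" using A by simp
  have "A ^\<^sub>m k * A * B = A ^\<^sub>m k" unfolding assoc_mult_mat[OF Ak A B] AB by (rule right_mult_one_mat[OF Ak])
  then have "B = A ^\<^sub>m k" using m(2) k B by simp
  then have "mat_trace B = (\<Sum>i<l. (U $$ (i,i)) ^ k)" using tr by simp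
  also have "\<dots> = (\<Sum>i<l. cnj (U $$ (i,i)))"
  proof (rule sum.cong[OF refl])
    fix i assume "i \<in> {..<l}"
    then have r: "(U $$ (i,i)) ^ Suc k = 1" using root k by auto
    then have "norm (U $$ (i,i)) ^ Suc k = 1 ^ Suc k" by (metis norm_one norm_power power_one)
    then have "norm (U $$ (i,i)) = 1" by (rule power_eq_imp_eq_base) auto
    then have "cnj (U $$ (i,i)) * U $$ (i,i) = 1" by (simp add: complex_norm_square[symmetric] mult.commute)
    then have "(U $$ (i,i)) ^ k = (cnj (U $$ (i,i)) * U $$ (i,i)) * (U $$ (i,i)) ^ k" by simp
    also have "\<dots> = cnj (U $$ (i,i)) * (U $$ (i,i)) ^ Suc k" by (simp only: mult.assoc power_Suc)
    finally show "(U $$ (i,i)) ^ k = cnj (U $$ (i,i))" by (simp only: r mult_1_right)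
  qed
  also have "\<dots> = cnj (mat_trace A)" using tr[of 1] A by simp
  finally show ?thesis .
qed

text \<open>Two powers of g coincide because the group is finite; cancelling equal factors in the
  representation gives a positive exponent at which \<rho> g becomes the identity.\<close>

lemma char_ginv:
  assumes \<rho>: "irreducible_rep W N l \<rho>" and g: "g \<in> W"
  shows "mat_trace (\<rho> (ginv g)) = cnj (mat_trace (\<rho> g))"
proof -
  note D = irreducible_rep_D[OF \<rho>]
  let ?A = "\<rho> g" and ?B = "\<rho> (ginv g)"
  have gc: "g \<in> carrier_mat N N" using g carrier by auto
  have A: "?A \<in> carrier_mat l l" and B: "?B \<in> carrier_mat l l" using D(2) g ginv(1) by auto
  have AB: "?A * ?B = 1\<^sub>m l" using D(3,4) g ginv by metis
  have BA: "?B * ?A = 1\<^sub>m l" using D(3,4) g ginv by metis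
  have mem: "g ^\<^sub>m k \<in> W \<and> \<rho> (g ^\<^sub>m k) = ?A ^\<^sub>m k" for k
  proof (induction k)
    case 0 then show ?case using gc A one_mem D(3) by simp
  next
    case (Suc k) then show ?case using mult_mem[OF _ g] D(4)[OF _ g] by simp
  qed
  have "\<not> inj (\<lambda>k. g ^\<^sub>m k)"
  proof
    assume "inj (\<lambda>k. g ^\<^sub>m k)"
    moreover have "range (\<lambda>k. g ^\<^sub>m k) \<subseteq> W" using mem by auto
    ultimately show False using fin finite_subset range_inj_infinite by blast
  qed
  then obtain i j where ij: "g ^\<^sub>m i = g ^\<^sub>m j" "i < j" unfolding inj_def by (metis linorder_neqE_nat)
  define m where "m = j - i"
  have m: "m > 0" "?A ^\<^sub>m i = ?A ^\<^sub>m (i + m)" using ij mem by (auto simp: m_def) metis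
  have "?A ^\<^sub>m m = 1\<^sub>m l" using m(2)
  proof (induction i)
    case 0 then show ?case using A by simp
  next
    case (Suc i)
    have c: "?A ^\<^sub>m i \<in> carrier_mat l l" "?A ^\<^sub>m (i + m) \<in> carrier_mat l l" using A by auto
    have "?A ^\<^sub>m i * ?A = ?A ^\<^sub>m (i + m) * ?A" using Suc.prems by simp
    then have "?A ^\<^sub>m i * ?A * ?B = ?A ^\<^sub>m (i + m) * ?A * ?B" by simp
    then have "?A ^\<^sub>m i = ?A ^\<^sub>m (i + m)"
      unfolding assoc_mult_mat[OF c(1) A B] assoc_mult_mat[OF c(2) A B] AB
        right_mult_one_mat[OF c(1)] right_mult_one_mat[OF c(2)] .
    then show ?case by (rule Suc.IH)
  qed
  from trace_of_finite_order[OF A AB B m(1) this] show ?thesis .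
qed

text \<open>The characters are functions restricted to W, so two different ones differ at some
  element of W; inequivalence of the representations enters in this form.\<close>

lemma irreducible_characters_orthogonal:
  assumes "\<chi> \<in> {restrict (\<lambda>w. mat_trace (\<rho> w)) W |\<rho> l. irreducible_rep W N l \<rho>}"
    and "\<psi> \<in> {restrict (\<lambda>w. mat_trace (\<rho> w)) W |\<rho> l. irreducible_rep W N l \<rho>}"
  shows "(\<Sum>g\<in>W. \<chi> g * cnj (\<psi> g)) = (if \<chi> = \<psi> then of_nat (card W) else 0)"
proof -
  obtain \<rho> l where \<rho>: "irreducible_rep W N l \<rho>" "\<chi> = restrict (\<lambda>w. mat_trace (\<rho> w)) W" using assms(1) by blast
  obtain \<rho>' l' where \<rho>': "irreducible_rep W N l' \<rho>'" "\<psi> = restrict (\<lambda>w. mat_trace (\<rho>' w)) W" using assms(2) by blast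
  show ?thesis
  proof (cases "\<chi> = \<psi>")
    case True
    have "\<chi> g * cnj (\<psi> g) = mat_trace (\<rho> g) * mat_trace (\<rho> (ginv g))" if "g \<in> W" for g
    proof -
      have "\<chi> g = mat_trace (\<rho> g)" using \<rho>(2) that by simp
      then show ?thesis using char_ginv[OF \<rho>(1) that] True by simp
    qed
    then show ?thesis using True char_norm_ginv[OF \<rho>(1)] by simp
  next
    case False
    have "\<exists>g0\<in>W. mat_trace (\<rho> g0) \<noteq> mat_trace (\<rho>' g0)"
    proof (rule ccontr)
      assume "\<not> ?thesis"
      then have "\<chi> = \<psi>" unfolding \<rho>(2) \<rho>'(2) by (intro restrict_ext) simp
      then show False using False by simp
    qed
    then obtain g0 where g0: "g0 \<in> W" "mat_trace (\<rho> g0) \<noteq> mat_trace (\<rho>' g0)" by blast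
    have "\<chi> g * cnj (\<psi> g) = mat_trace (\<rho> g) * mat_trace (\<rho>' (ginv g))" if "g \<in> W" for g
      using that char_ginv[OF \<rho>'(1) that] \<rho>(2) \<rho>'(2) by simp
    then show ?thesis using False char_orthogonal_ginv[OF \<rho>(1) \<rho>'(1) g0] by simp
  qed
qed

end

section \<open>The groups of monomial matrices\<close>

lemma mset_image_nth: "mset xs = image_mset ((!) xs) (mset_set {..<length xs})"
proof -
  have "mset xs = mset (map ((!) xs) [0..<length xs])" by (simp add: map_nth)
  then show ?thesis by (simp flip: mset_set_upto_eq_mset_upto atLeast0LessThan)
qed

lemma perm_restrict_permutes:
  assumes "q permutes A" "S \<subseteq> A" "q ` S = S"
  shows "perm_restrict q S permutes A"
proof (rule permutes_subset[OF _ assms(2)])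
  have "bij_betw q S S"
    using assms permutes_inj[OF assms(1)] by (auto simp: bij_betw_def intro: inj_on_subset)
  then have "bij_betw (perm_restrict q S) S S"
    by (rule iffD1[OF bij_betw_cong, rotated]) (simp add: perm_restrict_def)
  then show "perm_restrict q S permutes S"
    by (rule bij_imp_permutes) (simp add: perm_restrict_def)
qed

lemma sign_cycle_of_list: "distinct cs \<Longrightarrow> cs \<noteq> [] \<Longrightarrow> sign (cycle_of_list cs) = (-1) ^ (length cs - 1)"
proof (induction cs rule: cycle_of_list.induct)
  case (1 i j cs)
  have "sign (transpose i j \<circ> cycle_of_list (j # cs)) = sign (transpose i j) * sign (cycle_of_list (j # cs))"
    by (rule sign_compose[OF permutation_swap_id permutation_of_cycle])
  then show ?case unfolding cycle_of_list.simps(1) using 1 by (simp add: sign_swap_id del: o_apply)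
qed auto

text \<open>Restricted to one orbit, a permutation is the cycle that lists this orbit.\<close>

lemma sign_perm_restrict_orbit:
  assumes p: "permutation p"
  shows "sign (perm_restrict p (orbit p a)) = (-1) ^ (card (orbit p a) - 1)"
proof -
  let ?cs = "support p a"
  have set: "set ?cs = orbit p a"
    unfolding support_set[OF p] orbit_altdef_permutation[OF p] by auto
  have d: "distinct ?cs" using cycle_of_permutation[OF p] .
  have "perm_restrict p (orbit p a) = cycle_of_list ?cs"
  proof
    fix x
    show "perm_restrict p (orbit p a) x = cycle_of_list ?cs x"
    proof (cases "x \<in> orbit p a")
      case True
      then have "p x = cycle_of_list ?cs x" using cycle_restrict[OF p] set by blast
      then show ?thesis using True by (simp add: perm_restrict_def)
    next
      case False
      then show ?thesis using id_outside_supp[of x ?cs] set by (simp add: perm_restrict_def)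
    qed
  qed
  moreover have "?cs \<noteq> []" using set orbit_nonempty[of p a] by (metis list.set(1))
  moreover have "card (orbit p a) = length ?cs" using set distinct_card[OF d] by metis
  ultimately show ?thesis using sign_cycle_of_list[OF d] by metis
qed

lemma permutes_less: "q permutes {..<N} \<Longrightarrow> j < N \<Longrightarrow> q j < (N::nat)"
  using permutes_in_image[of q "{..<N}" j] by simp

section \<open>Monomial matrices whose entries are powers of a root of unity\<close>

locale wreath =
  fixes r N :: nat and \<zeta> :: complex
  assumes r: "r \<ge> 1" and root: "primitive_root r \<zeta>"
begin

lemma zeta_r: "\<zeta> ^ r = 1"
  using root by (simp add: primitive_root_def)

lemma norm_zeta: "norm \<zeta> = 1"
proof -
  have "norm \<zeta> ^ r = 1 ^ r" by (metis zeta_r norm_one norm_power power_one)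
  then show ?thesis using r by (intro power_eq_imp_eq_base[of "norm \<zeta>" r 1]) auto
qed

lemma zeta_nonzero [simp]: "\<zeta> \<noteq> 0"
  using norm_zeta by auto

lemma cnj_zeta: "cnj \<zeta> = inverse \<zeta>"
  using norm_zeta by (metis complex_norm_square divide_self_if inverse_eq_divide mult.commute
      nonzero_eq_divide_eq of_real_1 power_one zeta_nonzero)

lemma zeta_mod: "\<zeta> ^ (a mod r) = \<zeta> ^ a"
proof -
  have "\<zeta> ^ a = \<zeta> ^ (r * (a div r) + a mod r)" by simp
  also have "\<dots> = \<zeta> ^ (a mod r)" by (simp only: power_add power_mult zeta_r power_one mult_1)
  finally show ?thesis by simp
qed

lemma zeta_eq_1_iff: "\<zeta> ^ a = 1 \<longleftrightarrow> r dvd a"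
proof
  assume "\<zeta> ^ a = 1"
  then have "\<zeta> ^ (a mod r) = 1" by (simp add: zeta_mod)
  moreover have "a mod r < r" using r by simp
  ultimately have "a mod r = 0" using root unfolding primitive_root_def by (metis neq0_conv)
  then show "r dvd a" by auto
next
  assume "r dvd a"
  then have "a mod r = 0" by simp
  then show "\<zeta> ^ a = 1" using zeta_mod[of a] by simp
qed

lemma zeta_inj: "a < r \<Longrightarrow> b < r \<Longrightarrow> \<zeta> ^ a = \<zeta> ^ b \<Longrightarrow> a = b"
proof (induction a b rule: linorder_wlog)
  case (le a b)
  have "\<zeta> ^ b = \<zeta> ^ a * \<zeta> ^ (b - a)" using le(1) by (metis le_add_diff_inverse power_add)
  then have "\<zeta> ^ (b - a) = 1" using le by simp
  then have "r dvd (b - a)" by (simp add: zeta_eq_1_iff)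
  then show ?case using le by (metis diff_is_0_eq dual_order.antisym less_imp_diff_less nat_dvd_not_less neq0_conv)
qed auto

definition wm :: "(nat \<Rightarrow> nat) \<Rightarrow> (nat \<Rightarrow> nat) \<Rightarrow> complex mat" where
  "wm q c = mat N N (\<lambda>(i, j). if i = q j then \<zeta> ^ c j else 0)"

lemma Wgrp_eq: "Wgrp N \<zeta> = {wm q c |q c. q permutes {..<N}}"
  by (auto simp: Wgrp_def wm_def)

lemma wm_cong: "(\<And>j. j < N \<Longrightarrow> q j = q' j) \<Longrightarrow> (\<And>j. j < N \<Longrightarrow> \<zeta> ^ c j = \<zeta> ^ c' j) \<Longrightarrow> wm q c = wm q' c'"
  by (auto simp: wm_def intro!: eq_matI)

lemma wm_mult:
  assumes q: "q permutes {..<N}" and \<tau>: "\<tau> permutes {..<N}"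
  shows "wm q c * wm \<tau> d = wm (q \<circ> \<tau>) (\<lambda>j. d j + c (\<tau> j))"
proof (rule eq_matI)
  fix i j assume "i < dim_row (wm (q \<circ> \<tau>) (\<lambda>j. d j + c (\<tau> j)))" "j < dim_col (wm (q \<circ> \<tau>) (\<lambda>j. d j + c (\<tau> j)))"
  then have ij: "i < N" "j < N" by (auto simp: wm_def)
  have "(wm q c * wm \<tau> d) $$ (i,j) = (\<Sum>k<N. (if i = q k then \<zeta> ^ c k else 0) * (if k = \<tau> j then \<zeta> ^ d j else 0))"
    using ij by (simp add: wm_def scalar_prod_def atLeast0LessThan)
  also have "\<dots> = (\<Sum>k<N. if k = \<tau> j then (if i = q k then \<zeta> ^ c k else 0) * \<zeta> ^ d j else 0)"
    by (intro sum.cong) auto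
  also have "\<dots> = (if i = q (\<tau> j) then \<zeta> ^ (d j + c (\<tau> j)) else 0)"
    using permutes_less[OF \<tau> ij(2)] by (simp add: power_add)
  finally show "(wm q c * wm \<tau> d) $$ (i,j) = wm (q \<circ> \<tau>) (\<lambda>j. d j + c (\<tau> j)) $$ (i,j)"
    using ij by (simp add: wm_def)
qed (auto simp: wm_def)

lemma wm_one: "wm id (\<lambda>_. 0) = 1\<^sub>m N"
  by (rule eq_matI) (auto simp: wm_def)

text \<open>Only the residues of the exponents modulo r at the first N points matter; extensional
  functions with values below r make the parametrization injective.\<close>

lemma wm_bij: "bij_betw (\<lambda>(q, c). wm q c) ({q. q permutes {..<N}} \<times> ({..<N} \<rightarrow>\<^sub>E {..<r})) (Wgrp N \<zeta>)"
  unfolding bij_betw_def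
proof
  show "inj_on (\<lambda>(q, c). wm q c) ({q. q permutes {..<N}} \<times> ({..<N} \<rightarrow>\<^sub>E {..<r}))"
  proof (rule inj_onI, clarsimp)
    fix q c q' c'
    assume q: "q permutes {..<N}" and q': "q' permutes {..<N}" and eq: "wm q c = wm q' c'"
      and c: "c \<in> {..<N} \<rightarrow>\<^sub>E {..<r}" and c': "c' \<in> {..<N} \<rightarrow>\<^sub>E {..<r}"
    have e: "q j = q' j \<and> \<zeta> ^ c j = \<zeta> ^ c' j" if "j < N" for j
    proof -
      have "wm q c $$ (q j, j) = wm q' c' $$ (q j, j)" using eq by simp
      then have "\<zeta> ^ c j = (if q j = q' j then \<zeta> ^ c' j else 0)"
        using that permutes_less[OF q that] by (simp add: wm_def)
      then show ?thesis by (auto split: if_splits)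
    qed
    have "q = q'"
    proof
      fix j show "q j = q' j" using e permutes_not_in[OF q, of j] permutes_not_in[OF q', of j] by (cases "j < N") auto
    qed
    moreover have "c = c'"
      using c c' e zeta_inj by (intro PiE_ext[OF c c']) (auto simp: PiE_def Pi_def)
    ultimately show "q = q' \<and> c = c'" by simp
  qed
  show "(\<lambda>(q, c). wm q c) ` ({q. q permutes {..<N}} \<times> ({..<N} \<rightarrow>\<^sub>E {..<r})) = Wgrp N \<zeta>"
  proof (intro equalityI subsetI)
    fix w assume "w \<in> Wgrp N \<zeta>"
    then obtain q c where w: "w = wm q c" "q permutes {..<N}" by (auto simp: Wgrp_eq)
    let ?c = "restrict (\<lambda>j. c j mod r) {..<N}"
    have "w = wm q ?c" unfolding w by (rule wm_cong) (auto simp: zeta_mod)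
    moreover have "?c \<in> {..<N} \<rightarrow>\<^sub>E {..<r}" using r by auto
    ultimately show "w \<in> (\<lambda>(q, c). wm q c) ` ({q. q permutes {..<N}} \<times> ({..<N} \<rightarrow>\<^sub>E {..<r}))"
      using w(2) by (intro image_eqI[where x = "(q, ?c)"]) auto
  qed (auto simp: Wgrp_eq)
qed

lemma sum_Wgrp: "(\<Sum>w\<in>Wgrp N \<zeta>. f w) = (\<Sum>q | q permutes {..<N}. \<Sum>c\<in>{..<N} \<rightarrow>\<^sub>E {..<r}. f (wm q c))"
proof -
  have "(\<Sum>w\<in>Wgrp N \<zeta>. f w) = (\<Sum>p\<in>{q. q permutes {..<N}} \<times> ({..<N} \<rightarrow>\<^sub>E {..<r}). f ((\<lambda>(q, c). wm q c) p))"
    by (rule sum.reindex_bij_betw[OF wm_bij, symmetric])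
  then show ?thesis by (simp add: sum.cartesian_product case_prod_unfold)
qed

lemma card_Wgrp: "card (Wgrp N \<zeta>) = fact N * r ^ N"
  using bij_betw_same_card[OF wm_bij] by (simp add: card_cartesian_product card_permutations card_PiE)

sublocale W: matrix_group N "Wgrp N \<zeta>"
proof
  show "Wgrp N \<zeta> \<subseteq> carrier_mat N N" by (auto simp: Wgrp_eq wm_def)
  show "finite (Wgrp N \<zeta>)"
    using bij_betw_finite[OF wm_bij] by (simp add: finite_permutations finite_PiE)
  show "1\<^sub>m N \<in> Wgrp N \<zeta>"
    using permutes_id[of "{..<N}"] unfolding Wgrp_eq wm_one[symmetric] by blast
  fix g assume "g \<in> Wgrp N \<zeta>"
  then obtain q c where g: "g = wm q c" "q permutes {..<N}" by (auto simp: Wgrp_eq)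
  show "\<exists>h\<in>Wgrp N \<zeta>. g * h = 1\<^sub>m N \<and> h * g = 1\<^sub>m N"
  \<comment> \<open>The inverse monomial matrix: exponents are natural numbers, so the factor r - 1
    plays the role of -1 modulo r.\<close>
  proof (rule bexI[where x = "wm (inv_into UNIV q) (\<lambda>j. (r - 1) * c (inv_into UNIV q j))"], intro conjI)
    let ?i = "inv_into UNIV q"
    note i = permutes_inv[OF g(2)]
    have z: "\<zeta> ^ ((r - 1) * a + a) = 1" for a
    proof -
      have "(r - 1) * a + a = r * a" using r by (cases r) auto
      then show ?thesis by (simp add: zeta_eq_1_iff)
    qed
    show "wm ?i (\<lambda>j. (r - 1) * c (?i j)) \<in> Wgrp N \<zeta>" using i by (auto simp: Wgrp_eq)
    show "g * wm ?i (\<lambda>j. (r - 1) * c (?i j)) = 1\<^sub>m N"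
      unfolding g(1) wm_mult[OF g(2) i] wm_one[symmetric]
      by (rule wm_cong) (use permutes_inverses[OF g(2)] z in auto)
    have "c j + (r - 1) * c j = (r - 1) * c j + c j" for j by simp
    then show "wm ?i (\<lambda>j. (r - 1) * c (?i j)) * g = 1\<^sub>m N"
      unfolding g(1) wm_mult[OF i g(2)] wm_one[symmetric]
      by (intro wm_cong) (simp_all only: permutes_inverses[OF g(2)] z o_apply id_apply power_0)
  qed
next
  fix g h assume "g \<in> Wgrp N \<zeta>" "h \<in> Wgrp N \<zeta>"
  then show "g * h \<in> Wgrp N \<zeta>"
    by (auto simp: Wgrp_eq wm_mult permutes_compose) (metis permutes_compose)
qed

section \<open>Cycles and types of monomial matrices\<close>

definition orbs :: "(nat \<Rightarrow> nat) \<Rightarrow> nat set set" where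
  "orbs q = orbit q ` {..<N}"

text \<open>The cycle product is \<zeta> to this exponent. Reduced modulo r, it is the index of the
  component of the type to which the cycle contributes its length.\<close>

definition cyc_exp :: "(nat \<Rightarrow> nat) \<Rightarrow> nat set \<Rightarrow> nat" where
  "cyc_exp c C = (\<Sum>j\<in>C. c j) mod r"

lemma cyc_exp_less: "cyc_exp c C < r"
  using r by (simp add: cyc_exp_def)

lemma zeta_cyc_exp: "\<zeta> ^ cyc_exp c C = (\<Prod>j\<in>C. \<zeta> ^ c j)"
  by (simp add: cyc_exp_def zeta_mod power_sum)

lemma perm: "q permutes {..<N} \<Longrightarrow> permutation q"
  by (auto simp: permutation_permutes)

lemma orb_eq: "q permutes {..<N} \<Longrightarrow> j \<in> orbit q i \<Longrightarrow> orbit q j = orbit q i"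
  by (rule orbit_cyclic_eq3[OF cyclic_on_orbit'[OF perm]])

lemma orbs_char:
  assumes q: "q permutes {..<N}" and C: "C \<in> orbs q"
  shows "C = {j \<in> {..<N}. orbit q j = C}"
proof -
  obtain i where i: "i < N" "C = orbit q i" using C by (auto simp: orbs_def)
  show ?thesis
  proof (intro equalityI subsetI)
    fix j assume j: "j \<in> C"
    then show "j \<in> {j \<in> {..<N}. orbit q j = C}"
      using orb_eq[OF q, of j i] permutes_orbit_subset[OF q, of i] i by auto
  next
    fix j assume "j \<in> {j \<in> {..<N}. orbit q j = C}"
    then show "j \<in> C" using permutation_self_in_orbit[OF perm[OF q], of j] by auto
  qed
qed

lemma finite_orbs [simp]: "finite (orbs q)"
  by (simp add: orbs_def)

lemma orbs_facts:
  assumes "q permutes {..<N}" "C \<in> orbs q"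
  shows "finite C" "C \<noteq> {}" "card C > 0" "C \<subseteq> {..<N}"
proof -
  show 1: "C \<subseteq> {..<N}" using orbs_char[OF assms] by auto
  show 2: "finite C" using 1 finite_subset by blast
  show 3: "C \<noteq> {}" using assms(2) orbit_nonempty[of q] unfolding orbs_def by blast
  show "card C > 0" using 2 3 by (simp add: card_gt_0_iff)
qed

lemma prod_orbs:
  assumes "q permutes {..<N}"
  shows "(\<Prod>j<N. f j) = (\<Prod>C\<in>orbs q. \<Prod>j\<in>C. f j)"
proof -
  have "(\<Prod>j<N. f j) = (\<Prod>C\<in>orbit q ` {..<N}. \<Prod>j\<in>{j \<in> {..<N}. orbit q j = C}. f j)"
    by (rule prod.image_gen) simp
  also have "\<dots> = (\<Prod>C\<in>orbs q. \<Prod>j\<in>C. f j)"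
    unfolding orbs_def[symmetric] using orbs_char[OF assms] by (intro prod.cong) auto
  finally show ?thesis .
qed

lemma sum_orbs:
  assumes "q permutes {..<N}"
  shows "(\<Sum>j<N. f j) = (\<Sum>C\<in>orbs q. \<Sum>j\<in>C. f j)"
proof -
  have "(\<Sum>j<N. f j) = (\<Sum>C\<in>orbit q ` {..<N}. \<Sum>j\<in>{j \<in> {..<N}. orbit q j = C}. f j)"
    by (rule sum.image_gen) simp
  also have "\<dots> = (\<Sum>C\<in>orbs q. \<Sum>j\<in>C. f j)"
    unfolding orbs_def[symmetric] using orbs_char[OF assms] by (intro sum.cong) auto
  finally show ?thesis .
qed

lemma wm_entry: "q permutes {..<N} \<Longrightarrow> j < N \<Longrightarrow> wm q c $$ (q j, j) = \<zeta> ^ c j"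
  by (simp add: wm_def permutes_less)

text \<open>The permutation in \<open>has_type\<close> is only asserted to exist, but the nonzero
  entries of a monomial matrix determine it.\<close>

lemma has_type_wm:
  assumes q: "q permutes {..<N}"
  shows "has_type r N \<zeta> (wm q c) \<nu> \<longleftrightarrow>
    (\<forall>k<r. mset (\<nu> ! k) = image_mset card (mset_set {C \<in> orbs q. cyc_exp c C = k}))"
proof -
  have uniq: "q' = q" if q': "q' permutes {..<N}" and nz: "\<forall>j<N. wm q c $$ (q' j, j) \<noteq> 0" for q'
  proof
    fix j
    show "q' j = q j"
    proof (cases "j < N")
      case True
      then show ?thesis using nz permutes_less[OF q' True] by (auto simp: wm_def split: if_splits)
    next
      case False
      then show ?thesis using permutes_not_in[OF q, of j] permutes_not_in[OF q', of j] by simp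
    qed
  qed
  have set: "{C \<in> orbit q ` {..<N}. (\<Prod>j\<in>C. wm q c $$ (q j, j)) = \<zeta> ^ k} = {C \<in> orbs q. cyc_exp c C = k}"
    if "k < r" for k
  proof -
    have "(\<Prod>j\<in>C. wm q c $$ (q j, j)) = \<zeta> ^ k \<longleftrightarrow> cyc_exp c C = k" if C: "C \<in> orbs q" for C
    proof -
      have "(\<Prod>j\<in>C. wm q c $$ (q j, j)) = \<zeta> ^ cyc_exp c C"
        unfolding zeta_cyc_exp using orbs_facts(4)[OF q C] by (intro prod.cong) (auto simp: wm_entry[OF q])
      then show ?thesis using zeta_inj[OF cyc_exp_less \<open>k < r\<close>] by auto
    qed
    then show ?thesis unfolding orbs_def[symmetric] by auto
  qed
  have "has_type r N \<zeta> (wm q c) \<nu> \<longleftrightarrow> (\<forall>k<r. mset (\<nu> ! k) = image_mset card (mset_set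
        {C \<in> orbit q ` {..<N}. (\<Prod>j\<in>C. wm q c $$ (q j, j)) = \<zeta> ^ k}))"
    unfolding has_type_def
  proof
    assume "\<exists>q'. q' permutes {..<N} \<and> (\<forall>j<N. wm q c $$ (q' j, j) \<noteq> 0) \<and>
      (\<forall>k<r. mset (\<nu> ! k) = image_mset card (mset_set
        {C \<in> orbit q' ` {..<N}. (\<Prod>j\<in>C. wm q c $$ (q' j, j)) = \<zeta> ^ k}))"
    then show "\<forall>k<r. mset (\<nu> ! k) = image_mset card (mset_set
        {C \<in> orbit q ` {..<N}. (\<Prod>j\<in>C. wm q c $$ (q j, j)) = \<zeta> ^ k})" using uniq by blast
  next
    assume "\<forall>k<r. mset (\<nu> ! k) = image_mset card (mset_set
        {C \<in> orbit q ` {..<N}. (\<Prod>j\<in>C. wm q c $$ (q j, j)) = \<zeta> ^ k})"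
    then show "\<exists>q'. q' permutes {..<N} \<and> (\<forall>j<N. wm q c $$ (q' j, j) \<noteq> 0) \<and>
      (\<forall>k<r. mset (\<nu> ! k) = image_mset card (mset_set
        {C \<in> orbit q' ` {..<N}. (\<Prod>j\<in>C. wm q c $$ (q' j, j)) = \<zeta> ^ k}))"
      using q by (intro exI[of _ q]) (simp add: wm_entry)
  qed
  also have "\<dots> \<longleftrightarrow> (\<forall>k<r. mset (\<nu> ! k) = image_mset card (mset_set {C \<in> orbs q. cyc_exp c C = k}))"
    using set by auto
  finally show ?thesis .
qed

lemma type_exists:
  assumes "w \<in> Wgrp N \<zeta>"
  shows "\<exists>\<nu>\<in>mparts r N. has_type r N \<zeta> w \<nu>"
proof -
  obtain q c where w: "w = wm q c" and q: "q permutes {..<N}" using assms by (auto simp: Wgrp_eq)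
  define M where "M k = image_mset card (mset_set {C \<in> orbs q. cyc_exp c C = k})" for k
  define \<nu> where "\<nu> = map (\<lambda>k. rev (sorted_list_of_multiset (M k))) [0..<r]"
  have m: "mset (\<nu> ! k) = M k" if "k < r" for k using that by (simp add: \<nu>_def)
  have "is_partition (\<nu> ! k)" if k: "k < r" for k
  proof -
    have "0 \<notin># M k" using orbs_facts(3)[OF q] by (force simp: M_def)
    then have "0 \<notin> set (\<nu> ! k)" using m[OF k] by (metis set_mset_mset)
    then show ?thesis using k by (simp add: is_partition_def) (simp add: \<nu>_def)
  qed
  moreover have "(\<Sum>k<r. sum_list (\<nu> ! k)) = N"
  proof -
    have "(\<Sum>k<r. sum_list (\<nu> ! k)) = (\<Sum>k<r. \<Sum>C\<in>{C \<in> orbs q. cyc_exp c C = k}. card C)"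
      by (intro sum.cong refl) (simp add: m M_def sum_unfold_sum_mset flip: sum_mset_sum_list)
    also have "\<dots> = (\<Sum>C\<in>orbs q. card C)"
      using cyc_exp_less by (intro sum.group) auto
    also have "\<dots> = (\<Sum>C\<in>orbs q. \<Sum>j\<in>C. 1)" by simp
    also have "\<dots> = (\<Sum>j<N. 1)" by (rule sum_orbs[OF q, symmetric])
    finally show ?thesis by simp
  qed
  ultimately have "\<nu> \<in> mparts r N" by (simp add: mparts_def \<nu>_def)
  moreover have "has_type r N \<zeta> w \<nu>" unfolding w has_type_wm[OF q] using m by (simp add: M_def)
  ultimately show ?thesis by blast
qed

text \<open>Power sums and det(t - w) are both products, over the cycles, of a function of the
  exponent and the length of the cycle. This turns them into functions of the type.\<close>

lemma prod_type:
  assumes q: "q permutes {..<N}" and t: "has_type r N \<zeta> (wm q c) \<nu>"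
  shows "(\<Prod>k<r. \<Prod>i<length (\<nu> ! k). h k (\<nu> ! k ! i)) = (\<Prod>C\<in>orbs q. h (cyc_exp c C) (card C))"
proof -
  have "(\<Prod>i<length (\<nu> ! k). h k (\<nu> ! k ! i)) = (\<Prod>C\<in>{C \<in> orbs q. cyc_exp c C = k}. h (cyc_exp c C) (card C))"
    if "k < r" for k
  proof -
    have "(\<Prod>i<length (\<nu> ! k). h k (\<nu> ! k ! i)) = prod_mset (image_mset (h k) (mset (\<nu> ! k)))"
      unfolding mset_image_nth[of "\<nu> ! k"] by (simp add: prod_unfold_prod_mset multiset.map_comp o_def)
    also have "\<dots> = (\<Prod>C\<in>{C \<in> orbs q. cyc_exp c C = k}. h k (card C))"
      using t that unfolding has_type_wm[OF q] by (simp add: prod_unfold_prod_mset multiset.map_comp o_def)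
    finally show ?thesis by simp
  qed
  then have "(\<Prod>k<r. \<Prod>i<length (\<nu> ! k). h k (\<nu> ! k ! i)) =
      (\<Prod>k<r. \<Prod>C\<in>{C \<in> orbs q. cyc_exp c C = k}. h (cyc_exp c C) (card C))" by simp
  also have "\<dots> = (\<Prod>C\<in>orbs q. h (cyc_exp c C) (card C))"
    using cyc_exp_less by (intro prod.group) auto
  finally show ?thesis .
qed

end

section \<open>Coefficients of power sums, and the determinant of t - w\<close>

context wreath begin

text \<open>Colourings of the N points that are fixed by q, equivalently those constant on its
  cycles. The colours are variables of the r alphabets.\<close>

definition invf :: "(nat \<Rightarrow> nat) \<Rightarrow> 'b set \<Rightarrow> (nat \<Rightarrow> 'b) set" where
  "invf q V = {g \<in> {..<N} \<rightarrow>\<^sub>E V. \<forall>j<N. g (q j) = g j}"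

lemma invf_orbit:
  assumes q: "q permutes {..<N}" and g: "g \<in> invf q V" and i: "i < N"
  shows "j \<in> orbit q i \<Longrightarrow> g j = g i"
proof (induction rule: orbit.induct)
  case base then show ?case using g i by (simp add: invf_def)
next
  case (step y)
  then have "y < N" using permutes_orbit_subset[OF q, of i] i by auto
  then show ?case using step g by (simp add: invf_def)
qed

lemma invf_image:
  assumes q: "q permutes {..<N}" and g: "g \<in> invf q V" and C: "C \<in> orbs q" and j: "j \<in> C"
  shows "the_elem (g ` C) = g j"
proof -
  have jN: "j < N" "orbit q j = C" using orbs_char[OF q C] j by auto
  have gi: "g i = g j" if "i \<in> C" for i using invf_orbit[OF q g jN(1), of i] jN(2) that by simp
  have "g ` C = (\<lambda>_. g j) ` C" by (rule image_cong[OF refl gi])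
  then have "g ` C = {g j}" by (simp only: image_constant[OF j])
  then show ?thesis by simp
qed

text \<open>Multiplying out, each cycle C chooses one variable v, which appears to the power |C|;
  such choices are the colourings fixed by q. The root of unity attached to C is the product of the
  roots of its points, each raised to the alphabet index of v.\<close>

lemma mcoeff_power_sum:
  assumes q: "q permutes {..<N}" and t: "has_type r N \<zeta> (wm q c) \<nu>"
    and V: "finite V" "fst ` V \<subseteq> {..<r}" and b: "keys b \<subseteq> V"
  shows "mcoeff (power_sum r \<zeta> \<nu>) b =
    (\<Sum>g\<in>{g \<in> invf q V. (\<Sum>j<N. single (g j) 1) = b}. \<Prod>j<N. \<zeta> ^ (c j * fst (g j)))"
proof -
  define F where "F C = (\<Sum>j<r. mconst (\<zeta> ^ (cyc_exp c C * j)) * power_sum1 j (card C) :: complex sfun)" for C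
  have ps: "power_sum r \<zeta> \<nu> = (\<Prod>C\<in>orbs q. F C)"
    unfolding power_sum_def F_def
    by (rule prod_type[OF q t, of "\<lambda>k n. \<Sum>j<r. mconst (\<zeta> ^ (k * j)) * power_sum1 j n"])
  have Fs: "mcoeff (F C) (single v (card C)) = \<zeta> ^ (cyc_exp c C * fst v)"
    if "fst v < r" "C \<in> orbs q" for v C
  proof -
    have "(\<exists>i. single v (card C) = single (j, i) (card C)) \<longleftrightarrow> j = fst v" for j
    proof
      assume "\<exists>i. single v (card C) = single (j, i) (card C)"
      then obtain i where "single v (card C) = single (j, i) (card C)" by blast
      then have "{v} = {(j, i)}" using orbs_facts(3)[OF q that(2)] by (metis keys_single less_numeral_extra(3))
      then show "j = fst v" by auto
    qed (auto intro!: exI[of _ "snd v"])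
    then show ?thesis using that(1)
      by (simp add: F_def mcoeff_sum power_sum1_def if_distrib[of "\<lambda>x. _ * x"] cong: if_cong)
  qed
  have Fn: "\<exists>v. fst v < r \<and> m = single v (card C)" if "mcoeff (F C) m \<noteq> 0" for m C
  proof -
    have "\<exists>j<r. \<exists>i. m = single (j, i) (card C)"
    proof (rule ccontr)
      assume "\<not> ?thesis"
      then have "mcoeff (F C) m = 0" by (auto simp: F_def mcoeff_sum power_sum1_def intro!: sum.neutral)
      then show False using that by simp
    qed
    then show ?thesis by force
  qed
  let ?S = "{\<gamma> \<in> splits (orbs q) b. \<forall>C\<in>orbs q. \<exists>v. fst v < r \<and> \<gamma> C = single v (card C)}"
  let ?G = "{g \<in> invf q V. (\<Sum>j<N. single (g j) 1) = b}"
  let ?i = "\<lambda>\<gamma>. restrict (\<lambda>j. the_elem (keys (\<gamma> (orbit q j)))) {..<N}"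
  let ?j = "\<lambda>g. restrict (\<lambda>C. single (the_elem (g ` C)) (card C)) (orbs q)"
  have orb_in: "orbit q j \<in> orbs q" if "j < N" for j using that by (auto simp: orbs_def)
  have self: "j \<in> orbit q j" for j using permutation_self_in_orbit[OF perm[OF q]] .
  have sumj: "(\<Sum>C\<in>orbs q. ?j g C) = (\<Sum>j<N. single (g j) 1)" if g: "g \<in> invf q V" for g
  proof -
    have "(\<Sum>j\<in>C. single (g j) (1::nat)) = ?j g C" if C: "C \<in> orbs q" for C
    proof -
      have "(\<Sum>j\<in>C. single (g j) (1::nat)) = (\<Sum>j\<in>C. single (the_elem (g ` C)) 1)"
        by (intro sum.cong refl) (simp add: invf_image[OF q g C])
      also have "\<dots> = ?j g C" using C
        by (intro poly_mapping_eqI) (simp add: lookup_sum lookup_single when_def)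
      finally show ?thesis .
    qed
    then show ?thesis unfolding sum_orbs[OF q] by (intro sum.cong) auto
  qed
  have "mcoeff (power_sum r \<zeta> \<nu>) b = (\<Sum>\<gamma>\<in>?S. \<Prod>C\<in>orbs q. mcoeff (F C) (\<gamma> C))"
    unfolding ps mcoeff_prod[OF finite_orbs]
  proof (intro sum.mono_neutral_right finite_splits finite_orbs ballI)
    fix \<gamma> assume "\<gamma> \<in> splits (orbs q) b - ?S"
    then obtain C where "C \<in> orbs q" "mcoeff (F C) (\<gamma> C) = 0" using Fn by blast
    then show "(\<Prod>C\<in>orbs q. mcoeff (F C) (\<gamma> C)) = 0" by (intro prod_zero) auto
  qed auto
  also have "\<dots> = (\<Sum>g\<in>?G. \<Prod>j<N. \<zeta> ^ (c j * fst (g j)))"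
  proof (rule sum.reindex_bij_witness[where i = ?j and j = ?i], goal_cases)
    case (1 \<gamma>)
    show ?case
    proof (rule extensionalityI[where A = "orbs q"])
      fix C assume C: "C \<in> orbs q"
      then obtain i where i: "i < N" "C = orbit q i" by (auto simp: orbs_def)
      obtain v where v: "\<gamma> C = single v (card C)" using 1 C by blast
      have "?i \<gamma> ` C = {v}"
      proof -
        have "?i \<gamma> j = v" if "j \<in> C" for j
        proof -
          have "j < N" "orbit q j = C" using orbs_char[OF q C] that by auto
          then show ?thesis using v orbs_facts(3)[OF q C] by simp
        qed
        then show ?thesis using orbs_facts(2)[OF q C] by auto
      qed
      then show "?j (?i \<gamma>) C = \<gamma> C" using C v by simp
    qed (use 1 in \<open>auto simp: splits_def\<close>)
  next
    case (2 \<gamma>)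
    have v: "\<exists>v\<in>V. fst v < r \<and> \<gamma> C = single v (card C)" if C: "C \<in> orbs q" for C
    proof -
      obtain v where v: "fst v < r" "\<gamma> C = single v (card C)" using 2 C by blast
      \<comment> \<open>A variable chosen for a cycle has positive exponent in b, and is therefore
        one of the finitely many variables of \<open>V\<close>.\<close>
      have "lookup b v = (\<Sum>C\<in>orbs q. lookup (\<gamma> C) v)"
        using 2 by (auto simp: splits_def lookup_sum)
      moreover have "lookup (\<gamma> C) v \<le> (\<Sum>C\<in>orbs q. lookup (\<gamma> C) v)"
        using C by (intro member_le_sum) auto
      ultimately have "lookup b v > 0" using v orbs_facts(3)[OF q C] by simp
      then have "v \<in> V" using b by (auto simp: in_keys_iff)
      then show ?thesis using v by blast
    qed
    have "?i \<gamma> j \<in> V" if "j < N" for j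
      using v[OF orb_in[OF that]] orbs_facts(3)[OF q orb_in[OF that]] that by auto
    moreover have "?i \<gamma> (q j) = ?i \<gamma> j" if "j < N" for j
      using that permutes_less[OF q that] permutation_orbit_step[OF perm[OF q], of j] by simp
    ultimately have inv: "?i \<gamma> \<in> invf q V" by (auto simp: invf_def)
    have "?j (?i \<gamma>) = \<gamma>"
    proof (rule extensionalityI[where A = "orbs q"])
      fix C assume C: "C \<in> orbs q"
      obtain v where v: "\<gamma> C = single v (card C)" using 2 C by blast
      have "?i \<gamma> ` C = {v}"
      proof -
        have "?i \<gamma> j = v" if "j \<in> C" for j
        proof -
          have "j < N" "orbit q j = C" using orbs_char[OF q C] that by auto
          then show ?thesis using v orbs_facts(3)[OF q C] by simp
        qed
        then show ?thesis using orbs_facts(2)[OF q C] by auto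
      qed
      then show "?j (?i \<gamma>) C = \<gamma> C" using C v by simp
    qed (use 2 in \<open>auto simp: splits_def\<close>)
    then have "(\<Sum>j<N. single (?i \<gamma> j) 1) = (\<Sum>C\<in>orbs q. \<gamma> C)"
      using sumj[OF inv] by simp
    also have "\<dots> = b" using 2 by (auto simp: splits_def)
    finally show ?case using inv by simp
  next
    case (3 g)
    then have g: "g \<in> invf q V" by simp
    show ?case
    proof (rule extensionalityI[where A = "{..<N}"])
      fix j assume j: "j \<in> {..<N}"
      then have C: "orbit q j \<in> orbs q" using orb_in by auto
      then show "?i (?j g) j = g j"
        using j orbs_facts(3)[OF q C] invf_image[OF q g C self] by simp
    qed (use g in \<open>auto simp: invf_def PiE_def\<close>)
  next
    case (4 g)
    then have g: "g \<in> invf q V" by simp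
    have fr: "fst (the_elem (g ` C)) < r" if C: "C \<in> orbs q" for C
    proof -
      obtain j where j: "j \<in> C" using orbs_facts(2)[OF q C] by blast
      then have "g j \<in> V" using g orbs_facts(4)[OF q C] by (auto simp: invf_def)
      then show ?thesis using invf_image[OF q g C j] V by auto
    qed
    have "\<exists>v. fst v < r \<and> ?j g C = single v (card C)" if "C \<in> orbs q" for C
      by (rule exI[of _ "the_elem (g ` C)"]) (use that fr[OF that] in simp)
    then show ?case using sumj[OF g] 4 by (simp add: splits_def)
  next
    case (5 \<gamma>)
    have "(\<Prod>C\<in>orbs q. mcoeff (F C) (\<gamma> C)) = (\<Prod>C\<in>orbs q. \<Prod>j\<in>C. \<zeta> ^ (c j * fst (?i \<gamma> j)))"
    proof (rule prod.cong[OF refl])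
      fix C assume C: "C \<in> orbs q"
      obtain v where v: "fst v < r" "\<gamma> C = single v (card C)" using 5 C by blast
      have iv: "?i \<gamma> j = v" if "j \<in> C" for j
      proof -
        have "j < N" "orbit q j = C" using orbs_char[OF q C] that by auto
        then show ?thesis using v orbs_facts(3)[OF q C] by simp
      qed
      have "mcoeff (F C) (\<gamma> C) = (\<zeta> ^ cyc_exp c C) ^ fst v"
        unfolding v(2) Fs[OF v(1) C] by (simp add: power_mult)
      also have "\<dots> = (\<Prod>j\<in>C. \<zeta> ^ (c j * fst v))"
        unfolding zeta_cyc_exp by (simp add: prod_power_distrib power_mult)
      also have "\<dots> = (\<Prod>j\<in>C. \<zeta> ^ (c j * fst (?i \<gamma> j)))"
        by (intro prod.cong refl) (simp only: iv)
      finally show "mcoeff (F C) (\<gamma> C) = (\<Prod>j\<in>C. \<zeta> ^ (c j * fst (?i \<gamma> j)))" .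
    qed
    then show ?case unfolding prod_orbs[OF q] by simp
  qed
  finally show ?thesis .
qed

text \<open>In the Leibniz expansion S collects the points at which the summand coming from w is
  chosen. A term survives only if its permutation agrees with q on S and fixes all other points, and
  this forces S to be stable under q.\<close>

lemma char_poly_wm:
  assumes q: "q permutes {..<N}"
  shows "char_poly (wm q c) = (\<Sum>S\<in>{S. S \<subseteq> {..<N} \<and> q ` S = S}.
    of_int (sign (perm_restrict q S)) * (\<Prod>j\<in>S. [:- (\<zeta> ^ c j):]) * [:0, 1:] ^ (N - card S))"
proof -
  let ?A = "wm q c" and ?X = "[:0, 1:] :: complex poly"
  have A: "?A \<in> carrier_mat N N" by (simp add: wm_def)
  have cp: "char_poly_matrix ?A \<in> carrier_mat N N" using A by simp
  \<comment> \<open>The entry of w belonging to the point j sits in column j, whereas the Leibniz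
    formula runs over rows; hence the transposition. The entry is kept as a sum because at a fixed
    point of q both summands are present.\<close>
  have entry: "transpose_mat (char_poly_matrix ?A) $$ (j, i) =
      (if i = q j then [:- (\<zeta> ^ c j):] else 0) + (if i = j then ?X else 0)" if "i < N" "j < N" for i j
    using that A by (auto simp: char_poly_matrix_def wm_def)
  have "char_poly ?A = (\<Sum>p | p permutes {0..<N}. signof p * (\<Prod>j = 0..<N. transpose_mat (char_poly_matrix ?A) $$ (j, p j)))"
    unfolding char_poly_def by (subst det_transpose[OF cp, symmetric], subst det_def'[of _ N]) (use cp in auto)
  also have "\<dots> = (\<Sum>p | p permutes {..<N}. signof p * (\<Prod>j<N.
      (if p j = q j then [:- (\<zeta> ^ c j):] else 0) + (if p j = j then ?X else 0)))"
    unfolding atLeast0LessThan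
    by (intro sum.cong refl arg_cong2[where f = "(*)"] prod.cong) (auto simp: entry permutes_less)
  also have "\<dots> = (\<Sum>p | p permutes {..<N}. \<Sum>S\<in>Pow {..<N}. signof p *
      ((\<Prod>j\<in>S. if p j = q j then [:- (\<zeta> ^ c j):] else 0) * (\<Prod>j\<in>{..<N} - S. if p j = j then ?X else 0)))"
    unfolding prod_add[OF finite_lessThan] by (simp add: sum_distrib_left)
  also have "\<dots> = (\<Sum>S\<in>Pow {..<N}. \<Sum>p | p permutes {..<N}. signof p *
      ((\<Prod>j\<in>S. if p j = q j then [:- (\<zeta> ^ c j):] else 0) * (\<Prod>j\<in>{..<N} - S. if p j = j then ?X else 0)))"
    by (rule sum.swap)
  also have "\<dots> = (\<Sum>S\<in>Pow {..<N}. if q ` S = S then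
      of_int (sign (perm_restrict q S)) * (\<Prod>j\<in>S. [:- (\<zeta> ^ c j):]) * ?X ^ (N - card S) else 0)"
  proof (rule sum.cong[OF refl])
    fix S assume "S \<in> Pow {..<N}"
    then have S: "S \<subseteq> {..<N}" by simp
    then have fS: "finite S" using finite_subset by blast
    let ?f = "\<lambda>p. signof p * ((\<Prod>j\<in>S. if p j = q j then [:- (\<zeta> ^ c j):] else 0) * (\<Prod>j\<in>{..<N} - S. if p j = j then ?X else 0))"
    have pr: "p = perm_restrict q S \<and> q ` S = S" if p: "p permutes {..<N}" and nz: "?f p \<noteq> 0" for p
    proof -
      have a: "p j = q j" if "j \<in> S" for j
      proof (rule ccontr)
        assume "p j \<noteq> q j"
        then have "(\<Prod>j\<in>S. if p j = q j then [:- (\<zeta> ^ c j):] else 0) = 0"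
          using that fS by (intro prod_zero) auto
        then show False using nz by simp
      qed
      have b: "p j = j" if "j \<in> {..<N} - S" for j
      proof (rule ccontr)
        assume "p j \<noteq> j"
        then have "(\<Prod>j\<in>{..<N} - S. if p j = j then ?X else 0) = 0"
          using that by (intro prod_zero) auto
        then show False using nz by simp
      qed
      have b': "p j = j" if "j \<notin> S" for j
        using b[of j] that permutes_not_in[OF p, of j] by (cases "j < N") auto
      have "p permutes S" using p b' by (intro permutes_superset[OF p]) auto
      then have "p ` S = S" by (rule permutes_image)
      then have "q ` S = S" using a by simp
      moreover have "p = perm_restrict q S" using a b' by (auto simp: perm_restrict_def)
      ultimately show ?thesis by simp
    qed
    show "(\<Sum>p | p permutes {..<N}. ?f p) = (if q ` S = S then
      of_int (sign (perm_restrict q S)) * (\<Prod>j\<in>S. [:- (\<zeta> ^ c j):]) * ?X ^ (N - card S) else 0)"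
    proof (cases "q ` S = S")
      case True
      have p0: "perm_restrict q S permutes {..<N}" by (rule perm_restrict_permutes[OF q S True])
      have "(\<Sum>p | p permutes {..<N}. ?f p) = (\<Sum>p\<in>{perm_restrict q S}. ?f p)"
      proof (intro sum.mono_neutral_right ballI)
        fix p assume p: "p \<in> {p. p permutes {..<N}} - {perm_restrict q S}"
        show "?f p = 0"
        proof (rule ccontr)
          assume "?f p \<noteq> 0"
          then show False using pr[of p] p by blast
        qed
      qed (use p0 in \<open>simp_all add: finite_permutations\<close>)
      also have "\<dots> = of_int (sign (perm_restrict q S)) * (\<Prod>j\<in>S. [:- (\<zeta> ^ c j):]) * ?X ^ (N - card S)"
        using S fS by (simp add: perm_restrict_def card_Diff_subset mult.assoc)
      finally show ?thesis using True by simp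
    next
      case False
      then have f0: "?f p = 0" if "p permutes {..<N}" for p using pr[OF that] by blast
      have "(\<Sum>p | p permutes {..<N}. ?f p) = 0" by (rule sum.neutral, rule ballI, rule f0) simp
      then show ?thesis unfolding if_not_P[OF False] .
    qed
  qed
  also have "\<dots> = (\<Sum>S\<in>{S \<in> Pow {..<N}. q ` S = S}.
      of_int (sign (perm_restrict q S)) * (\<Prod>j\<in>S. [:- (\<zeta> ^ c j):]) * ?X ^ (N - card S))"
    by (rule sum.inter_filter[symmetric]) simp
  also have "{S \<in> Pow {..<N}. q ` S = S} = {S. S \<subseteq> {..<N} \<and> q ` S = S}" by auto
  finally show ?thesis .
qed

lemma stable_union_orbs:
  assumes q: "q permutes {..<N}"
  shows "bij_betw \<Union> (Pow (orbs q)) {S. S \<subseteq> {..<N} \<and> q ` S = S}"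
proof (rule bij_betwI[where g = "\<lambda>S. {C \<in> orbs q. C \<subseteq> S}"])
  have orbC: "orbit q j = C" if "C \<in> orbs q" "j \<in> C" for C j
    using orbs_char[OF q that(1)] that(2) by auto
  have img: "q ` C = C" if C: "C \<in> orbs q" for C
  proof -
    have "q ` C \<subseteq> C" using orbC[OF C] orbit.step[of _ q] by blast
    moreover have "card (q ` C) = card C" by (rule card_image[OF inj_on_subset[OF permutes_inj[OF q]]]) simp
    ultimately show ?thesis using orbs_facts(1)[OF q C] by (intro card_subset_eq) auto
  qed
  show "\<Union> \<in> Pow (orbs q) \<rightarrow> {S. S \<subseteq> {..<N} \<and> q ` S = S}"
  proof
    fix T assume "T \<in> Pow (orbs q)"
    then have T: "T \<subseteq> orbs q" by simp
    have "q ` \<Union> T = \<Union> T" using img T by (auto simp: image_Union) blast+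
    moreover have "\<Union> T \<subseteq> {..<N}" using orbs_facts(4)[OF q] T by blast
    ultimately show "\<Union> T \<in> {S. S \<subseteq> {..<N} \<and> q ` S = S}" by simp
  qed
  show "{C \<in> orbs q. C \<subseteq> \<Union> T} = T" if "T \<in> Pow (orbs q)" for T
  proof (intro equalityI subsetI)
    fix C assume C: "C \<in> {C \<in> orbs q. C \<subseteq> \<Union> T}"
    then obtain j where j: "j \<in> C" using orbs_facts(2)[OF q] by blast
    then obtain C' where C': "C' \<in> T" "j \<in> C'" using C by blast
    then have "C' = C" using orbC[of C j] orbC[of C' j] j C that by auto
    then show "C \<in> T" using C' by simp
  qed (use that in auto)
  show "\<Union> {C \<in> orbs q. C \<subseteq> S} = S" if S: "S \<in> {S. S \<subseteq> {..<N} \<and> q ` S = S}" for S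
  proof (intro equalityI subsetI)
    fix j assume j: "j \<in> S"
    have "orbit q j \<subseteq> S"
    proof
      fix i assume "i \<in> orbit q j"
      then show "i \<in> S" by induction (use j S in blast)+
    qed
    moreover have "orbit q j \<in> orbs q" using j S by (auto simp: orbs_def)
    moreover have "j \<in> orbit q j" using permutation_self_in_orbit[OF perm[OF q]] .
    ultimately show "j \<in> \<Union> {C \<in> orbs q. C \<subseteq> S}" by blast
  qed auto
qed auto

text \<open>Stable sets are unions of cycles, so the sum over them is an expanded product over
  cycles. For a single cycle, its sign combines with the |C| minus signs of the entries to one minus
  sign.\<close>

lemma char_poly_orbs:
  assumes q: "q permutes {..<N}"
  shows "char_poly (wm q c) = (\<Prod>C\<in>orbs q. [:- (\<zeta> ^ cyc_exp c C):] + [:0, 1:] ^ card C)"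
proof -
  let ?X = "[:0, 1:] :: complex poly"
  let ?u = "\<lambda>S. of_int (sign (perm_restrict q S)) * (\<Prod>j\<in>S. [:- (\<zeta> ^ c j):]) :: complex poly"
  have orbC: "orbit q j = C" if "C \<in> orbs q" "j \<in> C" for C j
    using orbs_char[OF q that(1)] that(2) by auto
  have uC: "?u C = [:- (\<zeta> ^ cyc_exp c C):]" if C: "C \<in> orbs q" for C
  proof -
    obtain a where a: "C = orbit q a" using C by (auto simp: orbs_def)
    obtain n where n: "card C = Suc n" using orbs_facts(3)[OF q C] by (cases "card C") auto
    have neg: "[:- x:] = (- 1) * [:x:]" for x :: complex by simp
    have cst: "(\<Prod>j\<in>A. [:f j:]) = [:\<Prod>j\<in>A. f j:]" for f :: "nat \<Rightarrow> complex" and A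
      by (induction A rule: infinite_finite_induct) auto
    have "sign (perm_restrict q C) = (-1) ^ n"
      using sign_perm_restrict_orbit[OF perm[OF q], of a] a n by simp
    then show ?thesis
      unfolding neg prod.distrib cst zeta_cyc_exp by (simp add: n flip: power_add mult_2)
  qed
  have u_union: "?u (\<Union> T) = (\<Prod>C\<in>T. ?u C) \<and> card (\<Union> T) = (\<Sum>C\<in>T. card C)" if "finite T" "T \<subseteq> orbs q" for T
    using that
  proof (induction T rule: finite_induct)
    case empty
    have "perm_restrict q {} = id" by (auto simp: perm_restrict_def)
    then show ?case by simp
  next
    case (insert C T)
    have C: "C \<in> orbs q" and T: "T \<subseteq> orbs q" using insert by auto
    have disj: "C \<inter> \<Union> T = {}"
    proof (rule ccontr)
      assume "C \<inter> \<Union> T \<noteq> {}"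
      then obtain j C' where "j \<in> C" "j \<in> C'" "C' \<in> T" by blast
      then have "C' = C" using orbC[OF C] orbC[of C' j] T by blast
      then show False using insert \<open>C' \<in> T\<close> by simp
    qed
    have f: "finite C" "finite (\<Union> T)" using orbs_facts(1)[OF q] C T insert by auto
    have st: "\<Union> T \<subseteq> {..<N} \<and> q ` \<Union> T = \<Union> T" "C \<subseteq> {..<N} \<and> q ` C = C"
      using bij_betw_apply[OF stable_union_orbs[OF q], of T]
        bij_betw_apply[OF stable_union_orbs[OF q], of "{C}"] T C by simp_all
    have p: "perm_restrict q (\<Union> T) permutes {..<N}" "perm_restrict q C permutes {..<N}"
      using perm_restrict_permutes[OF q] st by auto
    have "cyclic_on q C" using C cyclic_on_orbit'[OF perm[OF q]] by (auto simp: orbs_def)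
    then have "perm_restrict q (\<Union> T) \<circ> perm_restrict q C = perm_restrict q (\<Union> T \<union> C)"
      using disj by (intro perm_restrict_comp) auto
    then have "sign (perm_restrict q (\<Union> (insert C T))) = sign (perm_restrict q (\<Union> T)) * sign (perm_restrict q C)"
      using sign_compose[OF perm[OF p(1)] perm[OF p(2)]] by (simp add: Un_commute)
    then show ?case using insert T f disj by (simp add: prod.union_disjoint card_Un_disjoint mult_ac)
  qed
  have "char_poly (wm q c) = (\<Sum>S\<in>{S. S \<subseteq> {..<N} \<and> q ` S = S}. ?u S * ?X ^ (N - card S))"
    by (rule char_poly_wm[OF q])
  also have "\<dots> = (\<Sum>T\<in>Pow (orbs q). ?u (\<Union> T) * ?X ^ (N - card (\<Union> T)))"
    by (rule sum.reindex_bij_betw[OF stable_union_orbs[OF q], symmetric])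
  also have "\<dots> = (\<Sum>T\<in>Pow (orbs q). (\<Prod>C\<in>T. [:- (\<zeta> ^ cyc_exp c C):]) * (\<Prod>C\<in>orbs q - T. ?X ^ card C))"
  proof (rule sum.cong[OF refl])
    fix T assume "T \<in> Pow (orbs q)"
    then have T: "T \<subseteq> orbs q" "finite T" using finite_subset[OF _ finite_orbs] by auto
    have "N = (\<Sum>j<N. 1)" by simp
    also have "\<dots> = (\<Sum>C\<in>orbs q. \<Sum>j\<in>C. 1)" by (rule sum_orbs[OF q])
    also have "\<dots> = (\<Sum>C\<in>orbs q. card C)" by simp
    also have "\<dots> = (\<Sum>C\<in>orbs q - T. card C) + (\<Sum>C\<in>T. card C)"
      by (rule sum.subset_diff[OF T(1)]) simp
    finally have "N - card (\<Union> T) = (\<Sum>C\<in>orbs q - T. card C)" using u_union[OF T(2,1)] by simp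
    then have "?X ^ (N - card (\<Union> T)) = (\<Prod>C\<in>orbs q - T. ?X ^ card C)" by (simp only: power_sum)
    moreover have "?u (\<Union> T) = (\<Prod>C\<in>T. [:- (\<zeta> ^ cyc_exp c C):])"
    proof -
      have "?u (\<Union> T) = (\<Prod>C\<in>T. ?u C)" using u_union[OF T(2,1)] by blast
      also have "\<dots> = (\<Prod>C\<in>T. [:- (\<zeta> ^ cyc_exp c C):])" using uC T(1) by (intro prod.cong) auto
      finally show ?thesis .
    qed
    ultimately show "?u (\<Union> T) * ?X ^ (N - card (\<Union> T)) =
        (\<Prod>C\<in>T. [:- (\<zeta> ^ cyc_exp c C):]) * (\<Prod>C\<in>orbs q - T. ?X ^ card C)" by (simp only:)
  qed
  also have "\<dots> = (\<Prod>C\<in>orbs q. [:- (\<zeta> ^ cyc_exp c C):] + ?X ^ card C)"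
    by (rule prod_add[symmetric]) simp
  finally show ?thesis .
qed

lemma char_poly_type:
  assumes "w \<in> Wgrp N \<zeta>" "w' \<in> Wgrp N \<zeta>" "has_type r N \<zeta> w \<nu>" "has_type r N \<zeta> w' \<nu>"
  shows "char_poly w = char_poly w'"
proof -
  have "char_poly w = (\<Prod>k<r. \<Prod>i<length (\<nu> ! k). [:- (\<zeta> ^ k):] + [:0, 1:] ^ (\<nu> ! k ! i))"
    if ww: "w \<in> Wgrp N \<zeta>" "has_type r N \<zeta> w \<nu>" for w
  proof -
    obtain q c where w: "w = wm q c" and q: "q permutes {..<N}" using ww(1) by (auto simp: Wgrp_eq)
    show ?thesis using ww(2) unfolding w char_poly_orbs[OF q]
      by (intro prod_type[OF q, of c \<nu> "\<lambda>k n. [:- (\<zeta> ^ k):] + [:0, 1:] ^ n", symmetric])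
  qed
  from this[OF assms(1,3)] this[OF assms(2,4)] show ?thesis by simp
qed

end

section \<open>A signed orbit count\<close>

definition cnt :: "nat \<Rightarrow> (nat \<Rightarrow> 'b) \<Rightarrow> 'b \<Rightarrow> nat" where
  "cnt N F x = card {j \<in> {..<N}. F j = x}"

definition stab :: "nat \<Rightarrow> (nat \<Rightarrow> 'b) \<Rightarrow> (nat \<Rightarrow> nat) set" where
  "stab N F = {q. q permutes {..<N} \<and> (\<forall>j<N. F (q j) = F j)}"

lemma finite_stab: "finite (stab N F)"
  by (rule finite_subset[OF _ finite_permutations[of "{..<N}"]]) (auto simp: stab_def)

lemma image_mset_eq_cnt: "count (image_mset F (mset_set {..<N})) x = cnt N F x"
  by (simp add: count_image_mset cnt_def Int_def vimage_def conj_commute)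

lemma prod_cnt:
  fixes wt :: "'b \<Rightarrow> 'c::comm_monoid_mult"
  assumes "finite B" "\<And>j. j < N \<Longrightarrow> F j \<in> B"
  shows "(\<Prod>j<N. wt (F j)) = (\<Prod>x\<in>B. wt x ^ cnt N F x)"
proof -
  have "(\<Prod>x\<in>B. wt x ^ cnt N F x) = (\<Prod>x\<in>B. \<Prod>j\<in>{j \<in> {..<N}. F j = x}. wt (F j))"
    by (intro prod.cong refl) (simp add: cnt_def)
  also have "\<dots> = (\<Prod>j<N. wt (F j))"
    using assms by (intro prod.group) auto
  finally show ?thesis by simp
qed

text \<open>If two starred points have the same colour, composing with their transposition is a
  sign-reversing bijection of the stabilizer, and the sum cancels. Otherwise the stabilizer fixes
  every starred point, and all signs are 1.\<close>

lemma signed_stabilizer_sum: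
  fixes F :: "nat \<Rightarrow> 'b" and star :: "'b \<Rightarrow> bool" and N :: nat
  defines "S \<equiv> {j \<in> {..<N}. star (F j)}"
  shows "(\<Sum>q\<in>stab N F. sign (perm_restrict q S)) = (if inj_on F S then int (card (stab N F)) else 0)"
proof (cases "inj_on F S")
  case True
  have "sign (perm_restrict q S) = 1" if "q \<in> stab N F" for q
  proof -
    have q: "q permutes {..<N}" "\<And>j. j < N \<Longrightarrow> F (q j) = F j" using that by (auto simp: stab_def)
    have "q j = j" if "j \<in> S" for j
    proof -
      have j: "j < N" "star (F j)" using that by (auto simp: S_def)
      then have "q j \<in> S" using q permutes_less[OF q(1) j(1)] by (simp add: S_def)
      then show ?thesis using True that q(2)[OF j(1)] by (auto simp: inj_on_def)
    qed
    then have "perm_restrict q S = id" by (auto simp: perm_restrict_def)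
    then show ?thesis by simp
  qed
  then show ?thesis using True by simp
next
  case False
  then obtain a b where ab: "a \<in> S" "b \<in> S" "a \<noteq> b" "F a = F b" by (auto simp: inj_on_def)
  let ?t = "transpose a b"
  have tp: "?t permutes {..<N}" using ab by (intro permutes_swap_id) (auto simp: S_def)
  have Ft: "F (?t j) = F j" for j using ab(4) by (auto simp: transpose_def)
  have tS: "?t j \<in> S \<longleftrightarrow> j \<in> S" for j using ab by (auto simp: transpose_def)
  have bij: "bij_betw (\<lambda>q. q \<circ> ?t) (stab N F) (stab N F)"
  proof (rule bij_betwI[where g = "\<lambda>q. q \<circ> ?t"])
    have "q \<circ> ?t \<in> stab N F" if "q \<in> stab N F" for q
      using that permutes_less[OF tp] Ft permutes_compose[OF tp] by (auto simp: stab_def)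
    then show "(\<lambda>q. q \<circ> ?t) \<in> stab N F \<rightarrow> stab N F" "(\<lambda>q. q \<circ> ?t) \<in> stab N F \<rightarrow> stab N F" by auto
  qed (auto simp: o_assoc[symmetric])
  have flip: "sign (perm_restrict (q \<circ> ?t) S) = - sign (perm_restrict q S)" if "q \<in> stab N F" for q
  proof -
    have q: "q permutes {..<N}" "\<And>j. j < N \<Longrightarrow> F (q j) = F j" using that by (auto simp: stab_def)
    have "q ` S \<subseteq> S" using q permutes_less[OF q(1)] by (auto simp: S_def)
    moreover have "card (q ` S) = card S" by (rule card_image[OF inj_on_subset[OF permutes_inj[OF q(1)]]]) simp
    ultimately have "q ` S = S" by (intro card_subset_eq) (auto simp: S_def)
    then have "perm_restrict q S permutes {..<N}" by (intro perm_restrict_permutes[OF q(1)]) (auto simp: S_def)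
    then have p: "permutation (perm_restrict q S)" by (auto simp: permutation_permutes)
    \<comment> \<open>Both exchanged points lie in S, so restricting to S is compatible with the
      composition.\<close>
    have "perm_restrict (q \<circ> ?t) S = perm_restrict q S \<circ> ?t"
    proof
      fix j show "perm_restrict (q \<circ> ?t) S j = (perm_restrict q S \<circ> ?t) j"
        using tS[of j] ab by (cases "j \<in> S") (auto simp: perm_restrict_def transpose_def)
    qed
    then have "sign (perm_restrict (q \<circ> ?t) S) = sign (perm_restrict q S) * sign ?t"
      using sign_compose[OF p permutation_swap_id] by simp
    then show ?thesis using ab(3) by (simp add: sign_swap_id)
  qed
  have "(\<Sum>q\<in>stab N F. sign (perm_restrict q S)) = (\<Sum>q\<in>stab N F. sign (perm_restrict (q \<circ> ?t) S))"
    by (rule sum.reindex_bij_betw[OF bij, symmetric])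
  also have "\<dots> = - (\<Sum>q\<in>stab N F. sign (perm_restrict q S))"
    by (simp add: flip sum_negf)
  finally show ?thesis using False by simp
qed

text \<open>Colourings with the same multiplicities form one orbit of the symmetric group. Counting
  permutations by the colouring to which they move F0 gives the formula.\<close>

lemma sum_card_stab:
  assumes F0: "F0 \<in> {..<N} \<rightarrow>\<^sub>E B"
  shows "(\<Sum>F\<in>{F \<in> {..<N} \<rightarrow>\<^sub>E B. cnt N F = cnt N F0}. card (stab N F)) = fact N"
proof -
  let ?E = "{F \<in> {..<N} \<rightarrow>\<^sub>E B. cnt N F = cnt N F0}"
  let ?P = "{q. q permutes {..<N}}"
  let ?h = "\<lambda>q. restrict (F0 \<circ> q) {..<N}"
  have fib: "card {q \<in> ?P. ?h q = F} = card (stab N F)" if F: "F \<in> ?E" for F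
  proof -
    have "image_mset F (mset_set {..<N}) = image_mset F0 (mset_set {..<N})"
      using F by (intro multiset_eqI) (simp add: image_mset_eq_cnt)
    then obtain p where p: "p permutes {..<N}" "\<forall>x\<in>{..<N}. F x = F0 (p x)"
      using image_mset_eq_implies_permutes[of "{..<N}" F F0] by auto
    have i: "inv_into UNIV p permutes {..<N}" by (rule permutes_inv[OF p(1)])
    \<comment> \<open>The permutations that lead from F0 to F form a coset of the stabilizer of
      F.\<close>
    have "bij_betw (\<lambda>\<tau>. p \<circ> \<tau>) (stab N F) {q \<in> ?P. ?h q = F}"
    proof (rule bij_betwI[where g = "\<lambda>q. inv_into UNIV p \<circ> q"])
      show "(\<lambda>\<tau>. p \<circ> \<tau>) \<in> stab N F \<rightarrow> {q \<in> ?P. ?h q = F}"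
      proof
        fix \<tau> assume t: "\<tau> \<in> stab N F"
        then have \<tau>: "\<tau> permutes {..<N}" "\<And>j. j < N \<Longrightarrow> F (\<tau> j) = F j" by (auto simp: stab_def)
        have "?h (p \<circ> \<tau>) = F"
        proof (rule extensionalityI[where A = "{..<N}"])
          fix j assume "j \<in> {..<N}"
          then have j: "j < N" by simp
          then have "F0 (p (\<tau> j)) = F (\<tau> j)" using p(2) permutes_less[OF \<tau>(1) j] by simp
          then show "?h (p \<circ> \<tau>) j = F j" using \<tau>(2)[OF j] j by simp
        qed (use F in \<open>auto simp: PiE_def\<close>)
        then show "p \<circ> \<tau> \<in> {q \<in> ?P. ?h q = F}" using permutes_compose[OF \<tau>(1) p(1)] by simp
      qed
      show "(\<lambda>q. inv_into UNIV p \<circ> q) \<in> {q \<in> ?P. ?h q = F} \<rightarrow> stab N F"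
      proof
        fix q assume s: "q \<in> {q \<in> ?P. ?h q = F}"
        then have q: "q permutes {..<N}" by simp
        have "F (inv_into UNIV p (q j)) = F j" if j: "j < N" for j
        proof -
          have "inv_into UNIV p (q j) < N" by (rule permutes_less[OF i permutes_less[OF q j]])
          then have "F (inv_into UNIV p (q j)) = F0 (q j)"
            using p(2) permutes_inverses(1)[OF p(1)] by simp
          also have "\<dots> = ?h q j" using j by simp
          also have "\<dots> = F j" using s by simp
          finally show ?thesis .
        qed
        then show "inv_into UNIV p \<circ> q \<in> stab N F"
          using permutes_compose[OF q i] by (simp add: stab_def)
      qed
    qed (auto simp: fun_eq_iff permutes_inverses[OF p(1)])
    then show ?thesis by (rule bij_betw_same_card[symmetric])
  qed
  have im: "?h ` ?P \<subseteq> ?E"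
  proof (rule image_subsetI)
    fix q assume "q \<in> ?P"
    then have q: "q permutes {..<N}" by simp
    have "cnt N (?h q) x = cnt N F0 x" for x
    proof -
      have "{j \<in> {..<N}. F0 j = x} = q ` {j \<in> {..<N}. ?h q j = x}"
      proof (intro equalityI subsetI)
        fix j assume j: "j \<in> {j \<in> {..<N}. F0 j = x}"
        let ?i = "inv_into UNIV q j"
        have "q ?i = j" "?i < N" using permutes_inverses(1)[OF q] permutes_less[OF permutes_inv[OF q]] j by auto
        then show "j \<in> q ` {j \<in> {..<N}. ?h q j = x}" using j by (intro image_eqI[where x = ?i]) auto
      qed (use permutes_less[OF q] in auto)
      moreover have "inj_on q {j \<in> {..<N}. ?h q j = x}"
        by (rule inj_on_subset[OF permutes_inj[OF q]]) simp
      ultimately show ?thesis by (simp add: cnt_def card_image)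
    qed
    then show "?h q \<in> ?E"
      using F0 permutes_less[OF q] by auto
  qed
  have fE: "finite ?E"
  proof -
    have "?E \<subseteq> ?h ` ?P"
    proof
      fix F assume F: "F \<in> ?E"
      have "id \<in> stab N F" using permutes_id by (simp add: stab_def)
      then have "card (stab N F) > 0" using finite_stab by (auto simp: card_gt_0_iff)
      then have "{q \<in> ?P. ?h q = F} \<noteq> {}" using fib[OF F] by (metis card.empty less_numeral_extra(3))
      then show "F \<in> ?h ` ?P" by blast
    qed
    then show ?thesis by (rule finite_subset) (simp add: finite_permutations)
  qed
  have "(fact N :: nat) = (\<Sum>q\<in>?P. 1)" by (simp add: card_permutations)
  also have "\<dots> = (\<Sum>F\<in>?E. \<Sum>q\<in>{q \<in> ?P. ?h q = F}. 1)"
    by (rule sum.group[symmetric]) (use im fE in \<open>simp_all add: finite_permutations\<close>)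
  also have "\<dots> = (\<Sum>F\<in>?E. card (stab N F))"
    by (rule sum.cong[OF refl]) (simp only: card_eq_sum[symmetric] fib)
  finally show ?thesis by simp
qed

text \<open>The orbits of the symmetric group on colourings are labelled by such multiplicity
  functions.\<close>

definition mults :: "nat \<Rightarrow> 'b set \<Rightarrow> ('b \<Rightarrow> nat) set" where
  "mults N B = {\<rho>. (\<forall>x. x \<notin> B \<longrightarrow> \<rho> x = 0) \<and> (\<Sum>x\<in>B. \<rho> x) = N}"

lemma finite_mults:
  assumes "finite B"
  shows "finite (mults N B)"
proof (rule finite_subset)
  show "finite {\<rho>. \<forall>x. (x \<in> B \<longrightarrow> \<rho> x \<in> {..N}) \<and> (x \<notin> B \<longrightarrow> \<rho> x = 0)}"
    by (rule finite_set_of_finite_funs[OF assms]) simp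
  show "mults N B \<subseteq> {\<rho>. \<forall>x. (x \<in> B \<longrightarrow> \<rho> x \<in> {..N}) \<and> (x \<notin> B \<longrightarrow> \<rho> x = 0)}"
    using assms member_le_sum[of _ B] by (auto simp: mults_def)
qed

lemma mults_realize:
  assumes "finite B" "\<rho> \<in> mults N B"
  obtains F where "F \<in> {..<N} \<rightarrow>\<^sub>E B" "cnt N F = \<rho>"
proof -
  define M where "M = (\<Sum>x\<in>B. replicate_mset (\<rho> x) x)"
  obtain xs where xs: "mset xs = M" using ex_mset by blast
  have cM: "count M x = \<rho> x" for x
    using assms by (auto simp: M_def count_sum mults_def if_distrib cong: if_cong)
  have "size M = N" using assms by (simp add: M_def mults_def)
  then have len: "length xs = N" using xs by (metis size_mset)
  let ?F = "restrict ((!) xs) {..<N}"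
  have "set xs \<subseteq> B"
  proof
    fix x assume "x \<in> set xs"
    then have "count M x > 0" using xs by (metis count_greater_zero_iff set_mset_mset)
    then show "x \<in> B" using assms cM by (auto simp: mults_def)
  qed
  then have "?F \<in> {..<N} \<rightarrow>\<^sub>E B" using len nth_mem[of _ xs] by auto
  moreover have "cnt N ?F x = \<rho> x" for x
  proof -
    have "cnt N ?F x = cnt N ((!) xs) x" unfolding cnt_def by (intro arg_cong[where f = card]) auto
    also have "\<dots> = count (mset xs) x"
      unfolding mset_image_nth[of xs] len image_mset_eq_cnt ..
    finally show ?thesis using xs cM by simp
  qed
  ultimately show ?thesis using that by blast
qed

lemma cnt_in_mults:
  assumes "finite B" "F \<in> {..<N} \<rightarrow>\<^sub>E B"
  shows "cnt N F \<in> mults N B"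
proof -
  have "cnt N F x = 0" if "x \<notin> B" for x
    using assms that by (auto simp: cnt_def PiE_def Pi_def)
  moreover have "(\<Sum>x\<in>B. cnt N F x) = N"
  proof -
    have "(\<Sum>x\<in>B. cnt N F x) = (\<Sum>x\<in>B. \<Sum>j\<in>{j \<in> {..<N}. F j = x}. 1)" by (simp add: cnt_def)
    also have "\<dots> = (\<Sum>j<N. 1)" using assms by (intro sum.group) auto
    finally show ?thesis by simp
  qed
  ultimately show ?thesis by (simp add: mults_def)
qed

text \<open>After the sums are exchanged, the stabilizer of each colouring contributes its order or
  0. The weight depends only on the orbit, and the stabilizer orders along an orbit add up to N!.
  The predicate \<open>P\<close> selects a union of orbits.\<close>

lemma signed_burnside:
  fixes wt :: "'b \<Rightarrow> 'c::comm_ring_1" and star :: "'b \<Rightarrow> bool" and P :: "('b \<Rightarrow> nat) \<Rightarrow> bool"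
  assumes B: "finite B"
  shows "(\<Sum>q | q permutes {..<N}. \<Sum>F\<in>{F \<in> {F \<in> {..<N} \<rightarrow>\<^sub>E B. P (cnt N F)}. \<forall>j<N. F (q j) = F j}.
      of_int (sign (perm_restrict q {j \<in> {..<N}. star (F j)})) * (\<Prod>j<N. wt (F j))) =
    of_nat (fact N) * (\<Sum>\<rho>\<in>{\<rho> \<in> mults N B. (\<forall>x. star x \<longrightarrow> \<rho> x \<le> 1) \<and> P \<rho>}. \<Prod>x\<in>B. wt x ^ \<rho> x)"
proof -
  let ?PF = "{F \<in> {..<N} \<rightarrow>\<^sub>E B. P (cnt N F)}"
  let ?S = "\<lambda>F. {j \<in> {..<N}. star (F j)}"
  let ?W = "\<lambda>\<rho>. \<Prod>x\<in>B. wt x ^ \<rho> x"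
  let ?R = "{\<rho> \<in> mults N B. (\<forall>x. star x \<longrightarrow> \<rho> x \<le> 1) \<and> P \<rho>}"
  have "finite ({..<N} \<rightarrow>\<^sub>E B)" using B by (intro finite_PiE) auto
  then have fPF: "finite ?PF" by (rule rev_finite_subset) auto
  have inj: "inj_on F (?S F) \<longleftrightarrow> (\<forall>x. star x \<longrightarrow> cnt N F x \<le> 1)" for F
  proof
    assume inj: "inj_on F (?S F)"
    show "\<forall>x. star x \<longrightarrow> cnt N F x \<le> 1"
    proof (intro allI impI)
      fix x assume x: "star x"
      have "j = j'" if "j \<in> {j \<in> {..<N}. F j = x}" "j' \<in> {j \<in> {..<N}. F j = x}" for j j'
        using inj that x by (auto simp: inj_on_def)
      then show "cnt N F x \<le> 1" unfolding cnt_def by (intro card_le_Suc0_iff_eq[THEN iffD2, folded One_nat_def]) auto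
    qed
  next
    assume c: "\<forall>x. star x \<longrightarrow> cnt N F x \<le> 1"
    show "inj_on F (?S F)"
    proof (rule inj_onI)
      fix j j' assume j: "j \<in> ?S F" "j' \<in> ?S F" "F j = F j'"
      then have "card {i \<in> {..<N}. F i = F j} \<le> Suc 0" using c by (auto simp: cnt_def)
      then have "\<forall>a\<in>{i \<in> {..<N}. F i = F j}. \<forall>b\<in>{i \<in> {..<N}. F i = F j}. a = b"
        by (subst (asm) card_le_Suc0_iff_eq) auto
      then show "j = j'" using j by auto
    qed
  qed
  have "(\<Sum>q | q permutes {..<N}. \<Sum>F\<in>{F \<in> ?PF. \<forall>j<N. F (q j) = F j}.
      of_int (sign (perm_restrict q (?S F))) * (\<Prod>j<N. wt (F j))) =
    (\<Sum>F\<in>?PF. \<Sum>q\<in>{q \<in> {q. q permutes {..<N}}. \<forall>j<N. F (q j) = F j}.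
      of_int (sign (perm_restrict q (?S F))) * (\<Prod>j<N. wt (F j)))"
    by (rule sum.swap_restrict) (simp_all add: finite_permutations fPF)
  also have "\<dots> = (\<Sum>F\<in>?PF. of_int (\<Sum>q\<in>stab N F. sign (perm_restrict q (?S F))) * (\<Prod>j<N. wt (F j)))"
    by (simp add: stab_def sum_distrib_right)
  also have "\<dots> = (\<Sum>F\<in>?PF. if \<forall>x. star x \<longrightarrow> cnt N F x \<le> 1 then of_nat (card (stab N F)) * ?W (cnt N F) else 0)"
  proof (rule sum.cong[OF refl])
    fix F assume "F \<in> ?PF"
    then have "(\<Prod>j<N. wt (F j)) = ?W (cnt N F)" using B by (intro prod_cnt) auto
    then show "of_int (\<Sum>q\<in>stab N F. sign (perm_restrict q (?S F))) * (\<Prod>j<N. wt (F j)) =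
        (if \<forall>x. star x \<longrightarrow> cnt N F x \<le> 1 then of_nat (card (stab N F)) * ?W (cnt N F) else 0)"
      unfolding signed_stabilizer_sum inj
      by (simp only: if_distrib[of of_int] if_distrib[of "\<lambda>x. x * _"] of_int_of_nat_eq of_int_0 mult_zero_left)
  qed
  also have "\<dots> = (\<Sum>F\<in>{F \<in> ?PF. \<forall>x. star x \<longrightarrow> cnt N F x \<le> 1}. of_nat (card (stab N F)) * ?W (cnt N F))"
    by (rule sum.inter_filter[OF fPF, symmetric])
  also have "\<dots> = (\<Sum>\<rho>\<in>?R. \<Sum>F\<in>{F \<in> {F \<in> ?PF. \<forall>x. star x \<longrightarrow> cnt N F x \<le> 1}. cnt N F = \<rho>}. of_nat (card (stab N F)) * ?W (cnt N F))"
  proof (rule sum.group[symmetric])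
    show "finite {F \<in> ?PF. \<forall>x. star x \<longrightarrow> cnt N F x \<le> 1}" by (rule finite_subset[OF _ fPF]) auto
    show "finite ?R" by (rule finite_subset[OF _ finite_mults[OF B, of N]]) auto
    show "cnt N ` {F \<in> ?PF. \<forall>x. star x \<longrightarrow> cnt N F x \<le> 1} \<subseteq> ?R" using cnt_in_mults[OF B] by auto
  qed
  also have "\<dots> = (\<Sum>\<rho>\<in>?R. of_nat (fact N) * ?W \<rho>)"
  proof (rule sum.cong[OF refl])
    fix \<rho> assume \<rho>: "\<rho> \<in> ?R"
    then obtain F0 where F0: "F0 \<in> {..<N} \<rightarrow>\<^sub>E B" "cnt N F0 = \<rho>" using mults_realize[OF B] by blast
    have E: "{F \<in> {F \<in> ?PF. \<forall>x. star x \<longrightarrow> cnt N F x \<le> 1}. cnt N F = \<rho>} = {F \<in> {..<N} \<rightarrow>\<^sub>E B. cnt N F = cnt N F0}"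
      using \<rho> F0 by auto
    have "(\<Sum>F\<in>{F \<in> {..<N} \<rightarrow>\<^sub>E B. cnt N F = cnt N F0}. of_nat (card (stab N F)) * ?W (cnt N F)) =
        (\<Sum>F\<in>{F \<in> {..<N} \<rightarrow>\<^sub>E B. cnt N F = cnt N F0}. of_nat (card (stab N F)) * ?W \<rho>)"
      by (rule sum.cong[OF refl]) (simp add: F0(2))
    also have "\<dots> = of_nat (\<Sum>F\<in>{F \<in> {..<N} \<rightarrow>\<^sub>E B. cnt N F = cnt N F0}. card (stab N F)) * ?W \<rho>"
      by (simp add: sum_distrib_right)
    finally show "(\<Sum>F\<in>{F \<in> {F \<in> ?PF. \<forall>x. star x \<longrightarrow> cnt N F x \<le> 1}. cnt N F = \<rho>}. of_nat (card (stab N F)) * ?W (cnt N F)) = of_nat (fact N) * ?W \<rho>"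
      unfolding E sum_card_stab[OF F0(1)] .
  qed
  also have "\<dots> = of_nat (fact N) * (\<Sum>\<rho>\<in>?R. ?W \<rho>)" by (simp add: sum_distrib_left)
  finally show ?thesis .
qed

section \<open>The kernel identity\<close>

lemma sum_single_cnt:
  fixes \<phi> :: "'b \<Rightarrow> 'v"
  assumes "finite B" "\<And>j. j < N \<Longrightarrow> F j \<in> B"
  shows "(\<Sum>j<N. single (\<phi> (F j)) 1) = (\<Sum>x\<in>B. single (\<phi> x) (cnt N F x))"
proof -
  have "(\<Sum>x\<in>B. single (\<phi> x) (cnt N F x)) = (\<Sum>x\<in>B. \<Sum>j\<in>{j \<in> {..<N}. F j = x}. single (\<phi> (F j)) 1)"
  proof (rule sum.cong[OF refl])
    fix x
    have "(\<Sum>j\<in>{j \<in> {..<N}. F j = x}. single (\<phi> (F j)) (1::nat)) = (\<Sum>j\<in>{j \<in> {..<N}. F j = x}. single (\<phi> x) 1)"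
      by (rule sum.cong) auto
    also have "\<dots> = single (\<phi> x) (cnt N F x)"
      by (rule poly_mapping_eqI) (simp add: lookup_sum lookup_single when_def cnt_def)
    finally show "single (\<phi> x) (cnt N F x) = (\<Sum>j\<in>{j \<in> {..<N}. F j = x}. single (\<phi> (F j)) 1)" by simp
  qed
  also have "\<dots> = (\<Sum>j<N. single (\<phi> (F j)) 1)"
    using assms by (intro sum.group) auto
  finally show ?thesis by simp
qed

lemma prod_const_poly: "(\<Prod>j\<in>A. [:f j :: 'c::comm_ring_1:]) = [:\<Prod>j\<in>A. f j:]"
  by (induction A rule: infinite_finite_induct) (auto simp: one_pCons)

lemma sum_const_poly: "(\<Sum>j\<in>A. [:f j :: 'c::comm_ring_1:]) = [:\<Sum>j\<in>A. f j:]"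
  by (induction A rule: infinite_finite_induct) auto

type_synonym cell = "(nat \<times> nat) \<times> (nat \<times> nat) \<times> bool"

context wreath begin

text \<open>
  A multiplicity function on the cells \<open>(v, v', b)\<close> records a term of the expansion of \<open>q\<^sup>+\<close>: the
  factor belonging to \<open>v\<close> contributes the variable \<open>v'\<close>, through the numerator of its generating
  function if \<open>b\<close> and through the geometric series otherwise.
\<close>

definition compat :: "cell \<Rightarrow> bool" where
  "compat x \<longleftrightarrow> r dvd (r - 1) * fst (fst x) + fst (fst (snd x)) + of_bool (snd (snd x))"

definition kerP :: "(nat \<times> nat) set \<Rightarrow> monom_exp \<Rightarrow> monom_exp \<Rightarrow> (cell \<Rightarrow> nat) \<Rightarrow> bool" where
  "kerP V a b \<rho> \<longleftrightarrow> (\<forall>x. \<rho> x > 0 \<longrightarrow> compat x) \<and>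
     (\<Sum>x\<in>V \<times> V \<times> UNIV. single (fst x) (\<rho> x)) = a \<and>
     (\<Sum>x\<in>V \<times> V \<times> UNIV. single (fst (snd x)) (\<rho> x)) = b"

text \<open>The value of \<open>wq\<close> at 1/t, multiplied by t: 1 becomes t, and a term -t_k
  becomes -1. Since the multiplicities add up to N, the product over all cells absorbs the factor
  t^N.\<close>

definition wtp :: "cell \<Rightarrow> complex poly" where
  "wtp x = (if snd (snd x) then - 1 else [:0, 1:])"

text \<open>For a dominant exponent a this is t^N times the coefficient of x^b in the corresponding
  q^+ at 1/t, see \<open>tau_q_plus\<close>; here it appears as the result of the orbit
  count.\<close>

definition kernel_sum :: "(nat \<times> nat) set \<Rightarrow> monom_exp \<Rightarrow> monom_exp \<Rightarrow> complex poly" where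
  "kernel_sum V a b = (\<Sum>\<rho>\<in>{\<rho> \<in> mults N (V \<times> V \<times> UNIV). (\<forall>x. snd (snd x) \<longrightarrow> \<rho> x \<le> 1) \<and> kerP V a b \<rho>}.
     \<Prod>x\<in>V \<times> V \<times> UNIV. wtp x ^ \<rho> x)"

definition RW :: "(nat \<times> nat) set \<Rightarrow> (nat \<Rightarrow> nat) \<Rightarrow> (nat \<Rightarrow> nat) \<Rightarrow> monom_exp \<Rightarrow> complex" where
  "RW V q c b = (\<Sum>g\<in>{g \<in> invf q V. (\<Sum>j<N. single (g j) 1) = b}. \<Prod>j<N. \<zeta> ^ (c j * fst (g j)))"

lemma sum_zeta: "(\<Sum>c<r. (\<zeta> ^ e) ^ c) = (if r dvd e then of_nat r else 0)"
proof (cases "r dvd e")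
  case True
  then have "\<zeta> ^ e = 1" by (simp add: zeta_eq_1_iff)
  then show ?thesis using True by simp
next
  case False
  then have ne: "\<zeta> ^ e \<noteq> 1" by (simp add: zeta_eq_1_iff)
  have "(\<zeta> ^ e) ^ r = 1" by (metis mult.commute power_mult power_one zeta_r)
  then show ?thesis using False ne by (simp add: geometric_sum[OF ne])
qed

text \<open>Conjugation negates the exponent; since exponents are natural numbers, r - 1 stands for
  -1 modulo r.\<close>

lemma cnj_zeta_power: "cnj (\<zeta> ^ m) = \<zeta> ^ ((r - 1) * m)"
proof -
  have "\<zeta> ^ (r - 1) * \<zeta> = 1" using zeta_r r by (metis power_minus_mult less_eq_Suc_le One_nat_def)
  then have "cnj \<zeta> = \<zeta> ^ (r - 1)" unfolding cnj_zeta by (metis inverse_unique mult.commute)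
  then show ?thesis by (simp add: power_mult)
qed

text \<open>As a function of c, each term is a character of the group of N-tuples modulo r, and its
  sum vanishes unless the character is trivial.\<close>

lemma sum_c_term:
  fixes sg :: "complex poly"
  shows "(\<Sum>c\<in>{..<N} \<rightarrow>\<^sub>E {..<r}. sg * (\<Prod>j<N. [:(\<zeta> ^ e j) ^ c j:] * w j)) =
    (if \<forall>j<N. r dvd e j then of_nat (r ^ N) * (sg * (\<Prod>j<N. w j)) else 0)"
proof -
  have "(\<Sum>c\<in>{..<N} \<rightarrow>\<^sub>E {..<r}. sg * (\<Prod>j<N. [:(\<zeta> ^ e j) ^ c j:] * w j)) =
      sg * (\<Prod>j<N. w j) * (\<Sum>c\<in>{..<N} \<rightarrow>\<^sub>E {..<r}. \<Prod>j<N. [:(\<zeta> ^ e j) ^ c j:])"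
    unfolding sum_distrib_left
    by (rule sum.cong[OF refl]) (simp only: prod.distrib mult.assoc mult.commute[of "prod w {..<N}"])
  also have "(\<Sum>c\<in>{..<N} \<rightarrow>\<^sub>E {..<r}. \<Prod>j<N. [:(\<zeta> ^ e j) ^ c j:]) = (\<Prod>j<N. \<Sum>c<r. [:(\<zeta> ^ e j) ^ c:])"
    by (rule prod_sum_PiE[symmetric]) auto
  also have "\<dots> = (\<Prod>j<N. if r dvd e j then of_nat r else 0)"
    by (intro prod.cong refl) (simp add: sum_const_poly sum_zeta of_nat_poly)
  also have "\<dots> = (if \<forall>j<N. r dvd e j then of_nat (r ^ N) else 0)"
  proof (cases "\<forall>j<N. r dvd e j")
    case True then show ?thesis by simp
  next
    case False
    then have "(\<Prod>j<N. if r dvd e j then of_nat r else (0 :: complex poly)) = 0" by (intro prod_zero) auto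
    then show ?thesis unfolding if_not_P[OF False] .
  qed
  finally have fin: "(\<Sum>c\<in>{..<N} \<rightarrow>\<^sub>E {..<r}. sg * (\<Prod>j<N. [:(\<zeta> ^ e j) ^ c j:] * w j)) =
      sg * (\<Prod>j<N. w j) * (if \<forall>j<N. r dvd e j then of_nat (r ^ N) else 0)" .
  show ?thesis
  proof (cases "\<forall>j<N. r dvd e j")
    case True
    show ?thesis unfolding fin if_P[OF True] by (rule mult.commute)
  next
    case False
    show ?thesis unfolding fin if_not_P[OF False] by (rule mult_zero_right)
  qed
qed

lemma stable_iff:
  assumes q: "q permutes {..<N}" and S: "S \<subseteq> {..<N}"
  shows "q ` S = S \<longleftrightarrow> (\<forall>j<N. q j \<in> S \<longleftrightarrow> j \<in> S)"
proof
  assume s: "q ` S = S"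
  show "\<forall>j<N. q j \<in> S \<longleftrightarrow> j \<in> S"
    using inj_image_mem_iff[OF permutes_inj[OF q], of _ S] s by simp
next
  assume s: "\<forall>j<N. q j \<in> S \<longleftrightarrow> j \<in> S"
  have "card (q ` S) = card S" by (rule card_image[OF inj_on_subset[OF permutes_inj[OF q]]]) simp
  moreover have "q ` S \<subseteq> S" using s S by auto
  ultimately show "q ` S = S" using finite_subset[OF S finite_lessThan] by (intro card_subset_eq) auto
qed

lemma finite_invf: "finite V \<Longrightarrow> finite (invf q V)"
  by (rule finite_subset[of _ "{..<N} \<rightarrow>\<^sub>E V"]) (auto simp: invf_def intro!: finite_PiE)

text \<open>The three factors expand over colourings f and g fixed by q and over stable sets S. A
  triple (f, g, S) is the same as one colouring by cells fixed by q, and the sum over the exponents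
  c retains exactly the triples that satisfy \<open>compat\<close> at every point.\<close>

lemma kernel_fixed_perm:
  assumes q: "q permutes {..<N}" and V: "finite V"
  shows "(\<Sum>c\<in>{..<N} \<rightarrow>\<^sub>E {..<r}. [:cnj (RW V q c a) * RW V q c b:] * char_poly (wm q c)) =
    of_nat (r ^ N) * (\<Sum>F\<in>{F \<in> {F \<in> {..<N} \<rightarrow>\<^sub>E V \<times> V \<times> UNIV. kerP V a b (cnt N F)}. \<forall>j<N. F (q j) = F j}.
      of_int (sign (perm_restrict q {j \<in> {..<N}. snd (snd (F j))})) * (\<Prod>j<N. wtp (F j)))"
proof -
  define Ga where "Ga a = {g \<in> invf q V. (\<Sum>j<N. single (g j) 1) = a}" for a :: monom_exp
  define SS where "SS = {S. S \<subseteq> {..<N} \<and> q ` S = S}"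
  define ex where "ex f g S j = (r - 1) * fst (f j) + fst (g j) + of_bool (j \<in> S)" for f g :: "nat \<Rightarrow> nat \<times> nat" and S and j :: nat
  define sg where "sg S = (of_int (sign (perm_restrict q S)) :: complex poly)" for S
  define w where "w S j = (if j \<in> S then - 1 else [:0, 1:] :: complex poly)" for S and j :: nat
  have finG: "finite (Ga a)" for a unfolding Ga_def by (rule finite_subset[OF _ finite_invf[OF V, of q]]) auto
  have finS: "finite SS" unfolding SS_def by (rule finite_subset[of _ "Pow {..<N}"]) auto
  have H: "[:cnj (RW V q c a) * RW V q c b:] * char_poly (wm q c) =
      (\<Sum>t\<in>Ga a \<times> Ga b \<times> SS. sg (snd (snd t)) * (\<Prod>j<N. [:(\<zeta> ^ ex (fst t) (fst (snd t)) (snd (snd t)) j) ^ c j:] * w (snd (snd t)) j))" for c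
  proof -
    let ?F = "\<lambda>f. \<Prod>j<N. [:\<zeta> ^ ((r - 1) * (c j * fst (f j))):]"
    let ?G = "\<lambda>g. \<Prod>j<N. [:\<zeta> ^ (c j * fst (g j)):]"
    let ?S = "\<lambda>S. \<Prod>j<N. [:\<zeta> ^ (c j * of_bool (j \<in> S)):] * w S j"
    have p1: "[:cnj (RW V q c a):] = (\<Sum>f\<in>Ga a. \<Prod>j<N. [:\<zeta> ^ ((r - 1) * (c j * fst (f j))):])"
      unfolding RW_def Ga_def prod_const_poly sum_const_poly by (simp only: cnj_sum cnj_prod cnj_zeta_power)
    have p2: "[:RW V q c b:] = (\<Sum>g\<in>Ga b. \<Prod>j<N. [:\<zeta> ^ (c j * fst (g j)):])"
      unfolding RW_def Ga_def prod_const_poly sum_const_poly ..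
    have p3: "char_poly (wm q c) = (\<Sum>S\<in>SS. sg S * ?S S)"
      unfolding char_poly_wm[OF q] SS_def
    proof (rule sum.cong[OF refl])
      fix S assume "S \<in> {S. S \<subseteq> {..<N} \<and> q ` S = S}"
      then have S: "S \<subseteq> {..<N}" "finite S" using finite_subset by auto
      have "?S S =
          (\<Prod>j\<in>{..<N} - S. [:\<zeta> ^ (c j * of_bool (j \<in> S)):] * w S j) * (\<Prod>j\<in>S. [:\<zeta> ^ (c j * of_bool (j \<in> S)):] * w S j)"
        by (rule prod.subset_diff[OF S(1)]) simp
      also have "\<dots> = [:0, 1:] ^ (N - card S) * (\<Prod>j\<in>S. [:- (\<zeta> ^ c j):])"
        using S by (simp add: w_def card_Diff_subset one_pCons)
      finally show "of_int (sign (perm_restrict q S)) * (\<Prod>j\<in>S. [:- (\<zeta> ^ c j):]) * [:0, 1:] ^ (N - card S) =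
          sg S * ?S S"
        by (simp add: sg_def mult_ac)
    qed
    have cm: "[:x:] * [:y:] * [:z:] = [:x * y * z:]" for x y z :: complex by (simp add: mult_ac)
    have p4: "[:x * y:] * p = [:x:] * ([:y:] * p)" for x y :: complex and p by (simp add: mult.commute)
    have "[:cnj (RW V q c a) * RW V q c b:] * char_poly (wm q c) =
        (\<Sum>f\<in>Ga a. \<Prod>j<N. [:\<zeta> ^ ((r - 1) * (c j * fst (f j))):]) * ((\<Sum>g\<in>Ga b. \<Prod>j<N. [:\<zeta> ^ (c j * fst (g j)):]) *
        (\<Sum>S\<in>SS. sg S * ?S S))"
      by (simp only: p1 p2 p3 p4)
    also have "\<dots> = (\<Sum>f\<in>Ga a. \<Sum>g\<in>Ga b. \<Sum>S\<in>SS. ?F f *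
        (?G g * (sg S * ?S S)))"
      by (simp only: sum_product) (simp only: sum_distrib_left)
    also have "\<dots> = (\<Sum>f\<in>Ga a. \<Sum>g\<in>Ga b. \<Sum>S\<in>SS. sg S * (\<Prod>j<N. [:(\<zeta> ^ ex f g S j) ^ c j:] * w S j))"
    proof (intro sum.cong refl)
      fix f g :: "nat \<Rightarrow> nat \<times> nat" and S
      have e: "[:\<zeta> ^ ((r - 1) * (c j * fst (f j))):] * ([:\<zeta> ^ (c j * fst (g j)):] * ([:\<zeta> ^ (c j * of_bool (j \<in> S)):] * w S j)) =
          [:(\<zeta> ^ ex f g S j) ^ c j:] * w S j" for j
      proof -
        have "(r - 1) * (c j * fst (f j)) + c j * fst (g j) + c j * of_bool (j \<in> S) = ex f g S j * c j"
          by (simp add: ex_def algebra_simps)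
        then have "\<zeta> ^ ((r - 1) * (c j * fst (f j))) * \<zeta> ^ (c j * fst (g j)) * \<zeta> ^ (c j * of_bool (j \<in> S)) = (\<zeta> ^ ex f g S j) ^ c j"
          by (simp only: power_add[symmetric] power_mult[symmetric])
        then have "[:\<zeta> ^ ((r - 1) * (c j * fst (f j))):] * [:\<zeta> ^ (c j * fst (g j)):] * [:\<zeta> ^ (c j * of_bool (j \<in> S)):] = [:(\<zeta> ^ ex f g S j) ^ c j:]"
          by (simp only: cm)
        then show ?thesis by (simp only: mult.assoc[symmetric])
      qed
      have pe: "?F f * (?G g * ?S S) =
          (\<Prod>j<N. [:(\<zeta> ^ ex f g S j) ^ c j:] * w S j)"
        unfolding prod.distrib[symmetric] by (rule prod.cong[OF refl e])
      show "?F f *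
        (?G g * (sg S * ?S S)) =
        sg S * (\<Prod>j<N. [:(\<zeta> ^ ex f g S j) ^ c j:] * w S j)"
        by (simp only: mult.left_commute[of _ "sg S"] pe)
    qed
    also have "\<dots> = (\<Sum>t\<in>Ga a \<times> Ga b \<times> SS. sg (snd (snd t)) * (\<Prod>j<N. [:(\<zeta> ^ ex (fst t) (fst (snd t)) (snd (snd t)) j) ^ c j:] * w (snd (snd t)) j))"
      by (simp add: sum.cartesian_product case_prod_unfold)
    finally show ?thesis .
  qed
  let ?T = "Ga a \<times> Ga b \<times> SS"
  let ?d = "\<lambda>t. \<forall>j<N. r dvd ex (fst t) (fst (snd t)) (snd (snd t)) j"
  let ?FS = "{F \<in> {F \<in> {..<N} \<rightarrow>\<^sub>E V \<times> V \<times> UNIV. kerP V a b (cnt N F)}. \<forall>j<N. F (q j) = F j}"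
  have finT: "finite ?T" using finG finS by simp
  have "(\<Sum>c\<in>{..<N} \<rightarrow>\<^sub>E {..<r}. [:cnj (RW V q c a) * RW V q c b:] * char_poly (wm q c)) =
      (\<Sum>t\<in>?T. if ?d t then of_nat (r ^ N) * (sg (snd (snd t)) * (\<Prod>j<N. w (snd (snd t)) j)) else 0)"
    unfolding H by (subst sum.swap) (simp only: sum_c_term)
  also have "\<dots> = (\<Sum>t\<in>{t \<in> ?T. ?d t}. of_nat (r ^ N) * (sg (snd (snd t)) * (\<Prod>j<N. w (snd (snd t)) j)))"
    by (rule sum.inter_filter[OF finT, symmetric])
  also have "\<dots> = of_nat (r ^ N) * (\<Sum>t\<in>{t \<in> ?T. ?d t}. sg (snd (snd t)) * (\<Prod>j<N. w (snd (snd t)) j))"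
    by (simp only: sum_distrib_left)
  also have "(\<Sum>t\<in>{t \<in> ?T. ?d t}. sg (snd (snd t)) * (\<Prod>j<N. w (snd (snd t)) j)) =
      (\<Sum>F\<in>?FS. of_int (sign (perm_restrict q {j \<in> {..<N}. snd (snd (F j))})) * (\<Prod>j<N. wtp (F j)))"
  proof (rule sum.reindex_bij_witness[where
        j = "\<lambda>t. restrict (\<lambda>j. (fst t j, fst (snd t) j, j \<in> snd (snd t))) {..<N}" and
        i = "\<lambda>F. (restrict (\<lambda>j. fst (F j)) {..<N}, restrict (\<lambda>j. fst (snd (F j))) {..<N}, {j \<in> {..<N}. snd (snd (F j))})"], goal_cases)
    case (1 t)
    then obtain f g S where t: "t = (f, g, S)" "f \<in> Ga a" "g \<in> Ga b" "S \<in> SS" by auto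
    then have "f \<in> extensional {..<N}" "g \<in> extensional {..<N}" "S \<subseteq> {..<N}"
      by (auto simp: Ga_def SS_def invf_def PiE_def)
    then show ?case using t(1) by (auto simp: restrict_def extensional_def fun_eq_iff)
  next
    case (2 t)
    then obtain f g S where t: "t = (f, g, S)" "f \<in> Ga a" "g \<in> Ga b" "S \<in> SS" and d: "\<forall>j<N. r dvd ex f g S j" by auto
    let ?F = "restrict (\<lambda>j. (f j, g j, j \<in> S)) {..<N}"
    have F: "?F \<in> {..<N} \<rightarrow>\<^sub>E V \<times> V \<times> UNIV" using t by (auto simp: Ga_def invf_def)
    have inv: "?F (q j) = ?F j" if "j < N" for j
      using t that permutes_less[OF q that] stable_iff[OF q, of S] by (auto simp: Ga_def invf_def SS_def)
    have fin: "finite (V \<times> V \<times> (UNIV :: bool set))" using V by simp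
    have FV: "?F j \<in> V \<times> V \<times> UNIV" if "j < N" for j using F that by auto
    have c: "compat x" if "cnt N ?F x > 0" for x
    proof -
      have "{j \<in> {..<N}. ?F j = x} \<noteq> {}" using that unfolding cnt_def by (metis card.empty less_numeral_extra(3))
      then obtain j where "j < N" "?F j = x" by blast
      then show ?thesis using d by (auto simp: compat_def ex_def)
    qed
    have sa: "(\<Sum>j<N. single (fst (?F j)) 1) = a" and sb: "(\<Sum>j<N. single (fst (snd (?F j))) 1) = b"
      using t by (auto simp: Ga_def)
    have s1: "(\<Sum>j<N. single (fst (?F j)) 1) = (\<Sum>x\<in>V \<times> V \<times> UNIV. single (fst x) (cnt N ?F x))"
      by (rule sum_single_cnt[OF fin FV])
    have s2: "(\<Sum>j<N. single (fst (snd (?F j))) 1) = (\<Sum>x\<in>V \<times> V \<times> UNIV. single (fst (snd x)) (cnt N ?F x))"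
      by (rule sum_single_cnt[OF fin FV])
    have "kerP V a b (cnt N ?F)"
      unfolding kerP_def s1[symmetric] s2[symmetric] using c sa sb by blast
    then show ?case using F inv t(1) by simp
  next
    case (3 F)
    then have "F \<in> extensional {..<N}" by (auto simp: PiE_def)
    then show ?case by (auto simp: restrict_def extensional_def fun_eq_iff)
  next
    case (4 F)
    then have F: "F \<in> {..<N} \<rightarrow>\<^sub>E V \<times> V \<times> UNIV" and k: "kerP V a b (cnt N F)" and inv: "\<And>j. j < N \<Longrightarrow> F (q j) = F j" by auto
    have fin: "finite (V \<times> V \<times> (UNIV :: bool set))" using V by simp
    have FV: "F j \<in> V \<times> V \<times> UNIV" if "j < N" for j using F that by auto
    have FV1: "fst (F j) \<in> V" "fst (snd (F j)) \<in> V" if "j < N" for j using FV[OF that] by auto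
    have s1: "(\<Sum>j<N. single (fst (F j)) 1) = (\<Sum>x\<in>V \<times> V \<times> UNIV. single (fst x) (cnt N F x))"
      by (rule sum_single_cnt[OF fin FV])
    have s2: "(\<Sum>j<N. single (fst (snd (F j))) 1) = (\<Sum>x\<in>V \<times> V \<times> UNIV. single (fst (snd x)) (cnt N F x))"
      by (rule sum_single_cnt[OF fin FV])
    have s: "(\<Sum>j<N. single (fst (F j)) 1) = a" "(\<Sum>j<N. single (fst (snd (F j))) 1) = b"
      unfolding s1 s2 using k unfolding kerP_def by blast+
    have "restrict (\<lambda>j. fst (F j)) {..<N} \<in> Ga a" "restrict (\<lambda>j. fst (snd (F j))) {..<N} \<in> Ga b"
      using s FV1 inv permutes_less[OF q] by (auto simp: Ga_def invf_def)
    moreover have "{j \<in> {..<N}. snd (snd (F j))} \<in> SS"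
      unfolding SS_def using inv permutes_less[OF q] stable_iff[OF q, of "{j \<in> {..<N}. snd (snd (F j))}"] by auto
    moreover have "r dvd ex (restrict (\<lambda>j. fst (F j)) {..<N}) (restrict (\<lambda>j. fst (snd (F j))) {..<N}) {j \<in> {..<N}. snd (snd (F j))} j" if j: "j < N" for j
    proof -
      have "j \<in> {i \<in> {..<N}. F i = F j}" using j by simp
      then have "cnt N F (F j) > 0" unfolding cnt_def card_gt_0_iff by auto
      then have "compat (F j)" using k unfolding kerP_def by blast
      then show ?thesis using j by (simp add: compat_def ex_def)
    qed
    ultimately show ?case by simp
  next
    case (5 t)
    then obtain f g S where t: "t = (f, g, S)" "S \<in> SS" by auto
    then have "{j \<in> {..<N}. snd (snd (restrict (\<lambda>j. (f j, g j, j \<in> S)) {..<N} j))} = S" by (auto simp: SS_def)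
    moreover have "(\<Prod>j<N. wtp (restrict (\<lambda>j. (f j, g j, j \<in> S)) {..<N} j)) = (\<Prod>j<N. w S j)"
      by (intro prod.cong) (auto simp: wtp_def w_def)
    ultimately show ?case by (simp add: t(1) sg_def)
  qed
  finally show ?thesis .
qed

text \<open>The sum over q of the fixed-permutation formula is the signed orbit count for colourings
  by cells. The numerator cells are the starred ones, so they occur at most once, as in a product of
  linear factors.\<close>

theorem kernel_identity:
  assumes V: "finite V"
  shows "(\<Sum>q | q permutes {..<N}. \<Sum>c\<in>{..<N} \<rightarrow>\<^sub>E {..<r}. [:cnj (RW V q c a) * RW V q c b:] * char_poly (wm q c)) =
    of_nat (card (Wgrp N \<zeta>)) * kernel_sum V a b"
proof -
  have fin: "finite (V \<times> V \<times> (UNIV :: bool set))" using V by simp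
  have "(\<Sum>q | q permutes {..<N}. \<Sum>c\<in>{..<N} \<rightarrow>\<^sub>E {..<r}. [:cnj (RW V q c a) * RW V q c b:] * char_poly (wm q c)) =
    of_nat (r ^ N) * (\<Sum>q | q permutes {..<N}. \<Sum>F\<in>{F \<in> {F \<in> {..<N} \<rightarrow>\<^sub>E V \<times> V \<times> UNIV. kerP V a b (cnt N F)}. \<forall>j<N. F (q j) = F j}.
      of_int (sign (perm_restrict q {j \<in> {..<N}. snd (snd (F j))})) * (\<Prod>j<N. wtp (F j)))"
    unfolding sum_distrib_left by (rule sum.cong[OF refl]) (simp only: mem_Collect_eq kernel_fixed_perm[OF _ V] sum_distrib_left)
  also have "\<dots> = of_nat (r ^ N) * (of_nat (fact N) * kernel_sum V a b)"
    unfolding kernel_sum_def using signed_burnside[OF fin, where P = "kerP V a b" and star = "\<lambda>x. snd (snd x)" and wt = wtp] by simp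
  finally show ?thesis by (simp add: card_Wgrp mult_ac)
qed

end

section \<open>The generating functions of q\<close>

lemma mcoeff_mvar_mult:
  "mcoeff (mvar v * f) m = (if lookup m v > 0 then mcoeff f (m - single v 1) else 0)"
proof -
  let ?s = "single v (1::nat)"
  have "mcoeff (mvar v * f) m = (\<Sum>p\<in>adiag m. if fst p = ?s then mcoeff f (snd p) else 0)"
    unfolding mcoeff_mult by (rule sum.cong[OF refl]) (simp add: mvar_def)
  also have "\<dots> = (\<Sum>p\<in>{p \<in> adiag m. fst p = ?s}. mcoeff f (snd p))"
    by (rule sum.inter_filter[OF finite_adiag, symmetric])
  also have "{p \<in> adiag m. fst p = ?s} = (if lookup m v > 0 then {(?s, m - ?s)} else {})"
  proof (cases "lookup m v > 0")
    case True
    have "?s + (m - ?s) = m"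
      by (rule poly_mapping_eqI) (use True in \<open>auto simp: lookup_add lookup_minus lookup_single when_def\<close>)
    then show ?thesis using True by (auto simp: adiag_def)
  next
    case False
    then show ?thesis by (auto simp: adiag_def lookup_add)
  qed
  finally show ?thesis by simp
qed

section \<open>Elementary and complete symmetric functions of one alphabet\<close>

definition esym :: "nat \<Rightarrow> nat \<Rightarrow> ('c::comm_ring_1) sfun" where
  "esym k a = Abs_mfps (\<lambda>m. if fst ` keys m \<subseteq> {k} \<and> (\<forall>v. lookup m v \<le> 1) \<and> mdeg m = a then 1 else 0)"

definition hsym :: "nat \<Rightarrow> nat \<Rightarrow> ('c::comm_ring_1) sfun" where
  "hsym k a = Abs_mfps (\<lambda>m. if fst ` keys m \<subseteq> {k} \<and> mdeg m = a then 1 else 0)"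

lemma minus_single_facts:
  assumes "lookup m v > (0::nat)"
  shows "m = (m - single v 1) + single v 1"
    and "Suc (mdeg (m - single v 1)) = mdeg m"
    and "keys m = insert v (keys (m - single v 1))"
proof -
  show *: "m = (m - single v 1) + single v 1"
    by (rule poly_mapping_eqI) (use assms in \<open>auto simp: lookup_add lookup_minus lookup_single when_def\<close>)
  have "mdeg m = mdeg ((m - single v 1) + single v 1)" using * by simp
  then show "Suc (mdeg (m - single v 1)) = mdeg m" by (simp only: mdeg_add mdeg_single)
  show "keys m = insert v (keys (m - single v 1))"
    using assms by (auto simp: in_keys_iff lookup_minus lookup_single when_def split: if_splits)
qed

lemma snd_subset_insert:
  assumes "fst ` K \<subseteq> {k}" "(k, i) \<notin> K"
  shows "snd ` K \<subseteq> insert i I \<longleftrightarrow> snd ` K \<subseteq> I"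
proof -
  have "snd v \<noteq> i" if "v \<in> K" for v using assms that by (cases v) auto
  then show ?thesis by blast
qed

text \<open>Induction on the index set: if the variable with the new index occurs in m, the
  coefficient comes from the linear term of the new factor, otherwise from its constant
  term.\<close>

lemma mcoeff_eprod:
  fixes t :: "'c::comm_ring_1"
  assumes "finite I"
  shows "mcoeff (fps_nth (\<Prod>i\<in>I. 1 - fps_const (mconst t * mvar (k, i)) * fps_X) a) m =
    (if snd ` keys m \<subseteq> I then (- t) ^ a * mcoeff (esym k a) m else 0)"
  using assms
proof (induction I arbitrary: a m rule: finite_induct)
  case empty
  show ?case by (auto simp: esym_def mcoeff_one)
next
  case (insert i I)
  define F where "F = (\<Prod>i\<in>I. 1 - fps_const (mconst t * mvar (k, i)) * fps_X)"
  let ?m = "m - single (k, i) 1"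
  have "(\<Prod>i\<in>insert i I. 1 - fps_const (mconst t * mvar (k, i)) * fps_X) = F - fps_const (mconst t * mvar (k, i)) * (fps_X * F)"
    using insert by (simp add: F_def algebra_simps)
  then have eq: "mcoeff (fps_nth (\<Prod>i\<in>insert i I. 1 - fps_const (mconst t * mvar (k, i)) * fps_X) a) m =
      mcoeff (fps_nth F a) m - (if a = 0 then 0 else t * (if lookup m (k, i) > 0 then mcoeff (fps_nth F (a - 1)) ?m else 0))"
    by (cases a) (simp_all add: mult.assoc mcoeff_mvar_mult)
  note IH = insert.IH[folded F_def]
  show ?case
  proof (cases "lookup m (k, i) > 0")
    case False
    then have kn: "(k, i) \<notin> keys m" by (simp add: in_keys_iff)
    have sn: "snd ` keys m \<subseteq> insert i I \<longleftrightarrow> snd ` keys m \<subseteq> I" if "fst ` keys m \<subseteq> {k}"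
      by (rule snd_subset_insert[OF that kn])
    show ?thesis using False unfolding eq IH by (cases "fst ` keys m \<subseteq> {k}") (simp_all add: esym_def sn)
  next
    case True
    note ms = minus_single_facts[OF True]
    have "i \<in> snd ` keys m" using ms(3) by force
    then have z: "\<not> snd ` keys m \<subseteq> I" using insert.hyps by auto
    have f: "fst ` keys m \<subseteq> {k} \<longleftrightarrow> fst ` keys ?m \<subseteq> {k}" using ms(3) by auto
    show ?thesis
    proof (cases "fst ` keys ?m \<subseteq> {k} \<and> mdeg m = a")
      case False
      then have "\<not> (fst ` keys m \<subseteq> {k} \<and> mdeg m = a)" "a = 0 \<or> \<not> (fst ` keys ?m \<subseteq> {k} \<and> mdeg ?m = a - 1)"
        using f ms(2) by auto
      then show ?thesis unfolding eq IH using z by (auto simp: esym_def)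
    next
      case f2: True
      then have a: "a = Suc (mdeg ?m)" using ms(2) by simp
      have c: "snd ` keys ?m \<subseteq> I \<and> (\<forall>v. lookup ?m v \<le> 1) \<longleftrightarrow>
          snd ` keys m \<subseteq> insert i I \<and> (\<forall>v. lookup m v \<le> 1)"
      proof
        assume A: "snd ` keys ?m \<subseteq> I \<and> (\<forall>v. lookup ?m v \<le> 1)"
        then have "(k, i) \<notin> keys ?m" using insert.hyps by force
        then have k1: "lookup m (k, i) \<le> 1" by (simp add: in_keys_iff lookup_minus)
        have "lookup m v \<le> 1" for v
        proof (cases "v = (k, i)")
          case False then show ?thesis using A[THEN conjunct2, rule_format, of v] by (simp add: lookup_minus lookup_single)
        qed (use k1 in simp)
        moreover have "snd ` keys m \<subseteq> insert i I" using A ms(3) by auto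
        ultimately show "snd ` keys m \<subseteq> insert i I \<and> (\<forall>v. lookup m v \<le> 1)" by blast
      next
        assume A: "snd ` keys m \<subseteq> insert i I \<and> (\<forall>v. lookup m v \<le> 1)"
        then have "(k, i) \<notin> keys ?m" by (auto simp: in_keys_iff lookup_minus lookup_single)
        have "snd v \<in> I" if "v \<in> keys ?m" for v
        proof -
          have "fst v = k" using f2 that by auto
          then have "snd v \<noteq> i" using that \<open>(k, i) \<notin> _\<close> by (metis prod.collapse)
          then show ?thesis using A that ms(3) by auto
        qed
        moreover have "lookup ?m v \<le> 1" for v using A[THEN conjunct2, rule_format, of v] by (simp add: lookup_minus)
        ultimately show "snd ` keys ?m \<subseteq> I \<and> (\<forall>v. lookup ?m v \<le> 1)" by blast
      qed
      have fm: "fst ` keys m \<subseteq> {k}" using f f2 by simp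
      have mm: "mdeg m = a" and m': "mdeg ?m = a - 1" using f2 a by auto
      have a0: "a \<noteq> 0" using a by simp
      have e1: "mcoeff (esym k a :: 'c sfun) m = (if \<forall>v. lookup m v \<le> 1 then 1 else 0)"
        unfolding esym_def using fm mm by simp
      have e2: "mcoeff (esym k (a - 1) :: 'c sfun) ?m = (if \<forall>v. lookup ?m v \<le> 1 then 1 else 0)"
        unfolding esym_def using f2 m' by simp
      have "(- t) ^ a = - t * (- t) ^ (a - 1)" using a0 by (cases a) auto
      then show ?thesis unfolding eq IH e1 e2 using z c a0 True by (auto simp del: One_nat_def)
    qed
  qed
qed

lemma mcoeff_hprod:
  assumes "finite I"
  shows "mcoeff (fps_nth (\<Prod>i\<in>I. Abs_fps (\<lambda>j. mvar (k, i) ^ j) :: ('c::comm_ring_1) sfun fps) a) m =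
    (if snd ` keys m \<subseteq> I then mcoeff (hsym k a) m else 0)"
  using assms
proof (induction I arbitrary: a m rule: finite_induct)
  case empty
  show ?case by (auto simp: hsym_def mcoeff_one)
next
  case (insert i I)
  define F where "F = (\<Prod>i\<in>I. Abs_fps (\<lambda>j. mvar (k, i) ^ j) :: 'c sfun fps)"
  define G where "G = Abs_fps (\<lambda>j. mvar (k, i) ^ j :: 'c sfun)"
  \<comment> \<open>The functional equation of the geometric series yields a recursion in the degree
    a.\<close>
  have "G = 1 + fps_const (mvar (k, i)) * (fps_X * G)"
  proof (rule fps_ext)
    fix j show "fps_nth G j = fps_nth (1 + fps_const (mvar (k, i)) * (fps_X * G)) j"
      by (cases j) (auto simp: G_def)
  qed
  then have eq: "G * F = F + fps_const (mvar (k, i)) * (fps_X * (G * F))"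
    by (metis (no_types, lifting) distrib_right mult.assoc mult_1)
  then have step: "mcoeff (fps_nth (G * F) a) m = mcoeff (fps_nth F a) m +
      (if a = 0 then 0 else if lookup m (k, i) > 0 then mcoeff (fps_nth (G * F) (a - 1)) (m - single (k, i) 1) else 0)" for a m
  proof -
    have "fps_nth (G * F) a = fps_nth F a + mvar (k, i) * (if a = 0 then 0 else fps_nth (G * F) (a - 1))"
      using arg_cong[OF eq, of "\<lambda>h. fps_nth h a"] by (simp only: fps_add_nth fps_mult_left_const_nth fps_X_mult_nth)
    then show ?thesis by (simp only: mcoeff_add mcoeff_mvar_mult) (simp add: mcoeff_mvar_mult)
  qed
  note IH = insert.IH[folded F_def]
  have "mcoeff (fps_nth (G * F) a) m = (if snd ` keys m \<subseteq> insert i I then mcoeff (hsym k a) m else 0)" for a m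
  proof (induction a arbitrary: m)
    case 0
    show ?case unfolding step[of 0] IH by (auto simp: hsym_def)
  next
    case (Suc a)
    let ?m = "m - single (k, i) 1"
    show ?case
    proof (cases "lookup m (k, i) > 0")
      case False
      then have kn: "(k, i) \<notin> keys m" by (simp add: in_keys_iff)
      have sn: "snd ` keys m \<subseteq> insert i I \<longleftrightarrow> snd ` keys m \<subseteq> I" if "fst ` keys m \<subseteq> {k}"
        by (rule snd_subset_insert[OF that kn])
      show ?thesis using False unfolding step[of "Suc a"] IH by (cases "fst ` keys m \<subseteq> {k}") (simp_all add: hsym_def sn)
    next
      case True
      note ms = minus_single_facts[OF True]
      have "i \<in> snd ` keys m" using ms(3) by force
      then have z: "\<not> snd ` keys m \<subseteq> I" using insert.hyps by auto
      have f: "fst ` keys m \<subseteq> {k} \<longleftrightarrow> fst ` keys ?m \<subseteq> {k}"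
        "snd ` keys m \<subseteq> insert i I \<longleftrightarrow> snd ` keys ?m \<subseteq> insert i I" using ms(3) by auto
      have d: "mdeg m = Suc a \<longleftrightarrow> mdeg ?m = a" using ms(2) by arith
      show ?thesis unfolding step[of "Suc a"] IH using z True Suc.IH[of ?m] f d by (simp add: hsym_def)
    qed
  qed
  then show ?case using insert.hyps by (simp add: F_def G_def)
qed

text \<open>The numerators produce elementary symmetric functions of the preceding alphabet, the
  geometric series complete symmetric functions of the alphabet k. This finite formula makes
  symmetry and homogeneity of q visible.\<close>

lemma q_plus1_eq:
  "q_plus1 r k j = (\<Sum>a\<le>j. mconst ((- tvar (pred_mod r k)) ^ a) * (esym (pred_mod r k) a * hsym k (j - a)))"
proof (rule mfps_eqI)
  fix m :: monom_exp
  let ?I = "snd ` keys m" and ?k = "pred_mod r k" and ?t = "tvar (pred_mod r k)"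
  \<comment> \<open>Both parts of a splitting of m use variables of m only, so truncating the
    infinite product to these variables does not change the coefficient.\<close>
  have sub: "snd ` keys (fst p) \<subseteq> ?I" "snd ` keys (snd p) \<subseteq> ?I" if "p \<in> adiag m" for p
  proof -
    have "m = fst p + snd p" using that by (auto simp: adiag_def)
    then have "keys (fst p) \<subseteq> keys m" "keys (snd p) \<subseteq> keys m"
      by (auto simp: in_keys_iff lookup_add)
    then show "snd ` keys (fst p) \<subseteq> ?I" "snd ` keys (snd p) \<subseteq> ?I" by auto
  qed
  have "mcoeff (q_plus1 r k j) m = (\<Sum>a=0..j. mcoeff
      (fps_nth (\<Prod>i\<in>?I. 1 - fps_const (mconst ?t * mvar (?k, i)) * fps_X) a *
       fps_nth (\<Prod>i\<in>?I. Abs_fps (\<lambda>j. mvar (k, i) ^ j)) (j - a)) m)"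
    by (simp add: q_plus1_def q_series_def prod.distrib fps_mult_nth mcoeff_sum)
  also have "\<dots> = (\<Sum>a=0..j. (- ?t) ^ a * mcoeff (esym ?k a * hsym k (j - a)) m)"
    unfolding mcoeff_mult sum_distrib_left
    by (intro sum.cong refl) (simp add: mcoeff_eprod mcoeff_hprod sub)
  also have "\<dots> = mcoeff (\<Sum>a\<le>j. mconst ((- ?t) ^ a) * (esym ?k a * hsym k (j - a))) m"
    by (simp add: mcoeff_sum atMost_atLeast0)
  finally show "mcoeff (q_plus1 r k j) m = \<dots>" .
qed

lemma mcoeff_q_plus1:
  "mcoeff (q_plus1 r k j) m = (\<Sum>p\<in>adiag m.
     if fst ` keys (fst p) \<subseteq> {pred_mod r k} \<and> (\<forall>v. lookup (fst p) v \<le> 1) \<and>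
       fst ` keys (snd p) \<subseteq> {k} \<and> mdeg (fst p) + mdeg (snd p) = j
     then (- tvar (pred_mod r k)) ^ mdeg (fst p) else 0)"
proof -
  let ?t = "tvar (pred_mod r k)"
  let ?C = "\<lambda>p. fst ` keys (fst p) \<subseteq> {pred_mod r k} \<and> (\<forall>v. lookup (fst p) v \<le> 1) \<and>
       fst ` keys (snd p) \<subseteq> {k}"
  have "mcoeff (q_plus1 r k j) m = (\<Sum>p\<in>adiag m. \<Sum>a\<le>j. (- ?t) ^ a * (mcoeff (esym (pred_mod r k) a) (fst p) * mcoeff (hsym k (j - a)) (snd p)))"
    unfolding q_plus1_eq mcoeff_sum mcoeff_mconst_mult
    unfolding mcoeff_mult sum_distrib_left by (rule sum.swap)
  also have "\<dots> = (\<Sum>p\<in>adiag m. if ?C p \<and> mdeg (fst p) + mdeg (snd p) = j then (- ?t) ^ mdeg (fst p) else 0)"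
  proof (rule sum.cong[OF refl])
    fix p
    have "(\<Sum>a\<le>j. (- ?t) ^ a * (mcoeff (esym (pred_mod r k) a) (fst p) * mcoeff (hsym k (j - a)) (snd p))) =
        (\<Sum>a\<le>j. if a = mdeg (fst p) then (if ?C p \<and> mdeg (snd p) = j - a then (- ?t) ^ a else 0) else 0)"
      by (rule sum.cong[OF refl]) (auto simp: esym_def hsym_def)
    also have "\<dots> = (if ?C p \<and> mdeg (fst p) + mdeg (snd p) = j then (- ?t) ^ mdeg (fst p) else 0)"
      by auto
    finally show "(\<Sum>a\<le>j. (- ?t) ^ a * (mcoeff (esym (pred_mod r k) a) (fst p) * mcoeff (hsym k (j - a)) (snd p))) = \<dots>" .
  qed
  finally show ?thesis by (simp only: conj_assoc)
qed

section \<open>Block triangular factorization\<close>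

text \<open>The product is cut off outside Z. Equations between matrices are then equalities of
  functions, and associativity holds without membership conditions, so they can be used for
  rewriting.\<close>

definition mm :: "'a set \<Rightarrow> ('a \<Rightarrow> 'a \<Rightarrow> 'f::comm_ring_1) \<Rightarrow> ('a \<Rightarrow> 'a \<Rightarrow> 'f) \<Rightarrow> 'a \<Rightarrow> 'a \<Rightarrow> 'f" where
  "mm Z A B x y = (if x \<in> Z \<and> y \<in> Z then \<Sum>z\<in>Z. A x z * B z y else 0)"

definition idm :: "'a set \<Rightarrow> 'a \<Rightarrow> 'a \<Rightarrow> 'f::comm_ring_1" where
  "idm Z x y = (if x \<in> Z \<and> x = y then 1 else 0)"

definition trm :: "('a \<Rightarrow> 'a \<Rightarrow> 'f) \<Rightarrow> 'a \<Rightarrow> 'a \<Rightarrow> 'f" where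
  "trm A x y = A y x"

definition zoff :: "'a set \<Rightarrow> ('a \<Rightarrow> 'a \<Rightarrow> 'f::zero) \<Rightarrow> bool" where
  "zoff Z A \<longleftrightarrow> (\<forall>x y. x \<notin> Z \<or> y \<notin> Z \<longrightarrow> A x y = 0)"

lemma zoff_mm [simp]: "zoff Z (mm Z A B)"
  by (auto simp: zoff_def mm_def)

lemma zoff_idm [simp]: "zoff Z (idm Z)"
  by (auto simp: zoff_def idm_def)

lemma zoff_trm [simp]: "zoff Z (trm A) = zoff Z A"
  by (auto simp: zoff_def trm_def)

lemma trm_trm [simp]: "trm (trm A) = A"
  by (auto simp: trm_def fun_eq_iff)

lemma trm_idm [simp]: "trm (idm Z) = idm Z"
  by (auto simp: trm_def fun_eq_iff idm_def)

lemma trm_mm: "trm (mm Z A B) = mm Z (trm B) (trm A)"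
  by (auto simp: trm_def mm_def fun_eq_iff mult.commute)

lemma mm_assoc: "mm Z (mm Z A B) C = mm Z A (mm Z B C)"
proof (intro ext)
  fix x y
  show "mm Z (mm Z A B) C x y = mm Z A (mm Z B C) x y"
  proof (cases "x \<in> Z \<and> y \<in> Z")
    case True
    have "mm Z (mm Z A B) C x y = (\<Sum>w\<in>Z. (\<Sum>z\<in>Z. A x z * B z w) * C w y)"
      using True by (simp add: mm_def cong: sum.cong)
    also have "\<dots> = (\<Sum>w\<in>Z. \<Sum>z\<in>Z. A x z * (B z w * C w y))"
      by (simp add: sum_distrib_right mult.assoc)
    also have "\<dots> = (\<Sum>z\<in>Z. \<Sum>w\<in>Z. A x z * (B z w * C w y))"
      by (rule sum.swap)
    also have "\<dots> = mm Z A (mm Z B C) x y"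
      using True by (simp add: mm_def sum_distrib_left cong: sum.cong)
    finally show ?thesis .
  qed (auto simp: mm_def)
qed

lemma mm_idm_left: "finite Z \<Longrightarrow> zoff Z A \<Longrightarrow> mm Z (idm Z) A = A"
  by (auto simp: mm_def idm_def zoff_def fun_eq_iff if_distrib[of "\<lambda>x. x * _"] cong: if_cong)

lemma mm_idm_right: "finite Z \<Longrightarrow> zoff Z A \<Longrightarrow> mm Z A (idm Z) = A"
  by (auto simp: mm_def idm_def zoff_def fun_eq_iff if_distrib[of "\<lambda>x. _ * x"] cong: if_cong)

lemma mm_left_right_inverse:
  fixes A B :: "'a \<Rightarrow> 'a \<Rightarrow> 'f::field"
  assumes "finite Z" "mm Z A B = idm Z"
  shows "mm Z B A = idm Z"
proof -
  have "(\<Sum>z\<in>Z. A x z * B z y) = (if x = y then 1 else 0)" if "x \<in> Z" "y \<in> Z" for x y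
    using fun_cong[OF fun_cong[OF assms(2)], of x y] that by (simp add: mm_def idm_def)
  from fin_mat_left_right_inverse[OF assms(1) this] show ?thesis
    by (auto simp: mm_def idm_def fun_eq_iff)
qed

section \<open>Block triangular matrices whose blocks are intervals of a total order\<close>

locale block_order =
  fixes Z :: "'a set" and lt sim :: "'a \<Rightarrow> 'a \<Rightarrow> bool"
  assumes fin: "finite Z"
    and lt_irrefl: "x \<in> Z \<Longrightarrow> \<not> lt x x"
    and lt_trans: "x \<in> Z \<Longrightarrow> y \<in> Z \<Longrightarrow> z \<in> Z \<Longrightarrow> lt x y \<Longrightarrow> lt y z \<Longrightarrow> lt x z"
    and lt_total: "x \<in> Z \<Longrightarrow> y \<in> Z \<Longrightarrow> x \<noteq> y \<Longrightarrow> lt x y \<or> lt y x"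
    and sim_refl: "x \<in> Z \<Longrightarrow> sim x x"
    and sim_sym: "x \<in> Z \<Longrightarrow> y \<in> Z \<Longrightarrow> sim x y \<Longrightarrow> sim y x"
    and sim_trans: "x \<in> Z \<Longrightarrow> y \<in> Z \<Longrightarrow> z \<in> Z \<Longrightarrow> sim x y \<Longrightarrow> sim y z \<Longrightarrow> sim x z"
    and interval: "x \<in> Z \<Longrightarrow> y \<in> Z \<Longrightarrow> z \<in> Z \<Longrightarrow> sim x z \<Longrightarrow> lt x y \<Longrightarrow> lt y z \<Longrightarrow> sim y x"
begin

definition below :: "'a \<Rightarrow> 'a set" where
  "below x = {y \<in> Z. lt y x \<and> \<not> sim y x}"

definition bdiag :: "('a \<Rightarrow> 'a \<Rightarrow> 'f::zero) \<Rightarrow> bool" where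
  "bdiag L \<longleftrightarrow> zoff Z L \<and> (\<forall>x\<in>Z. \<forall>y\<in>Z. \<not> sim x y \<longrightarrow> L x y = 0)"

text \<open>Two diagonals occur: 1 for the Hall-Littlewood and Kostka matrices, and t^a for the
  unknowns of the equation. Inside a block only the diagonal can be nonzero, because
  \<open>below\<close> excludes similar elements.\<close>

definition blower :: "('a \<Rightarrow> 'f::comm_ring_1) \<Rightarrow> ('a \<Rightarrow> 'a \<Rightarrow> 'f) \<Rightarrow> bool" where
  "blower d P \<longleftrightarrow> zoff Z P \<and> (\<forall>x\<in>Z. P x x = d x) \<and> (\<forall>x\<in>Z. \<forall>y\<in>Z. P x y \<noteq> 0 \<longrightarrow> y = x \<or> y \<in> below x)"

lemma below_subset: "below x \<subseteq> Z"
  by (auto simp: below_def)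

lemma finite_below [simp]: "finite (below x)"
  using below_subset fin finite_subset by blast

text \<open>Similarity classes are intervals, so a class that does not contain x lies entirely on
  one side of x.\<close>

lemma below_sim_left: "x \<in> Z \<Longrightarrow> y \<in> below x \<Longrightarrow> z \<in> Z \<Longrightarrow> sim z y \<Longrightarrow> z \<in> below x"
  unfolding below_def mem_Collect_eq
  by (metis interval lt_total sim_sym sim_trans)

lemma below_total: "x \<in> Z \<Longrightarrow> y \<in> Z \<Longrightarrow> \<not> sim x y \<Longrightarrow> x \<in> below y \<or> y \<in> below x"
  unfolding below_def mem_Collect_eq by (metis lt_total sim_refl sim_sym)

lemma below_irrefl: "x \<notin> below x"
  unfolding below_def mem_Collect_eq by (metis lt_irrefl)

lemma below_trans: "x \<in> Z \<Longrightarrow> y \<in> below x \<Longrightarrow> z \<in> below y \<Longrightarrow> z \<in> below x"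
  unfolding below_def mem_Collect_eq by (metis interval lt_trans sim_sym)

lemma below_asym: "x \<in> Z \<Longrightarrow> y \<in> below x \<Longrightarrow> x \<notin> below y"
  using below_trans below_irrefl by blast

lemma below_not_sim: "y \<in> below x \<Longrightarrow> \<not> sim y x"
  by (auto simp: below_def)

lemma below_induct [consumes 1, case_names below]:
  assumes "x \<in> Z" and "\<And>x. x \<in> Z \<Longrightarrow> (\<And>y. y \<in> below x \<Longrightarrow> Q y) \<Longrightarrow> Q x"
  shows "Q x"
  using assms(1)
proof (induction "card (below x)" arbitrary: x rule: less_induct)
  case less
  show ?case
  proof (rule assms(2)[OF less.prems])
    fix y assume y: "y \<in> below x"
    then have "below y \<subset> below x"
      using below_trans[OF less.prems y] below_irrefl[of y] by blast
    then have "card (below y) < card (below x)" by (intro psubset_card_mono) auto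
    then show "Q y" using less.hyps y below_subset by blast
  qed
qed

lemma blower_zero: "blower d P \<Longrightarrow> x \<in> Z \<Longrightarrow> y \<noteq> x \<Longrightarrow> y \<notin> below x \<Longrightarrow> P x y = 0"
  unfolding blower_def zoff_def by metis

lemma bdiag_trm: "bdiag L \<Longrightarrow> bdiag (trm L)"
  unfolding bdiag_def zoff_trm trm_def by (meson sim_sym)

lemma blower_sum:
  assumes "blower d P" "x \<in> Z"
  shows "(\<Sum>z\<in>Z. P x z * g z) = d x * g x + (\<Sum>z\<in>below x. P x z * g z)"
proof -
  have "(\<Sum>z\<in>Z. P x z * g z) = (\<Sum>z\<in>insert x (below x). P x z * g z)"
    using assms(2) below_subset[of x]
    by (intro sum.mono_neutral_right fin) (auto simp: blower_zero[OF assms])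
  then show ?thesis using assms below_irrefl[of x] by (simp add: blower_def)
qed

lemma blower_mm:
  assumes P: "blower d P" and Q: "blower d' Q"
  shows "blower (\<lambda>x. d x * d' x) (mm Z P Q)"
  unfolding blower_def
proof (intro conjI ballI impI)
  fix x assume x: "x \<in> Z"
  have "Q z x = 0" if "z \<in> below x" for z
    using Q x that below_asym[OF x that] below_subset below_irrefl unfolding blower_def by (metis subsetD)
  then show "mm Z P Q x x = d x * d' x"
    using x Q by (simp add: mm_def blower_sum[OF P] blower_def)
  fix y assume y: "y \<in> Z" and nz: "mm Z P Q x y \<noteq> 0"
  then have "d x * Q x y + (\<Sum>z\<in>below x. P x z * Q z y) \<noteq> 0"
    using x by (simp add: mm_def blower_sum[OF P])
  then consider "Q x y \<noteq> 0" | "(\<Sum>z\<in>below x. P x z * Q z y) \<noteq> 0" by fastforce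
  then show "y = x \<or> y \<in> below x"
  proof cases
    case 1 then show ?thesis using Q x y by (auto simp: blower_def)
  next
    case 2
    then obtain z where z: "z \<in> below x" "P x z * Q z y \<noteq> 0" by (meson sum.neutral)
    then have "Q z y \<noteq> 0" by auto
    then have "y = z \<or> y \<in> below z" using blower_zero[OF Q, of z y] z below_subset by auto
    then show ?thesis using z below_trans[OF x] by auto
  qed
qed simp

text \<open>Row x of the inverse is determined by the rows strictly below x, so its support is found
  by induction along the blocks.\<close>

lemma blower_inverse:
  fixes P :: "'a \<Rightarrow> 'a \<Rightarrow> 'f::field"
  assumes P: "blower d P" and d: "\<And>x. x \<in> Z \<Longrightarrow> d x \<noteq> 0"
    and inv: "mm Z P Q = idm Z" and Q: "zoff Z Q"
  shows "blower (\<lambda>x. inverse (d x)) Q"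
proof -
  have eq: "d x * Q x y + (\<Sum>z\<in>below x. P x z * Q z y) = (if x = y then 1 else 0)"
    if "x \<in> Z" "y \<in> Z" for x y
    using fun_cong[OF fun_cong[OF inv], of x y] that by (simp add: mm_def idm_def blower_sum[OF P])
  have "Q x x = inverse (d x) \<and> (\<forall>y\<in>Z. Q x y \<noteq> 0 \<longrightarrow> y = x \<or> y \<in> below x)" if "x \<in> Z" for x
    using that
  proof (induction x rule: below_induct)
    case (below x)
    have "(\<Sum>z\<in>below x. P x z * Q z y) = 0" if y: "y \<in> Z" "y \<notin> below x" for y
    proof (rule sum.neutral, intro ballI)
      fix z assume z: "z \<in> below x"
      then have "Q z y = 0" using below.IH[OF z] y below_trans[OF below.hyps z] by auto
      then show "P x z * Q z y = 0" by simp
    qed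
    note s = this
    have "d x * Q x x = 1" using eq[OF below.hyps below.hyps] s[OF below.hyps below_irrefl] by simp
    then have "Q x x = inverse (d x)" using inverse_unique by metis
    moreover have "Q x y = 0" if "y \<in> Z" "y \<noteq> x" "y \<notin> below x" for y
      using eq[OF below.hyps that(1)] s[OF that(1,3)] that(2) d[OF below.hyps] by simp
    ultimately show ?case by blast
  qed
  then show ?thesis using Q by (auto simp: blower_def)
qed

text \<open>With A = P'^{-1} P and C = Q^{-1} Q' the two factorizations give A L = L' C^T. The left
  side is shaped by the lower triangular A, while the right side vanishes strictly below the
  diagonal blocks. Since L is invertible, A has no part below the diagonal; its diagonal is 1,
  because P and P' have the same one.\<close>

lemma ldu_left_unique:
  fixes P Q L P' Q' L' \<Omega> \<Omega>' :: "'a \<Rightarrow> 'a \<Rightarrow> 'f::field"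
  assumes d: "\<And>x. x \<in> Z \<Longrightarrow> d x \<noteq> 0"
    and P: "blower d P" and Q: "blower d Q" and L: "bdiag L"
    and P': "blower d P'" and Q': "blower d Q'" and L': "bdiag L'"
    and eq: "mm Z (mm Z P L) (trm Q) = \<Omega>" and eq': "mm Z (mm Z P' L') (trm Q') = \<Omega>"
    and inv: "mm Z \<Omega> \<Omega>' = idm Z"
  shows "P = P'"
proof -
  note z = P[unfolded blower_def, THEN conjunct1] Q[unfolded blower_def, THEN conjunct1]
    P'[unfolded blower_def, THEN conjunct1] Q'[unfolded blower_def, THEN conjunct1]
    L[unfolded bdiag_def, THEN conjunct1] L'[unfolded bdiag_def, THEN conjunct1]
  note li = mm_idm_left[OF fin] and ri = mm_idm_right[OF fin]
  have inv2: "mm Z \<Omega>' \<Omega> = idm Z" using mm_left_right_inverse[OF fin inv] .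
  \<comment> \<open>The inverses of the triangular factors are written down with the inverse of
    \<Omega>: every outer factor of an invertible product is invertible.\<close>
  define Qi where "Qi = trm (mm Z \<Omega>' (mm Z P L))"
  define P'i where "P'i = mm Z (mm Z L' (trm Q')) \<Omega>'"
  have "mm Z P' P'i = mm Z (mm Z (mm Z P' L') (trm Q')) \<Omega>'"
    by (simp only: P'i_def mm_assoc)
  then have P'i1: "mm Z P' P'i = idm Z" by (simp only: eq' inv)
  have P'i2: "mm Z P'i P' = idm Z" by (rule mm_left_right_inverse[OF fin P'i1])
  have "mm Z (trm Qi) (trm Q) = mm Z \<Omega>' (mm Z (mm Z P L) (trm Q))"
    by (simp only: Qi_def mm_assoc trm_trm)
  then have "trm (mm Z (trm Qi) (trm Q)) = trm (idm Z)" by (simp only: eq inv2)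
  then have Qi1: "mm Z Q Qi = idm Z" by (simp only: trm_mm trm_trm trm_idm)
  have "trm (mm Z Qi Q) = trm (idm Z)" by (simp only: mm_left_right_inverse[OF fin Qi1])
  then have Qi2: "mm Z (trm Q) (trm Qi) = idm Z" by (simp only: trm_mm trm_idm)
  have zi: "zoff Z Qi" "zoff Z P'i" by (simp_all add: Qi_def P'i_def)
  define A where "A = mm Z P'i P"
  define C where "C = mm Z Qi Q'"
  have A: "blower (\<lambda>x. inverse (d x) * d x) A" unfolding A_def
    by (intro blower_mm P blower_inverse[OF P' d P'i1 zi(2)])
  have C: "blower (\<lambda>x. inverse (d x) * d x) C" unfolding C_def
    by (intro blower_mm Q' blower_inverse[OF Q d Qi1 zi(1)])
  have "mm Z (mm Z P L) (mm Z (trm Q) (trm Qi)) = mm Z P' (mm Z L' (mm Z (trm Q') (trm Qi)))"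
    by (simp only: mm_assoc[symmetric] eq eq')
  then have PL: "mm Z P L = mm Z P' (mm Z L' (trm C))"
    by (simp add: Qi2 ri C_def trm_mm)
  have "mm Z A L = mm Z P'i (mm Z P L)" by (simp only: A_def mm_assoc)
  also have "\<dots> = mm Z (mm Z P'i P') (mm Z L' (trm C))" by (simp only: PL mm_assoc)
  finally have AL: "mm Z A L = mm Z L' (trm C)" by (simp only: P'i2 li zoff_mm)
  \<comment> \<open>Obtained by solving P L X = P for X; cancelling P on the left then shows that X
    is a right inverse of L.\<close>
  define Li where "Li = mm Z (trm Q) (mm Z \<Omega>' P)"
  have "mm Z P (mm Z L Li) = mm Z (mm Z (mm Z (mm Z P L) (trm Q)) \<Omega>') P"
    by (simp only: Li_def mm_assoc)
  then have PLL: "mm Z P (mm Z L Li) = P" by (simp only: eq inv li z(1))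
  define Pi where "Pi = mm Z (mm Z L (trm Q)) \<Omega>'"
  have "mm Z P Pi = mm Z (mm Z (mm Z P L) (trm Q)) \<Omega>'" by (simp only: Pi_def mm_assoc)
  then have "mm Z P Pi = idm Z" by (simp only: eq inv)
  then have PiP: "mm Z Pi P = idm Z" by (rule mm_left_right_inverse[OF fin])
  have "mm Z L Li = mm Z (mm Z Pi P) (mm Z L Li)" by (simp only: PiP li zoff_mm)
  also have "\<dots> = mm Z Pi P" by (simp only: mm_assoc PLL)
  finally have LLi: "mm Z L Li = idm Z" by (simp only: PiP)
  have "A x w = 0" if x: "x \<in> Z" and w: "w \<in> below x" for x w
  proof -
    \<comment> \<open>The part of row x of A strictly below the block of x. As L is block diagonal
      and \<open>below x\<close> is a union of blocks, multiplication by L does not mix it with the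
      rest of the row.\<close>
    define a where "a z = (if z \<in> below x then A x z else 0)" for z
    have aL: "(\<Sum>z\<in>Z. a z * L z y) = 0" if y: "y \<in> Z" for y
    proof (cases "y \<in> below x")
      case True
      have "(\<Sum>z\<in>Z. a z * L z y) = (\<Sum>z\<in>Z. A x z * L z y)"
        using L y below_sim_left[OF x True] by (intro sum.cong) (auto simp: a_def bdiag_def)
      also have "\<dots> = mm Z L' (trm C) x y" using x y AL by (metis mm_def)
      also have "\<dots> = (\<Sum>z\<in>Z. L' x z * C y z)" using x y by (simp add: mm_def trm_def)
      also have "\<dots> = 0"
      proof (rule sum.neutral, intro ballI)
        fix z assume z: "z \<in> Z"
        show "L' x z * C y z = 0"
        proof (rule ccontr)
          assume "\<not> ?thesis"
          then have "sim x z" "z = y \<or> z \<in> below y"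
            using L' C x y z by (auto simp: bdiag_def blower_def)
          moreover have "z \<in> below x" using calculation(2) True below_trans[OF x True] by auto
          ultimately show False using below_not_sim sim_sym x z by blast
        qed
      qed
      finally show ?thesis .
    next
      case False
      have "a z * L z y = 0" if z: "z \<in> Z" for z
        using False below_sim_left[OF x _ y, of z] L y z sim_sym[OF z y] by (auto simp: a_def bdiag_def)
      then show ?thesis by simp
    qed
    have wZ: "w \<in> Z" using w below_subset by auto
    have "a w = (\<Sum>z\<in>Z. a z * mm Z L Li z w)"
      using wZ by (simp add: LLi idm_def if_distrib[of "\<lambda>x. _ * x"] fin cong: if_cong)
    also have "\<dots> = (\<Sum>z\<in>Z. \<Sum>y\<in>Z. a z * L z y * Li y w)"
      using wZ by (simp add: mm_def sum_distrib_left mult.assoc)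
    also have "\<dots> = (\<Sum>y\<in>Z. (\<Sum>z\<in>Z. a z * L z y) * Li y w)"
      by (subst sum.swap) (simp add: sum_distrib_right)
    also have "\<dots> = 0" by (simp add: aL)
    finally show ?thesis using w by (simp add: a_def)
  qed
  then have "A = idm Z"
    using A d unfolding blower_def idm_def zoff_def fun_eq_iff by (metis left_inverse)
  then have "mm Z P' (mm Z P'i P) = P'" by (simp only: A_def ri z(3))
  moreover have "mm Z P' (mm Z P'i P) = P" by (simp only: mm_assoc[symmetric] P'i1 li z(1))
  ultimately show ?thesis by simp
qed

text \<open>Transposition exchanges the roles of P and Q, so uniqueness of the left factor is
  applied twice; cancelling both outer factors then recovers L.\<close>

lemma ldu_unique:
  fixes P Q L P' Q' L' \<Omega> \<Omega>' :: "'a \<Rightarrow> 'a \<Rightarrow> 'f::field"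
  assumes d: "\<And>x. x \<in> Z \<Longrightarrow> d x \<noteq> 0"
    and P: "blower d P" and Q: "blower d Q" and L: "bdiag L"
    and P': "blower d P'" and Q': "blower d Q'" and L': "bdiag L'"
    and eq: "mm Z (mm Z P L) (trm Q) = \<Omega>" and eq': "mm Z (mm Z P' L') (trm Q') = \<Omega>"
    and inv: "mm Z \<Omega> \<Omega>' = idm Z"
  shows "P = P' \<and> Q = Q' \<and> L = L'"
proof -
  have PP: "P = P'" by (rule ldu_left_unique[OF d P Q L P' Q' L' eq eq' inv])
  have inv2: "mm Z \<Omega>' \<Omega> = idm Z" using mm_left_right_inverse[OF fin inv] .
  then have "trm (mm Z \<Omega>' \<Omega>) = trm (idm Z)" by simp
  then have invt: "mm Z (trm \<Omega>) (trm \<Omega>') = idm Z" by (simp only: trm_mm trm_idm)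
  have eqt: "mm Z (mm Z Q (trm L)) (trm P) = trm \<Omega>" "mm Z (mm Z Q' (trm L')) (trm P') = trm \<Omega>"
    unfolding eq[symmetric] trm_mm trm_trm mm_assoc
    using arg_cong[OF eq', of trm] arg_cong[OF eq, of trm] by (simp_all only: trm_mm trm_trm mm_assoc)
  have QQ: "Q = Q'"
    by (rule ldu_left_unique[OF d Q P bdiag_trm[OF L] Q' P' bdiag_trm[OF L'] eqt invt])
  have z: "zoff Z P" "zoff Z L" "zoff Z L'"
    using P L L' by (auto simp: blower_def bdiag_def)
  have "mm Z P (mm Z (mm Z L (trm Q)) \<Omega>') = mm Z (mm Z (mm Z P L) (trm Q)) \<Omega>'"
    by (simp only: mm_assoc)
  then have "mm Z P (mm Z (mm Z L (trm Q)) \<Omega>') = idm Z" by (simp only: eq inv)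
  then obtain Pi where Pi: "mm Z Pi P = idm Z" using mm_left_right_inverse[OF fin] by blast
  have "mm Z (mm Z \<Omega>' (mm Z P L)) (trm Q) = mm Z \<Omega>' (mm Z (mm Z P L) (trm Q))"
    by (simp only: mm_assoc)
  then have "mm Z (mm Z \<Omega>' (mm Z P L)) (trm Q) = idm Z" by (simp only: eq inv2)
  then obtain Qi where Qi: "mm Z (trm Q) Qi = idm Z" using mm_left_right_inverse[OF fin] by blast
  have X: "X = mm Z (mm Z Pi (mm Z (mm Z P X) (trm Q))) Qi" if "zoff Z X" for X
  proof -
    have "mm Z (mm Z Pi (mm Z (mm Z P X) (trm Q))) Qi = mm Z (mm Z (mm Z Pi P) X) (mm Z (trm Q) Qi)"
      by (simp only: mm_assoc)
    then show ?thesis using that by (simp add: Pi Qi mm_idm_left[OF fin] mm_idm_right[OF fin])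
  qed
  have "L = mm Z (mm Z Pi \<Omega>) Qi" using X[OF z(2)] by (simp only: eq)
  moreover have "L' = mm Z (mm Z Pi \<Omega>) Qi" using X[OF z(3)] PP QQ by (simp only: eq')
  ultimately show ?thesis using PP QQ by simp
qed

end

section \<open>Orthogonalization over a local ring\<close>

locale local_block_order = block_order Z lt sim + local_subring A \<phi>
  for Z :: "'a set" and lt sim and A :: "'f::field set" and \<phi> :: "'f \<Rightarrow> 'g::field" +
  fixes G :: "'a \<Rightarrow> 'a \<Rightarrow> 'f"
  assumes G_in: "x \<in> Z \<Longrightarrow> y \<in> Z \<Longrightarrow> G x y \<in> A"
    and hom_G: "x \<in> Z \<Longrightarrow> y \<in> Z \<Longrightarrow> \<phi> (G x y) = (if x = y then 1 else 0)"
begin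

text \<open>Every principal submatrix of G has the identity as its residue.\<close>

lemma inverse_on_subset:
  assumes "I \<subseteq> Z"
  obtains H where "\<And>x y. x \<in> I \<Longrightarrow> y \<in> I \<Longrightarrow> H x y \<in> A"
    "\<And>x y. x \<in> I \<Longrightarrow> y \<in> I \<Longrightarrow> (\<Sum>z\<in>I. G x z * H z y) = (if x = y then 1 else 0)"
    "\<And>x y. x \<in> I \<Longrightarrow> y \<in> I \<Longrightarrow> (\<Sum>z\<in>I. H x z * G z y) = (if x = y then 1 else 0)"
proof -
  have I: "finite I" using assms fin finite_subset by blast
  have "(\<Sum>z\<in>I. \<phi> (G x z) * (if z = y then 1 else 0)) = (if x = y then 1 else 0)" if "x \<in> I" "y \<in> I" for x y
    using that assms I hom_G by (simp add: if_distrib[of "\<lambda>x. _ * x"] subset_iff cong: if_cong)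
  note N = this
  have "G x y \<in> A" if "x \<in> I" "y \<in> I" for x y using that assms G_in by blast
  from fin_mat_inverse[OF I this N] show ?thesis using that by blast
qed

text \<open>Read with G as a Gram matrix: the vector with coordinates \<open>U x\<close> is
  orthogonal to all basis vectors strictly below the block of x. Unlike the mutual orthogonality of
  two families, this is a condition on one family alone.\<close>

definition row_orth :: "('a \<Rightarrow> 'a \<Rightarrow> 'f) \<Rightarrow> bool" where
  "row_orth U \<longleftrightarrow> (\<forall>x\<in>Z. \<forall>y\<in>below x. (\<Sum>z\<in>Z. U x z * G z y) = 0)"

text \<open>For each x this is a linear system whose matrix is the principal submatrix of G on
  \<open>below x\<close>, invertible over \<open>A\<close>. Its right-hand side has residue 0,
  because G is the identity modulo the maximal ideal; so the off-diagonal entries of U have residue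
  0.\<close>

lemma row_orth_exists:
  obtains U where "blower (\<lambda>_. 1) U" "row_orth U" "\<And>x y. U x y \<in> A"
    "\<And>x y. x \<in> Z \<Longrightarrow> \<phi> (U x y) = (if x = y then 1 else 0)"
proof -
  have "\<exists>u. (\<forall>y. u y \<in> A \<and> \<phi> (u y) = 0 \<and> (y \<notin> below x \<longrightarrow> u y = 0)) \<and>
      (\<forall>k\<in>below x. G x k + (\<Sum>z\<in>below x. u z * G z k) = 0)" if x: "x \<in> Z" for x
  proof -
    obtain H where H: "\<And>y z. y \<in> below x \<Longrightarrow> z \<in> below x \<Longrightarrow> H y z \<in> A"
      "\<And>y k. y \<in> below x \<Longrightarrow> k \<in> below x \<Longrightarrow> (\<Sum>z\<in>below x. H y z * G z k) = (if y = k then 1 else 0)"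
      using inverse_on_subset[OF below_subset[of x]] by metis
    \<comment> \<open>Minus the row of G at x, restricted to \<open>below x\<close>, times the
      inverse of the principal submatrix there.\<close>
    define u where "u z = (if z \<in> below x then - (\<Sum>k\<in>below x. G x k * H k z) else 0)" for z
    have bz: "k \<in> Z" "k \<noteq> x" if "k \<in> below x" for k using that below_subset below_irrefl by auto
    have "u z \<in> A" for z
      unfolding u_def by (auto intro!: zero_in uminus_in sum_in mult_in G_in x H bz)
    moreover have "\<phi> (u z) = 0" for z
    proof (cases "z \<in> below x")
      case True
      have "\<phi> (u z) = - \<phi> (\<Sum>k\<in>below x. G x k * H k z)"
        using True by (auto simp: u_def intro!: hom_uminus sum_in mult_in G_in x H bz)
      also have "\<phi> (\<Sum>k\<in>below x. G x k * H k z) = (\<Sum>k\<in>below x. \<phi> (G x k * H k z))"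
        using True by (auto intro!: hom_sum mult_in G_in x H bz)
      also have "\<dots> = (\<Sum>k\<in>below x. \<phi> (G x k) * \<phi> (H k z))"
        using True by (auto intro!: sum.cong hom_mult G_in x H bz)
      also have "\<dots> = 0" using x bz by (auto simp: hom_G below_irrefl intro!: sum.neutral)
      finally show ?thesis by simp
    qed (simp add: u_def hom_zero)
    moreover have "G x k + (\<Sum>z\<in>below x. u z * G z k) = 0" if k: "k \<in> below x" for k
    proof -
      have "(\<Sum>z\<in>below x. u z * G z k) = - (\<Sum>z\<in>below x. \<Sum>j\<in>below x. G x j * (H j z * G z k))"
        by (simp add: u_def sum_distrib_right mult.assoc flip: sum_negf)
      also have "\<dots> = - (\<Sum>j\<in>below x. G x j * (\<Sum>z\<in>below x. H j z * G z k))"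
        by (subst sum.swap) (simp add: sum_distrib_left)
      also have "\<dots> = - (\<Sum>j\<in>below x. G x j * (if j = k then 1 else 0))"
        using k H(2) by simp
      also have "\<dots> = - G x k" using k by (simp add: if_distrib[of "\<lambda>x. _ * x"] cong: if_cong)
      finally show ?thesis by simp
    qed
    moreover have "y \<notin> below x \<longrightarrow> u y = 0" for y by (simp add: u_def)
    ultimately show ?thesis by blast
  qed
  then obtain u where u: "\<And>x y. x \<in> Z \<Longrightarrow> u x y \<in> A" "\<And>x y. x \<in> Z \<Longrightarrow> \<phi> (u x y) = 0"
    "\<And>x y. x \<in> Z \<Longrightarrow> y \<notin> below x \<Longrightarrow> u x y = 0"
    "\<And>x k. x \<in> Z \<Longrightarrow> k \<in> below x \<Longrightarrow> G x k + (\<Sum>z\<in>below x. u x z * G z k) = 0"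
    by metis
  define U where "U x y = (if x \<in> Z then if x = y then 1 else u x y else 0)" for x y
  have "blower (\<lambda>_. 1) U"
    using u(3) below_subset by (auto simp: blower_def U_def zoff_def)
  moreover have "row_orth U"
    unfolding row_orth_def
  proof (intro ballI)
    fix x y assume x: "x \<in> Z" and y: "y \<in> below x"
    have "(\<Sum>z\<in>below x. U x z * G z y) = (\<Sum>z\<in>below x. u x z * G z y)"
      using x below_irrefl[of x] by (intro sum.cong) (auto simp: U_def)
    then show "(\<Sum>z\<in>Z. U x z * G z y) = 0"
      using u(4)[OF x y] by (simp add: blower_sum[OF \<open>blower _ U\<close> x])
  qed
  moreover have "U x y \<in> A" for x y using u(1) by (auto simp: U_def zero_in one_in)
  moreover have "\<phi> (U x y) = (if x = y then 1 else 0)" if "x \<in> Z" for x y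
    using u(2) that by (auto simp: U_def hom_one)
  ultimately show ?thesis using that by blast
qed

lemma row_orth_unique:
  assumes U: "blower (\<lambda>_. 1) U" "row_orth U" and V: "blower (\<lambda>_. 1) V" "row_orth V"
  shows "U = V"
proof -
  have "U x w = V x w" if x: "x \<in> Z" and w: "w \<in> below x" for x w
  proof -
    obtain H where H: "\<And>y k. y \<in> below x \<Longrightarrow> k \<in> below x \<Longrightarrow> (\<Sum>z\<in>below x. G y z * H z k) = (if y = k then 1 else 0)"
      using inverse_on_subset[OF below_subset[of x]] by metis
    have a: "(\<Sum>z\<in>below x. (U x z - V x z) * G z y) = 0" if "y \<in> below x" for y
    proof -
      have "G x y + (\<Sum>z\<in>below x. U x z * G z y) = 0" "G x y + (\<Sum>z\<in>below x. V x z * G z y) = 0"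
        using blower_sum[OF U(1) x, of "\<lambda>z. G z y"] blower_sum[OF V(1) x, of "\<lambda>z. G z y"]
          U(2) V(2) x that by (auto simp: row_orth_def)
      then show ?thesis by (simp add: left_diff_distrib sum_subtractf add_eq_0_iff)
    qed
    have "U x w - V x w = (\<Sum>z\<in>below x. (U x z - V x z) * (if z = w then 1 else 0))"
      using w by (simp add: if_distrib[of "\<lambda>x. _ * x"] cong: if_cong)
    also have "\<dots> = (\<Sum>z\<in>below x. (U x z - V x z) * (\<Sum>y\<in>below x. G z y * H y w))"
      using w H by (intro sum.cong) auto
    also have "\<dots> = (\<Sum>y\<in>below x. (\<Sum>z\<in>below x. (U x z - V x z) * G z y) * H y w)"
      by (simp add: sum_distrib_left sum_distrib_right mult.assoc) (rule sum.swap)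
    also have "\<dots> = 0" by (simp add: a)
    finally show ?thesis by simp
  qed
  then show ?thesis
    using U(1) V(1) unfolding blower_def zoff_def fun_eq_iff by metis
qed

text \<open>The rows of V below a given one span the same space as the corresponding basis vectors,
  because V is unitriangular. Induction upwards in y turns orthogonality to the rows of V into
  orthogonality to basis vectors, and so decouples U from V.\<close>

lemma row_orth_if_orthogonal:
  assumes U: "blower (\<lambda>_. 1) U" and V: "blower (\<lambda>_. 1) V"
    and orth: "bdiag (mm Z (mm Z U G) (trm V))"
  shows "row_orth U"
  unfolding row_orth_def
proof (intro ballI)
  fix x y assume x: "x \<in> Z" and y: "y \<in> below x"
  have "y \<in> Z" using y below_subset by auto
  then have "y \<in> below x \<longrightarrow> mm Z U G x y = 0"
  proof (induction y rule: below_induct)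
    case (below y)
    show ?case
    proof
      assume yx: "y \<in> below x"
      have "mm Z (mm Z U G) (trm V) x y = 0"
        using orth x below.hyps below_not_sim[OF yx] sim_sym by (auto simp: bdiag_def)
      then have "(\<Sum>z\<in>Z. V y z * mm Z U G x z) = 0"
        using x below.hyps by (simp add: mm_def[of Z "mm Z U G"] trm_def mult.commute)
      moreover have "mm Z U G x z = 0" if "z \<in> below y" for z
        using below.IH[OF that] below_trans[OF x yx that] by simp
      ultimately show "mm Z U G x y = 0"
        using V below.hyps by (simp add: blower_sum[OF V below.hyps])
    qed
  qed
  then show "(\<Sum>z\<in>Z. U x z * G z y) = 0"
    using x y \<open>y \<in> Z\<close> by (simp add: mm_def)
qed

end

context block_order begin

text \<open>The condition on U kills the entries below the diagonal blocks, the condition on V,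
  taken with respect to the transposed form, those above.\<close>

lemma orthogonal_if_row_orth:
  fixes U V G :: "'a \<Rightarrow> 'a \<Rightarrow> 'f::field"
  assumes U: "blower (\<lambda>_. 1) U" and V: "blower (\<lambda>_. 1) V"
    and UG: "\<And>x y. x \<in> Z \<Longrightarrow> y \<in> below x \<Longrightarrow> (\<Sum>z\<in>Z. U x z * G z y) = 0"
    and VG: "\<And>x y. x \<in> Z \<Longrightarrow> y \<in> below x \<Longrightarrow> (\<Sum>z\<in>Z. V x z * G y z) = 0"
  shows "bdiag (mm Z (mm Z U G) (trm V))"
proof -
  have 1: "mm Z (mm Z U G) (trm V) x y = 0" if x: "x \<in> Z" and y: "y \<in> below x" for x y
  proof -
    have yZ: "y \<in> Z" using y below_subset by auto
    have "mm Z (mm Z U G) (trm V) x y = (\<Sum>z\<in>Z. V y z * mm Z U G x z)"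
      using x yZ by (simp add: mm_def[of Z "mm Z U G"] trm_def mult.commute)
    also have "\<dots> = 0"
      using x y yZ UG[OF x] below_trans[OF x y] below_subset
      by (auto simp: blower_sum[OF V yZ] mm_def intro!: sum.neutral)
    finally show ?thesis .
  qed
  have 2: "mm Z (mm Z U G) (trm V) x y = 0" if y: "y \<in> Z" and x: "x \<in> below y" for x y
  proof -
    have xZ: "x \<in> Z" using x below_subset by auto
    have "mm Z (mm Z U G) (trm V) x y = (\<Sum>z\<in>Z. U x z * mm Z G (trm V) z y)"
      using y xZ by (simp add: mm_assoc mm_def[of Z U])
    also have "\<dots> = 0"
      using x y xZ VG[OF y] below_trans[OF y x] below_subset
      by (auto simp: blower_sum[OF U xZ] mm_def trm_def mult.commute intro!: sum.neutral)
    finally show ?thesis .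
  qed
  show ?thesis
    unfolding bdiag_def using 1 2 below_total by (metis zoff_mm)
qed

end

section \<open>The coefficients of q and the kernel\<close>

lemma esym_0: "esym k 0 = 1"
  by (rule mfps_eqI) (auto simp: esym_def mcoeff_one)

lemma hsym_0: "hsym k 0 = 1"
  by (rule mfps_eqI) (auto simp: hsym_def mcoeff_one)

lemma q_plus1_0: "q_plus1 r k 0 = 1"
  by (simp add: q_plus1_eq esym_0 hsym_0)

text \<open>Indexing the product by variables allows one set V to serve several partitions: a
  variable outside the support contributes q_0 = 1.\<close>

lemma q_plus_prod:
  assumes \<nu>: "\<nu> \<in> mparts r N" and V: "finite V" "keys (xm \<nu>) \<subseteq> V"
  shows "q_plus r \<nu> = (\<Prod>v\<in>V. q_plus1 r (fst v) (lookup (xm \<nu>) v))"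
proof -
  have len: "length \<nu> = r" using \<nu> by (simp add: mparts_def)
  have "q_plus r \<nu> = (\<Prod>k<r. \<Prod>i<length (\<nu> ! k). q_plus1 r k (lookup (xm \<nu>) (k, i)))"
    unfolding q_plus_def by (intro prod.cong refl) (simp add: lookup_xm len)
  also have "\<dots> = (\<Prod>v\<in>Sigma {..<r} (\<lambda>k. {..<length (\<nu> ! k)}). q_plus1 r (fst v) (lookup (xm \<nu>) v))"
    by (simp add: prod.Sigma case_prod_unfold)
  also have "Sigma {..<r} (\<lambda>k. {..<length (\<nu> ! k)}) = keys (xm \<nu>)"
    using keys_xm[OF \<nu>] by simp
  also have "(\<Prod>v\<in>keys (xm \<nu>). q_plus1 r (fst v) (lookup (xm \<nu>) v)) =
      (\<Prod>v\<in>V. q_plus1 r (fst v) (lookup (xm \<nu>) v))"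
    by (rule prod.mono_neutral_left[OF V]) (auto simp: in_keys_iff q_plus1_0)
  finally show ?thesis .
qed

lemma lookup_sum_single:
  "finite V \<Longrightarrow> lookup (\<Sum>v'\<in>V. single v' (f v')) v = (if v \<in> V then f v else (0::nat))"
  by (simp add: lookup_sum lookup_single when_def)

lemma poly_mapping_sum_single:
  assumes "finite V" "keys m \<subseteq> V"
  shows "(\<Sum>v\<in>V. single v (lookup m v)) = (m :: _ \<Rightarrow>\<^sub>0 nat)"
  by (rule poly_mapping_eqI) (use assms in \<open>auto simp: lookup_sum_single in_keys_iff\<close>)

lemma sum_cells:
  assumes "finite V"
  shows "(\<Sum>x\<in>V \<times> V \<times> (UNIV :: bool set). g x) = (\<Sum>v\<in>V. \<Sum>v'\<in>V. (g (v, v', True) + g (v, v', False) :: 'c::comm_monoid_add))"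
  by (simp add: sum.cartesian_product' UNIV_bool add.commute)

lemma prod_cells:
  assumes "finite V"
  shows "(\<Prod>x\<in>V \<times> V \<times> (UNIV :: bool set). g x) = (\<Prod>v\<in>V. \<Prod>v'\<in>V. (g (v, v', True) * g (v, v', False) :: 'c::comm_monoid_mult))"
  by (simp add: prod.cartesian_product' UNIV_bool mult.commute)

context wreath begin

definition KR :: "(nat \<times> nat) set \<Rightarrow> monom_exp \<Rightarrow> monom_exp \<Rightarrow> (cell \<Rightarrow> nat) set" where
  "KR V a b = {\<rho> \<in> mults N (V \<times> V \<times> UNIV). (\<forall>x. snd (snd x) \<longrightarrow> \<rho> x \<le> 1) \<and> kerP V a b \<rho>}"

lemma pred_mod_less: "pred_mod r k < r"
  using r by (simp add: pred_mod_def)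

text \<open>Modulo r, the factor r - 1 is -1. So \<open>compat\<close> says that the alphabet of v'
  is that of v, or the preceding one for a numerator cell, which are the two alphabets in the
  generating function of q^+.\<close>

lemma compat_iff:
  assumes "fst v < r" "fst v' < r"
  shows "compat (v, v', True) \<longleftrightarrow> fst v' = pred_mod r (fst v)" "compat (v, v', False) \<longleftrightarrow> fst v' = fst v"
proof -
  obtain q where q: "r = Suc q" using r by (cases r) auto
  let ?k = "fst v" and ?j = "fst v'"
  have "compat (v, v', s) \<longleftrightarrow> (?j + of_bool s) mod r = ?k mod r" for s
  proof -
    have "compat (v, v', s) \<longleftrightarrow> int r dvd int ((r - 1) * ?k + ?j + of_bool s)"
      unfolding compat_def by (simp only: fst_conv snd_conv int_dvd_int_iff)
    also have "int ((r - 1) * ?k + ?j + of_bool s) = int r * int ?k + (int (?j + of_bool s) - int ?k)"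
      by (simp add: q algebra_simps)
    also have "int r dvd \<dots> \<longleftrightarrow> int r dvd int (?j + of_bool s) - int ?k" by (rule dvd_add_right_iff) simp
    also have "\<dots> \<longleftrightarrow> int (?j + of_bool s) mod int r = int ?k mod int r" by (rule mod_eq_dvd_iff[symmetric])
    also have "\<dots> \<longleftrightarrow> (?j + of_bool s) mod r = ?k mod r" by (simp only: of_nat_mod[symmetric] of_nat_eq_iff)
    finally show ?thesis .
  qed
  note * = this
  show "compat (v, v', False) \<longleftrightarrow> fst v' = fst v" using assms by (simp add: *)
  have "(?j + 1) mod r = ?k mod r \<longleftrightarrow> ?j = pred_mod r ?k"
  proof (cases "?k = 0")
    case True
    then have "pred_mod r ?k = q" by (simp add: pred_mod_def q)
    moreover have "(?j + 1) mod r = 0 \<longleftrightarrow> ?j = q" using assms by (cases "?j = q") (auto simp: q)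
    ultimately show ?thesis using True by simp
  next
    case False
    then have "pred_mod r ?k = ?k - 1" using assms by (simp add: pred_mod_def q mod_if)
    moreover have "(?j + 1) mod r = ?k \<longleftrightarrow> ?j = ?k - 1" using assms False by (cases "?j = q") (auto simp: q)
    ultimately show ?thesis using assms by simp
  qed
  then show "compat (v, v', True) \<longleftrightarrow> fst v' = pred_mod r (fst v)" using * by simp
qed

text \<open>For the sign plus the indeterminate has index k - 1, so a numerator cell carries the
  indeterminate with the index of the alphabet of its second variable.\<close>

definition wq :: "cell \<Rightarrow> tratfun" where
  "wq x = (if snd (snd x) then - tvar (pred_mod r (fst (fst x))) else 1)"

text \<open>The two monomials contributed by the factor at v: one from its numerator, one from its
  geometric series.\<close>

definition Dc :: "(nat \<times> nat) set \<Rightarrow> (cell \<Rightarrow> nat) \<Rightarrow> nat \<times> nat \<Rightarrow> monom_exp \<times> monom_exp" where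
  "Dc V \<rho> v = (\<Sum>v'\<in>V. single v' (\<rho> (v, v', True)), \<Sum>v'\<in>V. single v' (\<rho> (v, v', False)))"

definition okc :: "nat \<times> nat \<Rightarrow> nat \<Rightarrow> monom_exp \<times> monom_exp \<Rightarrow> bool" where
  "okc v j p \<longleftrightarrow> fst ` keys (fst p) \<subseteq> {pred_mod r (fst v)} \<and> (\<forall>v'. lookup (fst p) v' \<le> 1) \<and>
     fst ` keys (snd p) \<subseteq> {fst v} \<and> mdeg (fst p) + mdeg (snd p) = j"

lemma lookup_Dc:
  assumes "finite V"
  shows "lookup (fst (Dc V \<rho> v)) v' = (if v' \<in> V then \<rho> (v, v', True) else 0)"
    "lookup (snd (Dc V \<rho> v)) v' = (if v' \<in> V then \<rho> (v, v', False) else 0)"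
  using assms by (simp_all add: Dc_def lookup_sum_single)

lemma mdeg_Dc:
  "mdeg (fst (Dc V \<rho> v)) = (\<Sum>v'\<in>V. \<rho> (v, v', True))" "mdeg (snd (Dc V \<rho> v)) = (\<Sum>v'\<in>V. \<rho> (v, v', False))"
  by (simp_all add: Dc_def mdeg_sum)

text \<open>The conditions on \<rho> are sorted by the first variable of the cell. For each v they
  become the condition under which the factor at v has a nonzero term, and one equation remains for
  the product of all chosen monomials.\<close>

lemma KR_iff:
  assumes V: "finite V" "fst ` V \<subseteq> {..<r}" and a: "keys a \<subseteq> V" "mdeg a = N" and b: "keys b \<subseteq> V"
  shows "\<rho> \<in> KR V a b \<longleftrightarrow> (\<forall>x. x \<notin> V \<times> V \<times> UNIV \<longrightarrow> \<rho> x = 0) \<and>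
    (\<forall>v\<in>V. okc v (lookup a v) (Dc V \<rho> v)) \<and> (\<Sum>v\<in>V. fst (Dc V \<rho> v) + snd (Dc V \<rho> v)) = b"
proof (cases "\<forall>x. x \<notin> V \<times> V \<times> UNIV \<longrightarrow> \<rho> x = 0")
  case False
  then show ?thesis by (auto simp: KR_def mults_def)
next
  case off: True
  have s1: "(\<Sum>x\<in>V \<times> V \<times> UNIV. single (fst x) (\<rho> x)) =
      (\<Sum>v\<in>V. single v (mdeg (fst (Dc V \<rho> v)) + mdeg (snd (Dc V \<rho> v))))"
    unfolding sum_cells[OF V(1)] mdeg_Dc sum.distrib[symmetric]
    by (rule sum.cong[OF refl], rule poly_mapping_eqI) (auto simp: lookup_sum lookup_add lookup_single when_def)
  have s2: "(\<Sum>x\<in>V \<times> V \<times> UNIV. single (fst (snd x)) (\<rho> x)) = (\<Sum>v\<in>V. fst (Dc V \<rho> v) + snd (Dc V \<rho> v))"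
    unfolding sum_cells[OF V(1)] Dc_def by (simp add: sum.distrib)
  have N: "(\<Sum>x\<in>V \<times> V \<times> UNIV. \<rho> x) = (\<Sum>v\<in>V. mdeg (fst (Dc V \<rho> v)) + mdeg (snd (Dc V \<rho> v)))"
    unfolding sum_cells[OF V(1)] mdeg_Dc sum.distrib[symmetric] ..
  have A: "(\<Sum>x\<in>V \<times> V \<times> UNIV. single (fst x) (\<rho> x)) = a \<longleftrightarrow>
      (\<forall>v\<in>V. mdeg (fst (Dc V \<rho> v)) + mdeg (snd (Dc V \<rho> v)) = lookup a v)"
  proof -
    have "(\<Sum>x\<in>V \<times> V \<times> UNIV. single (fst x) (\<rho> x)) = a \<longleftrightarrow>
        (\<forall>v. (if v \<in> V then mdeg (fst (Dc V \<rho> v)) + mdeg (snd (Dc V \<rho> v)) else 0) = lookup a v)"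
      unfolding s1 poly_mapping_eq_iff fun_eq_iff lookup_sum_single[OF V(1)] ..
    also have "\<dots> \<longleftrightarrow> (\<forall>v\<in>V. mdeg (fst (Dc V \<rho> v)) + mdeg (snd (Dc V \<rho> v)) = lookup a v)"
      using a(1) by (auto simp: in_keys_iff)
    finally show ?thesis .
  qed
  \<comment> \<open>The total multiplicity is the degree of the first marginal, hence N.\<close>
  have AN: "(\<Sum>x\<in>V \<times> V \<times> UNIV. \<rho> x) = N" if "(\<Sum>x\<in>V \<times> V \<times> UNIV. single (fst x) (\<rho> x)) = a"
  proof -
    have "(\<Sum>x\<in>V \<times> V \<times> UNIV. \<rho> x) = mdeg (\<Sum>x\<in>V \<times> V \<times> UNIV. single (fst x) (\<rho> x))" by (simp add: mdeg_sum)
    then show ?thesis using that a(2) by simp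
  qed
  have pos_if: "(0 < (if P then n else 0)) = (P \<and> 0 < n)" for P and n :: nat by simp
  have C: "(\<forall>x. \<rho> x > 0 \<longrightarrow> compat x) \<longleftrightarrow> (\<forall>v\<in>V. fst ` keys (fst (Dc V \<rho> v)) \<subseteq> {pred_mod r (fst v)} \<and>
      fst ` keys (snd (Dc V \<rho> v)) \<subseteq> {fst v})"
  proof -
    have "(\<forall>x. \<rho> x > 0 \<longrightarrow> compat x) \<longleftrightarrow> (\<forall>v\<in>V. \<forall>v'\<in>V. \<forall>s. \<rho> (v, v', s) > 0 \<longrightarrow> compat (v, v', s))"
      using off by (metis SigmaE UNIV_I gr_implies_not_zero mem_Sigma_iff prod.collapse)
    also have "\<dots> \<longleftrightarrow> (\<forall>v\<in>V. \<forall>v'\<in>V. (\<rho> (v, v', True) > 0 \<longrightarrow> fst v' = pred_mod r (fst v)) \<and> (\<rho> (v, v', False) > 0 \<longrightarrow> fst v' = fst v))"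
    proof (intro ball_cong refl)
      fix v v' assume "v \<in> V" "v' \<in> V"
      then have "fst v < r" "fst v' < r" using V(2) by auto
      note c = compat_iff[OF this]
      show "(\<forall>s. \<rho> (v, v', s) > 0 \<longrightarrow> compat (v, v', s)) \<longleftrightarrow> (\<rho> (v, v', True) > 0 \<longrightarrow> fst v' = pred_mod r (fst v)) \<and> (\<rho> (v, v', False) > 0 \<longrightarrow> fst v' = fst v)"
        unfolding c[symmetric] by (rule all_bool_eq)
    qed
    also have "\<dots> \<longleftrightarrow> (\<forall>v\<in>V. (\<forall>v'. lookup (fst (Dc V \<rho> v)) v' > 0 \<longrightarrow> fst v' = pred_mod r (fst v)) \<and>
       (\<forall>v'. lookup (snd (Dc V \<rho> v)) v' > 0 \<longrightarrow> fst v' = fst v))"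
      unfolding lookup_Dc[OF V(1)] pos_if by blast
    also have "\<dots> \<longleftrightarrow> (\<forall>v\<in>V. fst ` keys (fst (Dc V \<rho> v)) \<subseteq> {pred_mod r (fst v)} \<and>
      fst ` keys (snd (Dc V \<rho> v)) \<subseteq> {fst v})"
      by (simp only: image_subset_iff in_keys_iff singleton_iff Ball_def neq0_conv)
    finally show ?thesis .
  qed
  have S: "(\<forall>x. snd (snd x) \<longrightarrow> \<rho> x \<le> 1) \<longleftrightarrow> (\<forall>v\<in>V. \<forall>v'. lookup (fst (Dc V \<rho> v)) v' \<le> 1)"
    unfolding lookup_Dc[OF V(1)]
  proof
    assume R: "\<forall>v\<in>V. \<forall>v'. (if v' \<in> V then \<rho> (v, v', True) else 0) \<le> 1"
    show "\<forall>x. snd (snd x) \<longrightarrow> \<rho> x \<le> 1"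
    proof (intro allI impI)
      fix x :: cell assume "snd (snd x)"
      then obtain v v' where x: "x = (v, v', True)" by (metis prod.collapse)
      show "\<rho> x \<le> 1"
      proof (cases "v \<in> V \<and> v' \<in> V")
        case True then show ?thesis using R[rule_format, of v v'] x by simp
      next
        case False then show ?thesis using off[rule_format, of x] x by simp
      qed
    qed
  qed auto
  have "\<rho> \<in> KR V a b \<longleftrightarrow> (\<Sum>x\<in>V \<times> V \<times> UNIV. \<rho> x) = N \<and> (\<forall>x. snd (snd x) \<longrightarrow> \<rho> x \<le> 1) \<and> (\<forall>x. \<rho> x > 0 \<longrightarrow> compat x) \<and>
      (\<Sum>x\<in>V \<times> V \<times> UNIV. single (fst x) (\<rho> x)) = a \<and>
      (\<Sum>x\<in>V \<times> V \<times> UNIV. single (fst (snd x)) (\<rho> x)) = b"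
    using off by (simp only: KR_def mults_def kerP_def mem_Collect_eq simp_thms conj_assoc) blast
  also have "\<dots> \<longleftrightarrow> (\<forall>x. snd (snd x) \<longrightarrow> \<rho> x \<le> 1) \<and> (\<forall>x. \<rho> x > 0 \<longrightarrow> compat x) \<and>
      (\<Sum>x\<in>V \<times> V \<times> UNIV. single (fst x) (\<rho> x)) = a \<and>
      (\<Sum>x\<in>V \<times> V \<times> UNIV. single (fst (snd x)) (\<rho> x)) = b"
    using AN by meson
  also have "\<dots> \<longleftrightarrow> (\<forall>v\<in>V. okc v (lookup a v) (Dc V \<rho> v)) \<and> (\<Sum>v\<in>V. fst (Dc V \<rho> v) + snd (Dc V \<rho> v)) = b"
    unfolding A C S s2 okc_def by blast
  finally show ?thesis using off by blast
qed

text \<open>Multiplying out, one chooses for each v its share of the monomial b and a splitting of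
  this share between numerator and geometric series. These choices correspond bijectively to
  multiplicity functions on cells.\<close>

lemma mcoeff_q_plus:
  assumes V: "finite V" "fst ` V \<subseteq> {..<r}" and \<mu>: "\<mu> \<in> mparts r N" and a: "keys (xm \<mu>) \<subseteq> V" and b: "keys b \<subseteq> V"
  shows "mcoeff (q_plus r \<mu>) b = (\<Sum>\<rho>\<in>KR V (xm \<mu>) b. \<Prod>x\<in>V \<times> V \<times> UNIV. wq x ^ \<rho> x)"
proof -
  let ?a = "lookup (xm \<mu>)"
  let ?w = "\<lambda>v p. (- tvar (pred_mod r (fst v))) ^ mdeg (fst p)"
  let ?T = "Sigma (splits V b) (\<lambda>\<gamma>. Pi\<^sub>E V (\<lambda>v. adiag (\<gamma> v)))"
  let ?ok = "\<lambda>t. \<forall>v\<in>V. okc v (?a v) (snd t v)"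
  have finT: "finite ?T" using V(1) finite_splits finite_adiag by (intro finite_SigmaI finite_PiE) auto
  have "mcoeff (q_plus r \<mu>) b = (\<Sum>\<gamma>\<in>splits V b. \<Prod>v\<in>V. \<Sum>p\<in>adiag (\<gamma> v). if okc v (?a v) p then ?w v p else 0)"
    unfolding q_plus_prod[OF \<mu> V(1) a] mcoeff_prod[OF V(1)] mcoeff_q_plus1 okc_def ..
  also have "\<dots> = (\<Sum>\<gamma>\<in>splits V b. \<Sum>\<delta>\<in>Pi\<^sub>E V (\<lambda>v. adiag (\<gamma> v)). \<Prod>v\<in>V. if okc v (?a v) (\<delta> v) then ?w v (\<delta> v) else 0)"
    by (rule sum.cong[OF refl], rule prod_sum_PiE) (use V finite_adiag in auto)
  also have "\<dots> = (\<Sum>t\<in>?T. \<Prod>v\<in>V. if okc v (?a v) (snd t v) then ?w v (snd t v) else 0)"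
    by (subst sum.Sigma) (use V(1) finite_splits finite_adiag in \<open>auto intro!: finite_PiE simp: case_prod_unfold\<close>)
  also have "\<dots> = (\<Sum>t\<in>?T. if ?ok t then (\<Prod>v\<in>V. ?w v (snd t v)) else 0)"
  proof (rule sum.cong[OF refl])
    fix t
    show "(\<Prod>v\<in>V. if okc v (?a v) (snd t v) then ?w v (snd t v) else 0) = (if ?ok t then (\<Prod>v\<in>V. ?w v (snd t v)) else 0)"
    proof (cases "?ok t")
      case True
      then show ?thesis by simp
    next
      case False
      then have "(\<Prod>v\<in>V. if okc v (?a v) (snd t v) then ?w v (snd t v) else 0) = 0" using V(1) by (intro prod_zero) auto
      then show ?thesis unfolding if_not_P[OF False] .
    qed
  qed
  also have "\<dots> = (\<Sum>t\<in>{t \<in> ?T. ?ok t}. \<Prod>v\<in>V. ?w v (snd t v))"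
    by (rule sum.inter_filter[OF finT, symmetric])
  also have "\<dots> = (\<Sum>\<rho>\<in>KR V (xm \<mu>) b. \<Prod>x\<in>V \<times> V \<times> UNIV. wq x ^ \<rho> x)"
  proof -
    \<comment> \<open>The multiplicity of a cell is an exponent in one of the two monomials chosen
      at v; \<open>dn\<close> rebuilds the monomials and their products.\<close>
    define up where "up t x = (if x \<in> V \<times> V \<times> UNIV then lookup ((if snd (snd x) then fst else snd) (snd t (fst x))) (fst (snd x)) else 0)"
      for t :: "((nat \<times> nat) \<Rightarrow> monom_exp) \<times> ((nat \<times> nat) \<Rightarrow> monom_exp \<times> monom_exp)" and x :: cell
    define dn where "dn \<rho> = (restrict (\<lambda>v. fst (Dc V \<rho> v) + snd (Dc V \<rho> v)) V, restrict (Dc V \<rho>) V)" for \<rho>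
    have keysb: "keys (\<gamma> v) \<subseteq> V" if "\<gamma> \<in> splits V b" "v \<in> V" for \<gamma> v
    proof
      fix v' assume "v' \<in> keys (\<gamma> v)"
      then have "lookup (\<gamma> v) v' > 0" by (simp add: in_keys_iff)
      moreover have "lookup (\<gamma> v) v' \<le> lookup b v'"
        using that V(1) by (auto simp: splits_def lookup_sum intro!: member_le_sum)
      ultimately show "v' \<in> V" using b by (auto simp: in_keys_iff)
    qed
    have ad: "fst (snd t v) + snd (snd t v) = fst t v" if t: "t \<in> ?T" and v: "v \<in> V" for t v
    proof -
      have "snd t \<in> Pi\<^sub>E V (\<lambda>v. adiag (fst t v))" using t by auto
      then have "snd t v \<in> adiag (fst t v)" using v by (rule PiE_mem)
      then show ?thesis by (simp add: adiag_def split_beta)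
    qed
    have Dup: "Dc V (up t) v = snd t v" if t: "t \<in> ?T" and v: "v \<in> V" for t v
    proof -
      have "keys (fst t v) \<subseteq> V" by (rule keysb) (use t v in auto)
      then have k: "keys (fst (snd t v)) \<subseteq> V" "keys (snd (snd t v)) \<subseteq> V"
        unfolding ad[OF t v, symmetric] by (auto simp: in_keys_iff lookup_add)
      have "Dc V (up t) v = (\<Sum>v'\<in>V. single v' (lookup (fst (snd t v)) v'),
          \<Sum>v'\<in>V. single v' (lookup (snd (snd t v)) v'))"
        unfolding Dc_def using v by (simp add: up_def)
      then show ?thesis using k by (simp add: poly_mapping_sum_single[OF V(1)])
    qed
    have off: "up t x = 0" if "x \<notin> V \<times> V \<times> UNIV" for t x using that by (simp add: up_def)
    note iff = KR_iff[OF V a mdeg_xm[OF \<mu>] b]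
    show ?thesis
    proof (rule sum.reindex_bij_witness[where j = up and i = dn], goal_cases)
      case (1 t)
      then have t: "t \<in> ?T" by simp
      then have ext: "fst t \<in> extensional V" "snd t \<in> extensional V" by (auto simp: splits_def PiE_def)
      have "fst (dn (up t)) = fst t" "snd (dn (up t)) = snd t"
        using ext by (auto simp: dn_def fun_eq_iff Dup[OF t] ad[OF t] extensional_def)
      then show ?case by (rule prod_eqI)
    next
      case (2 t)
      then have t: "t \<in> ?T" and ok: "?ok t" by auto
      have "(\<Sum>v\<in>V. fst (Dc V (up t) v) + snd (Dc V (up t) v)) = (\<Sum>v\<in>V. fst t v)"
        by (rule sum.cong[OF refl]) (simp add: Dup[OF t] ad[OF t])
      then show ?case unfolding iff using ok t off by (auto simp: Dup[OF t] splits_def)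
    next
      case (3 \<rho>)
      then have "\<forall>x. x \<notin> V \<times> V \<times> UNIV \<longrightarrow> \<rho> x = 0" by (simp add: iff)
      then show ?case by (auto simp: up_def dn_def fun_eq_iff lookup_Dc[OF V(1)])
    next
      case (4 \<rho>)
      then show ?case unfolding iff by (auto simp: dn_def splits_def adiag_def)
    next
      case (5 t)
      then have t: "t \<in> ?T" by simp
      have "(\<Prod>x\<in>V \<times> V \<times> UNIV. wq x ^ up t x) = (\<Prod>v\<in>V. \<Prod>v'\<in>V. (- tvar (pred_mod r (fst v))) ^ up t (v, v', True))"
        unfolding prod_cells[OF V(1)] by (simp add: wq_def)
      also have "\<dots> = (\<Prod>v\<in>V. ?w v (snd t v))"
        by (rule prod.cong[OF refl]) (simp only: power_sum[symmetric] mdeg_Dc(1)[symmetric] Dup[OF t])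
      finally show ?case .
    qed
  qed
  finally show ?thesis .
qed

end

section \<open>Symmetry, regularity and specialization of the functions q\<close>

lemma homog_esym: "k < r \<Longrightarrow> homog r a (esym k a)"
  by (auto simp: homog_def esym_def split: if_splits)

lemma homog_hsym: "k < r \<Longrightarrow> homog r a (hsym k a)"
  by (auto simp: homog_def hsym_def split: if_splits)

lemma mdeg_map_key:
  assumes "bij f"
  shows "mdeg (map_key f m) = mdeg m"
proof -
  have "mdeg m = (\<Sum>v\<in>f ` keys (map_key f m). lookup m v)"
    unfolding mdeg_def keys_map_key_bij[OF assms] ..
  also have "\<dots> = (\<Sum>v\<in>keys (map_key f m). lookup m (f v))"
    by (rule sum.reindex_cong[of f]) (use assms in \<open>auto intro: inj_on_subset[OF bij_is_inj]\<close>)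
  finally show ?thesis using assms by (simp add: mdeg_def lookup_map_key bij_is_inj)
qed

lemma symmetric_hsym: "symmetric_mfps (hsym k a)"
  unfolding symmetric_mfps_def
proof (intro allI impI)
  fix \<pi> :: "nat \<Rightarrow> nat \<Rightarrow> nat" and m
  assume "\<forall>k. bij (\<pi> k)"
  then have b: "bij (apm \<pi>)" by (intro bij_apm) auto
  show "mcoeff (hsym k a) (map_key (apm \<pi>) m) = mcoeff (hsym k a) m"
    by (simp add: hsym_def mdeg_map_key[OF b] fst_keys_map_key[OF b])
qed

lemma symmetric_esym: "symmetric_mfps (esym k a)"
  unfolding symmetric_mfps_def
proof (intro allI impI)
  fix \<pi> :: "nat \<Rightarrow> nat \<Rightarrow> nat" and m :: monom_exp
  assume "\<forall>k. bij (\<pi> k)"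
  then have b: "bij (apm \<pi>)" by (intro bij_apm) auto
  have "(\<forall>v. lookup (map_key (apm \<pi>) m) v \<le> 1) \<longleftrightarrow> (\<forall>v. lookup m v \<le> 1)"
  proof
    assume A: "\<forall>v. lookup (map_key (apm \<pi>) m) v \<le> 1"
    show "\<forall>v. lookup m v \<le> 1"
    proof
      fix v
      obtain u where "v = apm \<pi> u" using bij_is_surj[OF b] by blast
      then show "lookup m v \<le> 1" using A[rule_format, of u] by (simp add: lookup_map_key[OF bij_is_inj[OF b]])
    qed
  next
    assume A: "\<forall>v. lookup m v \<le> 1"
    show "\<forall>v. lookup (map_key (apm \<pi>) m) v \<le> 1"
      unfolding lookup_map_key[OF bij_is_inj[OF b]] using A by blast
  qed
  then show "mcoeff (esym k a) (map_key (apm \<pi>) m) = mcoeff (esym k a) m"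
    unfolding esym_def mcoeff_Abs mdeg_map_key[OF b] fst_keys_map_key[OF b] by (simp only:)
qed

lemma to_fract_sum: "to_fract (sum f A) = (\<Sum>x\<in>A. to_fract (f x))"
  by (induction A rule: infinite_finite_induct) auto

lemma to_fract_prod: "to_fract (prod f A) = (\<Prod>x\<in>A. to_fract (f x))"
  by (induction A rule: infinite_finite_induct) auto

lemma to_fract_power: "to_fract (p ^ n) = to_fract p ^ n"
  by (induction n) auto

text \<open>The coefficient at a degree bound may be zero, unlike a leading coefficient, but it is
  multiplicative all the same. It is applied to the weights \<open>wtp\<close>, with bound
  1.\<close>

lemma coeff_mult_le:
  assumes "degree p \<le> m" "degree q \<le> n"
  shows "coeff (p * q) (m + n) = coeff p m * coeff q n"
proof -
  have "coeff (p * q) (m + n) = (\<Sum>i\<le>m + n. coeff p i * coeff q (m + n - i))" by (rule coeff_mult)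
  also have "\<dots> = (\<Sum>i\<in>{m}. coeff p i * coeff q (m + n - i))"
  proof (rule sum.mono_neutral_right)
    show "\<forall>i\<in>{..m + n} - {m}. coeff p i * coeff q (m + n - i) = 0"
    proof
      fix i assume "i \<in> {..m + n} - {m}"
      then have "i > m \<or> m + n - i > n" by auto
      then show "coeff p i * coeff q (m + n - i) = 0" using assms by (auto simp: coeff_eq_0)
    qed
  qed auto
  finally show ?thesis by simp
qed

lemma coeff_power_le:
  assumes "degree p \<le> m"
  shows "degree (p ^ k) \<le> k * m" "coeff (p ^ k) (k * m) = coeff p m ^ k"
proof -
  show *: "degree (p ^ k) \<le> k * m" for k
    using degree_power_le[of p k] assms by (metis le_trans mult.commute mult_le_mono2)
  show "coeff (p ^ k) (k * m) = coeff p m ^ k"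
  proof (induction k)
    case (Suc k)
    then show ?case using coeff_mult_le[OF assms *[of k]] by simp
  qed simp
qed

lemma coeff_prod_le:
  assumes "\<And>x. x \<in> A \<Longrightarrow> degree (p x) \<le> n x"
  shows "degree (prod p A) \<le> sum n A \<and> coeff (prod p A) (sum n A) = (\<Prod>x\<in>A. coeff (p x) (n x))"
  using assms
proof (induction A rule: infinite_finite_induct)
  case (insert x A)
  then have d: "degree (p x) \<le> n x" "degree (prod p A) \<le> sum n A" by auto
  have "degree (p x * prod p A) \<le> n x + sum n A" using degree_mult_le[of "p x" "prod p A"] d by linarith
  then show ?case using insert coeff_mult_le[OF d] by simp
qed auto

lemma regular_power: "f \<in> regular_ratfun r \<Longrightarrow> f ^ n \<in> regular_ratfun r"
  and tau_power: "f \<in> regular_ratfun r \<Longrightarrow> tau (f ^ n) = tau f ^ n"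
  and eval0_power: "f \<in> regular_ratfun r \<Longrightarrow> eval0 (f ^ n) = eval0 f ^ n"
  using regular.prod_in[of "{..<n}" "\<lambda>_. f" r] tau_prod[of "{..<n}" "\<lambda>_. f" r] regular.hom_prod[of "{..<n}" "\<lambda>_. f" r]
  by simp_all

context wreath begin

lemma homog_q_plus1: "k < r \<Longrightarrow> homog r j (q_plus1 r k j)"
  unfolding q_plus1_eq
proof (intro homog_sum homog_mconst_mult)
  fix a assume "k < r" "a \<in> {..j}"
  then show "homog r j (esym (pred_mod r k) a * hsym k (j - a) :: tratfun sfun)"
    using homog_mult[OF homog_esym[OF pred_mod_less] homog_hsym, of k a "j - a"] by simp
qed

lemma homog_q_plus:
  assumes "\<mu> \<in> mparts r N"
  shows "homog r N (q_plus r \<mu>)"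
proof -
  have "homog r (\<Sum>v\<in>keys (xm \<mu>). lookup (xm \<mu>) v)
      (\<Prod>v\<in>keys (xm \<mu>). q_plus1 r (fst v) (lookup (xm \<mu>) v))"
    using fst_keys_xm[OF assms] by (intro homog_prod homog_q_plus1) auto
  then show ?thesis
    using q_plus_prod[OF assms finite_keys subset_refl] mdeg_xm[OF assms] by (simp add: mdeg_def)
qed

lemma symmetric_q_plus: "symmetric_mfps (q_plus r \<mu>)"
  unfolding q_plus_def q_plus1_eq
  by (intro symmetric_prod symmetric_sum symmetric_mconst_mult symmetric_mult symmetric_esym symmetric_hsym)

lemma wq_regular: "wq x \<in> regular_ratfun r"
  using regular.uminus_in[OF regular_tvar[OF pred_mod_less]] regular.one_in by (simp add: wq_def)

lemma q_plus_regular: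
  assumes \<mu>: "\<mu> \<in> mparts r N"
  shows "mcoeff (q_plus r \<mu>) b \<in> regular_ratfun r"
proof (cases "fst ` keys b \<subseteq> {..<r}")
  case True
  let ?V = "keys (xm \<mu>) \<union> keys b"
  have "mcoeff (q_plus r \<mu>) b = (\<Sum>\<rho>\<in>KR ?V (xm \<mu>) b. \<Prod>x\<in>?V \<times> ?V \<times> UNIV. wq x ^ \<rho> x)"
    by (rule mcoeff_q_plus) (use \<mu> True fst_keys_xm[OF \<mu>] in auto)
  also have "\<dots> \<in> regular_ratfun r"
    by (intro regular.sum_in regular.prod_in regular_power wq_regular)
  finally show ?thesis .
next
  case False
  then have "mcoeff (q_plus r \<mu>) b = 0" using homog_q_plus[OF \<mu>] by (auto simp: homog_def)
  then show ?thesis using regular.zero_in by simp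
qed

lemma q_plus_in_Xi: "\<mu> \<in> mparts r N \<Longrightarrow> q_plus r \<mu> \<in> Xi r N (regular_ratfun r)"
  unfolding Xi_iff using q_plus_regular homog_q_plus symmetric_q_plus by blast

lemma ut_wq: "ut * complexify (tau (wq x)) = to_fract (wtp x)"
proof -
  have "tau (- tvar k) = - inverse ut" if "k < r" for k
  proof -
    have "tau (- tvar k) + tau (tvar k) = 0"
      using tau_add[OF regular.uminus_in[OF regular_tvar] regular_tvar, OF that that] by (simp add: tau_zero)
    then show ?thesis by (simp add: tau_tvar add_eq_0_iff2)
  qed
  then have "tau (- tvar (pred_mod r k)) = - inverse ut" for k using pred_mod_less by blast
  moreover have "to_fract (- 1 :: complex poly) = - 1" by (simp only: to_fract_uminus to_fract_1)
  ultimately show ?thesis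
    by (simp add: wq_def wtp_def tau_one complexify_one complexify_uminus complexify_inverse ut_def[symmetric])
qed

text \<open>The coefficient of t in the weight is the value of \<open>wq\<close> at the origin. So
  the coefficient of t^N in \<open>kernel_sum\<close> computes q^+ at t = 0, while the whole
  polynomial computes it at 1/t.\<close>

lemma coeff_wtp: "coeff (wtp x) 1 = of_rat (eval0 (wq x))"
  using regular.hom_uminus[OF regular_tvar[OF pred_mod_less]] regular.hom_one by (simp add: wtp_def wq_def eval0_tvar)

lemma KR_sum:
  assumes "\<rho> \<in> KR V a b"
  shows "(\<Sum>x\<in>V \<times> V \<times> UNIV. \<rho> x) = N"
  using assms by (simp add: KR_def mults_def)

lemma kernel_sum_KR: "kernel_sum V a b = (\<Sum>\<rho>\<in>KR V a b. \<Prod>x\<in>V \<times> V \<times> UNIV. wtp x ^ \<rho> x)"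
  by (simp add: kernel_sum_def KR_def)

lemma tau_q_plus:
  assumes V: "finite V" "fst ` V \<subseteq> {..<r}" and \<mu>: "\<mu> \<in> mparts r N" and a: "keys (xm \<mu>) \<subseteq> V" and b: "keys b \<subseteq> V"
  shows "ut ^ N * complexify (tau (mcoeff (q_plus r \<mu>) b)) = to_fract (kernel_sum V (xm \<mu>) b)"
proof -
  have "tau (mcoeff (q_plus r \<mu>) b) = (\<Sum>\<rho>\<in>KR V (xm \<mu>) b. \<Prod>x\<in>V \<times> V \<times> UNIV. tau (wq x) ^ \<rho> x)"
    unfolding mcoeff_q_plus[OF assms] by (simp add: tau_sum[of _ _ r] tau_prod[of _ _ r] tau_power[of _ r] regular.prod_in regular_power wq_regular)
  then have "ut ^ N * complexify (tau (mcoeff (q_plus r \<mu>) b)) = (\<Sum>\<rho>\<in>KR V (xm \<mu>) b. ut ^ N * (\<Prod>x\<in>V \<times> V \<times> UNIV. complexify (tau (wq x)) ^ \<rho> x))"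
    by (simp add: complexify_sum complexify_prod complexify_power sum_distrib_left)
  also have "\<dots> = (\<Sum>\<rho>\<in>KR V (xm \<mu>) b. \<Prod>x\<in>V \<times> V \<times> UNIV. to_fract (wtp x) ^ \<rho> x)"
    by (rule sum.cong[OF refl]) (simp only: ut_wq[symmetric] power_mult_distrib prod.distrib power_sum[symmetric] KR_sum)
  finally show ?thesis by (simp add: kernel_sum_KR to_fract_sum to_fract_prod to_fract_power)
qed

lemma eval0_q_plus:
  assumes V: "finite V" "fst ` V \<subseteq> {..<r}" and \<mu>: "\<mu> \<in> mparts r N" and a: "keys (xm \<mu>) \<subseteq> V" and b: "keys b \<subseteq> V"
  shows "of_rat (eval0 (mcoeff (q_plus r \<mu>) b)) = coeff (kernel_sum V (xm \<mu>) b) N"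
proof -
  have eq: "eval0 (mcoeff (q_plus r \<mu>) b) = (\<Sum>\<rho>\<in>KR V (xm \<mu>) b. \<Prod>x\<in>V \<times> V \<times> UNIV. eval0 (wq x) ^ \<rho> x)"
    unfolding mcoeff_q_plus[OF assms]
    by (simp add: regular.hom_sum[of _ _ r] regular.hom_prod[of _ _ r] eval0_power[of _ r] regular.prod_in regular_power wq_regular)
  have d: "degree (wtp x) \<le> 1" for x by (simp add: wtp_def)
  have c: "coeff (\<Prod>x\<in>V \<times> V \<times> UNIV. wtp x ^ \<rho> x) N = (\<Prod>x\<in>V \<times> V \<times> UNIV. of_rat (eval0 (wq x)) ^ \<rho> x)" if "\<rho> \<in> KR V (xm \<mu>) b" for \<rho>
  proof -
    have "coeff (\<Prod>x\<in>V \<times> V \<times> UNIV. wtp x ^ \<rho> x) (\<Sum>x\<in>V \<times> V \<times> UNIV. \<rho> x) = (\<Prod>x\<in>V \<times> V \<times> UNIV. coeff (wtp x ^ \<rho> x) (\<rho> x))"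
      using coeff_prod_le[of "V \<times> V \<times> UNIV" "\<lambda>x. wtp x ^ \<rho> x" \<rho>] coeff_power_le(1)[OF d] by simp
    moreover have "coeff (wtp x ^ \<rho> x) (\<rho> x) = of_rat (eval0 (wq x)) ^ \<rho> x" for x
      using coeff_power_le(2)[OF d, of x "\<rho> x"] coeff_wtp[of x] by simp
    ultimately show ?thesis using KR_sum[OF that] by simp
  qed
  show ?thesis unfolding eq kernel_sum_KR coeff_sum of_rat_sum of_rat_prod of_rat_power
    by (rule sum.cong[OF refl]) (simp only: c)
qed

end

section \<open>The Gram matrix of the Schur functions\<close>

lemma inverse_if_rows_independent:
  fixes A :: "'a \<Rightarrow> 'a \<Rightarrow> 'f::field"
  assumes fin: "finite Z"
    and ind: "\<And>c x. (\<And>y. y \<in> Z \<Longrightarrow> (\<Sum>x\<in>Z. c x * A x y) = 0) \<Longrightarrow> x \<in> Z \<Longrightarrow> c x = 0"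
  obtains B where "\<And>x y. x \<in> Z \<Longrightarrow> y \<in> Z \<Longrightarrow> (\<Sum>z\<in>Z. A x z * B z y) = (if x = y then 1 else 0)"
proof -
  obtain h where h: "bij_betw h {0..<card Z} Z" using ex_bij_betw_nat_finite[OF fin] by blast
  define n where "n = card Z"
  define g where "g = inv_into {0..<n} h"
  have h': "bij_betw h {0..<n} Z" using h by (simp add: n_def)
  have g: "g z < n" "h (g z) = z" if "z \<in> Z" for z
    using that h' bij_betw_inv_into_right[OF h' that] bij_betwE[OF bij_betw_inv_into[OF h']] by (auto simp: g_def)
  have gh: "g (h i) = i" if "i < n" for i
    using bij_betw_inv_into_left[OF h', of i] that by (simp add: g_def)
  \<comment> \<open>Transposed, so that a vector in the kernel is a linear relation between the rows
    of A.\<close>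
  let ?M = "mat n n (\<lambda>(i, j). A (h j) (h i))"
  have M: "?M \<in> carrier_mat n n" by simp
  have "det ?M \<noteq> 0"
  proof
    assume "det ?M = 0"
    then obtain v where v: "v \<in> carrier_vec n" "v \<noteq> 0\<^sub>v n" "?M *\<^sub>v v = 0\<^sub>v n"
      using det_0_iff_vec_prod_zero_field[OF M] by blast
    define c where "c z = v $ g z" for z
    have "(\<Sum>x\<in>Z. c x * A x y) = 0" if y: "y \<in> Z" for y
    proof -
      have "(\<Sum>x\<in>Z. c x * A x y) = (\<Sum>i\<in>{0..<n}. c (h i) * A (h i) y)"
        by (rule sum.reindex_bij_betw[OF h', symmetric])
      also have "\<dots> = (?M *\<^sub>v v) $ g y"
        using v(1) g[OF y] by (auto simp: scalar_prod_def c_def gh mult.commute intro!: sum.cong)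
      finally show ?thesis using v(3) g[OF y] by simp
    qed
    then have "c x = 0" if "x \<in> Z" for x using ind that by blast
    then have "v $ i = 0" if "i < n" for i
      using that bij_betwE[OF h'] gh[OF that] unfolding c_def by (metis atLeastLessThan_iff le0)
    then have "v = 0\<^sub>v n" using v(1) by (intro eq_vecI) auto
    then show False using v(2) by simp
  qed
  from det_non_zero_imp_unit[OF M \<open>det ?M \<noteq> 0\<close>, of undefined]
  obtain B where B: "B \<in> carrier_mat n n" "?M * B = 1\<^sub>m n" "B * ?M = 1\<^sub>m n"
    by (auto simp: Units_def ring_mat_def)
  have "(\<Sum>z\<in>Z. A x z * B $$ (g y, g z)) = (if x = y then 1 else 0)" if x: "x \<in> Z" and y: "y \<in> Z" for x y
  proof -
    have "(\<Sum>z\<in>Z. A x z * B $$ (g y, g z)) = (\<Sum>i\<in>{0..<n}. A x (h i) * B $$ (g y, g (h i)))"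
      by (rule sum.reindex_bij_betw[OF h', symmetric])
    also have "\<dots> = (B * ?M) $$ (g y, g x)"
      using B(1) g[OF x] g[OF y] by (auto simp: scalar_prod_def gh mult.commute intro!: sum.cong)
    also have "\<dots> = (if g y = g x then 1 else 0)" using B(3) g[OF x] g[OF y] by simp
    also have "\<dots> = (if x = y then 1 else 0)" using g[OF x] g[OF y] by metis
    finally show ?thesis .
  qed
  then show thesis by (rule that)
qed

lemma symmetric_power_sum1: "symmetric_mfps (power_sum1 j m)"
  unfolding symmetric_mfps_def
proof (intro allI impI)
  fix \<pi> :: "nat \<Rightarrow> nat \<Rightarrow> nat" and x :: monom_exp
  assume pi: "\<forall>k. bij (\<pi> k)"
  then have b: "bij (apm \<pi>)" by (intro bij_apm) auto
  have "(\<exists>i. map_key (apm \<pi>) x = single (j, i) m) \<longleftrightarrow> (\<exists>i. x = single (j, i) m)"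
  proof
    assume "\<exists>i. map_key (apm \<pi>) x = single (j, i) m"
    then obtain i where i: "map_key (apm \<pi>) x = single (j, i) m" by blast
    have "x = single (j, \<pi> j i) m"
    proof (rule poly_mapping_eqI)
      fix v
      obtain u where u: "v = apm \<pi> u" using bij_is_surj[OF b] by blast
      have "lookup x v = lookup (single (j, i) m) u"
        unfolding i[symmetric] u lookup_map_key[OF bij_is_inj[OF b]] ..
      also have "\<dots> = lookup (single (apm \<pi> (j, i)) m) (apm \<pi> u)"
        using bij_is_inj[OF b] by (simp add: lookup_single when_def inj_eq)
      finally show "lookup x v = lookup (single (j, \<pi> j i) m) v"
        by (simp add: u apm_def)
    qed
    then show "\<exists>i. x = single (j, i) m" by blast
  next
    assume "\<exists>i. x = single (j, i) m"
    then obtain i where i: "x = single (j, i) m" by blast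
    obtain i' where i': "i = \<pi> j i'" using pi bij_is_surj by blast
    have "map_key (apm \<pi>) x = single (j, i') m"
    proof (rule poly_mapping_eqI)
      fix u
      have "(apm \<pi> (j, i') = apm \<pi> u) = ((j, i') = u)" using bij_is_inj[OF b] by (rule inj_eq)
      then show "lookup (map_key (apm \<pi>) x) u = lookup (single (j, i') m) u"
        by (simp add: lookup_map_key[OF bij_is_inj[OF b]] i i' lookup_single when_def apm_def)
    qed
    then show "\<exists>i. map_key (apm \<pi>) x = single (j, i) m" by blast
  qed
  then show "mcoeff (power_sum1 j m) (map_key (apm \<pi>) x) = mcoeff (power_sum1 j m) x"
    by (simp add: power_sum1_def)
qed

lemma symmetric_power_sum: "symmetric_mfps (power_sum r \<zeta> \<nu>)"
  unfolding power_sum_def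
  by (intro symmetric_prod symmetric_sum symmetric_mconst_mult symmetric_power_sum1)

section \<open>Column orthogonality and the inversion of the Frobenius formula\<close>

locale wreath_characters = wreath +
  fixes \<chi> :: "nat list list \<Rightarrow> complex mat \<Rightarrow> complex"
  assumes labelling: "char_labelling r \<zeta> N \<chi>"
begin

abbreviation "W \<equiv> Wgrp N \<zeta>"
abbreviation "T \<equiv> mparts r N"

definition ty :: "complex mat \<Rightarrow> nat list list" where
  "ty w = (SOME \<nu>. \<nu> \<in> T \<and> has_type r N \<zeta> w \<nu>)"

lemma ty: "w \<in> W \<Longrightarrow> ty w \<in> T" "w \<in> W \<Longrightarrow> has_type r N \<zeta> w (ty w)"
  using type_exists[of w] someI_ex[of "\<lambda>\<nu>. \<nu> \<in> T \<and> has_type r N \<zeta> w \<nu>"] unfolding ty_def by blast+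

lemma frobenius: "w \<in> W \<Longrightarrow> power_sum r \<zeta> (ty w) = (\<Sum>\<mu>\<in>T. mconst (\<chi> \<mu> w) * schur \<mu>)"
  using labelling ty unfolding char_labelling_def by blast

lemma card_W: "card W > 0"
  using r by (simp add: card_Wgrp)

lemma character_orthogonality:
  assumes "\<kappa> \<in> T" "\<mu> \<in> T"
  shows "(\<Sum>w\<in>W. \<chi> \<kappa> w * cnj (\<chi> \<mu> w)) = (if \<kappa> = \<mu> then of_nat (card W) else 0)"
proof -
  have b: "bij_betw \<chi> T (irreducible_characters N \<zeta>)" using labelling by (simp add: char_labelling_def)
  then have "\<chi> \<kappa> \<in> irreducible_characters N \<zeta>" "\<chi> \<mu> \<in> irreducible_characters N \<zeta>" using assms by (auto dest: bij_betwE)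
  from W.irreducible_characters_orthogonal[OF this[unfolded irreducible_characters_def]]
  have "(\<Sum>w\<in>W. \<chi> \<kappa> w * cnj (\<chi> \<mu> w)) = (if \<chi> \<kappa> = \<chi> \<mu> then of_nat (card W) else 0)" .
  then show ?thesis using bij_betw_imp_inj_on[OF b] assms by (auto simp: inj_on_def)
qed

text \<open>By the Frobenius formula, the character values at an element are the Schur coordinates
  of a power sum that depends only on the type; Schur functions are linearly independent.\<close>

lemma character_class_function:
  assumes "w \<in> W" "w' \<in> W" "ty w = ty w'" "\<kappa> \<in> T"
  shows "\<chi> \<kappa> w = \<chi> \<kappa> w'"
proof -
  have "(\<Sum>\<mu>\<in>T. (\<chi> \<mu> w - \<chi> \<mu> w') * mcoeff (schur \<mu>) (xm \<nu>)) = 0" for \<nu>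
  proof -
    have "(\<Sum>\<mu>\<in>T. \<chi> \<mu> w * mcoeff (schur \<mu>) (xm \<nu>)) = (\<Sum>\<mu>\<in>T. \<chi> \<mu> w' * mcoeff (schur \<mu>) (xm \<nu>))"
      using arg_cong[OF frobenius[OF assms(1)], of "\<lambda>f. mcoeff f (xm \<nu>)"] arg_cong[OF frobenius[OF assms(2)], of "\<lambda>f. mcoeff f (xm \<nu>)"] assms(3)
      by (simp add: mcoeff_sum)
    then show ?thesis by (simp add: left_diff_distrib sum_subtractf)
  qed
  then have "\<chi> \<kappa> w - \<chi> \<kappa> w' = 0" using schur_independent[of r N "\<lambda>\<mu>. \<chi> \<mu> w - \<chi> \<mu> w'" \<kappa>] assms(4) by blast
  then show ?thesis by simp
qed

text \<open>Row orthogonality, grouped by types, says that the character table times a rescaled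
  conjugate transpose is the identity. Both indices run over \<open>T\<close>, because the labelling
  matches characters with r-partitions; so the table is square and the relation can be
  reversed.\<close>

lemma column_orthogonality:
  assumes w: "w \<in> W" and w': "w' \<in> W"
  shows "(\<Sum>\<kappa>\<in>T. cnj (\<chi> \<kappa> w) * \<chi> \<kappa> w') = (if ty w = ty w' then of_nat (card W) / of_nat (card {v \<in> W. ty v = ty w}) else 0)"
proof -
  define c where "c \<nu> = card {v \<in> W. ty v = \<nu>}" for \<nu>
  \<comment> \<open>The character table as a function of the type, through a chosen element; a type
    without elements would get a zero column, so the table stays square.\<close>
  define X where "X \<kappa> \<nu> = (if c \<nu> = 0 then 0 else \<chi> \<kappa> (SOME v. v \<in> W \<and> ty v = \<nu>))" for \<kappa> \<nu>
  have X: "X \<kappa> (ty v) = \<chi> \<kappa> v" if "v \<in> W" "\<kappa> \<in> T" for \<kappa> v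
  proof -
    have "v \<in> {u \<in> W. ty u = ty v}" using that by simp
    then have "c (ty v) \<noteq> 0" unfolding c_def using W.fin by (metis (no_types, lifting) card_0_eq empty_iff finite_Collect_conjI finite_subset mem_Collect_eq subsetI)
    moreover have "(SOME u. u \<in> W \<and> ty u = ty v) \<in> W \<and> ty (SOME u. u \<in> W \<and> ty u = ty v) = ty v"
      by (rule someI[of _ v]) (use that in simp)
    ultimately show ?thesis using character_class_function[of "SOME u. u \<in> W \<and> ty u = ty v" v \<kappa>] that by (simp add: X_def)
  qed
  have AB: "(\<Sum>\<nu>\<in>T. X \<kappa> \<nu> * (of_nat (c \<nu>) * cnj (X \<mu> \<nu>) / of_nat (card W))) = (if \<kappa> = \<mu> then 1 else 0)"
    if "\<kappa> \<in> T" "\<mu> \<in> T" for \<kappa> \<mu>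
  proof -
    have "(\<Sum>\<nu>\<in>T. X \<kappa> \<nu> * (of_nat (c \<nu>) * cnj (X \<mu> \<nu>) / of_nat (card W))) =
        (\<Sum>\<nu>\<in>T. \<Sum>v\<in>{v \<in> W. ty v = \<nu>}. X \<kappa> (ty v) * cnj (X \<mu> (ty v))) / of_nat (card W)"
      unfolding sum_divide_distrib by (rule sum.cong[OF refl]) (simp add: c_def)
    also have "(\<Sum>\<nu>\<in>T. \<Sum>v\<in>{v \<in> W. ty v = \<nu>}. X \<kappa> (ty v) * cnj (X \<mu> (ty v))) = (\<Sum>v\<in>W. X \<kappa> (ty v) * cnj (X \<mu> (ty v)))"
      using ty(1) by (intro sum.group W.fin finite_mparts) auto
    also have "\<dots> = (\<Sum>v\<in>W. \<chi> \<kappa> v * cnj (\<chi> \<mu> v))" by (rule sum.cong[OF refl]) (simp add: X that)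
    finally show ?thesis using character_orthogonality[OF that] card_W by simp
  qed
  have "(\<Sum>\<kappa>\<in>T. of_nat (c (ty w)) * cnj (X \<kappa> (ty w)) / of_nat (card W) * X \<kappa> (ty w')) = (if ty w = ty w' then 1 else 0)"
    by (rule fin_mat_left_right_inverse[OF finite_mparts, where A = X, OF AB]) (use ty w w' in auto)
  moreover have "(\<Sum>\<kappa>\<in>T. of_nat (c (ty w)) * cnj (X \<kappa> (ty w)) / of_nat (card W) * X \<kappa> (ty w')) =
      of_nat (c (ty w)) / of_nat (card W) * (\<Sum>\<kappa>\<in>T. cnj (\<chi> \<kappa> w) * \<chi> \<kappa> w')"
    unfolding sum_distrib_left by (rule sum.cong[OF refl]) (simp add: X w w')
  moreover have "c (ty w) \<noteq> 0"
  proof -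
    have "w \<in> {v \<in> W. ty v = ty w}" using w by simp
    then show ?thesis unfolding c_def using W.fin by auto
  qed
  ultimately show ?thesis using card_W unfolding c_def[symmetric] by (auto simp: field_simps split: if_splits)
qed

text \<open>Up to the factor |W|, matrices built from functions in this way multiply like the
  functions themselves. Applied to det(t - w) and its reciprocal, it inverts the kernel
  matrix.\<close>

lemma class_matrix_product:
  fixes f g :: "complex mat \<Rightarrow> 'x::field" and emb :: "complex \<Rightarrow> 'x"
  assumes emb: "comm_ring_hom emb"
    and f: "\<And>w w'. w \<in> W \<Longrightarrow> w' \<in> W \<Longrightarrow> ty w = ty w' \<Longrightarrow> f w = f w'"
    and \<kappa>: "\<kappa> \<in> T" "\<kappa>' \<in> T"
  shows "(\<Sum>\<mu>\<in>T. (\<Sum>w\<in>W. emb (cnj (\<chi> \<kappa> w) * \<chi> \<mu> w) * f w) * (\<Sum>v\<in>W. emb (cnj (\<chi> \<mu> v) * \<chi> \<kappa>' v) * g v)) =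
    of_nat (card W) * (\<Sum>w\<in>W. emb (cnj (\<chi> \<kappa> w) * \<chi> \<kappa>' w) * (f w * g w))"
proof -
  interpret emb: comm_ring_hom emb by (rule emb)
  have "(\<Sum>\<mu>\<in>T. (\<Sum>w\<in>W. emb (cnj (\<chi> \<kappa> w) * \<chi> \<mu> w) * f w) * (\<Sum>v\<in>W. emb (cnj (\<chi> \<mu> v) * \<chi> \<kappa>' v) * g v)) =
      (\<Sum>\<mu>\<in>T. \<Sum>v\<in>W. \<Sum>w\<in>W. emb (cnj (\<chi> \<kappa> w)) * f w * (emb (\<chi> \<kappa>' v) * g v) * emb (cnj (\<chi> \<mu> v) * \<chi> \<mu> w))"
    unfolding sum_product by (rule sum.cong[OF refl], subst sum.swap) (simp add: emb.hom_mult mult_ac)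
  also have "\<dots> = (\<Sum>v\<in>W. \<Sum>w\<in>W. emb (cnj (\<chi> \<kappa> w)) * f w * (emb (\<chi> \<kappa>' v) * g v) * emb (\<Sum>\<mu>\<in>T. cnj (\<chi> \<mu> v) * \<chi> \<mu> w))"
    by (subst sum.swap, rule sum.cong[OF refl], subst sum.swap) (simp add: emb.hom_sum sum_distrib_left)
  also have "\<dots> = (\<Sum>v\<in>W. of_nat (card W) * (emb (cnj (\<chi> \<kappa> v) * \<chi> \<kappa>' v) * (f v * g v)))"
  proof (rule sum.cong[OF refl])
    fix v assume v: "v \<in> W"
    let ?C = "{w \<in> W. ty w = ty v}"
    have C: "finite ?C" "card ?C \<noteq> 0" using v W.fin by auto
    let ?e = "emb (of_nat (card W) / of_nat (card ?C))"
    have e: "of_nat (card ?C) * ?e = of_nat (card W)"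
    proof -
      have "emb (of_nat (card ?C) * (of_nat (card W) / of_nat (card ?C))) = emb (of_nat (card W))" using C by simp
      then show ?thesis by (simp only: emb.hom_mult emb.hom_of_nat)
    qed
    have "(\<Sum>w\<in>W. emb (cnj (\<chi> \<kappa> w)) * f w * (emb (\<chi> \<kappa>' v) * g v) * emb (\<Sum>\<mu>\<in>T. cnj (\<chi> \<mu> v) * \<chi> \<mu> w)) =
        (\<Sum>w\<in>W. if ty w = ty v then emb (cnj (\<chi> \<kappa> w)) * f w * (emb (\<chi> \<kappa>' v) * g v) * ?e else 0)"
      by (rule sum.cong[OF refl]) (auto simp: column_orthogonality[OF v])
    also have "\<dots> = (\<Sum>w\<in>?C. emb (cnj (\<chi> \<kappa> w)) * f w * (emb (\<chi> \<kappa>' v) * g v) * ?e)"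
      by (rule sum.inter_filter[OF W.fin, symmetric])
    also have "\<dots> = (\<Sum>w\<in>?C. emb (cnj (\<chi> \<kappa> v)) * f v * (emb (\<chi> \<kappa>' v) * g v) * ?e)"
    proof (rule sum.cong[OF refl])
      fix w assume "w \<in> ?C"
      then have w: "w \<in> W" "ty w = ty v" by auto
      show "emb (cnj (\<chi> \<kappa> w)) * f w * (emb (\<chi> \<kappa>' v) * g v) * ?e = emb (cnj (\<chi> \<kappa> v)) * f v * (emb (\<chi> \<kappa>' v) * g v) * ?e"
        unfolding f[OF w(1) v w(2)] character_class_function[OF w(1) v w(2) \<kappa>(1)] ..
    qed
    also have "\<dots> = emb (cnj (\<chi> \<kappa> v)) * f v * (emb (\<chi> \<kappa>' v) * g v) * (of_nat (card ?C) * ?e)"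
      by (simp add: mult_ac)
    finally show "(\<Sum>w\<in>W. emb (cnj (\<chi> \<kappa> w)) * f w * (emb (\<chi> \<kappa>' v) * g v) * emb (\<Sum>\<mu>\<in>T. cnj (\<chi> \<mu> v) * \<chi> \<mu> w)) =
        of_nat (card W) * (emb (cnj (\<chi> \<kappa> v) * \<chi> \<kappa>' v) * (f v * g v))"
      unfolding e by (simp add: emb.hom_mult mult_ac)
  qed
  finally show ?thesis by (simp only: sum_distrib_left)
qed

text \<open>
  The Frobenius formula is inverted here; the symmetry of the Schur functions follows, without
  the Bender--Knuth involution on tableaux.
\<close>

lemma schur_power_sum:
  assumes "\<kappa> \<in> T"
  shows "schur \<kappa> = mconst (1 / of_nat (card W)) * (\<Sum>w\<in>W. mconst (cnj (\<chi> \<kappa> w)) * power_sum r \<zeta> (ty w))"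
proof (rule mfps_eqI)
  fix m
  have "(\<Sum>w\<in>W. cnj (\<chi> \<kappa> w) * mcoeff (power_sum r \<zeta> (ty w)) m) = (\<Sum>w\<in>W. \<Sum>\<mu>\<in>T. cnj (\<chi> \<kappa> w) * \<chi> \<mu> w * mcoeff (schur \<mu>) m)"
    by (rule sum.cong[OF refl]) (simp add: frobenius mcoeff_sum sum_distrib_left mult.assoc)
  also have "\<dots> = (\<Sum>\<mu>\<in>T. (\<Sum>w\<in>W. \<chi> \<mu> w * cnj (\<chi> \<kappa> w)) * mcoeff (schur \<mu>) m)"
    by (subst sum.swap) (simp add: sum_distrib_left mult_ac)
  also have "\<dots> = (\<Sum>\<mu>\<in>T. if \<mu> = \<kappa> then of_nat (card W) * mcoeff (schur \<mu>) m else 0)"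
    by (rule sum.cong[OF refl]) (simp add: character_orthogonality assms)
  also have "\<dots> = of_nat (card W) * mcoeff (schur \<kappa>) m"
    using assms by (simp add: finite_mparts)
  finally show "mcoeff (schur \<kappa>) m = mcoeff (mconst (1 / of_nat (card W)) * (\<Sum>w\<in>W. mconst (cnj (\<chi> \<kappa> w)) * power_sum r \<zeta> (ty w))) m"
    using card_W by (simp add: mcoeff_sum)
qed

text \<open>Over the complex numbers the symmetry is inherited from the power sums. The coefficients
  being natural numbers, it then holds over every ring.\<close>

lemma symmetric_schur:
  assumes "\<kappa> \<in> T"
  shows "symmetric_mfps (schur \<kappa> :: ('c::comm_ring_1) sfun)"
proof -
  have "symmetric_mfps (schur \<kappa> :: complex sfun)"
    unfolding schur_power_sum[OF assms]
    by (intro symmetric_mconst_mult symmetric_sum symmetric_power_sum)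
  then show ?thesis unfolding symmetric_mfps_def mcoeff_schur_count of_nat_eq_iff by simp
qed

lemma schur_in_Xi:
  assumes "\<kappa> \<in> T" "\<And>k. of_nat k \<in> R"
  shows "schur \<kappa> \<in> Xi r N (R :: 'c::comm_ring_1 set)"
  unfolding Xi_iff using homog_schur[OF assms(1)] symmetric_schur[OF assms(1)] assms(2) by (simp add: mcoeff_schur_count)

end

lemma mm_eq_idm_iff: "mm Z A B = idm Z \<longleftrightarrow> (\<forall>x\<in>Z. \<forall>y\<in>Z. (\<Sum>z\<in>Z. A x z * B z y) = (if x = y then 1 else 0))"
  by (auto simp: mm_def idm_def fun_eq_iff)

text \<open>A change of basis for Gram matrices: if the transition matrix has the form K^T Q K and Y
  inverts it, then K Y K^T inverts Q.\<close>

lemma mm_conjugate_inverse: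
  assumes fin: "finite Z" and z: "zoff Z Y" "zoff Z K"
    and KJ: "mm Z K J = idm Z" and inv: "mm Z (mm Z (trm K) (mm Z Q K)) Y = idm Z" and Q: "zoff Z Q"
  shows "mm Z Q (mm Z (mm Z K Y) (trm K)) = idm Z"
proof -
  have JK: "mm Z (trm J) (trm K) = idm Z" unfolding trm_mm[symmetric] KJ by simp
  have "mm Z (mm Z (trm J) (trm K)) (mm Z (mm Z Q K) Y) = mm Z (trm J) (idm Z)"
    unfolding inv[symmetric] by (simp only: mm_assoc)
  then have "mm Z (mm Z Q K) Y = mm Z (trm J) (idm Z)"
    unfolding JK by (simp add: mm_idm_left fin)
  then have "mm Z (mm Z (mm Z Q K) Y) (trm K) = mm Z (trm J) (mm Z (idm Z) (trm K))" by (simp only: mm_assoc)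
  also have "\<dots> = idm Z" using JK z by (simp add: mm_idm_left fin)
  finally show ?thesis by (simp only: mm_assoc)
qed

section \<open>The transition matrix from q to m, and the Gram matrix of the Schur functions\<close>

context wreath_characters begin

text \<open>One finite set of variables containing all dominant monomials of size N, as the kernel
  identity requires finitely many colours.\<close>

definition Vb :: "(nat \<times> nat) set" where
  "Vb = (\<Union>\<mu>\<in>T. keys (xm \<mu>))"

lemma Vb: "finite Vb" "fst ` Vb \<subseteq> {..<r}" "\<mu> \<in> T \<Longrightarrow> keys (xm \<mu>) \<subseteq> Vb"
  using finite_mparts fst_keys_xm unfolding Vb_def by (blast intro: finite_UN_I finite_keys)+

text \<open>The coordinates of the functions q in the monomial functions, read off at dominant
  monomials.\<close>

definition Mq :: "nat list list \<Rightarrow> nat list list \<Rightarrow> tratfun" where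
  "Mq \<mu> \<kappa> = (if \<mu> \<in> T \<and> \<kappa> \<in> T then mcoeff (q_plus r \<mu>) (xm \<kappa>) else 0)"

lemma Mq_regular: "Mq \<mu> \<kappa> \<in> regular_ratfun r"
  using q_plus_regular regular.zero_in by (simp add: Mq_def)

text \<open>Products of ordinary Kostka numbers. The ring is left open, as the matrix is used over
  the rational numbers, the complex numbers and both kinds of rational functions.\<close>

definition Km :: "nat list list \<Rightarrow> nat list list \<Rightarrow> 'c::comm_ring_1" where
  "Km \<kappa> \<mu> = (if \<kappa> \<in> T \<and> \<mu> \<in> T then mcoeff (schur \<kappa>) (xm \<mu>) else 0)"

lemma zoff_Km: "zoff T Km"
  by (simp add: zoff_def Km_def)

lemma Km_of_nat: "Km \<kappa> \<mu> = of_nat (if \<kappa> \<in> T \<and> \<mu> \<in> T then schur_count \<kappa> (xm \<mu>) else 0)"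
  by (simp add: Km_def mcoeff_schur_count)

lemma of_rat_Km: "of_rat (Km \<kappa> \<mu>) = Km \<kappa> \<mu>"
  by (simp add: Km_of_nat)

lemma cnj_Km: "cnj (Km \<kappa> \<mu>) = Km \<kappa> \<mu>"
  by (simp add: Km_of_nat)

lemma Km_inverse:
  obtains J :: "nat list list \<Rightarrow> nat list list \<Rightarrow> 'f::field" where "mm T Km J = idm T"
proof -
  have "\<exists>J. \<forall>x\<in>T. \<forall>y\<in>T. (\<Sum>z\<in>T. (Km x z :: 'f) * J z y) = (if x = y then 1 else 0)"
  proof (rule inverse_if_rows_independent[OF finite_mparts[of r N], where A = "Km :: _ \<Rightarrow> _ \<Rightarrow> 'f"])
    fix c :: "nat list list \<Rightarrow> 'f" and x
    assume z: "\<And>y. y \<in> T \<Longrightarrow> (\<Sum>x\<in>T. c x * Km x y) = 0" and x: "x \<in> T"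
    show "c x = 0"
    proof (rule schur_independent[OF _ x])
      fix \<mu> assume m: "\<mu> \<in> T"
      have "(\<Sum>\<nu>\<in>T. c \<nu> * mcoeff (schur \<nu>) (xm \<mu>)) = (\<Sum>x\<in>T. c x * Km x \<mu>)"
        by (rule sum.cong[OF refl]) (simp add: Km_def m)
      then show "(\<Sum>\<nu>\<in>T. c \<nu> * mcoeff (schur \<nu>) (xm \<mu>)) = 0" using z[OF m] by simp
    qed
  qed blast
  then obtain J :: "nat list list \<Rightarrow> nat list list \<Rightarrow> 'f" where "\<forall>x\<in>T. \<forall>y\<in>T. (\<Sum>z\<in>T. Km x z * J z y) = (if x = y then 1 else 0)" by blast
  then have "mm T Km J = idm T" unfolding mm_eq_idm_iff .
  then show thesis by (rule that)
qed

definition RR :: "complex mat \<Rightarrow> nat list list \<Rightarrow> complex" where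
  "RR w \<mu> = (\<Sum>\<kappa>\<in>T. \<chi> \<kappa> w * Km \<kappa> \<mu>)"

lemma RR_power_sum: "w \<in> W \<Longrightarrow> \<mu> \<in> T \<Longrightarrow> RR w \<mu> = mcoeff (power_sum r \<zeta> (ty w)) (xm \<mu>)"
  unfolding RR_def by (simp add: frobenius mcoeff_sum Km_def)

text \<open>By the Frobenius formula, the fixed-colouring sums \<open>RW\<close> of the kernel
  identity are combinations of character values with Kostka numbers.\<close>

lemma kernel_characters:
  assumes "\<mu> \<in> T" "\<kappa> \<in> T"
  shows "of_nat (card W) * kernel_sum Vb (xm \<mu>) (xm \<kappa>) = (\<Sum>w\<in>W. [:cnj (RR w \<mu>) * RR w \<kappa>:] * char_poly w)"
proof -
  have "RW Vb q c (xm \<mu>) = RR (wm q c) \<mu>" if q: "q permutes {..<N}" and \<mu>: "\<mu> \<in> T" for q c \<mu>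
  proof -
    have w: "wm q c \<in> W" using q by (auto simp: Wgrp_eq)
    show ?thesis unfolding RR_power_sum[OF w \<mu>] RW_def
      by (rule mcoeff_power_sum[OF q ty(2)[OF w] Vb(1) Vb(2) Vb(3)[OF \<mu>], symmetric])
  qed
  then show ?thesis
    unfolding kernel_identity[OF Vb(1), symmetric] sum_Wgrp using assms by simp
qed

lemma char_poly_W: "w \<in> W \<Longrightarrow> degree (char_poly w) = N \<and> coeff (char_poly w) N = 1"
  using degree_monic_char_poly[of w N] W.carrier by auto

lemma char_poly_nz: "w \<in> W \<Longrightarrow> char_poly w \<noteq> 0"
  using char_poly_W[of w] by auto

lemma RR_product:
  assumes emb: "comm_ring_hom emb"
  shows "(\<Sum>w\<in>W. emb (cnj (RR w \<mu>) * RR w \<kappa>) * f w) =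
    (\<Sum>x\<in>T. emb (Km x \<mu>) * (\<Sum>y\<in>T. (\<Sum>w\<in>W. emb (cnj (\<chi> x w) * \<chi> y w) * f w) * emb (Km y \<kappa>)))"
proof -
  interpret emb: comm_ring_hom emb by (rule emb)
  have "(\<Sum>w\<in>W. emb (cnj (RR w \<mu>) * RR w \<kappa>) * f w) =
      (\<Sum>w\<in>W. \<Sum>x\<in>T. \<Sum>y\<in>T. emb (Km x \<mu>) * (emb (cnj (\<chi> x w) * \<chi> y w) * f w * emb (Km y \<kappa>)))"
    unfolding RR_def cnj_sum complex_cnj_mult cnj_Km sum_product
    unfolding emb.hom_sum sum_distrib_right
    by (intro sum.cong refl) (simp add: emb.hom_mult mult_ac)
  also have "\<dots> = (\<Sum>x\<in>T. \<Sum>w\<in>W. \<Sum>y\<in>T. emb (Km x \<mu>) * (emb (cnj (\<chi> x w) * \<chi> y w) * f w * emb (Km y \<kappa>)))" by (rule sum.swap)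
  also have "\<dots> = (\<Sum>x\<in>T. \<Sum>y\<in>T. \<Sum>w\<in>W. emb (Km x \<mu>) * (emb (cnj (\<chi> x w) * \<chi> y w) * f w * emb (Km y \<kappa>)))" by (rule sum.cong[OF refl], rule sum.swap)
  finally show ?thesis by (simp only: sum_distrib_left sum_distrib_right)
qed

text \<open>Compare the coefficients of t^N in the kernel identity: det(t - w) is monic of degree N,
  so the determinants disappear, and orthogonality of characters leaves K^T K.\<close>

lemma eval0_Mq:
  assumes "\<mu> \<in> T" "\<kappa> \<in> T"
  shows "eval0 (Mq \<mu> \<kappa>) = (\<Sum>x\<in>T. Km x \<mu> * Km x \<kappa>)"
proof -
  have "of_nat (card W) * (of_rat (eval0 (Mq \<mu> \<kappa>)) :: complex) = coeff (of_nat (card W) * kernel_sum Vb (xm \<mu>) (xm \<kappa>)) N"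
    using eval0_q_plus[OF Vb(1,2) assms(1) Vb(3)[OF assms(1)] Vb(3)[OF assms(2)]] assms by (simp add: Mq_def of_nat_poly)
  also have "\<dots> = (\<Sum>w\<in>W. cnj (RR w \<mu>) * RR w \<kappa> * 1)"
    unfolding kernel_characters[OF assms] coeff_sum by (rule sum.cong[OF refl]) (simp add: char_poly_W)
  also have "\<dots> = (\<Sum>x\<in>T. Km x \<mu> * (\<Sum>y\<in>T. (\<Sum>w\<in>W. cnj (\<chi> x w) * \<chi> y w * 1) * Km y \<kappa>))"
    by (rule RR_product[of "\<lambda>x. x"]) (unfold_locales, auto)
  also have "\<dots> = (\<Sum>x\<in>T. Km x \<mu> * (\<Sum>y\<in>T. if y = x then of_nat (card W) * Km y \<kappa> else 0))"
  proof (intro sum.cong refl arg_cong[where f = "(*) _"])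
    fix x y assume "x \<in> T" "y \<in> T"
    then show "(\<Sum>w\<in>W. cnj (\<chi> x w) * \<chi> y w * 1) * Km y \<kappa> = (if y = x then of_nat (card W) * Km y \<kappa> else 0)"
      using character_orthogonality[of y x] by (simp add: mult.commute)
  qed
  also have "\<dots> = of_nat (card W) * of_rat (\<Sum>x\<in>T. Km x \<mu> * Km x \<kappa>)"
    by (simp add: finite_mparts sum_distrib_left of_rat_sum of_rat_mult of_rat_Km mult_ac)
  finally show ?thesis using card_W by simp
qed

definition Yprop :: "(nat list list \<Rightarrow> nat list list \<Rightarrow> tratfun) \<Rightarrow> bool" where
  "Yprop Y \<longleftrightarrow> zoff T Y \<and> (\<forall>x y. Y x y \<in> regular_ratfun r) \<and> mm T Mq Y = idm T"

text \<open>The residue of the transition matrix is K^T K, which is invertible over Q; the local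
  ring lifts this to an inverse with regular entries.\<close>

lemma Yprop_ex: "\<exists>Y. Yprop Y"
proof -
  obtain J :: "nat list list \<Rightarrow> nat list list \<Rightarrow> rat" where J: "mm T Km J = idm T" by (rule Km_inverse)
  have JK: "mm T J Km = idm T"
    using J fin_mat_left_right_inverse[OF finite_mparts[of r N], of Km J] unfolding mm_eq_idm_iff by blast
  have E: "mm T (\<lambda>x y. eval0 (Mq x y)) B = mm T (mm T (trm Km) Km) B" for B
    unfolding mm_def by (intro ext if_cong refl sum.cong arg_cong2[where f = "(*)"]) (simp_all add: eval0_Mq trm_def)
  \<comment> \<open>From K J = 1 the residue K^T K has the inverse J J^T.\<close>
  have "mm T (\<lambda>x y. eval0 (Mq x y)) (mm T J (trm J)) = mm T (trm Km) (mm T (mm T Km J) (trm J))"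
    unfolding E by (simp only: mm_assoc)
  also have "\<dots> = trm (mm T J Km)"
    unfolding J mm_assoc[symmetric] by (simp add: mm_idm_right finite_mparts zoff_Km trm_mm)
  also have "\<dots> = idm T" by (simp add: JK)
  finally have inv: "(\<Sum>z\<in>T. eval0 (Mq x z) * mm T J (trm J) z y) = (if x = y then 1 else 0)" if "x \<in> T" "y \<in> T" for x y
    using that unfolding mm_eq_idm_iff by blast
  obtain Y where Y: "\<And>x y. x \<in> T \<Longrightarrow> y \<in> T \<Longrightarrow> Y x y \<in> regular_ratfun r"
    "\<And>x y. x \<in> T \<Longrightarrow> y \<in> T \<Longrightarrow> (\<Sum>z\<in>T. Mq x z * Y z y) = (if x = y then 1 else 0)"
    by (rule regular.fin_mat_inverse[OF finite_mparts[of r N] Mq_regular, where N = "mm T J (trm J)"]) (rule inv, assumption+, rule that, assumption+)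
  let ?Y = "\<lambda>x y. if x \<in> T \<and> y \<in> T then Y x y else 0"
  have "Yprop ?Y"
    unfolding Yprop_def mm_eq_idm_iff using Y regular.zero_in by (simp add: zoff_def cong: sum.cong)
  then show ?thesis by blast
qed

definition Y :: "nat list list \<Rightarrow> nat list list \<Rightarrow> tratfun" where
  "Y = (SOME Y. Yprop Y)"

lemma Y: "zoff T Y" "Y x y \<in> regular_ratfun r" "mm T Mq Y = idm T"
proof -
  have "Yprop Y" unfolding Y_def by (rule someI_ex[OF Yprop_ex])
  then show "zoff T Y" "Y x y \<in> regular_ratfun r" "mm T Mq Y = idm T" unfolding Yprop_def by blast+
qed

text \<open>As q and m are dual bases, \<open>Y\<close> is the Gram matrix of the monomial
  functions; the Kostka matrix changes to the Schur basis.\<close>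

definition Gram :: "nat list list \<Rightarrow> nat list list \<Rightarrow> tratfun" where
  "Gram = mm T (mm T Km Y) (trm Km)"

lemma Km_regular: "Km x y \<in> regular_ratfun r"
  unfolding Km_of_nat by (rule regular_of_nat)

lemma eval0_Km: "eval0 (Km x y) = Km x y"
  unfolding Km_of_nat by (rule eval0_of_nat)

lemma mm_regular: "(\<And>x y. A x y \<in> regular_ratfun r) \<Longrightarrow> (\<And>x y. B x y \<in> regular_ratfun r) \<Longrightarrow> mm T A B x y \<in> regular_ratfun r"
  unfolding mm_def using regular.zero_in by (auto intro!: regular.sum_in regular.mult_in)

lemma trm_regular: "trm Km x y \<in> regular_ratfun r"
  by (simp add: trm_def Km_regular)

lemma Gram_regular: "Gram x y \<in> regular_ratfun r"
  unfolding Gram_def by (rule mm_regular[OF mm_regular[OF Km_regular Y(2)] trm_regular])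

lemma mm_hom:
  assumes h0: "h 0 = 0" and hs: "\<And>f. (\<And>x. x \<in> T \<Longrightarrow> f x \<in> regular_ratfun r) \<Longrightarrow> h (sum f T) = (\<Sum>x\<in>T. h (f x))"
    and hm: "\<And>x y. x \<in> regular_ratfun r \<Longrightarrow> y \<in> regular_ratfun r \<Longrightarrow> h (x * y) = h x * h y"
    and "\<And>x y. A x y \<in> regular_ratfun r" "\<And>x y. B x y \<in> regular_ratfun r"
  shows "(\<lambda>x y. h (mm T A B x y)) = mm T (\<lambda>x y. h (A x y)) (\<lambda>x y. h (B x y))"
  unfolding mm_def using assms by (auto simp: fun_eq_iff regular.mult_in)

lemma mm_eval0:
  assumes "\<And>x y. A x y \<in> regular_ratfun r" "\<And>x y. B x y \<in> regular_ratfun r"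
  shows "(\<lambda>x y. eval0 (mm T A B x y)) = mm T (\<lambda>x y. eval0 (A x y)) (\<lambda>x y. eval0 (B x y))"
  by (rule mm_hom[of eval0]) (fact regular.hom_zero, erule regular.hom_sum, erule (1) regular.hom_mult, fact+)

lemma complexify_tau_sum:
  "(\<And>x. x \<in> X \<Longrightarrow> f x \<in> regular_ratfun r) \<Longrightarrow> complexify (tau (sum f X)) = (\<Sum>x\<in>X. complexify (tau (f x)))"
  by (simp add: tau_sum[of _ _ r] complexify_sum)

lemma complexify_tau_mult:
  "x \<in> regular_ratfun r \<Longrightarrow> y \<in> regular_ratfun r \<Longrightarrow> complexify (tau (x * y)) = complexify (tau x) * complexify (tau y)"
  by (simp add: tau_mult[of _ r] complexify_mult)

lemma complexify_tau_of_nat: "complexify (tau (of_nat n)) = of_nat n"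
proof (induction n)
  case (Suc n)
  show ?case using Suc by (simp add: tau_add[of _ r] regular_of_nat regular.one_in complexify_add tau_one complexify_one)
qed (simp add: tau_zero complexify_zero)

lemma ct_zero: "complexify (tau 0) = 0" and ct_one: "complexify (tau 1) = 1"
  by (simp_all add: tau_zero complexify_zero tau_one complexify_one)

lemma mm_ct:
  assumes "\<And>x y. A x y \<in> regular_ratfun r" "\<And>x y. B x y \<in> regular_ratfun r"
  shows "(\<lambda>x y. complexify (tau (mm T A B x y))) = mm T (\<lambda>x y. complexify (tau (A x y))) (\<lambda>x y. complexify (tau (B x y)))"
  by (rule mm_hom[of "\<lambda>x. complexify (tau x)"]) (fact ct_zero, erule complexify_tau_sum, erule (1) complexify_tau_mult, fact+)

text \<open>At the origin Y becomes the inverse of K^T K, and K (K^T K)^{-1} K^T is the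
  identity.\<close>

lemma eval0_Gram: "x \<in> T \<Longrightarrow> y \<in> T \<Longrightarrow> eval0 (Gram x y) = (if x = y then 1 else 0)"
proof -
  assume xy: "x \<in> T" "y \<in> T"
  obtain J :: "nat list list \<Rightarrow> nat list list \<Rightarrow> rat" where J: "mm T Km J = idm T" by (rule Km_inverse)
  let ?Y = "\<lambda>x y. eval0 (Y x y)"
  have G: "(\<lambda>x y. eval0 (Gram x y)) = mm T (mm T Km ?Y) (trm Km)"
  proof -
    have 1: "(\<lambda>x y. eval0 (mm T (mm T Km Y) (trm Km) x y)) = mm T (\<lambda>x y. eval0 (mm T Km Y x y)) (\<lambda>x y. eval0 (trm Km x y))"
      by (rule mm_eval0[OF mm_regular[OF Km_regular Y(2)] trm_regular])
    have 2: "(\<lambda>x y. eval0 (mm T Km Y x y)) = mm T (\<lambda>x y. eval0 (Km x y)) ?Y"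
      by (rule mm_eval0[OF Km_regular Y(2)])
    show ?thesis unfolding Gram_def 1 2 unfolding trm_def eval0_Km ..
  qed
  have zY: "zoff T ?Y" using Y(1) regular.hom_zero by (simp add: zoff_def)
  have "(\<lambda>x y. eval0 (mm T Mq Y x y)) = mm T (\<lambda>x y. eval0 (Mq x y)) ?Y"
    by (rule mm_eval0[OF Mq_regular Y(2)])
  moreover have "(\<lambda>x y. eval0 (idm T x y)) = idm T"
    by (auto simp: idm_def fun_eq_iff regular.hom_one regular.hom_zero)
  ultimately have "mm T (\<lambda>x y. eval0 (Mq x y)) ?Y = idm T"
    unfolding Y(3) by simp
  moreover have "mm T (\<lambda>x y. eval0 (Mq x y)) ?Y = mm T (mm T (trm Km) (mm T (idm T) Km)) ?Y"
    unfolding mm_idm_left[OF finite_mparts zoff_Km]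
    unfolding mm_def by (intro ext if_cong refl sum.cong arg_cong2[where f = "(*)"]) (simp_all add: eval0_Mq trm_def)
  ultimately have "mm T (idm T) (mm T (mm T Km ?Y) (trm Km)) = idm T"
    using mm_conjugate_inverse[OF finite_mparts zY zoff_Km J] by (metis zoff_idm)
  then have "(\<lambda>x y. eval0 (Gram x y)) = idm T" unfolding G by (simp add: mm_idm_left finite_mparts)
  then show ?thesis using xy by (simp add: idm_def fun_eq_iff)
qed

definition Gc :: "nat list list \<Rightarrow> nat list list \<Rightarrow> complex poly fract" where
  "Gc \<kappa> \<kappa>' = (if \<kappa> \<in> T \<and> \<kappa>' \<in> T then ut ^ N / of_nat (card W) *
     (\<Sum>w\<in>W. to_fract [:cnj (\<chi> \<kappa> w) * \<chi> \<kappa>' w:] * (1 / to_fract (char_poly w))) else 0)"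

definition Qc :: "nat list list \<Rightarrow> nat list list \<Rightarrow> complex poly fract" where
  "Qc \<kappa> \<kappa>' = (if \<kappa> \<in> T \<and> \<kappa>' \<in> T then
     (\<Sum>w\<in>W. to_fract [:cnj (\<chi> \<kappa> w) * \<chi> \<kappa>' w:] * to_fract (char_poly w)) / (of_nat (card W) * ut ^ N) else 0)"

lemma of_nat_W: "(of_nat (card W) :: complex poly fract) = to_fract [:of_nat (card W):]" "(of_nat (card W) :: complex poly fract) \<noteq> 0"
proof -
  show *: "(of_nat (card W) :: complex poly fract) = to_fract [:of_nat (card W):]" by (simp only: const_fract.hom_of_nat)
  show "(of_nat (card W) :: complex poly fract) \<noteq> 0" unfolding * using card_W by simp
qed

text \<open>\<open>Qc\<close> is built from det(t - w) and \<open>Gc\<close> from its reciprocal;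
  their product is therefore built from the constant function 1, which gives the orthogonality
  relations.\<close>

lemma Qc_Gc: "mm T Qc Gc = idm T"
  unfolding mm_eq_idm_iff
proof (intro ballI)
  fix x y assume x: "x \<in> T" and y: "y \<in> T"
  let ?S = "\<lambda>x y. \<Sum>w\<in>W. to_fract [:cnj (\<chi> x w) * \<chi> y w:] * to_fract (char_poly w)"
  let ?S' = "\<lambda>x y. \<Sum>w\<in>W. to_fract [:cnj (\<chi> x w) * \<chi> y w:] * (1 / to_fract (char_poly w))"
  let ?c = "of_nat (card W) :: complex poly fract"
  have q: "?c \<noteq> 0" by (rule of_nat_W)
  have scal: "A / (c * u) * (u / c * B) = A * B / (c * c)" if "u \<noteq> 0" for A B c u :: "complex poly fract"
    using that by simp
  have "(\<Sum>z\<in>T. Qc x z * Gc z y) = (\<Sum>z\<in>T. ?S x z * ?S' z y / (?c * ?c))"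
    using x y by (intro sum.cong refl) (simp only: Qc_def Gc_def simp_thms if_True scal power_not_zero ut_nonzero not_False_eq_True)
  also have "\<dots> = (\<Sum>z\<in>T. ?S x z * ?S' z y) / (?c * ?c)" by (rule sum_divide_distrib[symmetric])
  also have "(\<Sum>z\<in>T. ?S x z * ?S' z y) = ?c * (\<Sum>w\<in>W. to_fract [:cnj (\<chi> x w) * \<chi> y w:] * (to_fract (char_poly w) * (1 / to_fract (char_poly w))))"
  proof (rule class_matrix_product[OF const_fract.comm_ring_hom_axioms _ x y])
    fix w w' assume w: "w \<in> W" "w' \<in> W" "ty w = ty w'"
    have "has_type r N \<zeta> w' (ty w)" using ty(2)[OF w(2)] w(3) by simp
    then show "to_fract (char_poly w) = to_fract (char_poly w')" using char_poly_type[OF w(1,2) ty(2)[OF w(1)]] by simp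
  qed
  also have "(\<Sum>w\<in>W. to_fract [:cnj (\<chi> x w) * \<chi> y w:] * (to_fract (char_poly w) * (1 / to_fract (char_poly w)))) =
      to_fract [:\<Sum>w\<in>W. \<chi> y w * cnj (\<chi> x w):]"
    unfolding const_fract.hom_sum by (rule sum.cong[OF refl]) (simp add: char_poly_nz mult.commute)
  also have "\<dots> = (if x = y then ?c else 0)"
    unfolding character_orthogonality[OF y x] of_nat_W(1) by simp
  finally show "(\<Sum>z\<in>T. Qc x z * Gc z y) = (if x = y then 1 else 0)" using q by (auto split: if_splits)
qed

lemma ct_Mq: "(\<lambda>x y. complexify (tau (Mq x y))) = mm T (trm Km) (mm T Qc Km)"
proof (intro ext)
  fix \<mu> \<kappa>
  show "complexify (tau (Mq \<mu> \<kappa>)) = mm T (trm Km) (mm T Qc Km) \<mu> \<kappa>"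
  proof (cases "\<mu> \<in> T \<and> \<kappa> \<in> T")
    case True
    then have \<mu>: "\<mu> \<in> T" and \<kappa>: "\<kappa> \<in> T" by auto
    let ?c = "of_nat (card W) :: complex poly fract"
    let ?S = "\<lambda>x y. \<Sum>w\<in>W. to_fract [:cnj (\<chi> x w) * \<chi> y w:] * to_fract (char_poly w)"
    have c0: "?c * ut ^ N \<noteq> 0" using of_nat_W(2) by simp
    have e: "to_fract [:Km x y :: complex:] = Km x y" for x y by (simp only: Km_of_nat const_fract.hom_of_nat)
    have "?c * ut ^ N * complexify (tau (Mq \<mu> \<kappa>)) = ?c * to_fract (kernel_sum Vb (xm \<mu>) (xm \<kappa>))"
      using tau_q_plus[OF Vb(1,2) \<mu> Vb(3)[OF \<mu>] Vb(3)[OF \<kappa>]] \<mu> \<kappa> by (simp add: Mq_def mult.assoc)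
    also have "\<dots> = to_fract (of_nat (card W) * kernel_sum Vb (xm \<mu>) (xm \<kappa>))"
      by (simp only: of_nat_W(1) of_nat_poly to_fract_mult)
    also have "\<dots> = (\<Sum>w\<in>W. to_fract [:cnj (RR w \<mu>) * RR w \<kappa>:] * to_fract (char_poly w))"
      unfolding kernel_characters[OF \<mu> \<kappa>] to_fract_sum to_fract_mult ..
    also have "\<dots> = (\<Sum>x\<in>T. Km x \<mu> * (\<Sum>y\<in>T. ?S x y * Km y \<kappa>))"
      unfolding RR_product[OF const_fract.comm_ring_hom_axioms] e ..
    finally have eq: "?c * ut ^ N * complexify (tau (Mq \<mu> \<kappa>)) = (\<Sum>x\<in>T. Km x \<mu> * (\<Sum>y\<in>T. ?S x y * Km y \<kappa>))" .
    have "mm T (trm Km) (mm T Qc Km) \<mu> \<kappa> = (\<Sum>x\<in>T. Km x \<mu> * (\<Sum>y\<in>T. ?S x y / (?c * ut ^ N) * Km y \<kappa>))"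
      using \<mu> \<kappa> unfolding mm_def trm_def by (simp only: simp_thms if_True) (intro sum.cong refl, simp add: \<kappa> Qc_def)
    also have "\<dots> = (\<Sum>x\<in>T. Km x \<mu> * (\<Sum>y\<in>T. ?S x y * Km y \<kappa>)) / (?c * ut ^ N)"
      by (simp only: times_divide_eq_left sum_divide_distrib[symmetric] times_divide_eq_right)
    also have "\<dots> = complexify (tau (Mq \<mu> \<kappa>))" unfolding eq[symmetric] using c0 by simp
    finally show ?thesis by simp
  next
    case False
    then show ?thesis by (auto simp: mm_def Mq_def tau_zero complexify_zero)
  qed
qed

text \<open>The specialized Gram matrix and \<open>Gc\<close> are both inverse to \<open>Qc\<close>:
  the former by the definition of Y and the specialized transition matrix, the latter by
  \<open>Qc_Gc\<close>.\<close>

lemma ct_Gram: "(\<lambda>x y. complexify (tau (Gram x y))) = Gc"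
proof -
  obtain J :: "nat list list \<Rightarrow> nat list list \<Rightarrow> complex poly fract" where J: "mm T Km J = idm T" by (rule Km_inverse)
  let ?Y = "\<lambda>x y. complexify (tau (Y x y))"
  have e: "complexify (tau (Km x y)) = Km x y" for x y by (simp only: Km_of_nat complexify_tau_of_nat)
  have G: "(\<lambda>x y. complexify (tau (Gram x y))) = mm T (mm T Km ?Y) (trm Km)"
  proof -
    have 1: "(\<lambda>x y. complexify (tau (mm T (mm T Km Y) (trm Km) x y))) = mm T (\<lambda>x y. complexify (tau (mm T Km Y x y))) (\<lambda>x y. complexify (tau (trm Km x y)))"
      by (rule mm_ct[OF mm_regular[OF Km_regular Y(2)] trm_regular])
    have 2: "(\<lambda>x y. complexify (tau (mm T Km Y x y))) = mm T (\<lambda>x y. complexify (tau (Km x y))) ?Y"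
      by (rule mm_ct[OF Km_regular Y(2)])
    show ?thesis unfolding Gram_def 1 2 unfolding trm_def e ..
  qed
  have zY: "zoff T ?Y" using Y(1) ct_zero by (simp add: zoff_def)
  have zQ: "zoff T Qc" and zG: "zoff T Gc" by (simp_all add: zoff_def Qc_def Gc_def)
  have "(\<lambda>x y. complexify (tau (mm T Mq Y x y))) = mm T (\<lambda>x y. complexify (tau (Mq x y))) ?Y"
    by (rule mm_ct[OF Mq_regular Y(2)])
  moreover have "(\<lambda>x y. complexify (tau (idm T x y))) = idm T"
    by (auto simp: idm_def fun_eq_iff ct_one tau_zero)
  ultimately have "mm T (mm T (trm Km) (mm T Qc Km)) ?Y = idm T"
    unfolding Y(3) ct_Mq by simp
  then have QG: "mm T Qc (\<lambda>x y. complexify (tau (Gram x y))) = idm T"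
    unfolding G by (intro mm_conjugate_inverse[OF finite_mparts zY zoff_Km J _ zQ])
  have zC: "zoff T (\<lambda>x y. complexify (tau (Gram x y)))" unfolding G by simp
  have "(\<lambda>x y. complexify (tau (Gram x y))) = mm T (mm T Gc Qc) (\<lambda>x y. complexify (tau (Gram x y)))"
    unfolding mm_left_right_inverse[OF finite_mparts Qc_Gc] by (rule mm_idm_left[OF finite_mparts zC, symmetric])
  also have "\<dots> = Gc" unfolding mm_assoc QG by (rule mm_idm_right[OF finite_mparts zG])
  finally show ?thesis .
qed

end

section \<open>The bilinear form\<close>

lemma schur_image_independent:
  fixes c :: "'t \<Rightarrow> 'c::comm_ring_1"
  assumes \<theta>: "\<theta> \<in> S \<rightarrow> mparts r n" "inj_on \<theta> S"
    and z: "\<And>\<mu>. \<mu> \<in> mparts r n \<Longrightarrow> (\<Sum>\<nu>\<in>S. c \<nu> * mcoeff (schur (\<theta> \<nu>)) (xm \<mu>)) = 0"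
    and \<nu>: "\<nu> \<in> S"
  shows "c \<nu> = 0"
proof -
  define b where "b \<kappa> = (if \<kappa> \<in> \<theta> ` S then c (inv_into S \<theta> \<kappa>) else 0)" for \<kappa>
  have b: "b (\<theta> \<nu>) = c \<nu>" if "\<nu> \<in> S" for \<nu>
    using that \<theta>(2) by (simp add: b_def)
  have "b (\<theta> \<nu>) = 0"
  proof (rule schur_independent)
    show "\<theta> \<nu> \<in> mparts r n" using \<theta>(1) \<nu> by (rule funcset_mem)
    fix \<mu> assume \<mu>: "\<mu> \<in> mparts r n"
    have "(\<Sum>\<kappa>\<in>mparts r n. b \<kappa> * mcoeff (schur \<kappa>) (xm \<mu>)) = (\<Sum>\<kappa>\<in>\<theta> ` S. b \<kappa> * mcoeff (schur \<kappa>) (xm \<mu>))"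
      using \<theta>(1) by (intro sum.mono_neutral_right finite_mparts) (auto simp: b_def)
    also have "\<dots> = (\<Sum>\<nu>\<in>S. c \<nu> * mcoeff (schur (\<theta> \<nu>)) (xm \<mu>))"
      by (simp add: sum.reindex[OF \<theta>(2)] b cong: sum.cong)
    finally show "(\<Sum>\<kappa>\<in>mparts r n. b \<kappa> * mcoeff (schur \<kappa>) (xm \<mu>)) = 0" using z[OF \<mu>] by simp
  qed
  then show ?thesis using b[OF \<nu>] by simp
qed

lemma Xi_add: "f \<in> Xi r N (ratfun r) \<Longrightarrow> g \<in> Xi r N (ratfun r) \<Longrightarrow> f + g \<in> Xi r N (ratfun r)"
  unfolding Xi_iff by (simp add: ratfun_add homog_add symmetric_add)

lemma Xi_zero: "0 \<in> Xi r N (ratfun r)"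
  unfolding Xi_iff by (simp add: ratfun_zero homog_zero symmetric_zero)

lemma Xi_mconst: "c \<in> ratfun r \<Longrightarrow> f \<in> Xi r N (ratfun r) \<Longrightarrow> mconst c * f \<in> Xi r N (ratfun r)"
  unfolding Xi_iff by (simp add: ratfun_mult homog_mconst_mult symmetric_mconst_mult)

lemma Xi_sum: "(\<And>x. x \<in> A \<Longrightarrow> f x \<in> Xi r N (ratfun r)) \<Longrightarrow> sum f A \<in> Xi r N (ratfun r)"
  by (induction A rule: infinite_finite_induct) (auto intro: Xi_add Xi_zero)

lemma Xi_eqI:
  assumes "f \<in> Xi r N R" "g \<in> Xi r N R" "\<And>\<nu>. \<nu> \<in> mparts r N \<Longrightarrow> mcoeff f (xm \<nu>) = mcoeff g (xm \<nu>)"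
  shows "f = g"
  using assms homog_symmetric_eqI[of r N f g] unfolding Xi_iff by blast

text \<open>The map h says how a scalar acts on the values of L: by itself when L is scalar valued,
  and through \<open>mconst\<close> when L takes values in power series.\<close>

lemma linear_combination:
  assumes add: "\<And>f g. f \<in> Xi r N (ratfun r) \<Longrightarrow> g \<in> Xi r N (ratfun r) \<Longrightarrow> L (f + g) = L f + L g"
    and scale: "\<And>c f. c \<in> ratfun r \<Longrightarrow> f \<in> Xi r N (ratfun r) \<Longrightarrow> L (mconst c * f) = h c * (L f :: 'b::comm_ring_1)"
    and h0: "h 0 = 0"
    and A: "finite A" "\<And>x. x \<in> A \<Longrightarrow> c x \<in> ratfun r" "\<And>x. x \<in> A \<Longrightarrow> f x \<in> Xi r N (ratfun r)"
  shows "L (\<Sum>x\<in>A. mconst (c x) * f x) = (\<Sum>x\<in>A. h (c x) * L (f x))"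
  using A
proof (induction A rule: finite_induct)
  case empty
  show ?case using scale[OF ratfun_zero Xi_zero] h0 by simp
next
  case (insert x A)
  have "L (mconst (c x) * f x + (\<Sum>x\<in>A. mconst (c x) * f x)) = L (mconst (c x) * f x) + L (\<Sum>x\<in>A. mconst (c x) * f x)"
    using insert.prems by (intro add Xi_mconst Xi_sum) auto
  then show ?case using insert scale by simp
qed

section \<open>Existence and uniqueness of the bilinear form and of the maps Theta\<close>

context wreath_characters begin

abbreviation "XR \<equiv> Xi r N (ratfun r)"

lemma schur_XR: "\<kappa> \<in> T \<Longrightarrow> schur \<kappa> \<in> XR"
  by (rule schur_in_Xi) (auto intro: ratfun_of_nat)

lemma monomial_XR: "\<kappa> \<in> T \<Longrightarrow> monomial_sym \<kappa> \<in> XR"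
  by (rule monomial_sym_in_Xi) (auto intro: ratfun_zero ratfun_one)

lemma q_XR: "\<kappa> \<in> T \<Longrightarrow> q_plus r \<kappa> \<in> XR"
  using q_plus_in_Xi[of \<kappa>] regular_subset_ratfun unfolding Xi_iff by blast

lemma XR_mcoeff: "f \<in> XR \<Longrightarrow> mcoeff f m \<in> ratfun r"
  unfolding Xi_iff by blast

lemma Y_ratfun: "Y x y \<in> ratfun r"
  using Y(2) regular_subset_ratfun by blast

lemma Y_Mq: "x \<in> T \<Longrightarrow> y \<in> T \<Longrightarrow> (\<Sum>z\<in>T. Y x z * Mq z y) = (if x = y then 1 else 0)"
  using mm_left_right_inverse[OF finite_mparts Y(3)] unfolding mm_eq_idm_iff by blast

lemma Mq_Y: "x \<in> T \<Longrightarrow> y \<in> T \<Longrightarrow> (\<Sum>z\<in>T. Mq x z * Y z y) = (if x = y then 1 else 0)"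
  using Y(3) unfolding mm_eq_idm_iff by blast

text \<open>Coordinates in the basis of the q: the inverse transition matrix expresses each monomial
  function through them.\<close>

definition qc :: "tratfun sfun \<Rightarrow> nat list list \<Rightarrow> tratfun" where
  "qc f \<nu> = (\<Sum>\<kappa>\<in>T. mcoeff f (xm \<kappa>) * Y \<kappa> \<nu>)"

lemma qc_ratfun: "f \<in> XR \<Longrightarrow> qc f \<nu> \<in> ratfun r"
  unfolding qc_def by (intro ratfun_sum ratfun_mult XR_mcoeff Y_ratfun)

lemma q_expansion:
  assumes f: "f \<in> XR"
  shows "f = (\<Sum>\<nu>\<in>T. mconst (qc f \<nu>) * q_plus r \<nu>)"
proof (rule Xi_eqI[OF f])
  show "(\<Sum>\<nu>\<in>T. mconst (qc f \<nu>) * q_plus r \<nu>) \<in> XR"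
    by (intro Xi_sum Xi_mconst qc_ratfun f q_XR)
  fix \<mu> assume m: "\<mu> \<in> T"
  have "mcoeff (\<Sum>\<nu>\<in>T. mconst (qc f \<nu>) * q_plus r \<nu>) (xm \<mu>) = (\<Sum>\<nu>\<in>T. \<Sum>\<kappa>\<in>T. mcoeff f (xm \<kappa>) * (Y \<kappa> \<nu> * Mq \<nu> \<mu>))"
    unfolding mcoeff_sum mcoeff_mconst_mult qc_def sum_distrib_right
    by (intro sum.cong refl) (simp add: Mq_def m mult.assoc)
  also have "\<dots> = (\<Sum>\<kappa>\<in>T. mcoeff f (xm \<kappa>) * (\<Sum>\<nu>\<in>T. Y \<kappa> \<nu> * Mq \<nu> \<mu>))"
    unfolding sum_distrib_left by (rule sum.swap)
  also have "\<dots> = (\<Sum>\<kappa>\<in>T. if \<kappa> = \<mu> then mcoeff f (xm \<kappa>) else 0)"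
    by (rule sum.cong[OF refl]) (simp add: Y_Mq m)
  also have "\<dots> = mcoeff f (xm \<mu>)" using m by (simp add: finite_mparts)
  finally show "mcoeff f (xm \<mu>) = mcoeff (\<Sum>\<nu>\<in>T. mconst (qc f \<nu>) * q_plus r \<nu>) (xm \<mu>)" by simp
qed

lemma m_expansion:
  assumes f: "f \<in> XR"
  shows "f = (\<Sum>\<nu>\<in>T. mconst (mcoeff f (xm \<nu>)) * monomial_sym \<nu>)"
  using monomial_expansion[of r N f] f unfolding Xi_iff by blast

definition Bf :: "tratfun sfun \<Rightarrow> tratfun sfun \<Rightarrow> tratfun" where
  "Bf f g = (if f \<in> XR \<and> g \<in> XR then \<Sum>\<nu>\<in>T. qc f \<nu> * mcoeff g (xm \<nu>) else 0)"

lemma qc_add: "qc (f + g) \<nu> = qc f \<nu> + qc g \<nu>"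
  by (simp add: qc_def distrib_right sum.distrib)

lemma qc_scale: "qc (mconst c * f) \<nu> = c * qc f \<nu>"
  by (simp add: qc_def sum_distrib_left mult.assoc)

lemma is_hl_form_Bf: "is_hl_form r N Bf"
  unfolding is_hl_form_def Let_def
proof (intro conjI ballI allI impI)
  fix f g h assume "f \<in> XR" "g \<in> XR" "h \<in> XR"
  then show "Bf (f + g) h = Bf f h + Bf g h" "Bf h (f + g) = Bf h f + Bf h g"
    by (simp_all add: Bf_def Xi_add qc_add distrib_right distrib_left sum.distrib)
next
  fix c f g assume "c \<in> ratfun r" "f \<in> XR" "g \<in> XR"
  then show "Bf (mconst c * f) g = c * Bf f g" "Bf f (mconst c * g) = c * Bf f g"
    by (simp_all add: Bf_def Xi_mconst qc_scale sum_distrib_left mult.assoc mult.left_commute[of c])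
next
  fix f g assume "f \<notin> XR \<or> g \<notin> XR"
  then show "Bf f g = 0" by (auto simp: Bf_def)
next
  fix \<nu> \<mu> assume n: "\<nu> \<in> T" and m: "\<mu> \<in> T"
  have q: "qc (q_plus r \<nu>) \<kappa> = (if \<nu> = \<kappa> then 1 else 0)" if "\<kappa> \<in> T" for \<kappa>
    unfolding qc_def Mq_Y[OF n that, symmetric] by (rule sum.cong[OF refl]) (simp add: Mq_def n)
  have "Bf (q_plus r \<nu>) (monomial_sym \<mu>) = (\<Sum>\<kappa>\<in>T. if \<nu> = \<kappa> then mcoeff (monomial_sym \<mu>) (xm \<kappa>) else 0)"
    unfolding Bf_def if_P[OF conjI[OF q_XR[OF n] monomial_XR[OF m]]] by (rule sum.cong[OF refl]) (simp add: q)
  also have "\<dots> = (if \<nu> = \<mu> then 1 else 0)"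
    using n m by (auto simp: finite_mparts mcoeff_monomial_sym_xm)
  finally show "Bf (q_plus r \<nu>) (monomial_sym \<mu>) = (if \<nu> = \<mu> then 1 else 0)" .
qed

text \<open>The q and the m both span over \<open>ratfun r\<close>, so bilinearity and the duality
  relations fix the form. The value 0 off its domain makes the description definite for all
  arguments.\<close>

lemma hl_form_eq: "hl_form r N = Bf"
  unfolding hl_form_def
proof (rule the_equality, rule is_hl_form_Bf, intro ext)
  fix B f g
  assume B: "is_hl_form r N B"
  have B1: "B (f + g) h = B f h + B g h" "B h (f + g) = B h f + B h g" if "f \<in> XR" "g \<in> XR" "h \<in> XR" for f g h
    using B that unfolding is_hl_form_def Let_def by blast+
  have B2: "B (mconst c * f) g = c * B f g" "B f (mconst c * g) = c * B f g" if "c \<in> ratfun r" "f \<in> XR" "g \<in> XR" for c f g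
    using B that unfolding is_hl_form_def Let_def by blast+
  have B3: "B (q_plus r \<nu>) (monomial_sym \<mu>) = (if \<nu> = \<mu> then 1 else 0)" if "\<nu> \<in> T" "\<mu> \<in> T" for \<nu> \<mu>
    using B that unfolding is_hl_form_def Let_def by blast
  show "B f g = Bf f g"
  proof (cases "f \<in> XR \<and> g \<in> XR")
    case False
    then show ?thesis using B unfolding is_hl_form_def Let_def Bf_def by auto
  next
    case True
    then have f: "f \<in> XR" and g: "g \<in> XR" by auto
    have "B (q_plus r \<nu>) g = mcoeff g (xm \<nu>)" if n: "\<nu> \<in> T" for \<nu>
    proof -
      have "B (q_plus r \<nu>) (\<Sum>\<mu>\<in>T. mconst (mcoeff g (xm \<mu>)) * monomial_sym \<mu>) = (\<Sum>\<mu>\<in>T. mcoeff g (xm \<mu>) * B (q_plus r \<nu>) (monomial_sym \<mu>))"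
        by (rule linear_combination[where h = "\<lambda>c. c"]) (auto intro: B1 B2 q_XR[OF n] finite_mparts XR_mcoeff[OF g] monomial_XR)
      also have "\<dots> = (\<Sum>\<mu>\<in>T. if \<nu> = \<mu> then mcoeff g (xm \<mu>) else 0)"
        by (rule sum.cong[OF refl]) (simp add: B3 n)
      also have "\<dots> = mcoeff g (xm \<nu>)" using n by (simp add: finite_mparts)
      finally show ?thesis using m_expansion[OF g] by simp
    qed
    moreover have "B (\<Sum>\<nu>\<in>T. mconst (qc f \<nu>) * q_plus r \<nu>) g = (\<Sum>\<nu>\<in>T. qc f \<nu> * B (q_plus r \<nu>) g)"
      by (rule linear_combination[where h = "\<lambda>c. c"]) (auto intro: B1 B2 g finite_mparts qc_ratfun[OF f] q_XR)
    ultimately show ?thesis using q_expansion[OF f] f g by (simp add: Bf_def)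
  qed
qed

lemma Bf_schur:
  assumes "\<kappa> \<in> T" "\<mu> \<in> T"
  shows "Bf (schur \<kappa>) (schur \<mu>) = Gram \<kappa> \<mu>"
  using assms schur_XR by (simp add: Bf_def qc_def Gram_def mm_def trm_def Km_def cong: sum.cong)

lemma hl_form_schur_sum:
  assumes c: "\<And>\<nu>. c \<nu> \<in> ratfun r" and c': "\<And>\<nu>. c' \<nu> \<in> ratfun r"
  shows "hl_form r N (\<Sum>\<nu>\<in>T. mconst (c \<nu>) * schur \<nu>) (\<Sum>\<nu>\<in>T. mconst (c' \<nu>) * schur \<nu>) =
    (\<Sum>\<nu>\<in>T. \<Sum>\<mu>\<in>T. c \<nu> * c' \<mu> * Gram \<nu> \<mu>)"
proof -
  have B1: "Bf (f + g) h = Bf f h + Bf g h" "Bf h (f + g) = Bf h f + Bf h g" if "f \<in> XR" "g \<in> XR" "h \<in> XR" for f g h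
    using is_hl_form_Bf that unfolding is_hl_form_def Let_def by blast+
  have B2: "Bf (mconst c * f) g = c * Bf f g" "Bf f (mconst c * g) = c * Bf f g" if "c \<in> ratfun r" "f \<in> XR" "g \<in> XR" for c f g
    using is_hl_form_Bf that unfolding is_hl_form_def Let_def by blast+
  have s: "(\<Sum>\<nu>\<in>T. mconst (c' \<nu>) * schur \<nu>) \<in> XR" by (intro Xi_sum Xi_mconst c' schur_XR)
  have "Bf (\<Sum>\<nu>\<in>T. mconst (c \<nu>) * schur \<nu>) (\<Sum>\<nu>\<in>T. mconst (c' \<nu>) * schur \<nu>) =
      (\<Sum>\<nu>\<in>T. c \<nu> * Bf (schur \<nu>) (\<Sum>\<nu>\<in>T. mconst (c' \<nu>) * schur \<nu>))"
    by (rule linear_combination[where h = "\<lambda>c. c"]) (auto intro: B1 B2 s finite_mparts c schur_XR)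
  also have "\<dots> = (\<Sum>\<nu>\<in>T. c \<nu> * (\<Sum>\<mu>\<in>T. c' \<mu> * Bf (schur \<nu>) (schur \<mu>)))"
  proof (intro sum.cong refl arg_cong[where f = "(*) _"])
    fix \<nu> assume n: "\<nu> \<in> T"
    show "Bf (schur \<nu>) (\<Sum>\<nu>\<in>T. mconst (c' \<nu>) * schur \<nu>) = (\<Sum>\<mu>\<in>T. c' \<mu> * Bf (schur \<nu>) (schur \<mu>))"
      by (rule linear_combination[where h = "\<lambda>c. c"]) (auto intro: B1 B2 schur_XR[OF n] finite_mparts c' schur_XR)
  qed
  finally show ?thesis by (simp add: hl_form_eq Bf_schur sum_distrib_left mult.assoc)
qed

text \<open>The Kostka matrix is inverted over the regular functions in r indeterminates, because
  coordinates have to lie in \<open>ratfun r\<close> and not merely in the larger ambient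
  field.\<close>

lemma schur_spans:
  obtains c where "\<And>f \<nu>. f \<in> XR \<Longrightarrow> c f \<nu> \<in> ratfun r"
    "\<And>f. f \<in> XR \<Longrightarrow> f = (\<Sum>\<nu>\<in>T. mconst (c f \<nu>) * schur \<nu>)"
    "\<And>f g \<nu>. c (f + g) \<nu> = c f \<nu> + c g \<nu>" "\<And>a f \<nu>. c (mconst a * f) \<nu> = a * c f \<nu>"
    "\<And>\<kappa> \<nu>. \<kappa> \<in> T \<Longrightarrow> \<nu> \<in> T \<Longrightarrow> c (schur \<kappa>) \<nu> = (if \<kappa> = \<nu> then 1 else 0)"
proof -
  obtain J0 :: "nat list list \<Rightarrow> nat list list \<Rightarrow> rat" where J0: "mm T Km J0 = idm T" by (rule Km_inverse)
  have inv: "(\<Sum>z\<in>T. eval0 (Km x z) * J0 z y) = (if x = y then 1 else 0)" if "x \<in> T" "y \<in> T" for x y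
    using J0 that unfolding mm_eq_idm_iff eval0_Km by blast
  obtain J where J: "\<And>x y. x \<in> T \<Longrightarrow> y \<in> T \<Longrightarrow> J x y \<in> regular_ratfun r"
    "\<And>x y. x \<in> T \<Longrightarrow> y \<in> T \<Longrightarrow> (\<Sum>z\<in>T. Km x z * J z y) = (if x = y then 1 else 0)"
    "\<And>x y. x \<in> T \<Longrightarrow> y \<in> T \<Longrightarrow> (\<Sum>z\<in>T. J x z * Km z y) = (if x = y then 1 else 0)"
    by (rule regular.fin_mat_inverse[OF finite_mparts[of r N] Km_regular, where N = J0]) (rule inv, assumption+, rule that, assumption+)
  define c where "c f \<nu> = (if \<nu> \<in> T then \<Sum>\<kappa>\<in>T. mcoeff f (xm \<kappa>) * J \<kappa> \<nu> else 0)" for f \<nu>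
  show thesis
  proof (rule that)
    show c: "c f \<nu> \<in> ratfun r" if "f \<in> XR" for f \<nu>
    proof (cases "\<nu> \<in> T")
      case True
      have "J \<kappa> \<nu> \<in> ratfun r" if "\<kappa> \<in> T" for \<kappa> using J(1)[OF that True] regular_subset_ratfun by blast
      then show ?thesis using True XR_mcoeff[OF that] unfolding c_def by (simp add: ratfun_sum ratfun_mult)
    qed (simp add: c_def ratfun_zero)
    show "f = (\<Sum>\<nu>\<in>T. mconst (c f \<nu>) * schur \<nu>)" if f: "f \<in> XR" for f
    proof (rule Xi_eqI[OF f])
      show "(\<Sum>\<nu>\<in>T. mconst (c f \<nu>) * schur \<nu>) \<in> XR"
        by (intro Xi_sum Xi_mconst c f schur_XR)
      fix \<mu> assume m: "\<mu> \<in> T"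
      have "mcoeff (\<Sum>\<nu>\<in>T. mconst (c f \<nu>) * schur \<nu>) (xm \<mu>) = (\<Sum>\<nu>\<in>T. \<Sum>\<kappa>\<in>T. mcoeff f (xm \<kappa>) * (J \<kappa> \<nu> * Km \<nu> \<mu>))"
        unfolding mcoeff_sum mcoeff_mconst_mult
        by (intro sum.cong refl) (simp add: c_def Km_def m mult.assoc sum_distrib_right)
      also have "\<dots> = (\<Sum>\<kappa>\<in>T. mcoeff f (xm \<kappa>) * (\<Sum>\<nu>\<in>T. J \<kappa> \<nu> * Km \<nu> \<mu>))"
        unfolding sum_distrib_left by (rule sum.swap)
      also have "\<dots> = (\<Sum>\<kappa>\<in>T. if \<kappa> = \<mu> then mcoeff f (xm \<kappa>) else 0)"
        by (rule sum.cong[OF refl]) (simp add: J m)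
      also have "\<dots> = mcoeff f (xm \<mu>)" using m by (simp add: finite_mparts)
      finally show "mcoeff f (xm \<mu>) = mcoeff (\<Sum>\<nu>\<in>T. mconst (c f \<nu>) * schur \<nu>) (xm \<mu>)" by simp
    qed
    show "c (f + g) \<nu> = c f \<nu> + c g \<nu>" for f g \<nu>
      by (simp add: c_def distrib_right sum.distrib)
    show "c (mconst a * f) \<nu> = a * c f \<nu>" for a f \<nu>
      by (simp add: c_def sum_distrib_left mult.assoc)
    show "c (schur \<kappa>) \<nu> = (if \<kappa> = \<nu> then 1 else 0)" if "\<kappa> \<in> T" "\<nu> \<in> T" for \<kappa> \<nu>
      unfolding J(2)[OF that, symmetric] using that by (simp add: c_def Km_def cong: sum.cong)
  qed
qed

lemma Theta_schur_sum:
  assumes a: "\<And>\<nu>. \<nu> \<in> T \<Longrightarrow> a \<nu> \<in> ratfun r"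
  shows "Theta r N \<theta> (\<Sum>\<nu>\<in>T. mconst (a \<nu>) * schur \<nu>) = (\<Sum>\<nu>\<in>T. mconst (a \<nu>) * schur (\<theta> \<nu>))"
proof -
  obtain c where c: "\<And>f \<nu>. f \<in> XR \<Longrightarrow> c f \<nu> \<in> ratfun r"
    "\<And>f. f \<in> XR \<Longrightarrow> f = (\<Sum>\<nu>\<in>T. mconst (c f \<nu>) * schur \<nu>)"
    "\<And>f g \<nu>. c (f + g) \<nu> = c f \<nu> + c g \<nu>" "\<And>a f \<nu>. c (mconst a * f) \<nu> = a * c f \<nu>"
    "\<And>\<kappa> \<nu>. \<kappa> \<in> T \<Longrightarrow> \<nu> \<in> T \<Longrightarrow> c (schur \<kappa>) \<nu> = (if \<kappa> = \<nu> then 1 else 0)"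
    by (rule schur_spans) (rule that, assumption+)
  define P where "P L \<longleftrightarrow> (\<forall>f\<in>XR. \<forall>g\<in>XR. L (f + g) = L f + L g) \<and>
     (\<forall>c\<in>ratfun r. \<forall>f\<in>XR. L (mconst c * f) = mconst c * L f) \<and>
     (\<forall>f. f \<notin> XR \<longrightarrow> L f = 0) \<and>
     (\<forall>\<nu>\<in>T. L (schur \<nu>) = schur (\<theta> \<nu>))" for L :: "tratfun sfun \<Rightarrow> tratfun sfun"
  define L0 where "L0 f = (if f \<in> XR then \<Sum>\<nu>\<in>T. mconst (c f \<nu>) * schur (\<theta> \<nu>) else 0)" for f
  have comb: "L (\<Sum>\<nu>\<in>T. mconst (a \<nu>) * schur \<nu>) = (\<Sum>\<nu>\<in>T. mconst (a \<nu>) * schur (\<theta> \<nu>))"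
    if P: "P L" and a: "\<And>\<nu>. \<nu> \<in> T \<Longrightarrow> a \<nu> \<in> ratfun r" for L a
  proof -
    have "L (\<Sum>\<nu>\<in>T. mconst (a \<nu>) * schur \<nu>) = (\<Sum>\<nu>\<in>T. mconst (a \<nu>) * L (schur \<nu>))"
      by (rule linear_combination) (use P a in \<open>auto simp: P_def finite_mparts schur_XR\<close>)
    then show ?thesis using P by (simp add: P_def cong: sum.cong)
  qed
  have "P L0"
    unfolding P_def
  proof (intro conjI ballI allI impI)
    fix \<nu> assume n: "\<nu> \<in> T"
    have "L0 (schur \<nu>) = (\<Sum>\<mu>\<in>T. if \<nu> = \<mu> then schur (\<theta> \<mu>) else 0)"
      unfolding L0_def if_P[OF schur_XR[OF n]] by (rule sum.cong[OF refl]) (simp add: c(5) n)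
    then show "L0 (schur \<nu>) = schur (\<theta> \<nu>)" using n by (simp add: finite_mparts)
  qed (auto simp: L0_def Xi_add Xi_mconst c(3,4) mconst_add mconst_mult distrib_right sum.distrib sum_distrib_left mult.assoc)
  moreover have "L = L0" if "P L" for L
  proof
    fix f show "L f = L0 f"
    proof (cases "f \<in> XR")
      case True
      have "L (\<Sum>\<nu>\<in>T. mconst (c f \<nu>) * schur \<nu>) = (\<Sum>\<nu>\<in>T. mconst (c f \<nu>) * schur (\<theta> \<nu>))"
        by (rule comb[OF that, of "c f"]) (rule c(1)[OF True])
      then show ?thesis unfolding L0_def if_P[OF True] c(2)[OF True, symmetric] .
    qed (use that in \<open>simp add: P_def L0_def\<close>)
  qed
  ultimately have "Theta r N \<theta> = L0"
    unfolding Theta_def Let_def P_def[symmetric] by (rule the_equality)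
  then show ?thesis using comb[OF \<open>P L0\<close> a] by simp
qed

text \<open>Distinct \<nu> go to distinct Schur functions, so \<open>Theta\<close> is injective on
  its domain and \<open>inv_into\<close> is a genuine inverse on the image.\<close>

lemma back_schur_sum:
  assumes \<theta>: "\<theta> \<in> T \<rightarrow> mparts r n" "inj_on \<theta> T" and a: "\<And>\<nu>. \<nu> \<in> T \<Longrightarrow> a \<nu> \<in> ratfun r"
  shows "inv_into XR (Theta r N \<theta>) (\<Sum>\<nu>\<in>T. mconst (a \<nu>) * schur (\<theta> \<nu>)) = (\<Sum>\<nu>\<in>T. mconst (a \<nu>) * schur \<nu>)"
proof -
  obtain c where c: "\<And>f \<nu>. f \<in> XR \<Longrightarrow> c f \<nu> \<in> ratfun r"
    "\<And>f. f \<in> XR \<Longrightarrow> f = (\<Sum>\<nu>\<in>T. mconst (c f \<nu>) * schur \<nu>)"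
    by (rule schur_spans) (rule that, assumption+)
  have "inj_on (Theta r N \<theta>) XR"
  proof (rule inj_onI)
    fix f g assume f: "f \<in> XR" and g: "g \<in> XR" and eq: "Theta r N \<theta> f = Theta r N \<theta> g"
    have T: "Theta r N \<theta> h = (\<Sum>\<nu>\<in>T. mconst (c h \<nu>) * schur (\<theta> \<nu>))" if "h \<in> XR" for h
      using Theta_schur_sum[of "c h" \<theta>] c(1,2)[OF that] by simp
    have "c f \<nu> - c g \<nu> = 0" if "\<nu> \<in> T" for \<nu>
    proof (rule schur_image_independent[OF \<theta> _ that, where c = "\<lambda>\<nu>. c f \<nu> - c g \<nu>"])
      fix \<mu>
      have "(\<Sum>\<nu>\<in>T. (c f \<nu> - c g \<nu>) * mcoeff (schur (\<theta> \<nu>)) (xm \<mu>)) =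
          mcoeff (Theta r N \<theta> f) (xm \<mu>) - mcoeff (Theta r N \<theta> g) (xm \<mu>)"
        unfolding T[OF f] T[OF g] by (simp add: mcoeff_sum left_diff_distrib sum_subtractf)
      then show "(\<Sum>\<nu>\<in>T. (c f \<nu> - c g \<nu>) * mcoeff (schur (\<theta> \<nu>)) (xm \<mu>)) = 0" using eq by simp
    qed
    then have "(\<Sum>\<nu>\<in>T. mconst (c f \<nu>) * schur \<nu>) = (\<Sum>\<nu>\<in>T. mconst (c g \<nu>) * schur \<nu>)" by simp
    then show "f = g" using c(2)[OF f] c(2)[OF g] by simp
  qed
  moreover have "(\<Sum>\<nu>\<in>T. mconst (a \<nu>) * schur \<nu>) \<in> XR" by (intro Xi_sum Xi_mconst a schur_XR)
  ultimately show ?thesis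
    using inv_into_f_f[of "Theta r N \<theta>" XR "\<Sum>\<nu>\<in>T. mconst (a \<nu>) * schur \<nu>"] Theta_schur_sum[of a \<theta>] a by simp
qed

end

section \<open>Symbols\<close>

lemma shift_nth: "k < length s \<Longrightarrow> shift e s L ! k = map (\<lambda>a. a + e) (L ! k) @ [s ! k]"
  by (simp add: shift_def)

lemma length_shift [simp]: "length (shift e s L) = length s"
  by (simp add: shift_def)

lemma length_shift_iter: "length L = length s \<Longrightarrow> length ((shift e s ^^ i) L) = length s"
  by (cases i) auto

lemma length_row_shift_iter:
  "length L = length s \<Longrightarrow> k < length s \<Longrightarrow> length ((shift e s ^^ i) L ! k) = length (L ! k) + i"
  by (induction i) (auto simp: shift_nth)

lemma shift_inj:
  assumes "length L = length s" "length L' = length s" "shift e s L = shift e s L'"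
  shows "L = L'"
proof (rule nth_equalityI)
  fix k assume "k < length L"
  then have k: "k < length s" using assms by simp
  have "map (\<lambda>a. a + e) (L ! k) @ [s ! k] = map (\<lambda>a. a + e) (L' ! k) @ [s ! k]"
    using arg_cong[OF assms(3), of "\<lambda>M. M ! k"] by (simp add: shift_nth k)
  then have "map (\<lambda>a. a + e) (L ! k) = map (\<lambda>a. a + e) (L' ! k)" by simp
  moreover have "inj (\<lambda>a. a + e)" by (simp add: inj_on_def)
  ultimately show "L ! k = L' ! k" by (metis inj_map_eq_map)
qed (simp add: assms)

lemma shift_iter_inj:
  "length L = length s \<Longrightarrow> length L' = length s \<Longrightarrow> (shift e s ^^ i) L = (shift e s ^^ i) L' \<Longrightarrow> L = L'"
proof (induction i)
  case (Suc i)
  have "(shift e s ^^ i) L = (shift e s ^^ i) L'"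
    by (rule shift_inj[where s = s and e = e]) (use Suc.prems in \<open>auto simp: length_shift_iter\<close>)
  then show ?case using Suc by blast
qed simp

lemma mset_concat: "mset (concat L) = (\<Sum>R\<leftarrow>L. mset R)"
  by (induction L) auto

lemma mset_concat_shift:
  assumes "length L = length s"
  shows "mset (concat (shift e s L)) = image_mset (\<lambda>a. a + e) (mset (concat L)) + mset s"
proof -
  have L: "L = map (\<lambda>k. L ! k) [0..<length s]" using assms map_nth[of L] by simp
  have "mset (concat (shift e s L)) = (\<Sum>k\<leftarrow>[0..<length s]. image_mset (\<lambda>a. a + e) (mset (L ! k)) + {#s ! k#})"
    by (simp add: shift_def mset_concat comp_def)
  also have "\<dots> = (\<Sum>k\<leftarrow>[0..<length s]. image_mset (\<lambda>a. a + e) (mset (L ! k))) + (\<Sum>k\<leftarrow>[0..<length s]. {#s ! k#})"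
    by (rule sum_list_addf)
  also have "(\<Sum>k\<leftarrow>[0..<length s]. {#s ! k#}) = mset s"
  proof -
    have "(\<Sum>x\<leftarrow>xs. {#x#}) = mset xs" for xs :: "nat list" by (induction xs) auto
    note gen = this
    have "(\<Sum>k\<leftarrow>[0..<length s]. {#s ! k#}) = (\<Sum>x\<leftarrow>map ((!) s) [0..<length s]. {#x#})" by (simp only: map_map comp_def)
    then show ?thesis unfolding map_nth gen .
  qed
  also have "(\<Sum>k\<leftarrow>[0..<length s]. image_mset (\<lambda>a. a + e) (mset (L ! k))) = image_mset (\<lambda>a. a + e) (mset (concat L))"
  proof -
    have "(\<Sum>R\<leftarrow>M. image_mset (\<lambda>a. a + e) (mset R)) = image_mset (\<lambda>a. a + e) (mset (concat M))" for M :: "nat list list"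
      by (induction M) auto
    note gen = this
    have "(\<Sum>k\<leftarrow>[0..<length s]. image_mset (\<lambda>a. a + e) (mset (L ! k))) =
        (\<Sum>R\<leftarrow>map (\<lambda>k. L ! k) [0..<length s]. image_mset (\<lambda>a. a + e) (mset R))" by (simp only: map_map comp_def)
    then show ?thesis unfolding L[symmetric] gen .
  qed
  finally show ?thesis .
qed

lemma mset_concat_shift_iter:
  assumes "length L = length s" "length L' = length s" "mset (concat L) = mset (concat L')"
  shows "mset (concat ((shift e s ^^ i) L)) = mset (concat ((shift e s ^^ i) L'))"
  using assms by (induction i) (simp_all add: mset_concat_shift length_shift_iter)

section \<open>Shift classes, similarity and defect\<close>

definition Zt :: "nat \<Rightarrow> nat list \<Rightarrow> nat list list set" where
  "Zt e s = {L. \<exists>m. length m = length s \<and> L \<in> Ztilde e s m}"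

lemma length_Zt: "L \<in> Zt e s \<Longrightarrow> length L = length s"
  by (auto simp: Zt_def Ztilde_def)

lemma shift_rel_iff: "(L, L') \<in> shift_rel e s \<longleftrightarrow> L \<in> Zt e s \<and> L' = shift e s L"
  by (auto simp: shift_rel_def Zt_def)

lemma shift_Zt:
  assumes "L \<in> Zt e s"
  shows "shift e s L \<in> Zt e s"
proof -
  obtain m where m: "length m = length s" "L \<in> Ztilde e s m" using assms by (auto simp: Zt_def)
  have "shift e s L \<in> Ztilde e s (map Suc m)"
    unfolding Ztilde_def
  proof (intro CollectI conjI allI impI)
    fix k assume k: "k < length s"
    have row: "length (L ! k) = m ! k" "\<And>i. Suc i < m ! k \<Longrightarrow> L ! k ! i \<ge> L ! k ! Suc i + e" "m ! k > 0 \<Longrightarrow> last (L ! k) \<ge> s ! k"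
      using m(2) k by (auto simp: Ztilde_def)
    have mk: "map Suc m ! k = Suc (m ! k)" using k m(1) by simp
    show "length (shift e s L ! k) = map Suc m ! k" using k mk row by (simp add: shift_nth)
    show "last (shift e s L ! k) \<ge> s ! k" using k by (simp add: shift_nth)
    fix i assume "Suc i < map Suc m ! k"
    then have i: "i < m ! k" using mk by simp
    show "shift e s L ! k ! i \<ge> shift e s L ! k ! Suc i + e"
    proof (cases "Suc i < m ! k")
      case True
      then show ?thesis using row k i by (simp add: shift_nth nth_append)
    next
      case False
      then have "Suc i = m ! k" using i by simp
      moreover have "last (L ! k) = L ! k ! i" using row(1) i calculation by (metis Zero_not_Suc diff_Suc_1 last_conv_nth length_0_conv)
      ultimately show ?thesis using row k i by (simp add: shift_nth nth_append)
    qed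
  qed simp
  then show ?thesis using m(1) unfolding Zt_def by (intro CollectI exI[of _ "map Suc m"]) simp
qed

lemma symb_class_step:
  assumes "L \<in> symb_class e s L0" "(L, L') \<in> shift_rel e s \<or> (L', L) \<in> shift_rel e s"
  shows "L' \<in> symb_class e s L0"
  using assms unfolding symb_class_def Image_singleton_iff by (meson UnI1 UnI2 converse_iff rtrancl.rtrancl_into_rtrancl)

lemma symb_class_induct [consumes 1, case_names base step]:
  assumes "L \<in> symb_class e s L0" "P L0"
    and "\<And>L L'. P L \<Longrightarrow> (L, L') \<in> shift_rel e s \<or> (L', L) \<in> shift_rel e s \<Longrightarrow> P L'"
  shows "P L"
proof -
  have "(L0, L) \<in> (shift_rel e s \<union> (shift_rel e s)\<inverse>)\<^sup>*" using assms(1) by (simp add: symb_class_def)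
  then show ?thesis
    by (induction rule: rtrancl_induct) (use assms(2,3) in auto)
qed

lemma symb_class_refl: "L0 \<in> symb_class e s L0"
  by (simp add: symb_class_def)

lemma symb_class_Zt:
  assumes "L \<in> symb_class e s L0" "L0 \<in> Zt e s"
  shows "L \<in> Zt e s"
  using assms by (induction rule: symb_class_induct) (auto simp: shift_rel_iff intro: shift_Zt)

lemma symb_class_shift_iter:
  assumes "L \<in> symb_class e s L0" "L0 \<in> Zt e s"
  shows "(shift e s ^^ i) L \<in> symb_class e s L0"
proof (induction i)
  case (Suc i)
  have "(shift e s ^^ i) L \<in> Zt e s" by (rule symb_class_Zt[OF Suc assms(2)])
  then show ?case by (auto intro!: symb_class_step[OF Suc] simp: shift_rel_iff)
qed (simp add: assms)

text \<open>The generating relation is a function, so any zigzag of shifts and inverse shifts can be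
  resolved by shifting both ends further.\<close>

lemma symb_class_common_shift:
  assumes "L \<in> symb_class e s L0"
  shows "\<exists>i j. (shift e s ^^ i) L0 = (shift e s ^^ j) L"
  using assms
proof (induction rule: symb_class_induct)
  case base
  show ?case by (intro exI[of _ 0]) simp
next
  case (step L L')
  then obtain i j where ij: "(shift e s ^^ i) L0 = (shift e s ^^ j) L" by blast
  from step.hyps show ?case
  proof
    assume "(L, L') \<in> shift_rel e s"
    then have "L' = shift e s L" by (simp add: shift_rel_iff)
    then have "(shift e s ^^ Suc i) L0 = (shift e s ^^ j) L'" using ij by (simp add: funpow_swap1)
    then show ?thesis by blast
  next
    assume "(L', L) \<in> shift_rel e s"
    then have "L = shift e s L'" by (simp add: shift_rel_iff)
    then have "(shift e s ^^ i) L0 = (shift e s ^^ Suc j) L'" using ij by (simp add: funpow_swap1)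
    then show ?thesis by blast
  qed
qed

lemma similar_sym: "similar \<Lambda> \<Lambda>' \<Longrightarrow> similar \<Lambda>' \<Lambda>"
  unfolding similar_def by metis

lemma similar_refl: "\<Lambda> \<noteq> {} \<Longrightarrow> similar \<Lambda> \<Lambda>"
  unfolding similar_def by blast

text \<open>The two given representatives of the middle class become equal after suitable shifts.
  Shifting both members of a pair preserves equality of entry multisets, since the new multiset
  depends only on the old one and on e and s.\<close>

lemma similar_trans:
  assumes "L1 \<in> Zt e s" "L2 \<in> Zt e s" "L3 \<in> Zt e s"
    and "similar (symb_class e s L1) (symb_class e s L2)" "similar (symb_class e s L2) (symb_class e s L3)"
  shows "similar (symb_class e s L1) (symb_class e s L3)"
proof -
  obtain A B where AB: "A \<in> symb_class e s L1" "B \<in> symb_class e s L2" "mset (concat A) = mset (concat B)"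
    using assms(4) by (auto simp: similar_def)
  obtain B' C where BC: "B' \<in> symb_class e s L2" "C \<in> symb_class e s L3" "mset (concat B') = mset (concat C)"
    using assms(5) by (auto simp: similar_def)
  obtain i j where ij: "(shift e s ^^ i) L2 = (shift e s ^^ j) B" using symb_class_common_shift[OF AB(2)] by blast
  obtain i' j' where ij': "(shift e s ^^ i') L2 = (shift e s ^^ j') B'" using symb_class_common_shift[OF BC(1)] by blast
  \<comment> \<open>Both B and B' are moved to the same iterated shift of \<open>L2\<close>, the one
    with i + i' steps.\<close>
  have "(shift e s ^^ (i' + j)) B = (shift e s ^^ i') ((shift e s ^^ j) B)" by (simp add: funpow_add)
  also have "\<dots> = (shift e s ^^ (i' + i)) L2" by (simp only: ij[symmetric] funpow_add o_apply)
  also have "\<dots> = (shift e s ^^ (i + i')) L2" by (simp only: add.commute)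
  also have "\<dots> = (shift e s ^^ (i + j')) B'" by (simp only: ij' funpow_add o_apply)
  finally have eq: "(shift e s ^^ (i' + j)) B = (shift e s ^^ (i + j')) B'" .
  note len = length_Zt[OF symb_class_Zt]
  have "mset (concat ((shift e s ^^ (i' + j)) A)) = mset (concat ((shift e s ^^ (i' + j)) B))"
    by (rule mset_concat_shift_iter[OF len[OF AB(1) assms(1)] len[OF AB(2) assms(2)] AB(3)])
  also have "\<dots> = mset (concat ((shift e s ^^ (i + j')) C))"
    unfolding eq by (rule mset_concat_shift_iter[OF len[OF BC(1) assms(2)] len[OF BC(2) assms(3)] BC(3)])
  finally show ?thesis
    using symb_class_shift_iter[OF AB(1) assms(1)] symb_class_shift_iter[OF BC(2) assms(3)] unfolding similar_def by blast
qed

lemma defect_rep_shift: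
  assumes "length L = length s" "s \<noteq> []"
  shows "defect_rep (shift e s L) = defect_rep L"
proof -
  have L: "L = map (\<lambda>k. L ! k) [0..<length s]" using assms map_nth[of L] by simp
  have img: "length ` set (shift e s L) = Suc ` (length ` set L)"
  proof -
    have "length ` set (shift e s L) = (\<lambda>k. Suc (length (L ! k))) ` {0..<length s}" by (simp add: shift_def image_image)
    also have "\<dots> = Suc ` (length ` set (map (\<lambda>k. L ! k) [0..<length s]))" by (simp add: image_image)
    finally show ?thesis using L by simp
  qed
  have "L \<noteq> []" using assms by auto
  then have "Min (Suc ` (length ` set L)) = Suc (Min (length ` set L))"
    by (intro mono_Min_commute[symmetric]) (auto simp: mono_def)
  then show ?thesis
    using assms by (intro nth_equalityI) (auto simp: defect_rep_def img shift_nth)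
qed

lemma defect_rep_class:
  assumes "L \<in> symb_class e s L0" "L0 \<in> Zt e s" "s \<noteq> []"
  shows "defect_rep L = defect_rep L0"
  using assms by (induction rule: symb_class_induct) (auto simp: shift_rel_iff defect_rep_shift length_Zt)

lemma defect_symb_class:
  assumes "L0 \<in> Zt e s" "s \<noteq> []"
  shows "defect (symb_class e s L0) = defect_rep L0"
proof -
  have "defect_rep ` symb_class e s L0 = (\<lambda>_. defect_rep L0) ` symb_class e s L0"
    by (rule image_cong[OF refl]) (rule defect_rep_class[OF _ assms])
  also have "\<dots> = {defect_rep L0}" by (rule image_constant[OF symb_class_refl])
  finally have "defect_rep ` symb_class e s L0 = {defect_rep L0}" .
  then show ?thesis by (simp add: defect_def)
qed

text \<open>A common shift exists; equal row lengths force the same number of steps on both sides,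
  and shifting is injective.\<close>

lemma symb_class_eqD:
  assumes "symb_class e s L = symb_class e s L'" "length L = length s" "length L' = length s" "s \<noteq> []"
    and rows: "\<And>k. k < length s \<Longrightarrow> length (L ! k) = length (L' ! k)"
  shows "L = L'"
proof -
  have "L' \<in> symb_class e s L" using assms(1) symb_class_refl by blast
  then obtain i j where ij: "(shift e s ^^ i) L = (shift e s ^^ j) L'" using symb_class_common_shift by blast
  have 0: "0 < length s" using assms(4) by simp
  have "length (L ! 0) + i = length (L' ! 0) + j"
    using arg_cong[OF ij, of "\<lambda>M. length (M ! 0)"] unfolding length_row_shift_iter[OF assms(2) 0] length_row_shift_iter[OF assms(3) 0] .
  then have "i = j" using rows[OF 0] by simp
  then show ?thesis using shift_iter_inj[OF assms(2,3)] ij by blast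
qed

section \<open>The representatives attached to r-partitions\<close>

definition rep :: "nat \<Rightarrow> nat list \<Rightarrow> nat list \<Rightarrow> nat \<Rightarrow> nat list list \<Rightarrow> nat list list" where
  "rep e s d N \<nu> = add_mpart (Lambda0 e s (map (\<lambda>x. x + N) d)) \<nu>"

lemma symb_of_rep: "\<nu> \<in> mparts (length s) N \<Longrightarrow> symb_of e s d \<nu> = symb_class e s (rep e s d N \<nu>)"
  by (simp add: symb_of_def rep_def mparts_def)

lemma rep_nth:
  assumes "k < length s" "length d = length s"
  shows "rep e s d N \<nu> ! k = map (\<lambda>i. s ! k + (d ! k + N - Suc i) * e + rown (\<nu> ! k) i) [0..<d ! k + N]"
  using assms by (intro nth_equalityI) (auto simp: rep_def add_mpart_def Lambda0_def rown_def)

lemma length_rep: "length (rep e s d N \<nu>) = length s"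
  by (simp add: rep_def add_mpart_def Lambda0_def)

lemma rown_mono:
  assumes "is_partition \<nu>" "i \<le> j"
  shows "rown \<nu> j \<le> rown \<nu> i"
  using assms by (auto simp: is_partition_def rown_def sorted_rev_iff_nth_mono)

lemma rep_Zt:
  assumes "length d = length s" "\<nu> \<in> mparts (length s) N"
  shows "rep e s d N \<nu> \<in> Zt e s"
proof -
  have "rep e s d N \<nu> \<in> Ztilde e s (map (\<lambda>x. x + N) d)"
    unfolding Ztilde_def
  proof (intro CollectI conjI allI impI length_rep)
    fix k assume k: "k < length s"
    have p: "is_partition (\<nu> ! k)" using assms(2) k by (simp add: mparts_def)
    have m: "map (\<lambda>x. x + N) d ! k = d ! k + N" using k assms(1) by simp
    show "length (rep e s d N \<nu> ! k) = map (\<lambda>x. x + N) d ! k" using m by (simp add: rep_nth k assms(1))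
    {
      fix i assume i: "Suc i < map (\<lambda>x. x + N) d ! k"
      have "rown (\<nu> ! k) (Suc i) \<le> rown (\<nu> ! k) i" using rown_mono[OF p] by simp
      moreover have "d ! k + N - Suc i = Suc (d ! k + N - Suc (Suc i))" using i m by simp
      ultimately show "rep e s d N \<nu> ! k ! Suc i + e \<le> rep e s d N \<nu> ! k ! i"
        using i m by (simp add: rep_nth k assms(1))
    }
    assume "0 < map (\<lambda>x. x + N) d ! k"
    then show "s ! k \<le> last (rep e s d N \<nu> ! k)" using m by (simp add: rep_nth k assms(1) last_map)
  qed
  then show ?thesis using assms(1) by (auto simp: Zt_def intro!: exI[of _ "map (\<lambda>x. x + N) d"])
qed

lemma defect_rep_rep:
  assumes "length d = length s" "Min (set d) = 0" "s \<noteq> []"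
  shows "defect_rep (rep e s d N \<nu>) = d"
proof -
  have r: "rep e s d N \<nu> = map (\<lambda>k. rep e s d N \<nu> ! k) [0..<length s]" using map_nth[of "rep e s d N \<nu>"] by (simp add: length_rep)
  have "length ` set (rep e s d N \<nu>) = (\<lambda>k. length (rep e s d N \<nu> ! k)) ` {0..<length s}"
    by (subst r) (simp add: image_image)
  also have "\<dots> = (\<lambda>k. d ! k + N) ` {0..<length d}" using assms(1) by (intro image_cong) (auto simp: rep_nth)
  also have "\<dots> = (\<lambda>x. x + N) ` set d" by (simp add: image_image set_conv_nth atLeast0LessThan lessThan_def image_Collect) blast
  finally have img: "length ` set (rep e s d N \<nu>) = (\<lambda>x. x + N) ` set d" .
  have "Min ((\<lambda>x. x + N) ` set d) = Min (set d) + N"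
    using assms by (intro mono_Min_commute[symmetric]) (auto simp: mono_def)
  then show ?thesis
    using assms by (intro nth_equalityI) (auto simp: defect_rep_def img length_rep rep_nth)
qed

lemma rep_inj:
  assumes d: "length d = length s" and \<nu>: "\<nu> \<in> mparts (length s) N" and \<mu>: "\<mu> \<in> mparts (length s) N"
    and eq: "rep e s d N \<nu> = rep e s d N \<mu>"
  shows "\<nu> = \<mu>"
proof (rule nth_equalityI)
  show "length \<nu> = length \<mu>" using \<nu> \<mu> by (simp add: mparts_def)
  fix k assume "k < length \<nu>"
  then have k: "k < length s" using \<nu> by (simp add: mparts_def)
  have p: "is_partition (\<nu> ! k)" "is_partition (\<mu> ! k)" using \<nu> \<mu> k by (auto simp: mparts_def)
  have len: "length (\<nu> ! k) \<le> N" "length (\<mu> ! k) \<le> N" using length_part_le[OF \<nu> k] length_part_le[OF \<mu> k] by auto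
  have rows: "rown (\<nu> ! k) i = rown (\<mu> ! k) i" for i
  proof (cases "i < d ! k + N")
    case True
    then show ?thesis using arg_cong[OF eq, of "\<lambda>M. M ! k ! i"] by (simp add: rep_nth k d)
  next
    case False
    then show ?thesis using len by (simp add: rown_def)
  qed
  have pos: "rown \<kappa> i > 0 \<longleftrightarrow> i < length \<kappa>" if "is_partition \<kappa>" for \<kappa> i
    using that by (auto simp: rown_def is_partition_def) (metis neq0_conv nth_mem)
  have "length (\<nu> ! k) = length (\<mu> ! k)"
    using pos[OF p(1)] pos[OF p(2)] rows by (metis linorder_neqE_nat less_irrefl)
  then show "\<nu> ! k = \<mu> ! k"
    by (rule nth_equalityI) (use rows in \<open>metis rown_def \<open>length (\<nu> ! k) = length (\<mu> ! k)\<close>\<close>)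
qed

lemma defect_symb_of:
  assumes "length d = length s" "Min (set d) = 0" "s \<noteq> []" "\<nu> \<in> mparts (length s) N"
  shows "defect (symb_of e s d \<nu>) = d"
  using assms by (simp add: symb_of_rep defect_symb_class rep_Zt defect_rep_rep)

lemma inj_symb_of:
  assumes "length d = length s" "s \<noteq> []"
  shows "inj_on (symb_of e s d) (mparts (length s) N)"
proof (rule inj_onI)
  fix \<nu> \<mu> assume \<nu>: "\<nu> \<in> mparts (length s) N" and \<mu>: "\<mu> \<in> mparts (length s) N" and eq: "symb_of e s d \<nu> = symb_of e s d \<mu>"
  have "rep e s d N \<nu> = rep e s d N \<mu>"
    by (rule symb_class_eqD[OF eq[unfolded symb_of_rep[OF \<nu>] symb_of_rep[OF \<mu>]] length_rep length_rep assms(2)])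
       (simp add: rep_nth assms(1))
  then show "\<nu> = \<mu>" by (rule rep_inj[OF assms(1) \<nu> \<mu>])
qed

section \<open>Hall-Littlewood functions of symbols\<close>

locale hl_setting =
  fixes r n e \<alpha> :: nat and s :: "nat list" and D :: "nat list set"
    and \<theta> :: "nat list \<Rightarrow> nat list list \<Rightarrow> nat list list"
    and ord :: "(symb \<times> symb) set" and \<zeta> :: complex
    and \<chi> :: "nat \<Rightarrow> nat list list \<Rightarrow> complex mat \<Rightarrow> complex"
  assumes r: "r \<ge> 1" and len: "length s = r" and finite_D: "finite D"
    and D: "\<forall>d\<in>D. is_defect r \<alpha> d \<and> Zset e s \<alpha> n d \<noteq> {}"
    and \<theta>: "\<forall>d\<in>D. \<theta> d \<in> mparts r (nprime \<alpha> n d) \<rightarrow> mparts r n \<and> inj_on (\<theta> d) (mparts r (nprime \<alpha> n d))"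
    and ord: "admissible_order e s \<alpha> (ZD e s \<alpha> n D) ord"
    and root: "primitive_root r \<zeta>"
    and labelling: "\<forall>N. char_labelling r \<zeta> N (\<chi> N)"
begin

abbreviation "Z \<equiv> ZD e s \<alpha> n D"
abbreviation "TT d \<equiv> mparts r (nprime \<alpha> n d)"
abbreviation "mp \<Lambda> \<equiv> mpart_of e s \<alpha> n \<Lambda>"
abbreviation "ss \<Lambda> \<equiv> s_symb e s \<alpha> n \<theta> \<Lambda>"
abbreviation "HL \<equiv> hall_littlewood e s \<alpha> n D \<theta> ord"
abbreviation "KF \<equiv> kostka e s \<alpha> n D \<theta> ord"
abbreviation "solves \<equiv> is_solution Z ord (a_fun e s \<alpha>) (Omega e s \<alpha> n \<zeta> \<chi>)"

lemma wc: "wreath_characters r N \<zeta> (\<chi> N)"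
  using r root labelling by (intro wreath_characters.intro wreath.intro wreath_characters_axioms.intro) auto

lemma s_nonempty: "s \<noteq> []"
  using r len by auto

lemma D_facts: "d \<in> D \<Longrightarrow> length d = length s \<and> Min (set d) = 0 \<and> fdef \<alpha> d \<le> int n"
  using D len by (auto simp: is_defect_def Zset_def split: if_splits)

lemma Z_intro:
  assumes d: "d \<in> D" and \<nu>: "\<nu> \<in> TT d"
  shows "symb_of e s d \<nu> \<in> Z" "defect (symb_of e s d \<nu>) = d" "mp (symb_of e s d \<nu>) = \<nu>"
proof -
  show "symb_of e s d \<nu> \<in> Z"
    using d \<nu> D_facts[OF d] len by (auto simp: ZD_def Zset_def)
  show *: "defect (symb_of e s d \<nu>) = d"
    using D_facts[OF d] s_nonempty \<nu> len by (intro defect_symb_of) auto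
  have "inj_on (symb_of e s d) (TT d)"
    using inj_symb_of[of d s e] D_facts[OF d] s_nonempty len by auto
  then show "mp (symb_of e s d \<nu>) = \<nu>"
    using \<nu> by (simp add: mpart_of_def * len)
qed

lemma Z_elim:
  assumes "\<Lambda> \<in> Z"
  shows "defect \<Lambda> \<in> D" "mp \<Lambda> \<in> TT (defect \<Lambda>)" "symb_of e s (defect \<Lambda>) (mp \<Lambda>) = \<Lambda>"
proof -
  obtain d \<nu> where d: "d \<in> D" and \<nu>: "\<nu> \<in> TT d" and \<Lambda>: "\<Lambda> = symb_of e s d \<nu>"
    using assms by (auto simp: ZD_def Zset_def len split: if_splits)
  note Z_intro[OF d \<nu>]
  then show "defect \<Lambda> \<in> D" "mp \<Lambda> \<in> TT (defect \<Lambda>)" "symb_of e s (defect \<Lambda>) (mp \<Lambda>) = \<Lambda>"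
    using d \<nu> \<Lambda> by auto
qed

lemma finite_Z: "finite Z"
  unfolding ZD_def Zset_def using finite_D finite_mparts by simp

lemma sum_Z_defect:
  assumes d: "d \<in> D"
  shows "(\<Sum>\<Lambda>\<in>Z. if defect \<Lambda> = d then f \<Lambda> else 0) = (\<Sum>\<nu>\<in>TT d. f (symb_of e s d \<nu>))"
proof -
  have "(\<Sum>\<Lambda>\<in>Z. if defect \<Lambda> = d then f \<Lambda> else 0) = (\<Sum>\<Lambda>\<in>{\<Lambda> \<in> Z. defect \<Lambda> = d}. f \<Lambda>)"
    by (rule sum.inter_filter[OF finite_Z, symmetric])
  also have "\<dots> = (\<Sum>\<nu>\<in>TT d. f (symb_of e s d \<nu>))"
    by (rule sum.reindex_bij_witness[where i = "symb_of e s d" and j = "\<lambda>\<Lambda>. mp \<Lambda>"])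
       (use Z_elim Z_intro[OF d] in auto)
  finally show ?thesis .
qed

lemma sum_Z: "(\<Sum>\<Lambda>\<in>Z. f \<Lambda>) = (\<Sum>d\<in>D. \<Sum>\<nu>\<in>TT d. f (symb_of e s d \<nu>))"
proof -
  have "(\<Sum>\<Lambda>\<in>Z. f \<Lambda>) = (\<Sum>\<Lambda>\<in>Z. \<Sum>d\<in>D. if defect \<Lambda> = d then f \<Lambda> else 0)"
    by (rule sum.cong[OF refl]) (simp add: finite_D Z_elim(1))
  also have "\<dots> = (\<Sum>d\<in>D. \<Sum>\<Lambda>\<in>Z. if defect \<Lambda> = d then f \<Lambda> else 0)" by (rule sum.swap)
  also have "\<dots> = (\<Sum>d\<in>D. \<Sum>\<nu>\<in>TT d. f (symb_of e s d \<nu>))"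
    by (rule sum.cong[OF refl]) (rule sum_Z_defect)
  finally show ?thesis .
qed

lemma Z_class:
  assumes "\<Lambda> \<in> Z"
  obtains L where "L \<in> Zt e s" "\<Lambda> = symb_class e s L"
proof -
  let ?d = "defect \<Lambda>" and ?N = "nprime \<alpha> n (defect \<Lambda>)"
  have \<nu>: "mp \<Lambda> \<in> mparts (length s) ?N" using Z_elim(2)[OF assms] len by simp
  have "length ?d = length s" using D_facts[OF Z_elim(1)[OF assms]] by blast
  then have "rep e s ?d ?N (mp \<Lambda>) \<in> Zt e s" using \<nu> by (rule rep_Zt)
  moreover have "\<Lambda> = symb_class e s (rep e s ?d ?N (mp \<Lambda>))"
    using Z_elim(3)[OF assms] symb_of_rep[OF \<nu>] by simp
  ultimately show thesis by (rule that)
qed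

sublocale bo: block_order Z "sprec ord" similar
proof
  have lin: "linear_order_on Z ord" using ord by (simp add: admissible_order_def)
  have tr: "trans ord" and an: "antisym ord" and tot: "total_on Z ord"
    using lin by (auto simp: linear_order_on_def partial_order_on_def preorder_on_def)
  show "finite Z" by (rule finite_Z)
  show "\<not> sprec ord x x" for x by (simp add: sprec_def)
  show "sprec ord x z" if "sprec ord x y" "sprec ord y z" for x y z
    using that tr an unfolding sprec_def by (metis antisymD transD)
  show "sprec ord x y \<or> sprec ord y x" if "x \<in> Z" "y \<in> Z" "x \<noteq> y" for x y
    using that tot unfolding sprec_def total_on_def by metis
  show "similar x x" if x: "x \<in> Z" for x
  proof -
    obtain L where "x = symb_class e s L" by (rule Z_class[OF x])
    then show ?thesis using symb_class_refl[of L e s] by (intro similar_refl) auto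
  qed
  show "similar y x" if "similar x y" for x y using that by (rule similar_sym)
  show "similar x z" if xyz: "x \<in> Z" "y \<in> Z" "z \<in> Z" "similar x y" "similar y z" for x y z
  proof -
    obtain L1 where L1: "L1 \<in> Zt e s" "x = symb_class e s L1" by (rule Z_class[OF xyz(1)])
    obtain L2 where L2: "L2 \<in> Zt e s" "y = symb_class e s L2" by (rule Z_class[OF xyz(2)])
    obtain L3 where L3: "L3 \<in> Zt e s" "z = symb_class e s L3" by (rule Z_class[OF xyz(3)])
    show ?thesis using similar_trans[OF L1(1) L2(1) L3(1)] xyz(4,5) unfolding L1(2) L2(2) L3(2) by blast
  qed
  show "similar y x" if "x \<in> Z" "y \<in> Z" "z \<in> Z" "similar x z" "sprec ord x y" "sprec ord y z" for x y z
    using that ord unfolding admissible_order_def sprec_def by blast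
qed

section \<open>The Gram matrix on the direct sum over the defects\<close>

definition GramN :: "nat \<Rightarrow> nat list list \<Rightarrow> nat list list \<Rightarrow> tratfun" where
  "GramN N = wreath_characters.Gram r N"

definition G :: "symb \<Rightarrow> symb \<Rightarrow> tratfun" where
  "G \<Lambda> \<Lambda>' = (if \<Lambda> \<in> Z \<and> \<Lambda>' \<in> Z \<and> defect \<Lambda> = defect \<Lambda>' then GramN (nprime \<alpha> n (defect \<Lambda>)) (mp \<Lambda>) (mp \<Lambda>') else 0)"

lemma G_regular: "G \<Lambda> \<Lambda>' \<in> regular_ratfun r"
  unfolding G_def GramN_def using wreath_characters.Gram_regular[OF wc] regular.zero_in by simp

lemma eval0_G:
  assumes "\<Lambda> \<in> Z" "\<Lambda>' \<in> Z"
  shows "eval0 (G \<Lambda> \<Lambda>') = (if \<Lambda> = \<Lambda>' then 1 else 0)"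
proof (cases "defect \<Lambda> = defect \<Lambda>'")
  case True
  have "eval0 (G \<Lambda> \<Lambda>') = (if mp \<Lambda> = mp \<Lambda>' then 1 else 0)"
    using wreath_characters.eval0_Gram[OF wc Z_elim(2)[OF assms(1)]] Z_elim(2)[OF assms(2)] True assms by (simp add: G_def GramN_def)
  moreover have "mp \<Lambda> = mp \<Lambda>' \<longleftrightarrow> \<Lambda> = \<Lambda>'" using Z_elim(3)[OF assms(1)] Z_elim(3)[OF assms(2)] True by metis
  ultimately show ?thesis by simp
qed (auto simp: G_def regular.hom_zero)

sublocale bp: local_block_order Z "sprec ord" similar "regular_ratfun r" eval0 G
  by unfold_locales (use G_regular eval0_G in auto)

sublocale bm: local_block_order Z "sprec ord" similar "regular_ratfun r" eval0 "trm G"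
  by unfold_locales (use G_regular eval0_G in \<open>auto simp: trm_def\<close>)

lemma zoff_G: "zoff Z G"
  by (auto simp: zoff_def G_def)

text \<open>The element of the direct sum with prescribed coordinates at the symbols. The
  coordinates are unique because each \<theta>_d is injective and Schur functions are
  independent.\<close>

definition FF :: "(symb \<Rightarrow> 'c::comm_ring_1) \<Rightarrow> nat list \<Rightarrow> 'c sfun" where
  "FF a d = (\<Sum>\<Lambda>\<in>Z. mconst (a \<Lambda>) * ss \<Lambda> d)"

lemma FF_eq:
  assumes d: "d \<in> D"
  shows "FF a d = (\<Sum>\<nu>\<in>TT d. mconst (a (symb_of e s d \<nu>)) * schur (\<theta> d \<nu>))"
proof -
  have "FF a d = (\<Sum>\<Lambda>\<in>Z. if defect \<Lambda> = d then mconst (a \<Lambda>) * schur (\<theta> d (mp \<Lambda>)) else 0)"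
    unfolding FF_def by (rule sum.cong[OF refl]) (auto simp: s_symb_def)
  also have "\<dots> = (\<Sum>\<nu>\<in>TT d. mconst (a (symb_of e s d \<nu>)) * schur (\<theta> d \<nu>))"
    unfolding sum_Z_defect[OF d] by (rule sum.cong[OF refl]) (simp add: Z_intro[OF d])
  finally show ?thesis .
qed

lemma FF_inj:
  fixes a b :: "symb \<Rightarrow> 'c::comm_ring_1"
  assumes eq: "\<And>d. FF a d = FF b d" and \<Lambda>: "\<Lambda> \<in> Z"
  shows "a \<Lambda> = b \<Lambda>"
proof -
  let ?d = "defect \<Lambda>"
  have d: "?d \<in> D" by (rule Z_elim(1)[OF \<Lambda>])
  have "a (symb_of e s ?d (mp \<Lambda>)) - b (symb_of e s ?d (mp \<Lambda>)) = 0"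
  proof (rule schur_image_independent[where c = "\<lambda>\<nu>. a (symb_of e s ?d \<nu>) - b (symb_of e s ?d \<nu>)"])
    show "\<theta> ?d \<in> TT ?d \<rightarrow> mparts r n" "inj_on (\<theta> ?d) (TT ?d)" using \<theta> d by auto
    show "mp \<Lambda> \<in> TT ?d" by (rule Z_elim(2)[OF \<Lambda>])
    fix \<mu>
    have "(\<Sum>\<nu>\<in>TT ?d. (a (symb_of e s ?d \<nu>) - b (symb_of e s ?d \<nu>)) * mcoeff (schur (\<theta> ?d \<nu>)) (xm \<mu>)) =
        mcoeff (FF a ?d) (xm \<mu>) - mcoeff (FF b ?d) (xm \<mu>)"
      unfolding FF_eq[OF d] by (simp add: mcoeff_sum left_diff_distrib sum_subtractf)
    then show "(\<Sum>\<nu>\<in>TT ?d. (a (symb_of e s ?d \<nu>) - b (symb_of e s ?d \<nu>)) * mcoeff (schur (\<theta> ?d \<nu>)) (xm \<mu>)) = 0"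
      using eq by simp
  qed
  then show ?thesis using Z_elim(3)[OF \<Lambda>] by simp
qed

lemma sum_form_FF:
  assumes a: "\<And>\<Lambda>. a \<Lambda> \<in> ratfun r" and b: "\<And>\<Lambda>. b \<Lambda> \<in> ratfun r"
  shows "sum_form r \<alpha> n D \<theta> (FF a) (FF b) = (\<Sum>\<Lambda>\<in>Z. \<Sum>\<Lambda>'\<in>Z. a \<Lambda> * b \<Lambda>' * G \<Lambda> \<Lambda>')"
proof -
  have "(\<Sum>\<Lambda>'\<in>Z. a \<Lambda> * b \<Lambda>' * G \<Lambda> \<Lambda>') = (\<Sum>\<mu>\<in>TT (defect \<Lambda>). a \<Lambda> * b (symb_of e s (defect \<Lambda>) \<mu>) * GramN (nprime \<alpha> n (defect \<Lambda>)) (mp \<Lambda>) \<mu>)"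
    if \<Lambda>: "\<Lambda> \<in> Z" for \<Lambda>
  proof -
    have "(\<Sum>\<Lambda>'\<in>Z. a \<Lambda> * b \<Lambda>' * G \<Lambda> \<Lambda>') = (\<Sum>\<Lambda>'\<in>Z. if defect \<Lambda>' = defect \<Lambda> then a \<Lambda> * b \<Lambda>' * GramN (nprime \<alpha> n (defect \<Lambda>)) (mp \<Lambda>) (mp \<Lambda>') else 0)"
      by (rule sum.cong[OF refl]) (simp add: G_def \<Lambda>)
    also have "\<dots> = (\<Sum>\<mu>\<in>TT (defect \<Lambda>). a \<Lambda> * b (symb_of e s (defect \<Lambda>) \<mu>) * GramN (nprime \<alpha> n (defect \<Lambda>)) (mp \<Lambda>) \<mu>)"
      unfolding sum_Z_defect[OF Z_elim(1)[OF \<Lambda>]] by (rule sum.cong[OF refl]) (simp add: Z_intro[OF Z_elim(1)[OF \<Lambda>]])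
    finally show ?thesis .
  qed
  then have "(\<Sum>\<Lambda>\<in>Z. \<Sum>\<Lambda>'\<in>Z. a \<Lambda> * b \<Lambda>' * G \<Lambda> \<Lambda>') =
      (\<Sum>\<Lambda>\<in>Z. \<Sum>\<mu>\<in>TT (defect \<Lambda>). a \<Lambda> * b (symb_of e s (defect \<Lambda>) \<mu>) * GramN (nprime \<alpha> n (defect \<Lambda>)) (mp \<Lambda>) \<mu>)"
    by (intro sum.cong refl)
  also have "\<dots> = (\<Sum>d\<in>D. \<Sum>\<nu>\<in>TT d. \<Sum>\<mu>\<in>TT d. a (symb_of e s d \<nu>) * b (symb_of e s d \<mu>) * GramN (nprime \<alpha> n d) \<nu> \<mu>)"
    unfolding sum_Z by (intro sum.cong refl) (simp_all add: Z_intro cong: sum.cong)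
  also have "\<dots> = sum_form r \<alpha> n D \<theta> (FF a) (FF b)"
    unfolding sum_form_def Let_def
  proof (rule sum.cong[OF refl])
    fix d assume d: "d \<in> D"
    interpret w: wreath_characters r "nprime \<alpha> n d" \<zeta> "\<chi> (nprime \<alpha> n d)" by (rule wc)
    have t: "\<theta> d \<in> TT d \<rightarrow> mparts r n" "inj_on (\<theta> d) (TT d)" using \<theta> d by auto
    show "(\<Sum>\<nu>\<in>TT d. \<Sum>\<mu>\<in>TT d. a (symb_of e s d \<nu>) * b (symb_of e s d \<mu>) * GramN (nprime \<alpha> n d) \<nu> \<mu>) =
        hl_form r (nprime \<alpha> n d) (inv_into (Xi r (nprime \<alpha> n d) (ratfun r)) (Theta r (nprime \<alpha> n d) (\<theta> d)) (FF a d))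
          (inv_into (Xi r (nprime \<alpha> n d) (ratfun r)) (Theta r (nprime \<alpha> n d) (\<theta> d)) (FF b d))"
      unfolding FF_eq[OF d] w.back_schur_sum[OF t a] w.back_schur_sum[OF t b] w.hl_form_schur_sum[OF a b] GramN_def ..
  qed
  finally show ?thesis by simp
qed

lemma FF_mm:
  assumes "\<Lambda> \<in> Z"
  shows "FF (mm Z A B \<Lambda>) d = (\<Sum>M\<in>Z. mconst (A \<Lambda> M) * FF (B M) d)"
proof -
  have "FF (mm Z A B \<Lambda>) d = (\<Sum>\<Lambda>'\<in>Z. \<Sum>M\<in>Z. mconst (A \<Lambda> M) * (mconst (B M \<Lambda>') * ss \<Lambda>' d))"
    unfolding FF_def using assms
    by (intro sum.cong refl) (simp add: mm_def mconst_sum mconst_mult sum_distrib_right mult.assoc)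
  also have "\<dots> = (\<Sum>M\<in>Z. \<Sum>\<Lambda>'\<in>Z. mconst (A \<Lambda> M) * (mconst (B M \<Lambda>') * ss \<Lambda>' d))" by (rule sum.swap)
  finally show ?thesis by (simp add: FF_def sum_distrib_left)
qed

lemma FF_idm: "\<Lambda> \<in> Z \<Longrightarrow> FF (idm Z \<Lambda>) d = ss \<Lambda> d"
proof -
  assume \<Lambda>: "\<Lambda> \<in> Z"
  have "FF (idm Z \<Lambda>) d = (\<Sum>\<Lambda>'\<in>Z. if \<Lambda> = \<Lambda>' then ss \<Lambda>' d else 0)"
    unfolding FF_def by (rule sum.cong[OF refl]) (simp add: idm_def \<Lambda>)
  then show ?thesis using \<Lambda> finite_Z by simp
qed

lemma FF_blower:
  assumes "bo.blower (\<lambda>_. 1) U" "\<Lambda> \<in> Z"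
  shows "FF (U \<Lambda>) d = ss \<Lambda> d + (\<Sum>\<Lambda>'\<in>bo.below \<Lambda>. mconst (U \<Lambda> \<Lambda>') * ss \<Lambda>' d)"
proof -
  have "bo.blower (\<lambda>_. 1) (\<lambda>x y. mconst (U x y) :: 'a sfun)"
    using assms(1) unfolding bo.blower_def zoff_def by (metis mconst_0 mconst_1)
  from bo.blower_sum[OF this assms(2)] show ?thesis unfolding FF_def by simp
qed

lemma sum_form_mm:
  assumes "\<And>x y. U x y \<in> regular_ratfun r" "\<And>x y. V x y \<in> regular_ratfun r" "\<Lambda> \<in> Z" "\<Lambda>' \<in> Z"
  shows "sum_form r \<alpha> n D \<theta> (FF (U \<Lambda>)) (FF (V \<Lambda>')) = mm Z (mm Z U G) (trm V) \<Lambda> \<Lambda>'"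
proof -
  have "sum_form r \<alpha> n D \<theta> (FF (U \<Lambda>)) (FF (V \<Lambda>')) = (\<Sum>x\<in>Z. \<Sum>y\<in>Z. U \<Lambda> x * V \<Lambda>' y * G x y)"
    by (intro sum_form_FF subsetD[OF regular_subset_ratfun] assms)
  also have "\<dots> = (\<Sum>y\<in>Z. \<Sum>x\<in>Z. U \<Lambda> x * V \<Lambda>' y * G x y)" by (rule sum.swap)
  finally show ?thesis using assms(3,4) by (simp add: mm_def trm_def sum_distrib_left mult_ac cong: sum.cong)
qed

definition hlP :: "(symb \<Rightarrow> symb \<Rightarrow> tratfun) \<Rightarrow> (symb \<Rightarrow> symb \<Rightarrow> tratfun) \<Rightarrow> pm \<Rightarrow> symb \<Rightarrow> nat list \<Rightarrow> tratfun sfun" where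
  "hlP Up Um q \<Lambda> = (if \<Lambda> \<in> Z then FF ((case q of Plus \<Rightarrow> Up | Minus \<Rightarrow> Um) \<Lambda>) else (\<lambda>d. 0))"

lemma eval0_FF:
  assumes U: "\<And>y. a y \<in> regular_ratfun r" "\<And>y. eval0 (a y) = (if \<Lambda> = y then 1 else 0)" and \<Lambda>: "\<Lambda> \<in> Z"
  shows "map_mfps eval0 (FF a d) = ss \<Lambda> d"
proof (rule mfps_eqI)
  fix m
  \<comment> \<open>The coefficients of the basis elements are natural numbers, so evaluation at the
    origin affects the coordinates only.\<close>
  define c where "c \<Lambda>' = (if d = defect \<Lambda>' then schur_count (\<theta> d (mp \<Lambda>')) m else 0)" for \<Lambda>'
  have c: "mcoeff (ss \<Lambda>' d :: 'c::comm_ring_1 sfun) m = of_nat (c \<Lambda>')" for \<Lambda>'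
    by (simp add: s_symb_def c_def mcoeff_schur_count)
  have "mcoeff (map_mfps eval0 (FF a d)) m = eval0 (\<Sum>\<Lambda>'\<in>Z. a \<Lambda>' * of_nat (c \<Lambda>'))"
    by (simp add: map_mfps_def FF_def mcoeff_sum c)
  also have "\<dots> = (\<Sum>\<Lambda>'\<in>Z. eval0 (a \<Lambda>' * of_nat (c \<Lambda>')))"
    by (rule regular.hom_sum) (rule regular.mult_in[OF U(1) regular_of_nat])
  also have "\<dots> = (\<Sum>\<Lambda>'\<in>Z. if \<Lambda> = \<Lambda>' then of_nat (c \<Lambda>') else 0)"
    by (rule sum.cong[OF refl]) (simp add: regular.hom_mult[OF U(1) regular_of_nat] U(2) eval0_of_nat)
  also have "\<dots> = mcoeff (ss \<Lambda> d) m" using \<Lambda> finite_Z by (simp add: c)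
  finally show "mcoeff (map_mfps eval0 (FF a d)) m = mcoeff (ss \<Lambda> d) m" .
qed

lemma hl_family_hlP:
  assumes Up: "bo.blower (\<lambda>_. 1) Up" "\<And>x y. Up x y \<in> regular_ratfun r" "\<And>x y. x \<in> Z \<Longrightarrow> eval0 (Up x y) = (if x = y then 1 else 0)"
    and Um: "bo.blower (\<lambda>_. 1) Um" "\<And>x y. Um x y \<in> regular_ratfun r" "\<And>x y. x \<in> Z \<Longrightarrow> eval0 (Um x y) = (if x = y then 1 else 0)"
    and orth: "bo.bdiag (mm Z (mm Z Up G) (trm Um))"
  shows "is_hl_family e s \<alpha> n D \<theta> ord (hlP Up Um)"
  unfolding is_hl_family_def Let_def len
proof (intro conjI allI ballI impI)
  fix q
  define U where "U = (case q of Plus \<Rightarrow> Up | Minus \<Rightarrow> Um)"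
  have U: "bo.blower (\<lambda>_. 1) U" "\<And>x y. U x y \<in> regular_ratfun r" "\<And>x y. x \<in> Z \<Longrightarrow> eval0 (U x y) = (if x = y then 1 else 0)"
    using Up Um by (cases q; simp add: U_def)+
  have h: "hlP Up Um q \<Lambda> d = FF (U \<Lambda>) d" if "\<Lambda> \<in> Z" for \<Lambda> d using that by (simp add: hlP_def U_def)
  show "\<exists>u. (\<forall>\<Lambda>\<in>Z. \<forall>\<Lambda>'\<in>Z. u \<Lambda> \<Lambda>' \<in> regular_ratfun r) \<and>
        (\<forall>\<Lambda>\<in>Z. \<forall>d. hlP Up Um q \<Lambda> d = ss \<Lambda> d + (\<Sum>\<Lambda>'\<in>{\<Lambda>'\<in>Z. sprec ord \<Lambda>' \<Lambda> \<and> \<not> similar \<Lambda>' \<Lambda>}. mconst (u \<Lambda> \<Lambda>') * ss \<Lambda>' d))"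
    by (intro exI[of _ U] conjI ballI allI U(2)) (simp add: h FF_blower[OF U(1)] bo.below_def)
  fix \<Lambda> d assume \<Lambda>: "\<Lambda> \<in> Z"
  show "map_mfps eval0 (hlP Up Um q \<Lambda> d) = ss \<Lambda> d"
    unfolding h[OF \<Lambda>] by (rule eval0_FF[OF U(2) U(3)[OF \<Lambda>] \<Lambda>])
next
  fix \<Lambda> \<Lambda>' assume \<Lambda>: "\<Lambda> \<in> Z" "\<Lambda>' \<in> Z" "\<not> similar \<Lambda> \<Lambda>'"
  have "sum_form r \<alpha> n D \<theta> (FF (Up \<Lambda>)) (FF (Um \<Lambda>')) = mm Z (mm Z Up G) (trm Um) \<Lambda> \<Lambda>'"
    by (rule sum_form_mm) (fact Up(2) Um(2) \<Lambda>)+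
  also have "\<dots> = 0" using orth \<Lambda> unfolding bo.bdiag_def by blast
  finally show "sum_form r \<alpha> n D \<theta> (hlP Up Um Plus \<Lambda>) (hlP Up Um Minus \<Lambda>') = 0"
    using \<Lambda> by (simp add: hlP_def)
next
  fix q \<Lambda> assume "\<Lambda> \<notin> Z"
  then show "hlP Up Um q \<Lambda> = (\<lambda>d. 0)" by (simp add: hlP_def)
qed

text \<open>Turns an arbitrary family with the defining properties into a pair of unitriangular
  matrices, to which uniqueness of the orthogonalization applies.\<close>

lemma hl_family_form:
  assumes P: "is_hl_family e s \<alpha> n D \<theta> ord P"
  obtains U where "\<And>q. bo.blower (\<lambda>_. 1) (U q)" "\<And>q x y. U q x y \<in> regular_ratfun r" "P = hlP (U Plus) (U Minus)"
    "bo.bdiag (mm Z (mm Z (U Plus) G) (trm (U Minus)))"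
proof -
  note P' = P[unfolded is_hl_family_def Let_def len]
  have "\<forall>q. \<exists>u. (\<forall>\<Lambda>\<in>Z. \<forall>\<Lambda>'\<in>Z. u \<Lambda> \<Lambda>' \<in> regular_ratfun r) \<and>
        (\<forall>\<Lambda>\<in>Z. \<forall>d. P q \<Lambda> d = ss \<Lambda> d + (\<Sum>\<Lambda>'\<in>bo.below \<Lambda>. mconst (u \<Lambda> \<Lambda>') * ss \<Lambda>' d))"
    unfolding bo.below_def by (rule conjunct1[OF P'])
  from choice[OF this] obtain u where u: "\<And>q. (\<forall>\<Lambda>\<in>Z. \<forall>\<Lambda>'\<in>Z. u q \<Lambda> \<Lambda>' \<in> regular_ratfun r) \<and>
        (\<forall>\<Lambda>\<in>Z. \<forall>d. P q \<Lambda> d = ss \<Lambda> d + (\<Sum>\<Lambda>'\<in>bo.below \<Lambda>. mconst (u q \<Lambda> \<Lambda>') * ss \<Lambda>' d))"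
    by blast
  \<comment> \<open>The given coefficients u enter the family only at symbols strictly below;
    elsewhere their values are arbitrary and are replaced by those of a unitriangular
    matrix.\<close>
  define U where "U q x y = (if x \<in> Z then if y = x then 1 else if y \<in> bo.below x then u q x y else 0 else 0)" for q x y
  have bl: "bo.blower (\<lambda>_. 1) (U q)" for q
    unfolding bo.blower_def zoff_def
  proof (intro conjI allI ballI impI)
    show "U q x y = 0" if xy: "x \<notin> Z \<or> y \<notin> Z" for x y
    proof (cases "x \<in> Z")
      case True
      then have "y \<noteq> x" "y \<notin> bo.below x" using xy bo.below_subset[of x] by blast+
      then show ?thesis by (simp add: U_def)
    qed (simp add: U_def)
    show "y = x \<or> y \<in> bo.below x" if "U q x y \<noteq> 0" for x y using that by (simp add: U_def split: if_splits)
  qed (simp add: U_def)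
  have reg: "U q x y \<in> regular_ratfun r" for q x y
  proof -
    have "u q x y \<in> regular_ratfun r" if "x \<in> Z" "y \<in> bo.below x"
      using u[of q] that(1) subsetD[OF bo.below_subset that(2)] by blast
    then show ?thesis by (simp add: U_def regular.zero_in regular.one_in)
  qed
  have PU: "P q \<Lambda> = FF (U q \<Lambda>)" if \<Lambda>: "\<Lambda> \<in> Z" for q \<Lambda>
  proof
    fix d
    have "(\<Sum>\<Lambda>'\<in>bo.below \<Lambda>. mconst (U q \<Lambda> \<Lambda>') * ss \<Lambda>' d) = (\<Sum>\<Lambda>'\<in>bo.below \<Lambda>. mconst (u q \<Lambda> \<Lambda>') * ss \<Lambda>' d)"
    proof (rule sum.cong[OF refl])
      fix \<Lambda>' assume l: "\<Lambda>' \<in> bo.below \<Lambda>"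
      then have "\<Lambda>' \<noteq> \<Lambda>" using bo.below_irrefl[of \<Lambda>] by blast
      then show "mconst (U q \<Lambda> \<Lambda>') * ss \<Lambda>' d = mconst (u q \<Lambda> \<Lambda>') * ss \<Lambda>' d" using l \<Lambda> by (simp add: U_def)
    qed
    then show "P q \<Lambda> d = FF (U q \<Lambda>) d" using u[of q] \<Lambda> FF_blower[OF bl \<Lambda>] by simp
  qed
  have "P = hlP (U Plus) (U Minus)"
  proof (intro ext)
    fix q \<Lambda> d
    have "P q \<Lambda> = (\<lambda>d. 0)" if "\<Lambda> \<notin> Z" using P'[THEN conjunct2, THEN conjunct2, THEN conjunct2] that by blast
    then show "P q \<Lambda> d = hlP (U Plus) (U Minus) q \<Lambda> d"
      by (cases q; cases "\<Lambda> \<in> Z") (simp_all add: hlP_def PU)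
  qed
  moreover have "bo.bdiag (mm Z (mm Z (U Plus) G) (trm (U Minus)))"
    unfolding bo.bdiag_def
  proof (intro conjI ballI impI)
    fix x y assume xy: "x \<in> Z" "y \<in> Z" "\<not> similar x y"
    have "sum_form r \<alpha> n D \<theta> (P Plus x) (P Minus y) = 0"
      using P'[THEN conjunct2, THEN conjunct1] xy by blast
    moreover have "sum_form r \<alpha> n D \<theta> (FF (U Plus x)) (FF (U Minus y)) = mm Z (mm Z (U Plus) G) (trm (U Minus)) x y"
      by (rule sum_form_mm) (fact reg xy)+
    ultimately show "mm Z (mm Z (U Plus) G) (trm (U Minus)) x y = 0"
      unfolding PU[OF xy(1)] PU[OF xy(2)] by simp
  qed simp
  ultimately show thesis using bl reg by (intro that)
qed

text \<open>The defining expansion says that the Kostka matrix times U is the identity, by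
  independence of the basis elements. So the description is met by the inverse of U alone, which is
  again unitriangular with regular entries.\<close>

lemma kostka_unitriangular:
  assumes U: "bo.blower (\<lambda>_. 1) U" "\<And>x y. U x y \<in> regular_ratfun r" "\<And>x y. x \<in> Z \<Longrightarrow> eval0 (U x y) = (if x = y then 1 else 0)"
    and hl: "\<And>\<Lambda>. \<Lambda> \<in> Z \<Longrightarrow> HL q \<Lambda> = FF (U \<Lambda>)"
  shows "bo.blower (\<lambda>_. 1) (KF q) \<and> (\<forall>x y. KF q x y \<in> regular_ratfun r) \<and>
    mm Z U (KF q) = idm Z \<and> mm Z (KF q) U = idm Z"
proof -
  have inv: "(\<Sum>z\<in>Z. eval0 (U x z) * idm Z z y) = (if x = y then 1 else 0)" if "x \<in> Z" "y \<in> Z" for x y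
  proof -
    have "(\<Sum>z\<in>Z. eval0 (U x z) * idm Z z y) = (\<Sum>z\<in>Z. if x = z then idm Z z y else 0)"
      by (rule sum.cong[OF refl]) (simp add: U(3) that)
    then show ?thesis using that finite_Z by (simp add: idm_def)
  qed
  obtain K0 where K0: "\<And>x y. x \<in> Z \<Longrightarrow> y \<in> Z \<Longrightarrow> K0 x y \<in> regular_ratfun r"
    "\<And>x y. x \<in> Z \<Longrightarrow> y \<in> Z \<Longrightarrow> (\<Sum>z\<in>Z. U x z * K0 z y) = (if x = y then 1 else 0)"
    by (rule regular.fin_mat_inverse[OF finite_Z U(2), where N = "idm Z"]) (rule inv, assumption+, rule that, assumption+)
  define K where "K x y = (if x \<in> Z \<and> y \<in> Z then K0 x y else 0)" for x y
  have zK: "zoff Z K" by (simp add: zoff_def K_def)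
  have reg: "K x y \<in> regular_ratfun r" for x y using K0(1) regular.zero_in by (simp add: K_def)
  have UK: "mm Z U K = idm Z" unfolding mm_eq_idm_iff using K0(2) by (simp add: K_def cong: sum.cong)
  have KU: "mm Z K U = idm Z" by (rule mm_left_right_inverse[OF finite_Z UK])
  have bl: "bo.blower (\<lambda>x. inverse 1) K"
    by (rule bo.blower_inverse[OF U(1) _ UK zK]) simp
  have expand: "(\<Sum>\<Lambda>'\<in>Z. mconst (A \<Lambda> \<Lambda>') * HL q \<Lambda>' d) = FF (mm Z A U \<Lambda>) d" if "\<Lambda> \<in> Z" for A \<Lambda> d
    unfolding FF_mm[OF that] by (rule sum.cong[OF refl]) (simp add: hl)
  have "KF q = K"
    unfolding kostka_def Let_def len
  proof (rule the_equality)
    have "ss \<Lambda> d = (\<Sum>\<Lambda>'\<in>Z. mconst (K \<Lambda> \<Lambda>') * HL q \<Lambda>' d)" if "\<Lambda> \<in> Z" for \<Lambda> d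
      unfolding expand[OF that] KU FF_idm[OF that] ..
    then show "matrix_on Z K \<and> (\<forall>\<Lambda>\<in>Z. \<forall>\<Lambda>'\<in>Z. K \<Lambda> \<Lambda>' \<in> ratfun r) \<and>
        (\<forall>\<Lambda>\<in>Z. \<forall>d. ss \<Lambda> d = (\<Sum>\<Lambda>'\<in>Z. mconst (K \<Lambda> \<Lambda>') * HL q \<Lambda>' d))"
      using zK reg regular_subset_ratfun unfolding matrix_on_def zoff_def by blast
  next
    fix K'
    assume K': "matrix_on Z K' \<and> (\<forall>\<Lambda>\<in>Z. \<forall>\<Lambda>'\<in>Z. K' \<Lambda> \<Lambda>' \<in> ratfun r) \<and>
        (\<forall>\<Lambda>\<in>Z. \<forall>d. ss \<Lambda> d = (\<Sum>\<Lambda>'\<in>Z. mconst (K' \<Lambda> \<Lambda>') * HL q \<Lambda>' d))"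
    have eqd: "FF (mm Z K' U \<Lambda>) d = FF (idm Z \<Lambda>) d" if "\<Lambda> \<in> Z" for \<Lambda> d
      using K' that unfolding expand[OF that, symmetric] FF_idm[OF that] by simp
    have "mm Z K' U = idm Z"
    proof (intro ext)
      fix x y
      show "mm Z K' U x y = idm Z x y"
      proof (cases "x \<in> Z \<and> y \<in> Z")
        case True
        then show ?thesis using FF_inj[of "mm Z K' U x" "idm Z x" y] eqd by blast
      qed (auto simp: mm_def idm_def)
    qed
    then have "mm Z (mm Z K' U) K = K" using mm_idm_left[OF finite_Z zK] by simp
    moreover have "zoff Z K'" using K' by (simp add: matrix_on_def zoff_def)
    ultimately show "K' = K" unfolding mm_assoc UK using mm_idm_right[OF finite_Z] by metis
  qed
  then show ?thesis using bl reg UK KU by simp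
qed

text \<open>Orthogonality of the Hall-Littlewood functions states that B = U_+ G U_-^T is block
  diagonal. The Kostka matrices are the inverses of U_+ and U_-, so moving them to the other side
  factorizes G.\<close>

theorem kostka_decomposition:
  obtains B where "\<And>q. bo.blower (\<lambda>_. 1) (KF q)"
    "\<And>q x y. KF q x y \<in> regular_ratfun r"
    "bo.bdiag B" "\<And>x y. B x y \<in> regular_ratfun r"
    "G = mm Z (mm Z (KF Plus) B) (trm (KF Minus))"
proof -
  obtain Up where Up: "bo.blower (\<lambda>_. 1) Up" "bp.row_orth Up" "\<And>x y. Up x y \<in> regular_ratfun r"
    "\<And>x y. x \<in> Z \<Longrightarrow> eval0 (Up x y) = (if x = y then 1 else 0)"
    by (rule bp.row_orth_exists) (rule that, assumption+)
  obtain Um where Um: "bo.blower (\<lambda>_. 1) Um" "bm.row_orth Um" "\<And>x y. Um x y \<in> regular_ratfun r"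
    "\<And>x y. x \<in> Z \<Longrightarrow> eval0 (Um x y) = (if x = y then 1 else 0)"
    by (rule bm.row_orth_exists) (rule that, assumption+)
  define B where "B = mm Z (mm Z Up G) (trm Um)"
  have B: "bo.bdiag B"
    unfolding B_def
  proof (rule bo.orthogonal_if_row_orth[OF Up(1) Um(1)])
    show "(\<Sum>z\<in>Z. Up x z * G z y) = 0" if "x \<in> Z" "y \<in> bo.below x" for x y
      using Up(2) that unfolding bp.row_orth_def by blast
    show "(\<Sum>z\<in>Z. Um x z * G y z) = 0" if "x \<in> Z" "y \<in> bo.below x" for x y
      using Um(2) that unfolding bm.row_orth_def trm_def by blast
  qed
  have hl: "HL = hlP Up Um"
    unfolding hall_littlewood_def
  proof (rule the_equality)
    show "is_hl_family e s \<alpha> n D \<theta> ord (hlP Up Um)"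
      by (rule hl_family_hlP[OF Up(1) Up(3,4) Um(1) Um(3,4) B[unfolded B_def]])
    fix P assume P: "is_hl_family e s \<alpha> n D \<theta> ord P"
    obtain U where U: "\<And>q. bo.blower (\<lambda>_. 1) (U q)" "P = hlP (U Plus) (U Minus)"
      "bo.bdiag (mm Z (mm Z (U Plus) G) (trm (U Minus)))"
      by (rule hl_family_form[OF P]) (rule that, assumption+)
    have 1: "U Plus = Up"
      by (rule bp.row_orth_unique[OF U(1) bp.row_orth_if_orthogonal[OF U(1) U(1) U(3)] Up(1,2)])
    \<comment> \<open>Transposing the relation exchanges the signs and replaces G by its transpose,
      so the minus family is the orthogonalization for \<open>trm G\<close>.\<close>
    have "bo.bdiag (mm Z (mm Z (U Minus) (trm G)) (trm (U Plus)))"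
      using bo.bdiag_trm[OF U(3)] by (simp add: trm_mm mm_assoc)
    then have 2: "U Minus = Um"
      by (intro bm.row_orth_unique[OF U(1) bm.row_orth_if_orthogonal[OF U(1) U(1)] Um(1,2)])
    show "P = hlP Up Um" unfolding U(2) 1 2 ..
  qed
  let ?K = "KF"
  have Kp: "bo.blower (\<lambda>_. 1) (?K Plus) \<and> (\<forall>x y. ?K Plus x y \<in> regular_ratfun r) \<and> mm Z Up (?K Plus) = idm Z \<and> mm Z (?K Plus) Up = idm Z"
    by (rule kostka_unitriangular[OF Up(1) Up(3,4)]) (simp_all add: hl hlP_def)
  have Km: "bo.blower (\<lambda>_. 1) (?K Minus) \<and> (\<forall>x y. ?K Minus x y \<in> regular_ratfun r) \<and> mm Z Um (?K Minus) = idm Z \<and> mm Z (?K Minus) Um = idm Z"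
    by (rule kostka_unitriangular[OF Um(1) Um(3,4)]) (simp_all add: hl hlP_def)
  have "mm Z (mm Z (?K Plus) B) (trm (?K Minus)) = mm Z (mm Z (mm Z (?K Plus) Up) G) (trm (mm Z (?K Minus) Um))"
    unfolding B_def trm_mm by (simp only: mm_assoc)
  also have "\<dots> = G"
    using Kp Km zoff_G by (simp add: mm_idm_left mm_idm_right finite_Z)
  finally have GB: "G = mm Z (mm Z (?K Plus) B) (trm (?K Minus))" by simp
  have mmr: "mm Z A C x y \<in> regular_ratfun r" if "\<And>x y. A x y \<in> regular_ratfun r" "\<And>x y. C x y \<in> regular_ratfun r" for A C x y
    unfolding mm_def using that regular.zero_in by (auto intro!: regular.sum_in regular.mult_in)
  have "B x y \<in> regular_ratfun r" for x y
    unfolding B_def by (intro mmr Up(3) G_regular) (simp add: trm_def Um(3))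
  moreover have "bo.blower (\<lambda>_. 1) (?K q)" "?K q x y \<in> regular_ratfun r" for q x y
    using Kp Km by (cases q; blast)+
  ultimately show thesis using B GB by (intro that)
qed

text \<open>In Omega the conjugate falls on the character of the second index, in \<open>Gc\<close>
  on that of the first; this is the origin of the transposition.\<close>

lemma Omega_G:
  assumes "\<Lambda> \<in> Z" "\<Lambda>' \<in> Z"
  shows "Omega e s \<alpha> n \<zeta> \<chi> \<Lambda> \<Lambda>' = GW r n * complexify (tau (G \<Lambda>' \<Lambda>))"
proof (cases "defect \<Lambda> = defect \<Lambda>'")
  case False
  then show ?thesis by (simp add: Omega_def G_def tau_zero complexify_zero)
next
  case True
  let ?N = "nprime \<alpha> n (defect \<Lambda>)"
  interpret w: wreath_characters r ?N \<zeta> "\<chi> ?N" by (rule wc)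
  have t: "mp \<Lambda> \<in> mparts r ?N" "mp \<Lambda>' \<in> mparts r ?N" using Z_elim(2)[OF assms(1)] Z_elim(2)[OF assms(2)] True by auto
  have "complexify (tau (G \<Lambda>' \<Lambda>)) = w.Gc (mp \<Lambda>') (mp \<Lambda>)"
    using assms True w.ct_Gram by (simp add: G_def GramN_def fun_eq_iff)
  also have "\<dots> = ut ^ ?N / of_nat (card (Wgrp ?N \<zeta>)) *
     (\<Sum>w\<in>Wgrp ?N \<zeta>. to_fract [:\<chi> ?N (mp \<Lambda>) w * cnj (\<chi> ?N (mp \<Lambda>') w):] / to_fract (char_poly w))"
    using t by (simp add: w.Gc_def mult.commute)
  finally show ?thesis
    using True by (simp add: Omega_def len Let_def mult.assoc)
qed

end

section \<open>The matrix equation\<close>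

lemma ut_power_minus_one_nonzero:
  assumes "k > 0"
  shows "(ut :: 'a::field poly fract) ^ k - 1 \<noteq> 0"
proof
  assume "(ut :: 'a poly fract) ^ k - 1 = 0"
  then have "to_fract ([:0, 1:] ^ k :: 'a poly) = to_fract 1" by (simp add: ut_def to_fract_power)
  then have "([:0, 1:] ^ k :: 'a poly) = 1" by (simp only: to_fract_eq_iff)
  then have "degree ([:0, 1:] ^ k :: 'a poly) = 0" by simp
  then show False using assms by (simp add: degree_power_eq)
qed

context hl_setting begin

definition tp :: "symb \<Rightarrow> uratfun" where
  "tp \<Lambda> = ut powi a_fun e s \<alpha> \<Lambda>"

lemma tp_nonzero: "tp \<Lambda> \<noteq> 0"
  by (simp add: tp_def)

text \<open>The factor \<open>GW\<close> descended to Q(t); it is a common scalar and is absorbed in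
  the block diagonal matrix.\<close>

definition gw :: uratfun where
  "gw = (ut - 1) ^ n * ut ^ Nstar r n * (\<Prod>i=1..n. (ut ^ (i * r) - 1) / (ut - 1))"

lemma complexify_gw: "complexify gw = GW r n"
  by (simp add: gw_def GW_def complexify_mult complexify_power complexify_prod complexify_divide complexify_diff complexify_one)

lemma gw_nonzero: "gw \<noteq> 0"
  using ut_power_minus_one_nonzero[of 1, where 'a = rat] ut_power_minus_one_nonzero[where 'a = rat] r
  by (auto simp: gw_def)

definition Om :: "symb \<Rightarrow> symb \<Rightarrow> uratfun" where
  "Om x y = gw * tau (G y x)"

lemma zoff_Om: "zoff Z Om"
  using zoff_G by (auto simp: zoff_def Om_def tau_zero)

lemma Om_defect: "defect x \<noteq> defect y \<Longrightarrow> Om x y = 0"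
  by (simp add: Om_def G_def tau_zero)

lemma complexify_Om: "x \<in> Z \<Longrightarrow> y \<in> Z \<Longrightarrow> complexify (Om x y) = Omega e s \<alpha> n \<zeta> \<chi> x y"
  by (simp add: Om_def Omega_G complexify_mult complexify_gw)

text \<open>The inverse of G is taken with regular entries, because only there is \<open>tau\<close>
  multiplicative; its specialization, transposed and rescaled by \<open>gw\<close>, inverts the
  right-hand side.\<close>

lemma Om_inverse: "\<exists>H. mm Z Om H = idm Z"
proof -
  obtain H where H: "\<And>x y. x \<in> Z \<Longrightarrow> y \<in> Z \<Longrightarrow> H x y \<in> regular_ratfun r"
    "\<And>x y. x \<in> Z \<Longrightarrow> y \<in> Z \<Longrightarrow> (\<Sum>z\<in>Z. H x z * G z y) = (if x = y then 1 else 0)"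
    by (rule bp.inverse_on_subset[OF subset_refl]) (rule that, assumption+)
  have "mm Z Om (\<lambda>x y. inverse gw * tau (H y x)) = idm Z"
    unfolding mm_eq_idm_iff
  proof (intro ballI)
    fix x y assume x: "x \<in> Z" and y: "y \<in> Z"
    have "(\<Sum>z\<in>Z. Om x z * (inverse gw * tau (H y z))) = (\<Sum>z\<in>Z. tau (H y z * G z x))"
    proof (rule sum.cong[OF refl])
      fix z assume "z \<in> Z"
      then have "tau (H y z * G z x) = tau (H y z) * tau (G z x)" using tau_mult[OF H(1)[OF y] G_regular] by blast
      then show "Om x z * (inverse gw * tau (H y z)) = tau (H y z * G z x)" using gw_nonzero by (simp add: Om_def)
    qed
    also have "\<dots> = tau (\<Sum>z\<in>Z. H y z * G z x)"
      by (rule tau_sum[symmetric]) (rule regular.mult_in[OF H(1)[OF y] G_regular])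
    also have "\<dots> = (if x = y then 1 else 0)" unfolding H(2)[OF y x] by (simp add: tau_one tau_zero)
    finally show "(\<Sum>z\<in>Z. Om x z * (inverse gw * tau (H y z))) = (if x = y then 1 else 0)" .
  qed
  then show ?thesis by blast
qed

lemma unknown_P_iff: "unknown_P Z ord (a_fun e s \<alpha>) P \<longleftrightarrow> bo.blower tp P"
proof
  assume P: "unknown_P Z ord (a_fun e s \<alpha>) P"
  have d: "P x y = (if x = y then tp x else 0)" if "x \<in> Z" "y \<in> Z" "similar x y" for x y
    using P that unfolding unknown_P_def tp_def by blast
  have l: "similar y x \<or> sprec ord y x" if "x \<in> Z" "y \<in> Z" "P x y \<noteq> 0" for x y
    using P that unfolding unknown_P_def block_lower_triangular_def by blast
  show "bo.blower tp P"
    unfolding bo.blower_def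
  proof (intro conjI ballI impI)
    show "zoff Z P" using P unfolding unknown_P_def matrix_on_def zoff_def by blast
    fix x assume x: "x \<in> Z"
    show "P x x = tp x" using d[OF x x bo.sim_refl[OF x]] by simp
    fix y assume y: "y \<in> Z" "P x y \<noteq> 0"
    show "y = x \<or> y \<in> bo.below x"
    proof (cases "similar y x")
      case True
      then show ?thesis using d[OF x y(1) similar_sym] y(2) by (metis (full_types))
    next
      case False
      then show ?thesis using l[OF x y] y(1) by (simp add: bo.below_def)
    qed
  qed
next
  assume P: "bo.blower tp P"
  have z: "P x y = 0 \<or> y = x \<or> y \<in> bo.below x" if "x \<in> Z" "y \<in> Z" for x y
    using P that unfolding bo.blower_def by blast
  show "unknown_P Z ord (a_fun e s \<alpha>) P"
    unfolding unknown_P_def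
  proof (intro conjI ballI impI)
    show "matrix_on Z P" using P unfolding bo.blower_def matrix_on_def zoff_def by blast
    show "block_lower_triangular Z ord P"
      unfolding block_lower_triangular_def
    proof (intro ballI impI)
      fix x y assume xy: "x \<in> Z" "y \<in> Z" "P x y \<noteq> 0"
      then have "y = x \<or> y \<in> bo.below x" using z by blast
      then show "similar y x \<or> sprec ord y x"
      proof
        assume "y = x"
        then show ?thesis using bo.sim_refl[OF xy(1)] by simp
      qed (simp add: bo.below_def)
    qed
    fix x y assume xy: "x \<in> Z" "y \<in> Z" "similar x y"
    have "y \<notin> bo.below x" using similar_sym[OF xy(3)] by (simp add: bo.below_def)
    moreover have "P x x = tp x" using P xy(1) unfolding bo.blower_def by blast
    ultimately show "P x y = (if x = y then ut powi a_fun e s \<alpha> x else 0)"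
      using z[OF xy(1,2)] by (cases "x = y") (simp_all add: tp_def)
  qed
qed

lemma solution_iff:
  "solves Pm Pp L \<longleftrightarrow>
    bo.blower tp Pm \<and> bo.blower tp Pp \<and> bo.bdiag L \<and> mm Z (mm Z Pm L) (trm Pp) = Om"
proof -
  have bd: "matrix_on Z L \<and> block_diagonal Z L \<longleftrightarrow> bo.bdiag L"
  proof -
    have "block_diagonal Z L \<longleftrightarrow> (\<forall>x\<in>Z. \<forall>y\<in>Z. \<not> similar x y \<longrightarrow> L x y = 0)"
      unfolding block_diagonal_def by (rule iffI) (blast dest: similar_sym)+
    then show ?thesis unfolding matrix_on_def bo.bdiag_def zoff_def by simp
  qed
  have m: "(\<Sum>M\<in>Z. \<Sum>M'\<in>Z. Pm x M * L M M' * Pp y M') = mm Z (mm Z Pm L) (trm Pp) x y" if "x \<in> Z" "y \<in> Z" for x y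
    using that by (simp add: mm_def trm_def sum_distrib_right cong: sum.cong) (rule sum.swap)
  have "(\<forall>x\<in>Z. \<forall>y\<in>Z. complexify (\<Sum>M\<in>Z. \<Sum>M'\<in>Z. Pm x M * L M M' * Pp y M') = Omega e s \<alpha> n \<zeta> \<chi> x y) \<longleftrightarrow>
      (\<forall>x\<in>Z. \<forall>y\<in>Z. mm Z (mm Z Pm L) (trm Pp) x y = Om x y)"
    by (intro ball_cong refl) (simp add: m complexify_Om[symmetric] complexify_inj)
  also have "\<dots> \<longleftrightarrow> mm Z (mm Z Pm L) (trm Pp) = Om"
  proof
    assume eq: "\<forall>x\<in>Z. \<forall>y\<in>Z. mm Z (mm Z Pm L) (trm Pp) x y = Om x y"
    show "mm Z (mm Z Pm L) (trm Pp) = Om"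
    proof (intro ext)
      fix x y
      show "mm Z (mm Z Pm L) (trm Pp) x y = Om x y"
        using eq zoff_Om zoff_mm[of Z "mm Z Pm L" "trm Pp"] unfolding zoff_def by (cases "x \<in> Z \<and> y \<in> Z") auto
    qed
  qed simp
  finally show ?thesis unfolding is_solution_def unknown_P_iff using bd by blast
qed

lemma solution_unique:
  assumes "solves Pm Pp L"
    and "solves Pm' Pp' L'"
  shows "Pm = Pm' \<and> Pp = Pp' \<and> L = L'"
proof -
  obtain H where H: "mm Z Om H = idm Z" using Om_inverse by blast
  have 1: "bo.blower tp Pm" "bo.blower tp Pp" "bo.bdiag L" "mm Z (mm Z Pm L) (trm Pp) = Om"
    using assms(1) unfolding solution_iff by blast+
  have 2: "bo.blower tp Pm'" "bo.blower tp Pp'" "bo.bdiag L'" "mm Z (mm Z Pm' L') (trm Pp') = Om"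
    using assms(2) unfolding solution_iff by blast+
  show ?thesis by (rule bo.ldu_unique[OF tp_nonzero 1(1,2,3) 2(1,2,3) 1(4) 2(4) H])
qed

abbreviation "mK \<equiv> modified_kostka e s \<alpha> n D \<theta> ord"

text \<open>Specializing the factorization of G at 1/t and transposing it gives the equation, once
  the powers t^a are moved from the modified Kostka matrices into the middle factor.\<close>

lemma mK_solution: "\<exists>L. solves (mK Minus) (mK Plus) L"
proof -
  let ?K = "KF"
  obtain B where K: "\<And>q. bo.blower (\<lambda>_. 1) (?K q)" "\<And>q x y. ?K q x y \<in> regular_ratfun r"
    and B: "bo.bdiag B" "\<And>x y. B x y \<in> regular_ratfun r"
    and G: "G = mm Z (mm Z (?K Plus) B) (trm (?K Minus))"
    by (rule kostka_decomposition) (rule that, assumption+)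
  have mK: "mK q x y = tp y * tau (?K q x y)" for q x y
    by (simp add: modified_kostka_def tp_def tau_def)
  have bl: "bo.blower tp (mK q)" for q
    unfolding bo.blower_def
  proof (intro conjI ballI impI)
    show "zoff Z (mK q)"
      unfolding zoff_def mK using K(1)[of q] unfolding bo.blower_def zoff_def by (simp add: tau_zero)
    fix x assume x: "x \<in> Z"
    show "mK q x x = tp x" using K(1)[of q] x unfolding bo.blower_def mK by (simp add: tau_one)
    fix y assume y: "y \<in> Z" "mK q x y \<noteq> 0"
    then have "?K q x y \<noteq> 0" unfolding mK using tau_zero by force
    then show "y = x \<or> y \<in> bo.below x" using K(1)[of q] x y(1) unfolding bo.blower_def by blast
  qed
  \<comment> \<open>The modified matrices are the specialized Kostka matrices times the diagonal
    matrix of the t^a on the right, so both adjacent copies of that diagonal matrix are divided out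
    here. B is transposed because Omega is.\<close>
  define L where "L x y = inverse (tp x) * (gw * tau (B y x)) * inverse (tp y)" for x y
  have L: "bo.bdiag L"
    using bo.bdiag_trm[OF B(1)] unfolding bo.bdiag_def zoff_def trm_def L_def by (simp add: tau_zero)
  have "mm Z (mm Z (mK Minus) L) (trm (mK Plus)) = Om"
  proof (intro ext)
    fix x y
    show "mm Z (mm Z (mK Minus) L) (trm (mK Plus)) x y = Om x y"
    proof (cases "x \<in> Z \<and> y \<in> Z")
      case True
      then have x: "x \<in> Z" and y: "y \<in> Z" by auto
      have "tau (G y x) = tau (\<Sum>z\<in>Z. (\<Sum>w\<in>Z. ?K Plus y w * B w z) * ?K Minus x z)"
        using x y by (subst G) (simp add: mm_def trm_def cong: sum.cong)
      also have "\<dots> = (\<Sum>z\<in>Z. tau ((\<Sum>w\<in>Z. ?K Plus y w * B w z) * ?K Minus x z))"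
        by (intro tau_sum[of _ _ r] regular.mult_in regular.sum_in K(2) B(2))
      also have "\<dots> = (\<Sum>z\<in>Z. (\<Sum>w\<in>Z. tau (?K Plus y w) * tau (B w z)) * tau (?K Minus x z))"
      proof (rule sum.cong[OF refl])
        fix z
        have "tau ((\<Sum>w\<in>Z. ?K Plus y w * B w z) * ?K Minus x z) = tau (\<Sum>w\<in>Z. ?K Plus y w * B w z) * tau (?K Minus x z)"
          by (intro tau_mult[of _ r] regular.mult_in regular.sum_in K(2) B(2))
        also have "tau (\<Sum>w\<in>Z. ?K Plus y w * B w z) = (\<Sum>w\<in>Z. tau (?K Plus y w * B w z))"
          by (intro tau_sum[of _ _ r] regular.mult_in K(2) B(2))
        also have "\<dots> = (\<Sum>w\<in>Z. tau (?K Plus y w) * tau (B w z))"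
          by (intro sum.cong refl tau_mult[of _ r] K(2) B(2))
        finally show "tau ((\<Sum>w\<in>Z. ?K Plus y w * B w z) * ?K Minus x z) = (\<Sum>w\<in>Z. tau (?K Plus y w) * tau (B w z)) * tau (?K Minus x z)" .
      qed
      finally have tG: "tau (G y x) = (\<Sum>z\<in>Z. \<Sum>w\<in>Z. tau (?K Plus y w) * tau (B w z) * tau (?K Minus x z))"
        by (simp only: sum_distrib_right)
      have "mm Z (mm Z (mK Minus) L) (trm (mK Plus)) x y = (\<Sum>w\<in>Z. \<Sum>z\<in>Z. mK Minus x z * L z w * mK Plus y w)"
        using x y by (simp add: mm_def trm_def sum_distrib_right cong: sum.cong)
      also have "\<dots> = (\<Sum>w\<in>Z. \<Sum>z\<in>Z. gw * (tau (?K Plus y w) * tau (B w z) * tau (?K Minus x z)))"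
        by (intro sum.cong refl) (simp add: mK L_def tp_nonzero)
      also have "\<dots> = (\<Sum>z\<in>Z. \<Sum>w\<in>Z. gw * (tau (?K Plus y w) * tau (B w z) * tau (?K Minus x z)))"
        by (rule sum.swap)
      finally show ?thesis by (simp only: Om_def tG sum_distrib_left)
    next
      case False
      then show ?thesis using zoff_Om unfolding zoff_def by (auto simp: mm_def)
    qed
  qed
  then show ?thesis using bl L unfolding solution_iff by blast
qed

text \<open>Conjugation by the diagonal sign matrix that is 1 exactly on the symbols of defect \<open>d\<close>.\<close>

definition cj :: "nat list \<Rightarrow> (symb \<Rightarrow> symb \<Rightarrow> uratfun) \<Rightarrow> symb \<Rightarrow> symb \<Rightarrow> uratfun" where
  "cj d A x y = (if (defect x = d) = (defect y = d) then A x y else - A x y)"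

lemma cj_mm: "mm Z (cj d A) (cj d C) = cj d (mm Z A C)"
proof (intro ext)
  fix x y
  have "(\<Sum>z\<in>Z. cj d A x z * cj d C z y) = (\<Sum>z\<in>Z. if (defect x = d) = (defect y = d) then A x z * C z y else - (A x z * C z y))"
    by (rule sum.cong[OF refl]) (simp add: cj_def)
  then have *: "mm Z (cj d A) (cj d C) x y = (if x \<in> Z \<and> y \<in> Z then
      \<Sum>z\<in>Z. if (defect x = d) = (defect y = d) then A x z * C z y else - (A x z * C z y) else 0)"
    unfolding mm_def by (simp only:)
  show "mm Z (cj d A) (cj d C) x y = cj d (mm Z A C) x y"
    unfolding * unfolding cj_def[of d "mm Z A C" x y] mm_def
    by (cases "(defect x = d) = (defect y = d)") (simp_all add: sum_negf)
qed

lemma cj_trm: "trm (cj d A) = cj d (trm A)"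
  by (auto simp: trm_def cj_def fun_eq_iff)

text \<open>The sign matrix is its own inverse, so conjugation respects products. It preserves
  diagonals and zero patterns, and it fixes the right-hand side, which has no entries between
  different defects.\<close>

lemma cj_solution:
  assumes "solves Pm Pp L"
  shows "solves (cj d Pm) (cj d Pp) (cj d L)"
proof -
  have 1: "bo.blower tp Pm" "bo.blower tp Pp" "bo.bdiag L" "mm Z (mm Z Pm L) (trm Pp) = Om"
    using assms unfolding solution_iff by blast+
  have bl: "bo.blower tp (cj d P)" if "bo.blower tp P" for P
    using that unfolding bo.blower_def zoff_def cj_def by simp
  have "bo.bdiag (cj d L)"
    using 1(3) unfolding bo.bdiag_def zoff_def cj_def by simp
  moreover have "mm Z (mm Z (cj d Pm) (cj d L)) (trm (cj d Pp)) = Om"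
    unfolding cj_trm cj_mm 1(4) by (auto simp: cj_def fun_eq_iff Om_defect)
  ultimately show ?thesis using bl 1(1,2) unfolding solution_iff by blast
qed

text \<open>Conjugation for the defect of x negates the entries at (x, y), as y has another defect;
  uniqueness makes each of these entries equal to its negative.\<close>

lemma solution_defect:
  assumes sol: "solves Pm Pp L" and ne: "defect x \<noteq> defect y"
  shows "Pm x y = 0 \<and> Pp x y = 0 \<and> L x y = 0"
proof -
  have eq: "Pm = cj (defect x) Pm \<and> Pp = cj (defect x) Pp \<and> L = cj (defect x) L"
    by (rule solution_unique[OF sol cj_solution[OF sol]])
  have "A x y = 0" if "A = cj (defect x) A" for A
  proof -
    have "A x y = - A x y" using fun_cong[OF fun_cong[OF that, of x], of y] ne by (simp add: cj_def)
    then have "2 * A x y = 0" by (simp add: eq_neg_iff_add_eq_0 mult_2)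
    moreover have "(2 :: uratfun) = to_fract [:2:]" by (metis const_fract.hom_numeral)
    ultimately show ?thesis by simp
  qed
  then show ?thesis using eq by blast
qed

end

theorem theorem4p6:
  fixes r n e \<alpha> :: nat and s :: "nat list" and D :: "nat list set"
    and \<theta> :: "nat list \<Rightarrow> nat list list \<Rightarrow> nat list list"
    and ord :: "(symb \<times> symb) set" and \<zeta> :: complex
    and \<chi> :: "nat \<Rightarrow> nat list list \<Rightarrow> complex mat \<Rightarrow> complex"
  assumes "r \<ge> 1" and "\<alpha> < r"
    and "length s = r" and "\<forall>k<r. s ! k \<le> e"
    and "finite D" and "\<forall>d\<in>D. is_defect r \<alpha> d \<and> Zset e s \<alpha> n d \<noteq> {}"
    and "\<forall>d\<in>D. \<theta> d \<in> mparts r (nprime \<alpha> n d) \<rightarrow> mparts r n \<and>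
                 inj_on (\<theta> d) (mparts r (nprime \<alpha> n d))"
    and "admissible_order e s \<alpha> (ZD e s \<alpha> n D) ord"
    and "primitive_root r \<zeta>"
    and "\<forall>N. char_labelling r \<zeta> N (\<chi> N)"
  shows
    "(\<exists>!(Pm, Pp, L). is_solution (ZD e s \<alpha> n D) ord (a_fun e s \<alpha>) (Omega e s \<alpha> n \<zeta> \<chi>) Pm Pp L) \<and>
     (\<forall>Pm Pp L. is_solution (ZD e s \<alpha> n D) ord (a_fun e s \<alpha>) (Omega e s \<alpha> n \<zeta> \<chi>) Pm Pp L \<longrightarrow>
        modified_kostka e s \<alpha> n D \<theta> ord Minus = Pm \<and>
        modified_kostka e s \<alpha> n D \<theta> ord Plus = Pp \<and>
        (\<forall>\<Lambda>\<in>ZD e s \<alpha> n D. \<forall>\<Lambda>'\<in>ZD e s \<alpha> n D. defect \<Lambda> \<noteq> defect \<Lambda>' \<longrightarrow>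
           Pm \<Lambda> \<Lambda>' = 0 \<and> Pp \<Lambda> \<Lambda>' = 0 \<and> L \<Lambda> \<Lambda>' = 0))"
proof -
  interpret hl_setting r n e \<alpha> s D \<theta> ord \<zeta> \<chi>
    by (rule hl_setting.intro) (fact assms)+
  obtain L0 where L0: "solves (mK Minus) (mK Plus) L0"
    using mK_solution by blast
  have "\<exists>!(Pm, Pp, L). solves Pm Pp L"
  proof (rule ex1I)
    show "case (mK Minus, mK Plus, L0) of (Pm, Pp, L) \<Rightarrow> solves Pm Pp L"
      using L0 by simp
    fix x assume x: "case x of (Pm, Pp, L) \<Rightarrow> solves Pm Pp L"
    obtain Pm Pp L where xe: "x = (Pm, Pp, L)" by (cases x)
    then have "solves Pm Pp L" using x by simp
    from solution_unique[OF this L0] show "x = (mK Minus, mK Plus, L0)" unfolding xe by blast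
  qed
  moreover have "mK Minus = Pm \<and> mK Plus = Pp \<and>
      (\<forall>\<Lambda>\<in>Z. \<forall>\<Lambda>'\<in>Z. defect \<Lambda> \<noteq> defect \<Lambda>' \<longrightarrow> Pm \<Lambda> \<Lambda>' = 0 \<and> Pp \<Lambda> \<Lambda>' = 0 \<and> L \<Lambda> \<Lambda>' = 0)"
    if sol: "solves Pm Pp L" for Pm Pp L
    using solution_unique[OF L0 sol] solution_defect[OF sol] by blast
  ultimately show ?thesis by blast
qed

end
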